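(* Let $\alpha>0$ and let $(Z_i)_{i\in\mathbb{Z}}$ be a strictly stationary sequence of real random variables with $\mathrm{P}(|Z_1|>x)=x^{-\alpha}L(x)$ for $x>0$, where $L$ is slowly varying at infinity, and $$\lim_{x\to\infty}\frac{\mathrm{P}(Z_1>x)}{\mathrm{P}(|Z_1|>x)}=p,\qquad \lim_{x\to\infty}\frac{\mathrm{P}(Z_1<-x)}{\mathrm{P}(|Z_1|>x)}=q,$$ where $p\in[0,1]$ and $p+q=1$. Let $(a_n)_{n\in\mathbb{N}}$ be positive reals with $a_n\to\infty$ and $n\,\mathrm{P}(|Z_1|>a_n)\to1$ as $n\to\infty$. Assume $(Z_i)$ satisfies the local dependence condition $D'$ (see context). Let $(\sigma_i)_{i\in\mathbb{Z}}$ be positive reals such that $0<\beta_1\le\sigma_i\le\beta_2<\infty$ for all $i\in\mathbb{Z}$, for some constants $\beta_1,\beta_2$, and $\frac1n\sum_{i=1}^n\sigma_i^\alpha\to\sigma^\alpha>0$ as $n\to\infty$. Put $Y_i=\sigma_iZ_i$ for $i\in\mathbb{Z}$ and assume the mixing condition $\mathcal{A}'$ (see context) holds. Let $(c_j)_{j\ge0}$ be real numbers with $\sum_{j=0}^\infty|c_j|^\delta<\infty$ for some $\delta$ with $\delta<\alpha$ and $0<\delta\le1$. Define $$X_n=\sum_{j=0}^\infty c_jY_{n-j},\qquad N_n=\sum_{i=1}^n\delta_{(i/n,\;a_n^{-1}X_i)},\qquad n\in\mathbb{N}.$$ Then, as $n\to\infty$, $$N_n\xrightarrow{d}N:=\sum_{i=1}^\infty\sum_{j=0}^\infty\delta_{(T_i,\,P_ic_j)}$$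 in $M_p([0,1]\times\mathbb{E})$, where $\sum_{i=1}^\infty\delta_{(T_i,P_i)}$ is a Poisson process on $[0,1]\times\mathbb{E}$ with intensity measure $\mathrm{Leb}\times\nu$ and $$\nu(\mathrm{d}x)=\sigma^\alpha\bigl(p\,1_{(0,\infty)}(x)+q\,1_{(-\infty,0)}(x)\bigr)\alpha|x|^{-\alpha-1}\,\mathrm{d}x.$$
   Context: $\mathbb{E}=[-\infty,\infty]\setminus\{0\}$ with the metric $\rho(x,y)=\max\{|1/|x|-1/|y||,\,|\mathrm{sign}\,x-\mathrm{sign}\,y|\}$ (with $1/\infty=0$), so that a subset of $\mathbb{E}$ is relatively compact iff it is contained in $\mathbb{E}\setminus[-u,u]$ for some $u>0$. $M_p([0,1]\times\mathbb{E})$ is the space of Radon point measures on $[0,1]\times\mathbb{E}$ (finite on relatively compact sets) with the vague topology; $\xrightarrow{d}$ is convergence in distribution of random elements of this space. $C_K^+([0,1]\times\mathbb{E})$ is the set of nonnegative continuous real functions with compact support. $\delta_x$ is the Dirac measure at $x$, $\mathrm{Leb}$ is Lebesgue measure on $[0,1]$. Points whose second coordinate is $0$ do not belong to $[0,1]\times\mathbb{E}$ and are disregarded; correspondingly $f(t,0):=0$ for $f\in C_K^+([0,1]\times\mathbb{E})$. Condition $D'$: for all $x>0$, $$\lim_{k\to\infty}\limsup_{n\to\infty}\,n\sum_{i=2}^{\lfloor n/k\rfloor}\mathrm{P}\Bigl(\frac{|Z_1|}{a_n}>x,\ \frac{|Z_i|}{a_n}>x\Bigr)=0.$$ Condition $\mathcal{A}'$: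 there is a sequence of positive integers $(r_n)$ with $r_n\to\infty$, $r_n/n\to0$ such that, with $k_n=\lfloor n/r_n\rfloor$, for all $f\in C_K^+([0,1]\times\mathbb{E})$, as $n\to\infty$, $$\mathrm{E}\Bigl[\exp\Bigl\{-\sum_{i=1}^nf\Bigl(\frac in,\frac{Y_i}{a_n}\Bigr)\Bigr\}\Bigr]-\prod_{k=1}^{k_n}\mathrm{E}\Bigl[\exp\Bigl\{-\sum_{i=1}^{r_n}f\Bigl(\frac{kr_n}{n},\frac{Y_{i+(k-1)r_n}}{a_n}\Bigr)\Bigr\}\Bigr]\to0.$$ A function $L$ is slowly varying if $\lim_{x\to\infty}L(tx)/L(x)=1$ for all $t>0$. Under the stated summability of $(c_j)$ the series defining $X_n$ converges almost surely. *)

theory Defs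
  imports "HOL-Probability.Probability"
begin

definition E_space :: "ereal set" where
  "E_space = UNIV - {0}"

definition rho :: "ereal \<Rightarrow> ereal \<Rightarrow> real" where
  "rho x y = max \<bar>real_of_ereal (1 / \<bar>x\<bar>) - real_of_ereal (1 / \<bar>y\<bar>)\<bar>
                 \<bar>real_of_ereal (sgn x) - real_of_ereal (sgn y)\<bar>"

lemma Metric_space_rho: "Metric_space E_space rho"
proof
  fix x y z :: ereal
  show "0 \<le> rho x y" by (simp add: rho_def)
  show "rho x y = rho y x" by (simp add: rho_def abs_minus_commute)
  show "(rho x y = 0) = (x = y)" if "x \<in> E_space" "y \<in> E_space"
  proof
    assume "rho x y = 0"
    then have "real_of_ereal (1 / \<bar>x\<bar>) = real_of_ereal (1 / \<bar>y\<bar>)"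
      and "real_of_ereal (sgn x) = real_of_ereal (sgn y)"
      by (auto simp: rho_def max_def split: if_splits)
    then show "x = y"
      using that
      by (cases x; cases y)
         (auto simp: E_space_def sgn_if one_ereal_def zero_ereal_def abs_if split: if_splits)
  qed (simp add: rho_def)
  show "rho x z \<le> rho x y + rho y z"
    unfolding rho_def by linarith
qed

definition E_top :: "ereal topology" where
  "E_top = Metric_space.mtopology E_space rho"

definition S_space :: "(real \<times> ereal) set" where
  "S_space = {0..1} \<times> E_space"

definition S_top :: "(real \<times> ereal) topology" where
  "S_top = prod_topology (top_of_set {0..1}) E_top"

definition borel_of :: "'a topology \<Rightarrow> 'a measure" where
  "borel_of X = sigma (topspace X) {U. openin X U}"

lemma topspace_E_top: "topspace E_top = E_space"
  unfolding E_top_def by (rule Metric_space.topspace_mtopology[OF Metric_space_rho])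

lemma topspace_S_top: "topspace S_top = S_space"
  by (simp add: S_top_def S_space_def topspace_E_top)

lemma space_borel_of: "space (borel_of X) = topspace X"
  by (simp add: borel_of_def space_measure_of_conv)

text \<open>The sum of the Dirac measures at \<open>x i\<close> over \<open>i \<in> I\<close>, obtained by pushing forward the
  counting measure.  Points outside \<open>S_space\<close>, in particular those whose second coordinate is 0,
  are disregarded.\<close>

definition dirac_sum :: "'i set \<Rightarrow> ('i \<Rightarrow> real \<times> ereal) \<Rightarrow> (real \<times> ereal) measure" where
  "dirac_sum I x = distr (count_space {i \<in> I. x i \<in> S_space}) (borel_of S_top) x"

lemma emeasure_dirac_sum:
  assumes "A \<in> sets (borel_of S_top)"
  shows "emeasure (dirac_sum I x) A = (\<integral>\<^sup>+ i. indicator A (x i) \<partial>count_space I)"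
proof -
  have sub: "A \<subseteq> S_space"
    using sets.sets_into_space[OF assms] by (simp add: space_borel_of topspace_S_top)
  have "emeasure (dirac_sum I x) A
      = emeasure (count_space {i \<in> I. x i \<in> S_space}) {i \<in> I. x i \<in> A}"
    unfolding dirac_sum_def
    using assms sub
    by (subst emeasure_distr)
       (auto simp: space_borel_of topspace_S_top intro!: arg_cong2[where f = emeasure])
  also have "\<dots> = emeasure (count_space I) {i \<in> I. x i \<in> A}"
    using sub by (subst (1 2) emeasure_count_space) auto
  also have "\<dots> = (\<integral>\<^sup>+ i. indicator {i \<in> I. x i \<in> A} i \<partial>count_space I)"
    by (rule nn_integral_indicator[symmetric]) auto
  also have "\<dots> = (\<integral>\<^sup>+ i. indicator A (x i) \<partial>count_space I)"
    by (intro nn_integral_cong) (auto split: split_indicator)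
  finally show ?thesis .
qed

text \<open>Countable sums of Dirac measures, with multiplicities allowed (\<open>x\<close> need not be injective),
  that are finite on relatively compact sets.\<close>

definition Mp :: "(real \<times> ereal) measure set" where
  "Mp = {\<mu>. (\<exists>(I :: nat set) x. x ` I \<subseteq> S_space \<and> \<mu> = dirac_sum I x) \<and>
            (\<forall>A \<in> sets (borel_of S_top).
               compactin S_top (S_top closure_of A) \<longrightarrow> emeasure \<mu> A < \<infinity>)}"

text \<open>Nonnegative continuous functions with compact support on \<open>[0,1] \<times> E\<close>, extended by 0 to
  the whole type; in particular \<open>f (t, 0) = 0\<close>.\<close>

definition CK_plus :: "(real \<times> ereal \<Rightarrow> real) set" where
  "CK_plus = {f. continuous_map S_top euclideanreal f \<and> (\<forall>z. 0 \<le> f z) \<and>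
                 (\<forall>z. z \<notin> S_space \<longrightarrow> f z = 0) \<and>
                 compactin S_top (S_top closure_of {z \<in> S_space. f z \<noteq> 0})}"

text \<open>The coarsest topology on \<open>Mp\<close> for which all maps \<open>\<mu> \<mapsto> \<integral>f d\<mu>\<close>, \<open>f \<in> CK_plus\<close>, are
  continuous.\<close>

definition vague_top :: "(real \<times> ereal) measure topology" where
  "vague_top = topology_generated_by
     {{\<mu> \<in> Mp. (\<integral>z. f z \<partial>\<mu>) \<in> U} | f U. f \<in> CK_plus \<and> open U}"

lemma topspace_vague_top: "topspace vague_top = Mp"
proof -
  have "(\<lambda>_. 0) \<in> CK_plus"
    by (simp add: CK_plus_def)
  moreover have "Mp = {\<mu> \<in> Mp. (\<integral>z. (\<lambda>_. 0::real) z \<partial>\<mu>) \<in> UNIV}"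
    by simp
  ultimately have "Mp \<in> {{\<mu> \<in> Mp. (\<integral>z. f z \<partial>\<mu>) \<in> U} | f U. f \<in> CK_plus \<and> open U}"
    by blast
  then show ?thesis
    unfolding vague_top_def topology_generated_by_topspace by auto
qed

definition conv_in_dist ::
  "'b topology \<Rightarrow> 'a measure \<Rightarrow> (nat \<Rightarrow> 'a \<Rightarrow> 'b) \<Rightarrow> 'c measure \<Rightarrow> ('c \<Rightarrow> 'b) \<Rightarrow> bool" where
  "conv_in_dist T M \<xi> M' \<eta> \<longleftrightarrow>
     (\<forall>n. \<xi> n \<in> M \<rightarrow>\<^sub>M borel_of T) \<and> \<eta> \<in> M' \<rightarrow>\<^sub>M borel_of T \<and>
     (\<forall>g :: 'b \<Rightarrow> real. continuous_map T euclideanreal g \<and> bounded (g ` topspace T) \<longrightarrow>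
        (\<lambda>n. \<integral>\<omega>. g (\<xi> n \<omega>) \<partial>M) \<longlonglongrightarrow> (\<integral>\<omega>. g (\<eta> \<omega>) \<partial>M'))"

text \<open>\<open>\<Xi>\<close> is a Poisson process on \<open>[0,1] \<times> E\<close> with intensity measure \<open>\<Lambda>\<close>.  Its realizations are
  only required to lie in \<open>Mp\<close> almost surely.\<close>

definition poisson_process ::
  "'a measure \<Rightarrow> (real \<times> ereal) measure \<Rightarrow> ('a \<Rightarrow> (real \<times> ereal) measure) \<Rightarrow> bool" where
  "poisson_process M \<Lambda> \<Xi> \<longleftrightarrow>
     (AE \<omega> in M. \<Xi> \<omega> \<in> Mp) \<and>
     (\<forall>A \<in> sets (borel_of S_top). (\<lambda>\<omega>. emeasure (\<Xi> \<omega>) A) \<in> borel_measurable M) \<and>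
     (\<forall>A \<in> sets (borel_of S_top). \<forall>k :: nat.
        measure M {\<omega> \<in> space M. emeasure (\<Xi> \<omega>) A = of_nat k} =
        (if emeasure \<Lambda> A < \<infinity>
         then exp (- measure \<Lambda> A) * measure \<Lambda> A ^ k / fact k else 0)) \<and>
     (\<forall>(m :: nat) A. A ` {..<m} \<subseteq> sets (borel_of S_top) \<and> disjoint_family_on A {..<m} \<longrightarrow>
        prob_space.indep_vars M (\<lambda>_. borel) (\<lambda>i \<omega>. emeasure (\<Xi> \<omega>) (A i)) {..<m})"

text \<open>The measure \<open>\<nu>\<close>; the parameter \<open>s\<close> is the constant \<open>\<sigma>\<close> (not \<open>\<sigma>\<^sup>\<alpha>\<close>).\<close>

definition nu :: "real \<Rightarrow> real \<Rightarrow> real \<Rightarrow> real \<Rightarrow> ereal measure" where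
  "nu \<alpha> s p q = distr
     (density (restrict_space lborel (UNIV - {0}))
        (\<lambda>x. ennreal (s powr \<alpha> * (p * indicator {0<..} x + q * indicator {..<0} x)
                      * \<alpha> * \<bar>x\<bar> powr (- \<alpha> - 1))))
     (borel_of E_top) ereal"

definition intensity :: "real \<Rightarrow> real \<Rightarrow> real \<Rightarrow> real \<Rightarrow> (real \<times> ereal) measure" where
  "intensity \<alpha> s p q = restrict_space lborel {0..1} \<Otimes>\<^sub>M nu \<alpha> s p q"

definition slowly_varying :: "(real \<Rightarrow> real) \<Rightarrow> bool" where
  "slowly_varying L \<longleftrightarrow> (\<forall>t>0. ((\<lambda>x. L (t * x) / L x) \<longlongrightarrow> 1) at_top)"

definition strictly_stationary :: "'a measure \<Rightarrow> (int \<Rightarrow> 'a \<Rightarrow> real) \<Rightarrow> bool" where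
  "strictly_stationary M Z \<longleftrightarrow>
     (\<forall>J h. finite J \<longrightarrow>
        distr M (\<Pi>\<^sub>M j\<in>J. borel) (\<lambda>\<omega>. \<lambda>j\<in>J. Z (j + h) \<omega>) =
        distr M (\<Pi>\<^sub>M j\<in>J. borel) (\<lambda>\<omega>. \<lambda>j\<in>J. Z j \<omega>))"

definition cond_D' :: "'a measure \<Rightarrow> (int \<Rightarrow> 'a \<Rightarrow> real) \<Rightarrow> (nat \<Rightarrow> real) \<Rightarrow> bool" where
  "cond_D' M Z a \<longleftrightarrow>
     (\<forall>x>0. (\<lambda>k. limsup (\<lambda>n. ereal (real n * (\<Sum>i = 2..n div k.
        measure M {\<omega> \<in> space M. \<bar>Z 1 \<omega>\<bar> / a n > x \<and> \<bar>Z (int i) \<omega>\<bar> / a n > x}))))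
        \<longlonglongrightarrow> 0)"

definition cond_A' :: "'a measure \<Rightarrow> (int \<Rightarrow> 'a \<Rightarrow> real) \<Rightarrow> (nat \<Rightarrow> real) \<Rightarrow> bool" where
  "cond_A' M Y a \<longleftrightarrow>
     (\<exists>r :: nat \<Rightarrow> nat. (\<forall>n. r n > 0) \<and> filterlim r at_top sequentially \<and>
        (\<lambda>n. real (r n) / real n) \<longlonglongrightarrow> 0 \<and>
        (\<forall>f \<in> CK_plus. (\<lambda>n.
           (\<integral>\<omega>. exp (- (\<Sum>i = 1..n. f (real i / real n, ereal (Y (int i) \<omega> / a n)))) \<partial>M)
           - (\<Prod>k = 1..n div r n. \<integral>\<omega>. exp (- (\<Sum>i = 1..r n.
                f (real (k * r n) / real n, ereal (Y (int (i + (k - 1) * r n)) \<omega> / a n)))) \<partial>M))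
           \<longlonglongrightarrow> 0))"

end

(*
  Convergence in distribution in the vague topology reduces to convergence of the Laplace
  functionals E exp (- N f): the functions mu |-> exp (- mu f) span an algebra, which on compact
  families of point measures is dense (Stone-Weierstrass) in the vaguely continuous functions;
  tightness also comes from the Laplace functionals.

  For the points (i/n, Y_i/a_n), condition A' factorises the Laplace functional over blocks of
  length r_n, and condition D' makes two large values within a block negligible, so each factor
  is 1 minus a sum of one-point expectations; these add up to the integral of 1 - exp (-f) with
  respect to the intensity, by regular variation and Cesaro convergence of sigma_i^alpha.

  For X, cut the series at m terms.  By D', with high probability a window of length m contains
  at most one large Z, so the sum of f (i/n, X_i/a_n) is close to the sum over i and j < m of
  f (i/n, c_j Y_i/a_n), which is the Y-functional of the test function (t, y) |-> sum over j < m
  of f (t, c_j y).  The rest of the series is controlled by subadditivity of |.|^delta and a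
  truncated moment bound.  Finally m tends to infinity.
*)
theory Submission
  imports Defs
begin

section \<open>The space of time--value pairs\<close>

text \<open>The vague topology on \<open>Mp\<close> is never metrised. Topological arguments take
  place in a second countable space of parametrised configurations (\<open>slots\<close>), mapped
  continuously onto \<open>Mp\<close>. This serves twice: for Borel measurability of random
  measures, and for Stone-Weierstrass, where the parametrisation is not injective and only functions
  that factor through the measure are approximated. Such an approximation is good on one compact
  family only, so the approximants are also kept bounded on all of \<open>Mp\<close>, to pay for
  rare exceptional configurations. Condition A' freezes time at the block end k r_n / n while the
  points carry the time i / n; uniform continuity of the test function bridges the two. To have it
  up to the infinite points, the second coordinate is compactified by y / (1 + |y|). The Poisson
  limit is known only through its counts, so its Laplace functional is rebuilt from simple
  functions. In the passage from Y to X the expected number of large X_i is bounded first, and the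
  tolerances are derived from that bound before m and n are chosen.\<close>

definition squash :: "ereal \<Rightarrow> real" where
  "squash y = (case y of ereal r \<Rightarrow> r / (1 + \<bar>r\<bar>) | PInfty \<Rightarrow> 1 | MInfty \<Rightarrow> - 1)"

text \<open>Constant outside [-1,1] so as to be total; on [-1,1] it is the inverse of
  \<open>squash\<close>.\<close>

definition unsquash :: "real \<Rightarrow> ereal" where
  "unsquash v = (if v \<ge> 1 then \<infinity> else if v \<le> - 1 then - \<infinity> else ereal (v / (1 - \<bar>v\<bar>)))"

lemma squash_simps [simp]:
  "squash (ereal r) = r / (1 + \<bar>r\<bar>)" "squash \<infinity> = 1" "squash (- \<infinity>) = - 1" "squash 0 = 0"
  by (auto simp: squash_def zero_ereal_def)

lemma real_squash_bounds: "\<bar>r / (1 + \<bar>r\<bar>)\<bar> < (1::real)"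
  by (simp add: abs_divide)

lemma unsquash_squash [simp]: "unsquash (squash y) = y"
proof (cases y)
  case (real r)
  have "- 1 < r / (1 + \<bar>r\<bar>)" "r / (1 + \<bar>r\<bar>) < 1"
    using real_squash_bounds[of r] by linarith+
  moreover have "r / (1 + \<bar>r\<bar>) / (1 - \<bar>r / (1 + \<bar>r\<bar>)\<bar>) = r"
    by (simp add: abs_divide divide_simps)
  ultimately show ?thesis
    using real by (simp add: unsquash_def)
qed (auto simp: unsquash_def)

lemma squash_unsquash:
  assumes "\<bar>v\<bar> \<le> 1"
  shows "squash (unsquash v) = v"
proof (cases "\<bar>v\<bar> = 1")
  case True
  then show ?thesis by (auto simp: unsquash_def abs_if split: if_splits)
next
  case False
  then have v: "\<bar>v\<bar> < 1" using assms by simp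
  then have "v / (1 - \<bar>v\<bar>) / (1 + \<bar>v / (1 - \<bar>v\<bar>)\<bar>) = v"
    by (simp add: divide_simps)
  then show ?thesis using v by (auto simp: unsquash_def)
qed

lemma abs_squash_le_1: "\<bar>squash y\<bar> \<le> 1"
  by (cases y) (use real_squash_bounds in \<open>auto simp: less_imp_le simp del: abs_divide\<close>)

lemma squash_range: "squash y \<in> {-1..1}"
  using abs_squash_le_1[of y] by auto

text \<open>For equal signs the difference is (x - y) / ((1 + |x|)(1 + |y|)), whose denominator is
  at least 1; for opposite signs each of the two terms shrinks towards 0 separately. The Lipschitz
  constant 1 lets later estimates pass from distances of reals to distances of squashed
  values.\<close>

lemma squash_real_mono_lipschitz:
  fixes x y :: real
  assumes "y \<le> x"
  shows "0 \<le> x/(1+\<bar>x\<bar>) - y/(1+\<bar>y\<bar>)" "x/(1+\<bar>x\<bar>) - y/(1+\<bar>y\<bar>) \<le> x - y"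
proof -
  have nn: "0 \<le> u * v" if "u \<ge> 0" "v \<ge> 0" for u v :: real using that by simp
  have le: "d / m \<le> d" if "d \<ge> 0" "m \<ge> 1" for d m :: real
    using that mult_left_mono[of 1 m d] by (simp add: divide_le_eq)
  consider "0 \<le> y" | "x \<le> 0" | "y < 0" "0 < x" by linarith
  then have "0 \<le> x/(1+\<bar>x\<bar>) - y/(1+\<bar>y\<bar>) \<and> x/(1+\<bar>x\<bar>) - y/(1+\<bar>y\<bar>) \<le> x - y"
  proof cases
    case 1
    then have x: "x \<ge> 0" using assms by simp
    have "x/(1+x) - y/(1+y) = (x - y) / ((1+x)*(1+y))"
      using 1 x by (simp add: divide_simps) (simp add: algebra_simps)
    moreover have "(1+x)*(1+y) \<ge> 1" using nn[OF x 1] 1 x by (simp add: algebra_simps)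
    ultimately show ?thesis using 1 x assms le[of "x - y"] by simp
  next
    case 2
    then have y: "y \<le> 0" using assms by simp
    have "x/(1-x) - y/(1-y) = (x - y) / ((1-x)*(1-y))"
      using 2 y by (simp add: divide_simps) (simp add: algebra_simps)
    moreover have "(1-x)*(1-y) \<ge> 1" using nn[of "-x" "-y"] 2 y by (simp add: algebra_simps)
    ultimately show ?thesis using 2 y assms le[of "x - y"] by simp
  next
    case 3
    have "0 \<le> x/(1+x)" "x/(1+x) \<le> x" using 3 le[of x "1+x"] by auto
    moreover have "y/(1-y) \<le> 0" "- y / (1-y) \<le> - y" using 3 le[of "-y" "1-y"] by (auto simp: divide_le_0_iff)
    ultimately have "0 \<le> x/(1+x) - y/(1-y) \<and> x/(1+x) - y/(1-y) \<le> x - y" by simp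
    then show ?thesis using 3 by simp
  qed
  then show "0 \<le> x/(1+\<bar>x\<bar>) - y/(1+\<bar>y\<bar>)" "x/(1+\<bar>x\<bar>) - y/(1+\<bar>y\<bar>) \<le> x - y" by auto
qed

lemma squash_lipschitz: "\<bar>squash (ereal x) - squash (ereal y)\<bar> \<le> \<bar>x - y\<bar>"
  using squash_real_mono_lipschitz[of y x] squash_real_mono_lipschitz[of x y]
  by (cases "y \<le> x") auto

lemma squash_mono: "x \<le> y \<Longrightarrow> squash x \<le> squash y"
  using squash_real_mono_lipschitz[of "real_of_ereal x" "real_of_ereal y"]
    abs_squash_le_1[of x] abs_squash_le_1[of y]
  by (cases x; cases y) (auto simp del: abs_divide)

lemma unsquash_mono: "\<bar>u\<bar> \<le> 1 \<Longrightarrow> \<bar>v\<bar> \<le> 1 \<Longrightarrow> u \<le> v \<Longrightarrow> unsquash u \<le> unsquash v"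
  by (metis squash_mono squash_unsquash linorder_linear order_antisym)

lemma unsquash_image: "unsquash ` {-1..1} = UNIV"
proof -
  have "y \<in> unsquash ` {-1..1}" for y
    using unsquash_squash[of y] squash_range[of y] by (metis image_eqI)
  then show ?thesis by auto
qed

text \<open>A monotone map with open image has no jumps; here the image is the whole extended
  line.\<close>

lemma continuous_on_unsquash: "continuous_on {-1..1} unsquash"
  by (rule continuous_onI_mono) (auto simp: unsquash_image abs_le_iff intro: unsquash_mono)

text \<open>The inverse of a continuous injection on a compact set is continuous.\<close>

lemma continuous_on_squash: "continuous_on UNIV squash"
proof -
  have "continuous_on (unsquash ` {-1..1}) squash"
    by (rule continuous_on_inv[OF continuous_on_unsquash]) (auto simp: squash_unsquash abs_le_iff)
  then show ?thesis by (simp add: unsquash_image)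
qed

lemma squash_strict_mono: "x < y \<Longrightarrow> squash x < squash y"
  by (metis squash_mono unsquash_squash order_less_le)

lemma squash_less_iff [simp]: "squash x < squash y \<longleftrightarrow> x < y"
  by (metis squash_strict_mono linorder_not_le order_less_le)

lemma squash_uminus [simp]: "squash (- y) = - squash y"
  by (cases y) auto

lemma squash_eq_0_iff [simp]: "squash y = 0 \<longleftrightarrow> y = 0"
  by (metis squash_simps(4) unsquash_squash)

section \<open>The metric \<open>rho\<close> in the squashed coordinate and the topology it
  induces\<close>

lemma sgn_squash: "real_of_ereal (sgn y) = sgn (squash y)"
  by (cases y) (auto simp: sgn_if zero_less_divide_iff)

lemma abs_squash: "\<bar>squash y\<bar> = squash \<bar>y\<bar>"
  by (cases y) auto

text \<open>|squash y| = |y| / (1 + |y|) gives 1 / |squash y| = 1 + 1 / |y|, also at the infinite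
  points, where both sides are 1. Hence the first part of \<open>rho\<close> compares reciprocals of
  squashed values.\<close>

lemma inverse_abs_squash:
  "y \<noteq> 0 \<Longrightarrow> real_of_ereal (1 / \<bar>y\<bar>) = 1 / \<bar>squash y\<bar> - 1"
  by (cases y) (auto simp: field_simps one_ereal_def zero_ereal_def)

lemma rho_squash:
  assumes "x \<in> E_space" "y \<in> E_space"
  shows "rho x y = max (\<bar>1 / \<bar>squash x\<bar> - 1 / \<bar>squash y\<bar>\<bar>) (\<bar>sgn (squash x) - sgn (squash y)\<bar>)"
  using assms by (simp add: rho_def inverse_abs_squash E_space_def sgn_squash)

text \<open>Away from 0 inversion is a homeomorphism on each half-line, and the sign part of
  \<open>rho\<close> keeps the two half-lines apart, so \<open>rho\<close> induces the ordinary
  topology of the extended line. From here on all topology is that of subspaces of real x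
  \<open>ereal\<close>.\<close>

lemma E_top_eq: "E_top = top_of_set E_space"
proof -
  interpret Metric_space E_space rho by (rule Metric_space_rho)
  have "openin mtopology U \<longleftrightarrow> openin (top_of_set E_space) U" for U
  proof
    assume U: "openin mtopology U"
    have "\<exists>V. open V \<and> x \<in> V \<and> E_space \<inter> V \<subseteq> U" if "x \<in> U" for x
    proof -
      from U that obtain r where r: "r > 0" "mball x r \<subseteq> U" and x: "x \<in> E_space"
        unfolding openin_mtopology by (meson in_mono)
      \<comment> \<open>A neighbourhood inside the \<open>rho\<close>-ball: the reciprocals are
        close, and the product condition forces y to have the sign of x, which makes the second part
        of \<open>rho\<close> zero.\<close>
      let ?V = "{y. \<bar>1 / \<bar>squash x\<bar> - 1 / \<bar>squash y\<bar>\<bar> < r \<and> squash y * sgn (squash x) > 0} \<inter> - {0}"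
      have o: "open (- {0::ereal})" by auto
      have c1: "continuous_on (- {0::ereal}) (\<lambda>y. \<bar>1 / \<bar>squash x\<bar> - 1 / \<bar>squash y\<bar>\<bar>)"
        by (intro continuous_intros continuous_on_subset[OF continuous_on_squash]) auto
      have c2: "continuous_on (- {0::ereal}) (\<lambda>y. squash y * sgn (squash x))"
        by (intro continuous_intros continuous_on_subset[OF continuous_on_squash]) auto
      have "open ((\<lambda>y. \<bar>1 / \<bar>squash x\<bar> - 1 / \<bar>squash y\<bar>\<bar>) -` {..<r} \<inter> - {0})"
        "open ((\<lambda>y. squash y * sgn (squash x)) -` {0<..} \<inter> - {0})"
        using continuous_on_open_vimage[OF o, THEN iffD1, rule_format, OF c1, of "{..<r}"]
          continuous_on_open_vimage[OF o, THEN iffD1, rule_format, OF c2, of "{0<..}"] by auto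
      then have "open (((\<lambda>y. \<bar>1 / \<bar>squash x\<bar> - 1 / \<bar>squash y\<bar>\<bar>) -` {..<r} \<inter> - {0})
          \<inter> ((\<lambda>y. squash y * sgn (squash x)) -` {0<..} \<inter> - {0}))" by auto
      then have "open ?V" by (rule arg_cong[where f = "open", THEN iffD1, rotated]) auto
      moreover have "x \<in> ?V"
        using x r squash_eq_0_iff[of x] by (auto simp: E_space_def sgn_if zero_less_mult_iff simp del: squash_eq_0_iff)
      moreover have "E_space \<inter> ?V \<subseteq> U"
      proof
        fix y assume y: "y \<in> E_space \<inter> ?V"
        then have "sgn (squash y) = sgn (squash x)"
          by (auto simp: sgn_if zero_less_mult_iff split: if_splits)
        then have "rho x y < r" using y x r by (simp add: rho_squash)
        then show "y \<in> U" using r y x by auto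
      qed
      ultimately show ?thesis by (intro exI[of _ ?V]) blast
    qed
    then obtain V where V: "\<And>x. x \<in> U \<Longrightarrow> open (V x) \<and> x \<in> V x \<and> E_space \<inter> V x \<subseteq> U"
      by metis
    have "U \<subseteq> E_space" using U by (simp add: openin_mtopology)
    then have "U = E_space \<inter> (\<Union>x\<in>U. V x)" using V by blast
    then show "openin (top_of_set E_space) U"
      using V by (metis openin_open open_UN)
  next
    assume "openin (top_of_set E_space) U"
    then obtain V where V: "open V" "U = E_space \<inter> V" by (auto simp: openin_open)
    have "\<exists>r>0. mball x r \<subseteq> U" if x: "x \<in> U" for x
    proof -
      have "\<exists>A. open A \<and> A \<inter> {-1..1} = unsquash -` V \<inter> {-1..1}"
        using continuous_on_unsquash V(1) unfolding continuous_on_open_invariant by blast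
      then obtain A where A: "open A" "A \<inter> {-1..1} = unsquash -` V \<inter> {-1..1}" by blast
      have "squash x \<in> unsquash -` V \<inter> {-1..1}" using x V(2) squash_range by auto
      then have "squash x \<in> A" using A(2) by blast
      then obtain d where d: "d > 0" "\<And>v. \<bar>v - squash x\<bar> < d \<Longrightarrow> v \<in> A"
        using A(1) unfolding open_dist by (metis dist_real_def)
      \<comment> \<open>The cap 1 forces equal signs, since distinct signs differ by 2; the bound on
        reciprocals transfers to squashed values because |a - b| = |1/a - 1/b| a b with a, b at most
        1.\<close>
      have "y \<in> U" if y: "y \<in> E_space" "rho x y < min d 1" for y
      proof -
        have xE: "x \<in> E_space" using x V by auto
        let ?a = "\<bar>squash x\<bar>" and ?b = "\<bar>squash y\<bar>"
        have ab: "0 < ?a" "0 < ?b" "?a \<le> 1" "?b \<le> 1"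
          using xE y(1) abs_squash_le_1 by (auto simp: E_space_def)
        have lt: "\<bar>1 / ?a - 1 / ?b\<bar> < d" "\<bar>sgn (squash x) - sgn (squash y)\<bar> < 1"
          using y(2) rho_squash[OF xE y(1)] by auto
        have "\<bar>?a - ?b\<bar> = \<bar>1 / ?a - 1 / ?b\<bar> * (?a * ?b)"
        proof -
          have "1 / ?a - 1 / ?b = (?b - ?a) / (?a * ?b)" using ab by (simp add: field_simps)
          then have "\<bar>1 / ?a - 1 / ?b\<bar> = \<bar>?b - ?a\<bar> / (?a * ?b)"
            using ab by (simp add: abs_mult)
          then show ?thesis using ab by (simp add: abs_minus_commute)
        qed
        also have "\<dots> \<le> \<bar>1 / ?a - 1 / ?b\<bar> * 1"
          using ab by (intro mult_left_mono) (auto simp: mult_le_one)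
        finally have "\<bar>?a - ?b\<bar> < d" using lt by simp
        moreover have "sgn (squash x) = sgn (squash y)"
          using lt(2) by (auto simp: sgn_if split: if_splits)
        ultimately have "\<bar>squash y - squash x\<bar> < d"
          by (auto simp: sgn_if abs_if split: if_splits)
        then have "squash y \<in> A \<inter> {-1..1}" using d squash_range by auto
        then have "y \<in> V" using A(2) by auto
        then show ?thesis using V y by auto
      qed
      then show ?thesis using d(1) by (intro exI[of _ "min d 1"]) auto
    qed
    then show "openin mtopology U" using V by (auto simp: openin_mtopology)
  qed
  then show ?thesis by (simp add: E_top_def topology_eq)
qed

lemma S_top_eq: "S_top = top_of_set S_space"
  by (simp add: S_top_def E_top_eq S_space_def prod_topology_subtopology_eu)

lemma S_space_alt: "S_space = {0..1} \<times> (- {0})"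
  by (auto simp: S_space_def E_space_def)

lemma S_space_borel [measurable]: "S_space \<in> sets borel"
proof -
  have "S_space = {z \<in> space borel. fst z \<in> {0..1::real} \<and> snd z \<noteq> (0::ereal)}"
    by (auto simp: S_space_alt)
  also have "\<dots> \<in> sets borel"
    unfolding borel_prod[symmetric] by measurable
  finally show ?thesis .
qed

lemma sets_borel_of_top_of_set:
  assumes "S \<in> sets borel"
  shows "sets (borel_of (top_of_set S)) = sets (restrict_space borel S)"
proof -
  have "sets (restrict_space borel S) = (\<inter>) S ` sigma_sets UNIV {U. open U}"
    by (simp add: sets_restrict_space borel_def)
  also have "\<dots> = sigma_sets S ((\<inter>) S ` {U. open U})"
    using assms by (intro sigma_sets_Int) (auto simp: borel_def)
  also have "(\<inter>) S ` {U. open U} = {U. openin (top_of_set S) U}"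
    by (auto simp: openin_open)
  finally show ?thesis
    by (simp add: borel_of_def)
       (subst sets_measure_of, auto simp: openin_open)
qed

lemma sets_borel_of_S_top: "sets (borel_of S_top) = sets (restrict_space borel S_space)"
  unfolding S_top_eq by (rule sets_borel_of_top_of_set) simp

lemma space_borel_of_S_top [simp]: "space (borel_of S_top) = S_space"
  by (simp add: space_borel_of topspace_S_top)

lemma compactin_S_top: "compactin S_top A \<longleftrightarrow> compact A \<and> A \<subseteq> S_space"
  by (simp add: S_top_eq compactin_subtopology)

section \<open>Relatively compact sets and test functions\<close>

text \<open>For u > 0 these are compact, and every relatively compact set lies in one of them; local
  finiteness and compact support are therefore tested on slabs only.\<close>

definition slab :: "real \<Rightarrow> (real \<times> ereal) set" where
  "slab u = {0..1} \<times> {y. ereal u \<le> \<bar>y\<bar>}"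

lemma slab_subset: "0 < u \<Longrightarrow> slab u \<subseteq> S_space"
  by (auto simp: slab_def S_space_alt)

lemma closed_abs_ge: "closed {y::ereal. ereal u \<le> \<bar>y\<bar>}"
proof -
  have "{y. ereal u \<le> \<bar>y\<bar>} = {y. squash (ereal u) \<le> \<bar>squash y\<bar>}"
    by (simp add: abs_squash linorder_not_less[symmetric] del: squash_simps)
  also have "closed \<dots>"
    by (intro closed_Collect_le continuous_intros continuous_on_squash)
  finally show ?thesis .
qed

lemma compact_slab: "compact (slab u)"
proof -
  have "compact (UNIV \<inter> {y::ereal. ereal u \<le> \<bar>y\<bar>})"
    by (intro compact_Int_closed compact_UNIV closed_abs_ge)
  then show ?thesis
    unfolding slab_def by (intro compact_Times) auto
qed

lemma abs_squash_le_abs: "ereal \<bar>squash y\<bar> \<le> \<bar>y\<bar>"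
  using squash_lipschitz[of _ 0] by (cases y) (auto simp: abs_divide)

text \<open>On a compact subset of \<open>S_space\<close> the continuous function |squash (snd z)|
  attains a positive minimum, and |squash y| \<le> |y| makes that minimum a valid radius.
  Conversely, a slab is compact and closed.\<close>

lemma compactin_closure_S_top:
  assumes A: "A \<subseteq> S_space"
  shows "compactin S_top (S_top closure_of A) \<longleftrightarrow> (\<exists>u>0. A \<subseteq> slab u)"
proof
  assume c: "compactin S_top (S_top closure_of A)"
  define K where "K = S_top closure_of A"
  have K: "compact K" "K \<subseteq> S_space" "A \<subseteq> K"
    using c A closure_of_subset[of A S_top] by (auto simp: K_def compactin_S_top topspace_S_top)
  show "\<exists>u>0. A \<subseteq> slab u"
  proof (cases "K = {}")
    case True
    then show ?thesis using K by (intro exI[of _ 1]) auto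
  next
    case False
    have "continuous_on K (\<lambda>z. \<bar>squash (snd z)\<bar>)"
      by (intro continuous_intros continuous_on_compose2[OF continuous_on_squash]) auto
    then obtain z where z: "z \<in> K" "\<And>w. w \<in> K \<Longrightarrow> \<bar>squash (snd z)\<bar> \<le> \<bar>squash (snd w)\<bar>"
      using continuous_attains_inf[OF K(1) False] by metis
    have "squash (snd z) \<noteq> 0" using z K by (auto simp: S_space_alt)
    moreover have "A \<subseteq> slab \<bar>squash (snd z)\<bar>"
    proof
      fix w assume w: "w \<in> A"
      then have "ereal \<bar>squash (snd z)\<bar> \<le> \<bar>snd w\<bar>"
        using z(2)[of w] K(3) abs_squash_le_abs[of "snd w"] by (metis ereal_less_eq(3) order_trans subsetD)
      then show "w \<in> slab \<bar>squash (snd z)\<bar>"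
        using w A by (cases w) (auto simp: slab_def S_space_alt)
    qed
    ultimately show ?thesis by (intro exI[of _ "\<bar>squash (snd z)\<bar>"]) auto
  qed
next
  assume "\<exists>u>0. A \<subseteq> slab u"
  then obtain u where u: "u > 0" "A \<subseteq> slab u" by auto
  have "closedin S_top (slab u)"
    using slab_subset[OF u(1)] compact_imp_closed[OF compact_slab]
    by (auto simp: S_top_eq closedin_closed)
  then have "S_top closure_of A \<subseteq> slab u"
    using u(2) by (simp add: closure_of_minimal)
  then show "compactin S_top (S_top closure_of A)"
    using compact_slab slab_subset[OF u(1)]
    by (intro closed_compactin[OF _ _ closedin_closure_of, of S_top "slab u"]) (simp_all add: compactin_S_top)
qed

text \<open>The working description of test functions: since f vanishes near y = 0, it extends
  continuously by 0 across y = 0, and continuity can be asked on the compact space [0,1] x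
  \<open>ereal\<close>. Boundedness and uniform continuity come from this compactness.\<close>

lemma CK_plus_iff:
  "f \<in> CK_plus \<longleftrightarrow> (\<forall>z. 0 \<le> f z) \<and> (\<forall>z. z \<notin> S_space \<longrightarrow> f z = 0) \<and>
     continuous_on ({0..1} \<times> UNIV) f \<and> (\<exists>u>0. \<forall>t y. \<bar>y\<bar> < ereal u \<longrightarrow> f (t, y) = 0)"
  (is "_ \<longleftrightarrow> ?P \<and> ?Z \<and> ?C \<and> ?U")
proof -
  have cl: "compactin S_top (S_top closure_of {z \<in> S_space. f z \<noteq> 0}) \<longleftrightarrow> ?U" if ?Z
  proof -
    have "{z \<in> S_space. f z \<noteq> 0} \<subseteq> slab u \<longleftrightarrow> (\<forall>t y. \<bar>y\<bar> < ereal u \<longrightarrow> f (t, y) = 0)" if "u > 0" for u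
    proof
      assume L: "{z \<in> S_space. f z \<noteq> 0} \<subseteq> slab u"
      show "\<forall>t y. \<bar>y\<bar> < ereal u \<longrightarrow> f (t, y) = 0"
      proof (intro allI impI, rule ccontr)
        fix t y assume "\<bar>y\<bar> < ereal u" and ne: "f (t, y) \<noteq> 0"
        moreover have "(t, y) \<in> S_space" using ne \<open>?Z\<close> by blast
        then have "(t, y) \<in> slab u" using L ne by blast
        ultimately show False by (simp add: slab_def not_le[symmetric])
      qed
    next
      assume R: "\<forall>t y. \<bar>y\<bar> < ereal u \<longrightarrow> f (t, y) = 0"
      then show "{z \<in> S_space. f z \<noteq> 0} \<subseteq> slab u"
        unfolding slab_def S_space_alt by (auto simp: not_le[symmetric])
    qed
    then show ?thesis
      by (subst compactin_closure_S_top) auto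
  qed
  have cont: "continuous_on S_space f \<longleftrightarrow> ?C" if Z: ?Z and ?U
  proof
    assume c: "continuous_on S_space f"
    from \<open>?U\<close> obtain u where u: "u > 0" "\<And>t y. \<bar>y\<bar> < ereal u \<Longrightarrow> f (t, y) = 0" by auto
    \<comment> \<open>\<open>S_space\<close> and the strip |y| < u are relatively open and cover
      [0,1] x \<open>ereal\<close>; f and 0 agree on their overlap and are glued.\<close>
    let ?N = "{0..1::real} \<times> (- {y. ereal u \<le> \<bar>y\<bar>})"
    have un: "{0..1::real} \<times> UNIV = S_space \<union> ?N"
      using u by (auto simp: S_space_alt)
    have "openin (top_of_set (S_space \<union> ?N)) S_space"
      unfolding un[symmetric] unfolding S_space_alt
      by (rule openin_Times_eq[THEN iffD2]) (auto simp: open_openin[symmetric])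
    moreover have "openin (top_of_set (S_space \<union> ?N)) ?N"
      unfolding un[symmetric] using closed_abs_ge
      by (intro openin_Times_eq[THEN iffD2]) (auto simp: open_openin[symmetric] open_Compl)
    ultimately have "continuous_on (S_space \<union> ?N) (\<lambda>z. if z \<in> S_space then f z else 0)"
      using u Z by (intro continuous_on_cases_local_open c) (auto simp: not_le, metis linorder_not_le)
    then show ?C unfolding un by (rule continuous_on_eq) (use Z in auto)
  next
    assume ?C then show "continuous_on S_space f"
      by (rule continuous_on_subset) (auto simp: S_space_alt)
  qed
  show ?thesis unfolding CK_plus_def using cl cont by (auto simp: S_top_eq)
qed

lemma CK_plusD:
  assumes "f \<in> CK_plus"
  shows "0 \<le> f z" "z \<notin> S_space \<Longrightarrow> f z = 0" "f (t, 0) = 0" "continuous_on ({0..1} \<times> UNIV) f"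
  using assms[unfolded CK_plus_iff] by (blast, blast, auto simp: S_space_alt)

lemma CK_plus_supportE:
  assumes "f \<in> CK_plus"
  obtains u where "u > 0" "\<And>t y. \<bar>y\<bar> < ereal u \<Longrightarrow> f (t, y) = 0"
  using assms by (auto simp: CK_plus_iff)

lemma CK_plus_measurable:
  assumes "f \<in> CK_plus"
  shows "f \<in> borel_measurable (borel_of S_top)"
proof -
  have "continuous_on S_space f"
    using CK_plusD(4)[OF assms] by (rule continuous_on_subset) (auto simp: S_space_alt)
  then have "f \<in> borel_measurable (restrict_space borel S_space)"
    by (rule borel_measurable_continuous_on_restrict)
  then show ?thesis by (simp cong: measurable_cong_sets add: sets_borel_of_S_top)
qed

lemma CK_plus_borel [measurable_dest]:
  assumes "f \<in> CK_plus"
  shows "f \<in> borel_measurable borel"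
proof -
  have "(\<lambda>z. if z \<in> S_space then f z else 0) \<in> borel_measurable borel"
    using CK_plus_measurable[OF assms]
    by (intro measurable_If_restrict_space_iff[THEN iffD2])
       (auto cong: measurable_cong_sets simp: sets_borel_of_S_top)
  moreover have "(\<lambda>z. if z \<in> S_space then f z else 0) = f" using CK_plusD(2)[OF assms] by auto
  ultimately show ?thesis by simp
qed

text \<open>The function is pulled back to the compact rectangle [0,1] x [-1,1]; this controls its
  oscillation in y uniformly up to the infinite points.\<close>

lemma CK_plus_uniformly_continuous:
  assumes f: "f \<in> CK_plus" and e: "e > 0"
  obtains d where "d > 0"
    "\<And>t t' y y'. t \<in> {0..1} \<Longrightarrow> t' \<in> {0..1} \<Longrightarrow> \<bar>t - t'\<bar> < d \<Longrightarrow> \<bar>squash y - squash y'\<bar> < d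
      \<Longrightarrow> \<bar>f (t, y) - f (t', y')\<bar> < e"
proof -
  let ?F = "\<lambda>z. f (fst z, unsquash (snd z))"
  have "continuous_on ({0..1} \<times> {-1..1}) ?F"
    by (rule continuous_on_compose2[OF CK_plusD(4)[OF f]], rule continuous_on_Pair,
        rule continuous_on_fst[OF continuous_on_id],
        rule continuous_on_compose2[OF continuous_on_unsquash continuous_on_snd[OF continuous_on_id]]) auto
  then have "uniformly_continuous_on ({0..1} \<times> {-1..1}) ?F"
    by (rule compact_uniformly_continuous) (intro compact_Times compact_Icc)
  then obtain d where d: "d > 0" "\<And>z w. z \<in> {0..1} \<times> {-1..1} \<Longrightarrow> w \<in> {0..1} \<times> {-1..1}
      \<Longrightarrow> dist w z < d \<Longrightarrow> dist (?F w) (?F z) < e"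
    using e unfolding uniformly_continuous_on_def by metis
  show ?thesis
  \<comment> \<open>The Euclidean distance is at most the sum of the two coordinate distances, hence
    the halving.\<close>
  proof (rule that[of "d / 2"])
    fix t t' :: real and y y' :: ereal
    assume A: "t \<in> {0..1}" "t' \<in> {0..1}" "\<bar>t - t'\<bar> < d / 2" "\<bar>squash y - squash y'\<bar> < d / 2"
    have "dist (t, squash y) (t', squash y') \<le> \<bar>t - t'\<bar> + \<bar>squash y - squash y'\<bar>"
      unfolding dist_Pair_Pair dist_real_def by (rule order_trans[OF sqrt_sum_squares_le_sum_abs]) simp
    then have "dist (?F (t, squash y)) (?F (t', squash y')) < e"
      using A by (intro d) (auto simp: squash_range[simplified])
    then show "\<bar>f (t, y) - f (t', y')\<bar> < e" by (simp add: dist_real_def)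
  qed (use d in auto)
qed

lemma CK_plus_bounded:
  assumes f: "f \<in> CK_plus"
  obtains B where "B > 0" "\<And>z. f z \<le> B"
proof -
  have "compact ({0..1::real} \<times> (UNIV :: ereal set))"
    by (rule compact_Times[OF compact_Icc compact_UNIV])
  then have "compact (f ` ({0..1} \<times> UNIV))"
    using CK_plusD(4)[OF f] by (rule compact_continuous_image[rotated])
  then obtain B where B: "\<And>z. z \<in> {0..1} \<times> UNIV \<Longrightarrow> norm (f z) \<le> B"
    using compact_imp_bounded bounded_iff by (metis image_eqI)
  have "f z \<le> max B 1" for z
    using B[of z] CK_plusD(2)[OF f, of z] by (cases "z \<in> S_space") (auto simp: S_space_alt)
  then show ?thesis by (intro that[of "max B 1"]) auto
qed

lemma CK_plus_zero: "(\<lambda>_. 0) \<in> CK_plus"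
  by (auto simp: CK_plus_iff intro: exI[of _ 1])

lemma CK_plus_add:
  assumes "f \<in> CK_plus" "g \<in> CK_plus"
  shows "(\<lambda>z. f z + g z) \<in> CK_plus"
proof -
  obtain u where u: "u > 0" "\<And>t y. \<bar>y\<bar> < ereal u \<Longrightarrow> f (t, y) = 0"
    using CK_plus_supportE[OF assms(1)] by blast
  obtain v where v: "v > 0" "\<And>t y. \<bar>y\<bar> < ereal v \<Longrightarrow> g (t, y) = 0"
    using CK_plus_supportE[OF assms(2)] by blast
  have "continuous_on ({0..1} \<times> UNIV) (\<lambda>z. f z + g z)"
    by (intro continuous_on_add CK_plusD assms)
  moreover have "\<forall>t y. \<bar>y\<bar> < ereal (min u v) \<longrightarrow> f (t, y) + g (t, y) = 0"
    using u v by simp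
  ultimately show ?thesis
    unfolding CK_plus_iff using u(1) v(1) CK_plusD(1,2)[OF assms(1)] CK_plusD(1,2)[OF assms(2)]
    by (metis add.right_neutral add_nonneg_nonneg min_less_iff_conj)
qed

lemma CK_plus_sum: "finite A \<Longrightarrow> (\<And>i. i \<in> A \<Longrightarrow> f i \<in> CK_plus) \<Longrightarrow> (\<lambda>z. \<Sum>i\<in>A. f i z) \<in> CK_plus"
  by (induction A rule: finite_induct) (auto intro: CK_plus_zero CK_plus_add)

lemma CK_plus_cmult: "f \<in> CK_plus \<Longrightarrow> 0 \<le> c \<Longrightarrow> (\<lambda>z. c * f z) \<in> CK_plus"
  unfolding CK_plus_iff by (auto intro!: continuous_intros)

lemma CK_plus_one_minus_exp: "f \<in> CK_plus \<Longrightarrow> (\<lambda>z. 1 - exp (- f z)) \<in> CK_plus"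
  unfolding CK_plus_iff by (auto intro!: continuous_intros)

text \<open>For c = 0 every point, even an infinite one, is sent to second coordinate 0, where f
  vanishes; for c \<noteq> 0 multiplication is continuous on the extended line and the radius of
  vanishing becomes u / |c|.\<close>

lemma CK_plus_scale:
  assumes f: "f \<in> CK_plus"
  shows "(\<lambda>(t, y). f (t, y * ereal c)) \<in> CK_plus"
proof (cases "c = 0")
  case True
  then show ?thesis using CK_plusD(3)[OF f] CK_plus_zero
    by (simp add: zero_ereal_def[symmetric] case_prod_unfold)
next
  case False
  obtain u where u: "u > 0" "\<And>t y. \<bar>y\<bar> < ereal u \<Longrightarrow> f (t, y) = 0"
    using CK_plus_supportE[OF f] by blast
  have "continuous_on ({0..1} \<times> UNIV) (\<lambda>z::real\<times>ereal. (fst z, snd z * ereal c))"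
    unfolding continuous_on_def
    by (intro ballI tendsto_Pair tendsto_mult_ereal tendsto_fst tendsto_snd tendsto_const tendsto_ident_at)
       (use False in auto)
  then have "continuous_on ({0..1} \<times> UNIV) (\<lambda>z. f (fst z, snd z * ereal c))"
    by (rule continuous_on_compose2[OF CK_plusD(4)[OF f]]) auto
  moreover have "f (t, y * ereal c) = 0" if "\<bar>y\<bar> < ereal (u / \<bar>c\<bar>)" for t y
  proof (rule u(2))
    show "\<bar>y * ereal c\<bar> < ereal u" using that False by (cases y) (auto simp: abs_mult field_simps)
  qed
  moreover have "f (t, y * ereal c) = 0" if "(t, y) \<notin> S_space" for t y
    using that False CK_plusD(2)[OF f] by (auto simp: S_space_alt)
  ultimately show ?thesis
    using f u False unfolding CK_plus_iff
    by (auto simp: case_prod_unfold intro!: exI[of _ "u / \<bar>c\<bar>"])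
qed

lemma CK_plus_bumpE:
  assumes "u > 0"
  obtains f where "f \<in> CK_plus" "\<And>z. z \<in> slab u \<Longrightarrow> 1 \<le> f z"
proof
  define k where "k = squash (ereal u)"
  have k: "k > 0" unfolding k_def using assms by simp
  \<comment> \<open>Linear in |squash y| between k / 2, where it is 0, and k, where it is 1; k is
    the squashed radius.\<close>
  let ?f = "\<lambda>z::real\<times>ereal. if fst z \<in> {0..1} then max 0 (min 1 (2 * \<bar>squash (snd z)\<bar> / k - 1)) else 0"
  have "continuous_on ({0..1} \<times> UNIV) (\<lambda>z::real\<times>ereal. max 0 (min 1 (2 * \<bar>squash (snd z)\<bar> / k - 1)))"
    using k by (intro continuous_intros continuous_on_compose2[OF continuous_on_squash]) auto
  then have cont: "continuous_on ({0..1} \<times> UNIV) ?f"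
    by (rule continuous_on_eq) auto
  have supp: "?f (t, y) = 0" if "\<bar>y\<bar> < ereal (k / 2)" for t y
  proof -
    have "ereal \<bar>squash y\<bar> < ereal (k / 2)" using abs_squash_le_abs that by (rule order_le_less_trans)
    then show ?thesis using k by (simp add: field_simps)
  qed
  show "?f \<in> CK_plus"
    unfolding CK_plus_iff
  proof (intro conjI allI impI exI[of _ "k / 2"])
    show "?f (t, y) = 0" if "\<bar>y\<bar> < ereal (k / 2)" for t y using supp[OF that] .
  qed (use cont k in \<open>auto simp: S_space_alt\<close>)
  fix z assume "z \<in> slab u"
  then have "k \<le> \<bar>squash (snd z)\<bar>" "fst z \<in> {0..1}"
    unfolding k_def abs_squash slab_def by (auto intro!: squash_mono simp del: squash_simps)
  then show "1 \<le> ?f z" using k by (simp add: field_simps)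
qed

lemma sets_dirac_sum [simp]: "sets (dirac_sum I x) = sets (borel_of S_top)"
  by (simp add: dirac_sum_def)

section \<open>Point measures\<close>

lemma slab_sets: "0 < u \<Longrightarrow> slab u \<in> sets (borel_of S_top)"
proof -
  assume u: "0 < u"
  have "slab u = S_space \<inter> slab u" using slab_subset[OF u] by auto
  moreover have "slab u \<in> sets borel" by (intro borel_closed compact_imp_closed compact_slab)
  ultimately show ?thesis by (metis sets_borel_of_S_top sets_restrict_space image_eqI)
qed

lemma dirac_sum_cong:
  assumes "{i \<in> I. x i \<in> S_space} = {i \<in> J. y i \<in> S_space}"
    and "\<And>i. i \<in> I \<Longrightarrow> x i \<in> S_space \<Longrightarrow> x i = y i"
  shows "dirac_sum I x = dirac_sum J y"
  unfolding dirac_sum_def assms(1)[symmetric]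
  by (rule distr_cong) (use assms in auto)

lemma dirac_sum_reindex:
  assumes h: "bij_betw h J I"
  shows "dirac_sum I x = dirac_sum J (\<lambda>j. x (h j))"
proof (rule measure_eqI)
  fix A assume "A \<in> sets (dirac_sum I x)"
  then have A: "A \<in> sets (borel_of S_top)" by simp
  show "emeasure (dirac_sum I x) A = emeasure (dirac_sum J (\<lambda>j. x (h j))) A"
    unfolding emeasure_dirac_sum[OF A]
    by (rule nn_integral_bij_count_space[OF h, symmetric])
qed simp

lemma emeasure_dirac_sum_count:
  assumes "A \<in> sets (borel_of S_top)"
  shows "emeasure (dirac_sum I x) A = emeasure (count_space I) {i \<in> I. x i \<in> A}"
proof -
  have "emeasure (dirac_sum I x) A = (\<integral>\<^sup>+ i. indicator {i \<in> I. x i \<in> A} i \<partial>count_space I)"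
    unfolding emeasure_dirac_sum[OF assms] by (intro nn_integral_cong) (auto split: split_indicator)
  then show ?thesis by simp
qed

lemma integral_dirac_sum:
  fixes f :: "real \<times> ereal \<Rightarrow> real"
  assumes f: "f \<in> borel_measurable (borel_of S_top)" "\<And>z. z \<notin> S_space \<Longrightarrow> f z = 0"
    and F: "finite F" "F \<subseteq> I" "\<And>i. i \<in> I \<Longrightarrow> i \<notin> F \<Longrightarrow> f (x i) = 0"
  shows "(\<integral>z. f z \<partial>dirac_sum I x) = (\<Sum>i\<in>F. f (x i))"
proof -
  have eq: "{i \<in> I. x i \<in> S_space \<and> f (x i) \<noteq> 0} = {i \<in> F. f (x i) \<noteq> 0}"
    using F f(2) by blast
  have "(\<integral>z. f z \<partial>dirac_sum I x) = (\<integral>i. f (x i) \<partial>count_space {i \<in> I. x i \<in> S_space})"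
    unfolding dirac_sum_def by (rule integral_distr) (use f in auto)
  also have "\<dots> = (\<Sum>i | i \<in> {i \<in> I. x i \<in> S_space} \<and> f (x i) \<noteq> 0. f (x i))"
    using F(1) by (intro lebesgue_integral_count_space_finite_support) (auto simp: eq)
  also have "\<dots> = (\<Sum>i\<in>F. f (x i))"
    using F(1) eq by (intro sum.mono_neutral_cong_left) auto
  finally show ?thesis .
qed

lemma integral_dirac_sum_CK:
  assumes f: "f \<in> CK_plus"
    and F: "finite F" "F \<subseteq> I" "\<And>i. i \<in> I \<Longrightarrow> i \<notin> F \<Longrightarrow> f (x i) = 0"
  shows "(\<integral>z. f z \<partial>dirac_sum I x) = (\<Sum>i\<in>F. f (x i))"
  by (rule integral_dirac_sum[OF CK_plus_measurable[OF f] CK_plusD(2)[OF f] F])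

text \<open>Indices outside \<open>S_space\<close> are invisible to \<open>dirac_sum\<close>, and
  the remaining countable set is renumbered by naturals to meet the form required in
  \<open>Mp\<close>; finiteness on relatively compact sets reduces to slabs.\<close>

lemma dirac_sum_in_Mp_iff:
  assumes "countable I"
  shows "dirac_sum I x \<in> Mp \<longleftrightarrow> (\<forall>u>0. finite {i \<in> I. x i \<in> slab u})"
proof -
  have fin: "emeasure (dirac_sum I x) A < \<infinity> \<longleftrightarrow> finite {i \<in> I. x i \<in> A}"
    if "A \<in> sets (borel_of S_top)" for A
    unfolding emeasure_dirac_sum_count[OF that] by (simp add: emeasure_count_space of_nat_less_top)
  let ?I' = "{i \<in> I. x i \<in> S_space}"
  have "countable ?I'" using assms by simp
  then have "bij_betw (from_nat_into ?I') (to_nat_on ?I' ` ?I') ?I'"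
    by (auto simp: bij_betw_def inj_on_def image_image)
  then have "dirac_sum ?I' x = dirac_sum (to_nat_on ?I' ` ?I') (\<lambda>j. x (from_nat_into ?I' j))"
    and sub: "(\<lambda>j. x (from_nat_into ?I' j)) ` (to_nat_on ?I' ` ?I') \<subseteq> S_space"
    by (auto intro: dirac_sum_reindex dest: bij_betwE)
  moreover have "dirac_sum I x = dirac_sum ?I' x" by (rule dirac_sum_cong) auto
  ultimately have ex: "\<exists>(J :: nat set) y. y ` J \<subseteq> S_space \<and> dirac_sum I x = dirac_sum J y"
    by (intro exI[of _ "to_nat_on ?I' ` ?I'"] exI[of _ "\<lambda>j. x (from_nat_into ?I' j)"] conjI sub) simp
  have "(\<forall>A \<in> sets (borel_of S_top). compactin S_top (S_top closure_of A) \<longrightarrow>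
      emeasure (dirac_sum I x) A < \<infinity>) \<longleftrightarrow> (\<forall>u>0. finite {i \<in> I. x i \<in> slab u})" (is "?L \<longleftrightarrow> ?R")
  proof
    assume ?L
    then show ?R
      using slab_sets slab_subset fin compactin_closure_S_top by (metis subset_refl)
  next
    assume R: ?R
    show ?L
    proof (intro ballI impI)
      fix A assume A: "A \<in> sets (borel_of S_top)" "compactin S_top (S_top closure_of A)"
      have "A \<subseteq> S_space" using sets.sets_into_space[OF A(1)] by simp
      from A(2)[unfolded compactin_closure_S_top[OF this]]
      obtain u where u: "u > 0" "A \<subseteq> slab u" by (elim exE conjE)
      have "{i \<in> I. x i \<in> A} \<subseteq> {i \<in> I. x i \<in> slab u}" using u(2) by auto
      then have "finite {i \<in> I. x i \<in> A}" using R u(1) finite_subset by auto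
      then show "emeasure (dirac_sum I x) A < \<infinity>" by (simp only: fin[OF A(1)])
    qed
  qed
  then show ?thesis unfolding Mp_def using ex by blast
qed

lemma MpE:
  assumes "\<mu> \<in> Mp"
  obtains I :: "nat set" and x where "x ` I \<subseteq> S_space" "\<mu> = dirac_sum I x"
    "\<And>u. u > 0 \<Longrightarrow> finite {i \<in> I. x i \<in> slab u}"
proof -
  from assms obtain I :: "nat set" and x where I: "x ` I \<subseteq> S_space" "\<mu> = dirac_sum I x"
    unfolding Mp_def by blast
  moreover have "\<And>u. u > 0 \<Longrightarrow> finite {i \<in> I. x i \<in> slab u}"
    using assms dirac_sum_in_Mp_iff[of I x] I by auto
  ultimately show ?thesis using that by blast
qed

lemma not_slab_vanish:
  assumes "f \<in> CK_plus" "\<And>t y. \<bar>y\<bar> < ereal u \<Longrightarrow> f (t, y) = 0" "z \<notin> slab u"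
  shows "f z = 0"
  using assms CK_plusD(2)[OF assms(1), of z]
  by (cases z) (auto simp: slab_def S_space_alt not_le)

lemma integral_Mp_slab:
  assumes f: "f \<in> CK_plus" and u: "\<And>t y. \<bar>y\<bar> < ereal u \<Longrightarrow> f (t, y) = 0"
    and "finite {i \<in> I. x i \<in> slab u}"
  shows "(\<integral>z. f z \<partial>dirac_sum I x) = (\<Sum>i \<in> {i \<in> I. x i \<in> slab u}. f (x i))"
  using not_slab_vanish[OF f u] assms(3) by (intro integral_dirac_sum_CK[OF f]) blast+

text \<open>On the slab of the smaller radius both integrands live on one finite set of points, so
  all integrals are finite sums.\<close>

lemma integral_Mp_add:
  assumes f: "f \<in> CK_plus" and g: "g \<in> CK_plus" and "\<mu> \<in> Mp"
  shows "(\<integral>z. f z + g z \<partial>\<mu>) = (\<integral>z. f z \<partial>\<mu>) + (\<integral>z. g z \<partial>\<mu>)"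
proof -
  obtain u where u: "u > 0" "\<And>t y. \<bar>y\<bar> < ereal u \<Longrightarrow> f (t, y) = 0"
    using CK_plus_supportE[OF f] by blast
  obtain v where v: "v > 0" "\<And>t y. \<bar>y\<bar> < ereal v \<Longrightarrow> g (t, y) = 0"
    using CK_plus_supportE[OF g] by blast
  obtain I :: "nat set" and x where I: "\<mu> = dirac_sum I x"
    "\<And>u. u > 0 \<Longrightarrow> finite {i \<in> I. x i \<in> slab u}"
    using MpE[OF assms(3)] by metis
  have fin: "finite {i \<in> I. x i \<in> slab (min u v)}" using u v I(2)[of "min u v"] by auto
  note eq = integral_Mp_slab[where u = "min u v", OF _ _ fin]
  have "(\<integral>z. f z + g z \<partial>dirac_sum I x) = (\<Sum>i \<in> {i \<in> I. x i \<in> slab (min u v)}. f (x i) + g (x i))"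
    by (rule eq[OF CK_plus_add[OF f g]]) (use u v in simp)
  moreover have "(\<integral>z. f z \<partial>dirac_sum I x) = (\<Sum>i \<in> {i \<in> I. x i \<in> slab (min u v)}. f (x i))"
    by (rule eq[OF f]) (use u v in simp)
  moreover have "(\<integral>z. g z \<partial>dirac_sum I x) = (\<Sum>i \<in> {i \<in> I. x i \<in> slab (min u v)}. g (x i))"
    by (rule eq[OF g]) (use u v in simp)
  ultimately show ?thesis unfolding I by (simp add: sum.distrib)
qed

lemma integral_Mp_nonneg: "f \<in> CK_plus \<Longrightarrow> 0 \<le> (\<integral>z. f z \<partial>\<mu>)"
  by (intro integral_nonneg_AE) (simp add: CK_plusD)

text \<open>Turns a bound on one integral into a bound on a number of points; this is how tightness
  of integrals yields the row lengths of \<open>slots\<close>.\<close>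

lemma emeasure_slab_le_integral:
  assumes f: "f \<in> CK_plus" "\<And>z. z \<in> slab v \<Longrightarrow> 1 \<le> f z" and v: "v > 0" and "\<mu> \<in> Mp"
  shows "emeasure \<mu> (slab v) \<le> ennreal (\<integral>z. f z \<partial>\<mu>)"
proof -
  obtain u where u: "u > 0" "\<And>t y. \<bar>y\<bar> < ereal u \<Longrightarrow> f (t, y) = 0"
    using CK_plus_supportE[OF f(1)] by blast
  obtain I :: "nat set" and x where I: "\<mu> = dirac_sum I x"
    "\<And>u. u > 0 \<Longrightarrow> finite {i \<in> I. x i \<in> slab u}"
    using MpE[OF assms(4)] by metis
  have "{i \<in> I. x i \<in> slab v} \<subseteq> {i \<in> I. x i \<in> slab u}"
    using not_slab_vanish[OF f(1), of u] u(2) f(2) by (metis (no_types, lifting) Collect_mono not_one_le_zero)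
  then have "(\<Sum>i \<in> {i \<in> I. x i \<in> slab v}. f (x i)) \<le> (\<Sum>i \<in> {i \<in> I. x i \<in> slab u}. f (x i))"
    by (intro sum_mono2 I(2) u(1) CK_plusD(1)[OF f(1)])
  moreover have "(\<Sum>i \<in> {i \<in> I. x i \<in> slab v}. 1) \<le> (\<Sum>i \<in> {i \<in> I. x i \<in> slab v}. f (x i))"
    by (intro sum_mono f(2)) simp
  ultimately have "real (card {i \<in> I. x i \<in> slab v}) \<le> (\<Sum>i \<in> {i \<in> I. x i \<in> slab u}. f (x i))"
    by simp
  moreover have "(\<integral>z. f z \<partial>dirac_sum I x) = (\<Sum>i \<in> {i \<in> I. x i \<in> slab u}. f (x i))"
    by (rule integral_Mp_slab[OF f(1) u(2) I(2)[OF u(1)]])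
  ultimately show ?thesis
    unfolding I(1) emeasure_dirac_sum_count[OF slab_sets[OF v]]
    using I(2)[OF v] by (simp add: emeasure_count_space ennreal_of_nat_eq_real_of_nat ennreal_leI)
qed

section \<open>Compact families of point measures\<close>

text \<open>A compact metrisable parametrisation of point measures: slot \<open>(j, i)\<close> holds a point of size at
  most \<open>1/j\<close> and only the first \<open>m j\<close> slots of row \<open>j\<close> are occupied. A slot with second coordinate \<open>0\<close>
  is empty, because \<open>dirac_sum\<close> only sees points of \<open>S_space\<close>.\<close>

definition slots :: "(nat \<Rightarrow> nat) \<Rightarrow> (nat \<times> nat \<Rightarrow> real \<times> ereal) set" where
  "slots m = {x. \<forall>j i. x (j, i) \<in> {0..1} \<times> {y. (1 \<le> j \<longrightarrow> \<bar>y\<bar> \<le> ereal (1 / real j)) \<and> (m j \<le> i \<longrightarrow> y = 0)}}"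

lemma closed_abs_le: "closed {y::ereal. \<bar>y\<bar> \<le> ereal u}"
proof -
  have "{y. \<bar>y\<bar> \<le> ereal u} = {y. \<bar>squash y\<bar> \<le> squash (ereal u)}"
    by (simp add: abs_squash linorder_not_less[symmetric] del: squash_simps)
  also have "closed \<dots>"
    by (intro closed_Collect_le continuous_intros continuous_on_squash)
  finally show ?thesis .
qed

text \<open>Tychonoff: each slot ranges over a compact set. Row 0 has no size bound and may hold
  infinite points, which the compact space \<open>ereal\<close> accommodates.\<close>

lemma compact_slots: "compact (slots m)"
proof -
  let ?K = "\<lambda>p::nat \<times> nat. {0..1::real} \<times> {y. (1 \<le> fst p \<longrightarrow> \<bar>y\<bar> \<le> ereal (1 / real (fst p))) \<and> (m (fst p) \<le> snd p \<longrightarrow> y = 0)}"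
  have "closed {y. (1 \<le> j \<longrightarrow> \<bar>y\<bar> \<le> ereal (1 / real j)) \<and> (m j \<le> i \<longrightarrow> y = 0)}" for j i :: nat
    by (intro closed_Collect_conj closed_Collect_imp closed_abs_le open_Collect_const closed_Collect_eq continuous_intros)
  then have "compact (UNIV \<inter> {y. (1 \<le> j \<longrightarrow> \<bar>y\<bar> \<le> ereal (1 / real j)) \<and> (m j \<le> i \<longrightarrow> y = 0)})" for j i :: nat
    by (intro compact_Int_closed compact_UNIV)
  then have "compact (?K p)" for p by (intro compact_Times compact_Icc) simp
  then have "compactin (product_topology (\<lambda>_. euclidean) UNIV) (PiE UNIV ?K)"
    by (subst compactin_PiE) (auto simp: compactin_euclidean_iff)
  moreover have "PiE UNIV ?K = slots m" by (auto simp: slots_def PiE_def Pi_def)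
  ultimately show ?thesis by (simp add: euclidean_product_topology compactin_euclidean_iff)
qed

lemma slots_time: "x \<in> slots m \<Longrightarrow> fst (x p) \<in> {0..1}"
  by (cases p) (auto simp: slots_def mem_Times_iff)

text \<open>The finite index set depends on \<open>m\<close> and \<open>J\<close> only, not on the
  configuration; hence the integral of a test function is one fixed finite sum on all of
  \<open>slots m\<close>.\<close>

lemma slots_slab:
  assumes x: "x \<in> slots m" and J: "1 / real J < u" "1 \<le> J" and p: "x p \<in> slab u"
  shows "p \<in> Sigma {..J} (\<lambda>j. {..<m j})"
proof -
  obtain j i where ji: "p = (j, i)" by (cases p)
  have u: "u > 0" using J by (meson divide_nonneg_nonneg of_nat_0_le_iff order_le_less_trans zero_le_one)
  have y: "1 \<le> j \<longrightarrow> \<bar>snd (x p)\<bar> \<le> ereal (1 / real j)" "m j \<le> i \<longrightarrow> snd (x p) = 0"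
    using x unfolding slots_def ji by (auto simp: mem_Times_iff)
  have U: "ereal u \<le> \<bar>snd (x p)\<bar>" using p by (auto simp: slab_def)
  have "j \<le> J"
  proof (rule ccontr)
    assume "\<not> j \<le> J"
    then have "ereal (1 / real j) \<le> ereal (1 / real J)" "1 \<le> j" using J by (auto simp: frac_le)
    then have "ereal u \<le> ereal (1 / real J)" using y U by (meson order_trans)
    then show False using J by simp
  qed
  moreover have "i < m j" using y(2) U u by (auto simp: not_less[symmetric])
  ultimately show ?thesis by (simp add: ji)
qed

lemma slots_in_Mp: "x \<in> slots m \<Longrightarrow> dirac_sum UNIV x \<in> Mp"
proof -
  assume x: "x \<in> slots m"
  have "finite {p \<in> UNIV. x p \<in> slab u}" if "u > 0" for u
  proof -
    obtain J where "1 / real (Suc J) < u" using nat_approx_posE[OF \<open>u > 0\<close>] by auto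
    then have "{p \<in> UNIV. x p \<in> slab u} \<subseteq> Sigma {..Suc J} (\<lambda>j. {..<m j})"
      using slots_slab[OF x, of "Suc J" u] by auto
    then show ?thesis by (rule finite_subset) simp
  qed
  then show ?thesis by (simp add: dirac_sum_in_Mp_iff)
qed

lemma integral_slots:
  assumes f: "f \<in> CK_plus" and u: "\<And>t y. \<bar>y\<bar> < ereal u \<Longrightarrow> f (t, y) = 0"
    and J: "1 / real J < u" "1 \<le> J" and x: "x \<in> slots m"
  shows "(\<integral>z. f z \<partial>dirac_sum UNIV x) = (\<Sum>p \<in> Sigma {..J} (\<lambda>j. {..<m j}). f (x p))"
  using slots_slab[OF x J] not_slab_vanish[OF f u] by (intro integral_dirac_sum_CK[OF f]) (simp, simp, blast)

text \<open>Points are sorted into rows by size: row j receives the points in the slab of radius 1 /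
  (j + 1) that are in no earlier one. There are at most \<open>m j\<close> of them, so they fit into
  the first \<open>m j\<close> slots.\<close>

lemma slots_surj:
  assumes "\<mu> \<in> Mp" and m: "\<And>j. emeasure \<mu> (slab (1 / real (Suc j))) \<le> of_nat (m j)"
  obtains x where "x \<in> slots m" "\<mu> = dirac_sum UNIV x"
proof -
  obtain I :: "nat set" and w where I: "w ` I \<subseteq> S_space" "\<mu> = dirac_sum I w"
    "\<And>u. u > 0 \<Longrightarrow> finite {i \<in> I. w i \<in> slab u}"
    using MpE[OF assms(1)] by metis
  define lev where "lev i = (LEAST j. w i \<in> slab (1 / real (Suc j)))" for i
  have ex: "\<exists>j. w i \<in> slab (1 / real (Suc j))" if "i \<in> I" for i
  proof -
    have S: "w i \<in> S_space" using I(1) that by auto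
    then have "\<bar>squash (snd (w i))\<bar> > 0" by (auto simp: S_space_alt)
    then obtain j where "1 / real (Suc j) < \<bar>squash (snd (w i))\<bar>" using nat_approx_posE by blast
    then have "ereal (1 / real (Suc j)) \<le> \<bar>snd (w i)\<bar>"
      using abs_squash_le_abs[of "snd (w i)"] by (meson ereal_less_eq(3) less_imp_le order_trans)
    then show ?thesis using S unfolding slab_def S_space_alt by (cases "w i") auto
  qed
  have lev: "w i \<in> slab (1 / real (Suc (lev i)))" if "i \<in> I" for i
    unfolding lev_def by (rule LeastI_ex[OF ex[OF that]])
  \<comment> \<open>Minimality of the row excludes the point from the slab of the preceding row; row
    0 has no predecessor, hence no bound.\<close>
  have lev_le: "\<bar>snd (w i)\<bar> \<le> ereal (1 / real (lev i))" if "i \<in> I" "1 \<le> lev i" for i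
  proof -
    obtain k where k: "lev i = Suc k" using \<open>1 \<le> lev i\<close> by (cases "lev i") auto
    have "w i \<notin> slab (1 / real (Suc k))"
      using not_less_Least[of k "\<lambda>j. w i \<in> slab (1 / real (Suc j))"] k unfolding lev_def by auto
    then show ?thesis using lev[OF that(1)] k by (cases "w i") (auto simp: slab_def)
  qed
  define L where "L j = {i \<in> I. lev i = j}" for j
  have L: "finite (L j) \<and> card (L j) \<le> m j" for j
  proof -
    have sub: "L j \<subseteq> {i \<in> I. w i \<in> slab (1 / real (Suc j))}" using lev by (auto simp: L_def)
    have fin: "finite {i \<in> I. w i \<in> slab (1 / real (Suc j))}" by (rule I(3)) simp
    have "of_nat (card {i \<in> I. w i \<in> slab (1 / real (Suc j))}) \<le> (of_nat (m j) :: ennreal)"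
      using m[of j] fin unfolding I(2) by (subst (asm) emeasure_dirac_sum_count) (auto intro!: slab_sets simp: emeasure_count_space)
    then have "card {i \<in> I. w i \<in> slab (1 / real (Suc j))} \<le> m j" by simp
    then show ?thesis using card_mono[OF fin sub] finite_subset[OF sub fin] by simp
  qed
  have "\<exists>e. e ` L j \<subseteq> {..<m j} \<and> inj_on e (L j)" for j
    by (rule card_le_inj) (use L in auto)
  then obtain e where e: "\<And>j. e j ` L j \<subseteq> {..<m j}" "\<And>j. inj_on (e j) (L j)" by metis
  define slot where "slot i = (lev i, e (lev i) i)" for i
  have inj: "inj_on slot I"
  proof (rule inj_onI)
    fix i k assume ik: "i \<in> I" "k \<in> I" "slot i = slot k"
    then have "lev i = lev k" "e (lev i) i = e (lev i) k" by (auto simp: slot_def)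
    then show "i = k" using e(2)[of "lev i"] ik by (auto simp: L_def inj_on_def)
  qed
  \<comment> \<open>The default (0, 0) has second coordinate 0 and so marks an empty slot.\<close>
  define x where "x p = (if p \<in> slot ` I then w (inv_into I slot p) else (0, 0))" for p
  have xs: "x (slot i) = w i" if "i \<in> I" for i
    using that inj by (simp add: x_def)
  have "x \<in> slots m"
    unfolding slots_def
  proof (intro CollectI allI)
    fix j i
    show "x (j, i) \<in> {0..1} \<times> {y. (1 \<le> j \<longrightarrow> \<bar>y\<bar> \<le> ereal (1 / real j)) \<and> (m j \<le> i \<longrightarrow> y = 0)}"
    proof (cases "(j, i) \<in> slot ` I")
      case True
      then obtain k where k: "k \<in> I" "(j, i) = slot k" by auto
      then have j: "j = lev k" "i = e j k" by (auto simp: slot_def)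
      then have "k \<in> L j" using k by (simp add: L_def)
      then have "i < m j" using e(1)[of j] j by auto
      moreover have "x (j, i) = w k" using xs k by simp
      moreover have "w k \<in> S_space" using k I by auto
      ultimately show ?thesis using lev_le[OF k(1)] j by (cases "w k") (auto simp: S_space_alt)
    qed (simp add: x_def)
  qed
  moreover have "dirac_sum UNIV x = dirac_sum (slot ` I) x"
    by (rule dirac_sum_cong) (auto simp: x_def S_space_alt)
  moreover have "dirac_sum (slot ` I) x = dirac_sum I (\<lambda>i. x (slot i))"
    by (rule dirac_sum_reindex) (use inj in \<open>simp add: inj_on_imp_bij_betw\<close>)
  moreover have "dirac_sum I (\<lambda>i. x (slot i)) = dirac_sum I w"
    by (rule dirac_sum_cong) (auto simp: xs)
  ultimately show ?thesis using that I(2) by metis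
qed

section \<open>Neighbourhoods, continuity and measurability in the vague topology\<close>

text \<open>Induction over the generation of the topology: for an intersection the finite families
  are merged and the smaller tolerance is taken.\<close>

lemma vague_nbhd:
  assumes "openin vague_top U" "\<mu> \<in> U"
  obtains F e where "finite F" "F \<subseteq> CK_plus" "e > 0"
    "{\<mu>' \<in> Mp. \<forall>f\<in>F. \<bar>(\<integral>z. f z \<partial>\<mu>') - (\<integral>z. f z \<partial>\<mu>)\<bar> < e} \<subseteq> U"
proof -
  let ?N = "\<lambda>F e. {\<mu>' \<in> Mp. \<forall>f\<in>F. \<bar>(\<integral>z. f z \<partial>\<mu>') - (\<integral>z. f z \<partial>\<mu>)\<bar> < e}"
  have "generate_topology_on {{\<mu> \<in> Mp. (\<integral>z. f z \<partial>\<mu>) \<in> U} | f U. f \<in> CK_plus \<and> open U} U"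
    using assms(1) by (simp add: vague_top_def openin_topology_generated_by_iff)
  then have "\<mu> \<in> U \<longrightarrow> (\<exists>F e. finite F \<and> F \<subseteq> CK_plus \<and> e > 0 \<and> ?N F e \<subseteq> U)"
  proof induction
    case (Int a b)
    show ?case
    proof
      assume "\<mu> \<in> a \<inter> b"
      then have ab: "\<mu> \<in> a" "\<mu> \<in> b" by auto
      obtain F e where F: "finite F" "F \<subseteq> CK_plus" "e > 0" "?N F e \<subseteq> a"
        using Int.IH(1)[THEN mp, OF ab(1)] by (elim exE conjE)
      obtain F' e' where F': "finite F'" "F' \<subseteq> CK_plus" "e' > 0" "?N F' e' \<subseteq> b"
        using Int.IH(2)[THEN mp, OF ab(2)] by (elim exE conjE)
      have "?N (F \<union> F') (min e e') \<subseteq> ?N F e \<inter> ?N F' e'"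
        by (rule subsetI) (simp only: mem_Collect_eq ball_Un min_less_iff_conj Int_iff, blast)
      then show "\<exists>F e. finite F \<and> F \<subseteq> CK_plus \<and> e > 0 \<and> ?N F e \<subseteq> a \<inter> b"
        using F F' by (intro exI[of _ "F \<union> F'"] exI[of _ "min e e'"] conjI) (simp, simp, simp, blast)
    qed
  next
    case (UN K)
    show ?case
    proof
      assume "\<mu> \<in> \<Union>K"
      then obtain k where k: "k \<in> K" "\<mu> \<in> k" by auto
      obtain F e where F: "finite F" "F \<subseteq> CK_plus" "e > 0" "?N F e \<subseteq> k"
        using UN.IH[OF k(1), THEN mp, OF k(2)] by (elim exE conjE)
      have "?N F e \<subseteq> \<Union>K" using F(4) k(1) by blast
      then show "\<exists>F e. finite F \<and> F \<subseteq> CK_plus \<and> e > 0 \<and> ?N F e \<subseteq> \<Union>K"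
        using F(1-3) by (intro exI conjI)
    qed
  next
    case (Basis s)
    then obtain f V where s: "s = {\<mu> \<in> Mp. (\<integral>z. f z \<partial>\<mu>) \<in> V}" "f \<in> CK_plus" "open V" by auto
    show ?case
    proof
      assume "\<mu> \<in> s"
      then obtain e where "e > 0" "\<And>r. \<bar>r - (\<integral>z. f z \<partial>\<mu>)\<bar> < e \<Longrightarrow> r \<in> V"
        using s unfolding open_dist dist_real_def by (metis (mono_tags, lifting) mem_Collect_eq)
      then show "\<exists>F e. finite F \<and> F \<subseteq> CK_plus \<and> e > 0 \<and> ?N F e \<subseteq> s"
        using s by (intro exI[of _ "{f}"] exI[of _ e]) auto
    qed
  qed simp
  then show ?thesis using assms(2) by (elim impE exE conjE) (assumption, rule that)
qed

lemma continuous_map_vague_integral: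
  assumes "f \<in> CK_plus"
  shows "continuous_map vague_top euclideanreal (\<lambda>\<mu>. \<integral>z. f z \<partial>\<mu>)"
proof (rule continuous_map[THEN iffD2], intro conjI allI impI)
  fix U :: "real set" assume "openin euclideanreal U"
  then have "{\<mu> \<in> Mp. (\<integral>z. f z \<partial>\<mu>) \<in> U} \<in>
      {{\<mu> \<in> Mp. (\<integral>z. f z \<partial>\<mu>) \<in> U} | f U. f \<in> CK_plus \<and> open U}"
    using assms by auto
  then show "openin vague_top {\<mu> \<in> topspace vague_top. (\<integral>z. f z \<partial>\<mu>) \<in> U}"
    unfolding topspace_vague_top unfolding vague_top_def by (rule topology_generated_by_Basis)
qed auto

lemma continuous_map_into_vague:
  assumes "h ` topspace T \<subseteq> Mp"
    and "\<And>f. f \<in> CK_plus \<Longrightarrow> continuous_map T euclideanreal (\<lambda>x. \<integral>z. f z \<partial>(h x))"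
  shows "continuous_map T vague_top h"
  unfolding vague_top_def
proof (rule continuous_on_generated_topo)
  fix U assume "U \<in> {{\<mu> \<in> Mp. (\<integral>z. f z \<partial>\<mu>) \<in> U} | f U. f \<in> CK_plus \<and> open U}"
  then obtain f V where U: "U = {\<mu> \<in> Mp. (\<integral>z. f z \<partial>\<mu>) \<in> V}" "f \<in> CK_plus" "open V" by auto
  have "h -` U \<inter> topspace T = {x \<in> topspace T. (\<integral>z. f z \<partial>(h x)) \<in> V}"
    using U assms(1) by auto
  also have "openin T \<dots>"
    using openin_continuous_map_preimage[OF assms(2)[OF U(2)], of V] U(3) by simp
  finally show "openin T (h -` U \<inter> topspace T)" .
next
  show "h ` topspace T \<subseteq> \<Union> {{\<mu> \<in> Mp. (\<integral>z. f z \<partial>\<mu>) \<in> U} | f U. f \<in> CK_plus \<and> open U}"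
    using assms(1) topspace_vague_top by (simp add: vague_top_def)
qed

text \<open>\<open>m\<close> may vary too: its coordinates are discrete, so near a given pair the
  row lengths up to \<open>J\<close> are constant and the integral is a fixed finite sum of
  continuous functions of the slots.\<close>

lemma continuous_on_slots_integral:
  assumes f: "f \<in> CK_plus"
  shows "continuous_on {(m, x). x \<in> slots m} (\<lambda>(m, x). \<integral>z. f z \<partial>dirac_sum UNIV x)"
    (is "continuous_on ?D ?h")
  unfolding continuous_on_def
proof
  fix d0 assume d0: "d0 \<in> ?D"
  obtain m0 x0 where mx: "d0 = (m0, x0)" "x0 \<in> slots m0" using d0 by auto
  obtain u where u: "u > 0" "\<And>t y. \<bar>y\<bar> < ereal u \<Longrightarrow> f (t, y) = 0"
    using CK_plus_supportE[OF f] by blast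
  obtain J' where J': "1 / real (Suc J') < u" using nat_approx_posE[OF u(1)] by auto
  define J where "J = Suc J'"
  have J: "1 / real J < u" "1 \<le> J" using J' by (auto simp: J_def)
  let ?s = "\<lambda>d::(nat \<Rightarrow> nat) \<times> (nat \<times> nat \<Rightarrow> real \<times> ereal). \<Sum>p \<in> Sigma {..J} (\<lambda>j. {..<m0 j}). f (snd d p)"
  have "continuous_on ?D (\<lambda>d. f (snd d p))" for p
  proof (rule continuous_on_compose2[OF CK_plusD(4)[OF f]])
    show "continuous_on ?D (\<lambda>d. snd d p)"
      by (rule continuous_on_compose2[OF continuous_on_product_coordinates continuous_on_snd[OF continuous_on_id]]) auto
    show "(\<lambda>d. snd d p) ` ?D \<subseteq> {0..1} \<times> UNIV"
    proof (rule image_subsetI)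
      fix d assume "d \<in> ?D"
      then have "fst (snd d p) \<in> {0..1}" by (intro slots_time[where m = "fst d"]) auto
      then show "snd d p \<in> {0..1} \<times> UNIV" by (simp add: mem_Times_iff)
    qed
  qed
  then have "continuous_on ?D ?s" by (intro continuous_on_sum)
  then have l1: "(?s \<longlongrightarrow> ?s d0) (at d0 within ?D)"
    using d0 unfolding continuous_on_def by blast
  have l2: "\<forall>\<^sub>F d in at d0 within ?D. ?s d = ?h d"
  proof -
    have "\<forall>\<^sub>F d in at d0 within ?D. fst d j = m0 j" for j
    proof -
      have "continuous_on UNIV (\<lambda>d::(nat \<Rightarrow> nat) \<times> (nat \<times> nat \<Rightarrow> real \<times> ereal). fst d j)"
        by (rule continuous_on_compose2[OF continuous_on_product_coordinates continuous_on_fst[OF continuous_on_id]]) auto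
      then have "((\<lambda>d. fst d j) \<longlongrightarrow> m0 j) (at d0)"
        using mx(1) unfolding continuous_on_def by fastforce
      then have "((\<lambda>d. fst d j) \<longlongrightarrow> m0 j) (at d0 within ?D)"
        by (rule tendsto_mono[OF at_le[OF subset_UNIV]])
      then show ?thesis by (simp add: tendsto_discrete)
    qed
    then have "\<forall>\<^sub>F d in at d0 within ?D. \<forall>j\<in>{..J}. fst d j = m0 j"
      by (intro eventually_ball_finite) auto
    moreover have "\<forall>\<^sub>F d in at d0 within ?D. d \<in> ?D" by (simp add: eventually_at_filter)
    ultimately show ?thesis
    proof eventually_elim
      case (elim d)
      then have "?h d = (\<Sum>p \<in> Sigma {..J} (\<lambda>j. {..<fst d j}). f (snd d p))"
        using integral_slots[OF f u(2) J] by (auto simp: case_prod_unfold)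
      also have "Sigma {..J} (\<lambda>j. {..<fst d j}) = Sigma {..J} (\<lambda>j. {..<m0 j})"
        using elim by (intro Sigma_cong) auto
      finally show ?case by simp
    qed
  qed
  have l3: "?s d0 = ?h d0" using integral_slots[OF f u(2) J mx(2)] by (simp add: mx)
  show "(?h \<longlongrightarrow> ?h d0) (at d0 within ?D)"
    by (rule Lim_transform_eventually[OF l1[unfolded l3] l2])
qed

text \<open>The Borel sets of the vague topology are generated by its open sets, not a priori by the maps
  \<open>\<mu> \<mapsto> \<integral>f d\<mu>\<close>. The pairs \<open>(m, x)\<close> with \<open>x \<in> slots m\<close> form a second countable space that maps onto
  \<open>Mp\<close>, so by the Lindelof property every vaguely open set is a countable union of basic ones.\<close>

lemma measurable_into_vague:
  assumes h: "\<And>\<omega>. \<omega> \<in> space M \<Longrightarrow> h \<omega> \<in> Mp"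
    and meas: "\<And>f. f \<in> CK_plus \<Longrightarrow> (\<lambda>\<omega>. \<integral>z. f z \<partial>(h \<omega>)) \<in> borel_measurable M"
  shows "h \<in> M \<rightarrow>\<^sub>M borel_of vague_top"
  unfolding borel_of_def
proof (rule measurable_measure_of)
  fix U assume "U \<in> {U. openin vague_top U}"
  then have U: "openin vague_top U" by simp
  let ?N = "\<lambda>\<mu> F e. {\<mu>' \<in> Mp. \<forall>f\<in>F. \<bar>(\<integral>z. f z \<partial>\<mu>') - (\<integral>z. f z \<partial>\<mu>)\<bar> < e}"
  let ?D = "{(m, x). x \<in> slots m}"
  let ?U = "{\<mu>. \<mu> \<in> Mp \<and> \<mu> \<in> U}"
  define Q where "Q \<mu> F e \<longleftrightarrow> finite F \<and> F \<subseteq> CK_plus \<and> e > 0 \<and> ?N \<mu> F e \<subseteq> U" for \<mu> F e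
  have "\<exists>F e. Q \<mu> F e" if "\<mu> \<in> U" for \<mu>
    by (rule vague_nbhd[OF U that]) (unfold Q_def, blast)
  then obtain F e where "\<And>\<mu>. \<mu> \<in> U \<Longrightarrow> Q \<mu> (F \<mu>) (e \<mu>)" by metis
  then have Fe: "\<And>\<mu>. \<mu> \<in> U \<Longrightarrow> finite (F \<mu>)" "\<And>\<mu>. \<mu> \<in> U \<Longrightarrow> F \<mu> \<subseteq> CK_plus" "\<And>\<mu>. \<mu> \<in> U \<Longrightarrow> e \<mu> > 0"
    "\<And>\<mu>. \<mu> \<in> U \<Longrightarrow> ?N \<mu> (F \<mu>) (e \<mu>) \<subseteq> U"
    unfolding Q_def by simp_all
  define G where "G \<mu> = {d \<in> ?D. \<forall>f\<in>F \<mu>. \<bar>(\<integral>z. f z \<partial>dirac_sum UNIV (snd d)) - (\<integral>z. f z \<partial>\<mu>)\<bar> < e \<mu>}" for \<mu>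
  have Oop: "openin (top_of_set ?D) (G \<mu>)" if "\<mu> \<in> U" for \<mu>
  proof -
    have "openin (top_of_set ?D) {d \<in> ?D. \<bar>(\<integral>z. f z \<partial>dirac_sum UNIV (snd d)) - (\<integral>z. f z \<partial>\<mu>)\<bar> < e \<mu>}"
      if "f \<in> F \<mu>" for f
    proof -
      have "f \<in> CK_plus" using that Fe(2)[OF \<open>\<mu> \<in> U\<close>] by blast
      then have "continuous_on ?D (\<lambda>d. \<bar>(\<integral>z. f z \<partial>dirac_sum UNIV (snd d)) - (\<integral>z. f z \<partial>\<mu>)\<bar>)"
        using continuous_on_slots_integral by (intro continuous_intros) (simp add: case_prod_unfold)
      from continuous_openin_preimage_gen[OF this open_lessThan[of "e \<mu>"]]
      show ?thesis by (rule back_subst[where P = "openin _"]) auto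
    qed
    then have "openin (top_of_set ?D) (?D \<inter> (\<Inter>f\<in>F \<mu>. {d \<in> ?D. \<bar>(\<integral>z. f z \<partial>dirac_sum UNIV (snd d)) - (\<integral>z. f z \<partial>\<mu>)\<bar> < e \<mu>}))"
      using Fe(1)[OF \<open>\<mu> \<in> U\<close>] by (cases "F \<mu> = {}") (simp, intro openin_Int openin_INT2, simp_all)
    then show ?thesis by (rule back_subst[where P = "openin _"]) (auto simp: G_def)
  qed
  obtain \<F> where \<F>: "\<F> \<subseteq> G ` U" "countable \<F>" "\<Union>\<F> = \<Union>(G ` U)"
  proof (rule Lindelof_openin[of "G ` U" ?D])
    show "openin (top_of_set ?D) S" if "S \<in> G ` U" for S using that Oop by auto
  qed
  obtain C where C: "countable C" "C \<subseteq> U" "\<F> = G ` C"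
    using countable_subset_image[of \<F> G U] \<F> by blast
  have "U = (\<Union>\<mu>\<in>C. ?N \<mu> (F \<mu>) (e \<mu>))"
  proof
    show "(\<Union>\<mu>\<in>C. ?N \<mu> (F \<mu>) (e \<mu>)) \<subseteq> U" using Fe(4) C(2) by blast
    show "U \<subseteq> (\<Union>\<mu>\<in>C. ?N \<mu> (F \<mu>) (e \<mu>))"
    proof
      fix \<mu> assume \<mu>: "\<mu> \<in> U"
      then have Mp: "\<mu> \<in> Mp" using openin_subset[OF U] by (auto simp: topspace_vague_top)
      obtain I :: "nat set" and w where I: "\<mu> = dirac_sum I w"
        "\<And>u. u > 0 \<Longrightarrow> finite {i \<in> I. w i \<in> slab u}"
        using MpE[OF Mp] by metis
      \<comment> \<open>The exact numbers of points of \<mu> serve as row lengths, so every \<mu> is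
        reached by the parametrisation without a bound common to all measures.\<close>
      have "emeasure \<mu> (slab (1 / real (Suc j))) \<le> of_nat (card {i \<in> I. w i \<in> slab (1 / real (Suc j))})" for j
        unfolding I(1) using I(2)[of "1 / real (Suc j)"]
        by (subst emeasure_dirac_sum_count) (auto intro!: slab_sets simp: emeasure_count_space)
      then obtain x where x: "x \<in> slots (\<lambda>j. card {i \<in> I. w i \<in> slab (1 / real (Suc j))})" "\<mu> = dirac_sum UNIV x"
        by (rule slots_surj[OF Mp])
      then have "(\<lambda>j. card {i \<in> I. w i \<in> slab (1 / real (Suc j))}, x) \<in> G \<mu>"
        using Fe(3)[OF \<mu>] by (simp add: G_def)
      then have "(\<lambda>j. card {i \<in> I. w i \<in> slab (1 / real (Suc j))}, x) \<in> (\<Union>\<mu>\<in>C. G \<mu>)"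
        using \<F>(3) C(3) \<mu> by auto
      then obtain \<nu> where "\<nu> \<in> C" "(\<lambda>j. card {i \<in> I. w i \<in> slab (1 / real (Suc j))}, x) \<in> G \<nu>" by blast
      then show "\<mu> \<in> (\<Union>\<mu>\<in>C. ?N \<mu> (F \<mu>) (e \<mu>))"
        using Mp by (intro UN_I[of \<nu>]) (auto simp: G_def x(2))
    qed
  qed
  then have "h -` U \<inter> space M = (\<Union>\<mu>\<in>C. {\<omega> \<in> space M. \<forall>f\<in>F \<mu>. \<bar>(\<integral>z. f z \<partial>(h \<omega>)) - (\<integral>z. f z \<partial>\<mu>)\<bar> < e \<mu>})"
    using h by auto
  also have "\<dots> \<in> sets M"
  proof (rule sets.countable_UN''[OF C(1)])
    fix \<mu> assume "\<mu> \<in> C"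
    then have "finite (F \<mu>)" "F \<mu> \<subseteq> CK_plus" using Fe(1,2) C(2) by blast+
    then show "{\<omega> \<in> space M. \<forall>f\<in>F \<mu>. \<bar>(\<integral>z. f z \<partial>(h \<omega>)) - (\<integral>z. f z \<partial>\<mu>)\<bar> < e \<mu>} \<in> sets M"
      using meas
      by (intro sets.sets_Collect_finite_All borel_measurable_less borel_measurable_abs
          borel_measurable_diff borel_measurable_const) (auto simp: subset_iff)
  qed
  finally show "h -` U \<inter> space M \<in> sets M" .
qed (use h openin_subset[of vague_top] in \<open>auto simp: topspace_vague_top\<close>)

section \<open>Convergence of Laplace functionals implies convergence in distribution\<close>

text \<open>By the Lindelof property of \<open>C \<times> C\<close>, countably many members of the algebra separate what the
  algebra separates; they map \<open>C\<close> to a compact set of sequences on which the usual theorem applies.\<close>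

lemma Stone_Weierstrass_nonseparating:
  fixes C :: "'a::second_countable_topology set" and g :: "'a \<Rightarrow> real"
  assumes C: "compact C" and const: "\<And>c. P (\<lambda>_. c)"
    and cont: "\<And>f. P f \<Longrightarrow> continuous_on C f"
    and add: "\<And>f g. P f \<Longrightarrow> P g \<Longrightarrow> P (\<lambda>x. f x + g x)"
    and mult: "\<And>f g. P f \<Longrightarrow> P g \<Longrightarrow> P (\<lambda>x. f x * g x)"
    and g: "continuous_on C g"
    and sep: "\<And>x y. x \<in> C \<Longrightarrow> y \<in> C \<Longrightarrow> (\<And>f. P f \<Longrightarrow> f x = f y) \<Longrightarrow> g x = g y"
    and e: "e > 0"
  obtains f where "P f" "\<And>x. x \<in> C \<Longrightarrow> \<bar>g x - f x\<bar> < e"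
proof -
  define W where "W f = {p \<in> C \<times> C. f (fst p) - f (snd p) \<in> - {0::real}}" for f
  have W: "openin (top_of_set (C \<times> C)) (W f)" if "P f" for f
  proof -
    have "continuous_on (C \<times> C) (\<lambda>p. f (fst p) - f (snd p))"
      by (intro continuous_on_diff continuous_on_compose2[OF cont[OF that]] continuous_on_fst
          continuous_on_snd continuous_on_id) auto
    from continuous_openin_preimage_gen[OF this, of "- {0}"] show ?thesis
      by (rule back_subst[where P = "openin _"]) (auto simp: W_def)
  qed
  obtain \<F> where \<F>: "\<F> \<subseteq> W ` Collect P" "countable \<F>" "\<Union>\<F> = \<Union>(W ` Collect P)"
  proof (rule Lindelof_openin[of "W ` Collect P" "C \<times> C"])
    show "openin (top_of_set (C \<times> C)) S" if "S \<in> W ` Collect P" for S using that W by auto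
  qed
  obtain D where D: "countable D" "D \<subseteq> Collect P" "\<F> = W ` D"
    using \<F>(1,2) countable_subset_image[of \<F> W "Collect P"] by blast
  \<comment> \<open>The zero function separates nothing but makes the family nonempty, so that it
    can be enumerated by \<open>from_nat_into\<close>.\<close>
  define D' where "D' = insert (\<lambda>_. 0) D"
  have D': "countable D'" "D' \<noteq> {}" "\<And>f. f \<in> D' \<Longrightarrow> P f"
    using D const by (auto simp: D'_def)
  define J where "J x = (\<lambda>k. from_nat_into D' k x)" for x
  have PJ: "P (from_nat_into D' k)" for k by (intro D'(3) from_nat_into D'(2))
  have eqD: "f x = f y" if J: "J x = J y" and f: "f \<in> D'" for f x y
  proof -
    obtain k where "from_nat_into D' k = f" using from_nat_into_surj[OF D'(1) f] by blast
    then show ?thesis using fun_cong[OF J, of k] by (simp add: J_def)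
  qed
  have eqP: "f x = f y" if "J x = J y" "x \<in> C" "y \<in> C" "P f" for f x y
  proof (rule ccontr)
    assume "f x \<noteq> f y"
    then have "(x, y) \<in> \<Union>(W ` Collect P)" using that by (auto simp: W_def)
    then obtain h where "h \<in> D" "(x, y) \<in> W h" using \<F>(3) D(3) by (metis UN_E)
    then show False using eqD[OF that(1), of h] by (simp add: D'_def W_def)
  qed
  have Jc: "continuous_on C J"
    unfolding J_def by (intro continuous_on_coordinatewise_then_product cont PJ)
  have S: "compact (J ` C)" by (rule compact_continuous_image[OF Jc C])
  \<comment> \<open>By the separation hypothesis g factors through \<open>J\<close>; the factor is
    read off at an arbitrary preimage.\<close>
  define G where "G z = g (inv_into C J z)" for z
  have GJ: "G (J x) = g x" if "x \<in> C" for x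
  proof -
    have "J (inv_into C J (J x)) = J x" "inv_into C J (J x) \<in> C"
      using that by (auto intro: f_inv_into_f inv_into_into)
    then show ?thesis unfolding G_def using that eqP by (intro sep) auto
  qed
  \<comment> \<open>\<open>J\<close> carries compact sets to compact, hence closed, sets. It is thus
    a quotient map onto its image, and continuity of g descends.\<close>
  have Gc: "continuous_on (J ` C) G"
    unfolding continuous_on_closed_invariant
  proof (intro allI impI)
    fix B :: "real set" assume "closed B"
    then have "closedin (top_of_set C) (C \<inter> g -` B)"
      using g continuous_closedin_preimage by blast
    then have "compact (C \<inter> g -` B)" using C closedin_compact by blast
    then have "compact (J ` (C \<inter> g -` B))"
      by (intro compact_continuous_image continuous_on_subset[OF Jc]) auto
    moreover have "J ` (C \<inter> g -` B) \<inter> J ` C = G -` B \<inter> J ` C" using GJ by (auto 4 3)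
    ultimately show "\<exists>A. closed A \<and> A \<inter> J ` C = G -` B \<inter> J ` C"
      using compact_imp_closed by blast
  qed
  define P' where "P' h \<longleftrightarrow> continuous_on (J ` C) h \<and> (\<exists>f. P f \<and> (\<forall>x\<in>C. f x = h (J x)))" for h
  have "\<exists>h. P' h \<and> (\<forall>z\<in>J ` C. \<bar>G z - h z\<bar> < e)"
  proof (rule Stone_Weierstrass_HOL[OF S])
    show "P' (\<lambda>x. c)" for c unfolding P'_def using const by auto
    show "P' f \<Longrightarrow> continuous_on (J ` C) f" for f by (simp add: P'_def)
    show "P' (\<lambda>x. f x + h x)" if PP: "P' f \<and> P' h" for f h
    proof -
      obtain f' h' where "P f'" "\<And>x. x \<in> C \<Longrightarrow> f' x = f (J x)" "P h'" "\<And>x. x \<in> C \<Longrightarrow> h' x = h (J x)"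
        using PP unfolding P'_def by blast
      then show ?thesis using PP unfolding P'_def
        by (intro conjI exI[of _ "\<lambda>x. f' x + h' x"] add continuous_on_add) auto
    qed
    show "P' (\<lambda>x. f x * h x)" if PP: "P' f \<and> P' h" for f h
    proof -
      obtain f' h' where "P f'" "\<And>x. x \<in> C \<Longrightarrow> f' x = f (J x)" "P h'" "\<And>x. x \<in> C \<Longrightarrow> h' x = h (J x)"
        using PP unfolding P'_def by blast
      then show ?thesis using PP unfolding P'_def
        by (intro conjI exI[of _ "\<lambda>x. f' x * h' x"] mult continuous_on_mult) auto
    qed
    show "\<exists>f. P' f \<and> f x \<noteq> f y" if xy: "x \<in> J ` C \<and> y \<in> J ` C \<and> x \<noteq> y" for x y
    proof -
      obtain k where k: "x k \<noteq> y k" using xy by (auto simp: fun_eq_iff)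
      have "P' (\<lambda>z. z k)" unfolding P'_def
        by (intro conjI continuous_on_subset[OF continuous_on_product_coordinates] exI[of _ "from_nat_into D' k"] PJ)
           (auto simp: J_def)
      then show ?thesis using k by blast
    qed
    show "continuous_on (J ` C) G" by (rule Gc)
    show "0 < e" by (rule e)
  qed
  then obtain h f where "P f" "\<And>x. x \<in> C \<Longrightarrow> f x = h (J x)" "\<And>z. z \<in> J ` C \<Longrightarrow> \<bar>G z - h z\<bar> < e"
    unfolding P'_def by blast
  then show ?thesis using that[of f] GJ by (metis image_eqI)
qed

section \<open>The algebra of exponential combinations\<close>

text \<open>The linear span of the maps \<mu> \<mapsto> exp (- \<integral>f d\<mu>). Only the values
  on \<open>Mp\<close> are prescribed, because additivity of the integral, and with it closure under
  products, is available there.\<close>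

inductive exp_comb :: "((real \<times> ereal) measure \<Rightarrow> real) \<Rightarrow> bool" where
  exp: "f \<in> CK_plus \<Longrightarrow> (\<And>\<mu>. \<mu> \<in> Mp \<Longrightarrow> U \<mu> = c * exp (- (\<integral>z. f z \<partial>\<mu>))) \<Longrightarrow> exp_comb U"
| add: "exp_comb U \<Longrightarrow> exp_comb V \<Longrightarrow> (\<And>\<mu>. \<mu> \<in> Mp \<Longrightarrow> W \<mu> = U \<mu> + V \<mu>) \<Longrightarrow> exp_comb W"

lemma exp_comb_const: "exp_comb (\<lambda>_. c)"
  by (rule exp_comb.exp[OF CK_plus_zero, of _ c]) simp

lemma exp_comb_plus: "exp_comb U \<Longrightarrow> exp_comb V \<Longrightarrow> exp_comb (\<lambda>\<mu>. U \<mu> + V \<mu>)"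
  by (rule exp_comb.add) auto

text \<open>Exponentials multiply by adding test functions, and \<open>CK_plus\<close> is closed
  under addition. The equation for \<open>W\<close> is kept as a premise so that the induction can
  vary \<open>W\<close>.\<close>

lemma exp_comb_mult_exp:
  assumes "exp_comb V" and f: "f \<in> CK_plus"
  shows "(\<And>\<mu>. \<mu> \<in> Mp \<Longrightarrow> W \<mu> = c * exp (- (\<integral>z. f z \<partial>\<mu>)) * V \<mu>) \<Longrightarrow> exp_comb W"
  using assms(1)
proof (induction arbitrary: W)
  case (exp g U d)
  show ?case
  proof (rule exp_comb.exp[OF CK_plus_add[OF f exp.hyps(1)], of W "c * d"])
    fix \<mu> :: "(real \<times> ereal) measure" assume \<mu>: "\<mu> \<in> Mp"
    show "W \<mu> = c * d * exp (- (\<integral>z. f z + g z \<partial>\<mu>))"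
      using exp.prems[OF \<mu>] exp.hyps(2)[OF \<mu>] integral_Mp_add[OF f exp.hyps(1) \<mu>]
      by (simp add: exp_diff exp_minus field_simps)
  qed
next
  case (add U V X)
  show ?case
    by (rule exp_comb.add[OF add.IH(1)[OF refl] add.IH(2)[OF refl]])
       (simp add: add.prems add.hyps algebra_simps)
qed

lemma exp_comb_mult: "exp_comb U \<Longrightarrow> exp_comb V \<Longrightarrow> exp_comb (\<lambda>\<mu>. U \<mu> * V \<mu>)"
proof (induction rule: exp_comb.induct)
  case (exp f U c)
  then show ?case using exp_comb_mult_exp[OF exp.prems exp.hyps(1), of _ c] by simp
next
  case (add U V' W)
  show ?case
    by (rule exp_comb.add[OF add.IH(1)[OF add.prems] add.IH(2)[OF add.prems]])
       (simp add: add.hyps algebra_simps)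
qed

text \<open>Serves the clipping of large values: a continuous cut-off is imitated by a polynomial
  without leaving the algebra.\<close>

lemma exp_comb_polynomial:
  fixes p :: "real \<Rightarrow> real"
  assumes "real_polynomial_function p" and U: "exp_comb U"
  shows "exp_comb (\<lambda>\<mu>. p (U \<mu>))"
  using assms(1)
proof induction
  case (linear f)
  then interpret bounded_linear f .
  have "f x = f 1 * x" for x using scaleR[of x 1] by simp
  then have "(\<lambda>\<mu>. f (U \<mu>)) = (\<lambda>\<mu>. f 1 * U \<mu>)" by metis
  then show ?case using exp_comb_mult[OF exp_comb_const U] by metis
next
  case (const c)
  show ?case by (rule exp_comb_const)
next
  case (add f g)
  show ?case by (rule exp_comb_plus[OF add.IH])
next
  case (mult f g)
  show ?case by (rule exp_comb_mult[OF mult.IH])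
qed

lemma exp_comb_bounded: "exp_comb U \<Longrightarrow> \<exists>B. \<forall>\<mu>\<in>Mp. \<bar>U \<mu>\<bar> \<le> B"
proof (induction rule: exp_comb.induct)
  case (exp f U c)
  have "\<bar>U \<mu>\<bar> \<le> \<bar>c\<bar>" if "\<mu> \<in> Mp" for \<mu>
    using exp.hyps(2)[OF that] integral_Mp_nonneg[OF exp.hyps(1), of \<mu>]
    by (simp add: abs_mult mult_left_le)
  then show ?case by blast
next
  case (add U V W)
  then obtain B B' where "\<forall>\<mu>\<in>Mp. \<bar>U \<mu>\<bar> \<le> B" "\<forall>\<mu>\<in>Mp. \<bar>V \<mu>\<bar> \<le> B'" by blast
  then have "\<forall>\<mu>\<in>Mp. \<bar>W \<mu>\<bar> \<le> B + B'"
    using add.hyps(3) by (smt (verit) abs_triangle_ineq)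
  then show ?case by blast
qed

lemma exp_comb_continuous: "exp_comb U \<Longrightarrow> continuous_map vague_top euclideanreal U"
proof (induction rule: exp_comb.induct)
  case (exp f U c)
  have "continuous_map vague_top euclideanreal (\<lambda>\<mu>. c * exp (- (\<integral>z. f z \<partial>\<mu>)))"
    using continuous_map_compose[OF continuous_map_vague_integral[OF exp.hyps(1)],
        of euclideanreal "\<lambda>x. c * exp (- x)"]
    by (simp add: o_def continuous_intros)
  then show ?case
    by (rule continuous_map_eq) (simp add: topspace_vague_top exp.hyps)
next
  case (add U V W)
  have "continuous_map vague_top euclideanreal (\<lambda>\<mu>. U \<mu> + V \<mu>)"
    by (intro continuous_map_add add.IH)
  then show ?case
    by (rule continuous_map_eq) (simp add: topspace_vague_top add.hyps)
qed

lemma continuous_map_borel_of: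
  assumes "continuous_map T euclideanreal g"
  shows "g \<in> borel_measurable (borel_of T)"
proof (rule borel_measurableI)
  fix S :: "real set" assume "open S"
  then have "openin T {x \<in> topspace T. g x \<in> S}"
    using openin_continuous_map_preimage[OF assms, of S] by simp
  then have "{x \<in> topspace T. g x \<in> S} \<in> sets (borel_of T)"
    unfolding borel_of_def by (auto intro!: sigma_sets.Basic dest: openin_subset)
  moreover have "g -` S \<inter> space (borel_of T) = {x \<in> topspace T. g x \<in> S}"
    by (auto simp: space_borel_of)
  ultimately show "g -` S \<inter> space (borel_of T) \<in> sets (borel_of T)" by simp
qed

text \<open>Vague neighbourhoods see a measure only through integrals of test functions. This
  supplies the separation hypothesis of Stone-Weierstrass: what the exponentials cannot distinguish,
  g cannot distinguish.\<close>

lemma vague_indistinguishable: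
  assumes "\<mu> \<in> Mp" "\<nu> \<in> Mp" and eq: "\<And>f. f \<in> CK_plus \<Longrightarrow> (\<integral>z. f z \<partial>\<mu>) = (\<integral>z. f z \<partial>\<nu>)"
    and g: "continuous_map vague_top euclideanreal g"
  shows "g \<mu> = g \<nu>"
proof (rule ccontr)
  assume ne: "g \<mu> \<noteq> g \<nu>"
  have "openin vague_top {x \<in> topspace vague_top. g x \<in> - {g \<nu>}}"
    by (rule openin_continuous_map_preimage[OF g]) (simp add: open_Compl)
  moreover have "\<mu> \<in> {x \<in> topspace vague_top. g x \<in> - {g \<nu>}}"
    using ne assms(1) by (simp add: topspace_vague_top)
  ultimately obtain F e where F: "F \<subseteq> CK_plus" "e > 0"
    "{\<mu>' \<in> Mp. \<forall>f\<in>F. \<bar>(\<integral>z. f z \<partial>\<mu>') - (\<integral>z. f z \<partial>\<mu>)\<bar> < e} \<subseteq> {x \<in> topspace vague_top. g x \<in> - {g \<nu>}}"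
    by (rule vague_nbhd)
  moreover have "\<nu> \<in> {\<mu>' \<in> Mp. \<forall>f\<in>F. \<bar>(\<integral>z. f z \<partial>\<mu>') - (\<integral>z. f z \<partial>\<mu>)\<bar> < e}"
    using F assms(2) eq by (auto simp: subset_iff)
  ultimately show False by blast
qed

lemma random_Mp_integral_measurable:
  assumes "\<xi> \<in> M \<rightarrow>\<^sub>M borel_of vague_top" "f \<in> CK_plus"
  shows "(\<lambda>\<omega>. \<integral>z. f z \<partial>(\<xi> \<omega>)) \<in> borel_measurable M"
  using measurable_compose[OF assms(1) continuous_map_borel_of[OF continuous_map_vague_integral[OF assms(2)]]] .

lemma random_Mp_in_Mp: "\<xi> \<in> M \<rightarrow>\<^sub>M borel_of vague_top \<Longrightarrow> \<omega> \<in> space M \<Longrightarrow> \<xi> \<omega> \<in> Mp"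
  using measurable_space[of \<xi> M "borel_of vague_top" \<omega>] by (simp add: space_borel_of topspace_vague_top)

lemma exp_comb_integrable:
  assumes "prob_space M" and \<xi>: "\<xi> \<in> M \<rightarrow>\<^sub>M borel_of vague_top" and U: "exp_comb U"
  shows "integrable M (\<lambda>\<omega>. U (\<xi> \<omega>))"
proof -
  interpret prob_space M by fact
  obtain B where B: "\<forall>\<mu>\<in>Mp. \<bar>U \<mu>\<bar> \<le> B" using exp_comb_bounded[OF U] by auto
  show ?thesis
  proof (rule integrable_const_bound[of _ B])
    show "AE \<omega> in M. norm (U (\<xi> \<omega>)) \<le> B"
      using B random_Mp_in_Mp[OF \<xi>] by (intro AE_I2) simp
    show "(\<lambda>\<omega>. U (\<xi> \<omega>)) \<in> borel_measurable M"
      using measurable_compose[OF \<xi> continuous_map_borel_of[OF exp_comb_continuous[OF U]]] .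
  qed
qed

lemma exp_comb_expectation_converges:
  assumes M: "prob_space M" "prob_space M'"
    and \<xi>: "\<And>n::nat. \<xi> n \<in> M \<rightarrow>\<^sub>M borel_of vague_top" and \<eta>: "\<eta> \<in> M' \<rightarrow>\<^sub>M borel_of vague_top"
    and lap: "\<And>f. f \<in> CK_plus \<Longrightarrow> (\<lambda>n. \<integral>\<omega>. exp (- (\<integral>z. f z \<partial>\<xi> n \<omega>)) \<partial>M)
      \<longlonglongrightarrow> (\<integral>\<omega>. exp (- (\<integral>z. f z \<partial>\<eta> \<omega>)) \<partial>M')"
    and "exp_comb U"
  shows "(\<lambda>n. \<integral>\<omega>. U (\<xi> n \<omega>) \<partial>M) \<longlonglongrightarrow> (\<integral>\<omega>. U (\<eta> \<omega>) \<partial>M')"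
  using assms(6)
proof induction
  case (exp f U c)
  have "(\<integral>\<omega>. U (\<xi> n \<omega>) \<partial>M) = c * (\<integral>\<omega>. exp (- (\<integral>z. f z \<partial>\<xi> n \<omega>)) \<partial>M)" for n
    unfolding integral_mult_right_zero[symmetric]
    by (intro Bochner_Integration.integral_cong refl exp.hyps(2) random_Mp_in_Mp[OF \<xi>])
  moreover have "(\<integral>\<omega>. U (\<eta> \<omega>) \<partial>M') = c * (\<integral>\<omega>. exp (- (\<integral>z. f z \<partial>\<eta> \<omega>)) \<partial>M')"
    unfolding integral_mult_right_zero[symmetric]
    by (intro Bochner_Integration.integral_cong refl exp.hyps(2) random_Mp_in_Mp[OF \<eta>])
  ultimately show ?case using tendsto_mult_left[OF lap[OF exp.hyps(1)], of c] by simp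
next
  case (add U V W)
  have "(\<integral>\<omega>. W (\<xi> n \<omega>) \<partial>M) = (\<integral>\<omega>. U (\<xi> n \<omega>) \<partial>M) + (\<integral>\<omega>. V (\<xi> n \<omega>) \<partial>M)" for n
    unfolding Bochner_Integration.integral_add[OF exp_comb_integrable[OF M(1) \<xi> add.hyps(1)] exp_comb_integrable[OF M(1) \<xi> add.hyps(2)], symmetric]
    by (intro Bochner_Integration.integral_cong refl add.hyps(3) random_Mp_in_Mp[OF \<xi>])
  moreover have "(\<integral>\<omega>. W (\<eta> \<omega>) \<partial>M') = (\<integral>\<omega>. U (\<eta> \<omega>) \<partial>M') + (\<integral>\<omega>. V (\<eta> \<omega>) \<partial>M')"
    unfolding Bochner_Integration.integral_add[OF exp_comb_integrable[OF M(2) \<eta> add.hyps(1)] exp_comb_integrable[OF M(2) \<eta> add.hyps(2)], symmetric]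
    by (intro Bochner_Integration.integral_cong refl add.hyps(3) random_Mp_in_Mp[OF \<eta>])
  ultimately show ?case using tendsto_add[OF add.IH] by simp
qed

text \<open>The approximation is confined to measures coming from \<open>slots m\<close>, but the
  bound B + e holds on all of \<open>Mp\<close> and does not depend on \<open>m\<close>. It makes
  the contribution of the remaining measures small as soon as they have small probability.\<close>

lemma exp_comb_approx:
  assumes g: "continuous_map vague_top euclideanreal g" "\<And>\<mu>. \<mu> \<in> Mp \<Longrightarrow> \<bar>g \<mu>\<bar> \<le> B" and "B > 0" "e > 0"
  obtains V where "exp_comb V" "\<And>\<mu>. \<mu> \<in> Mp \<Longrightarrow> \<bar>V \<mu>\<bar> \<le> B + e"
    "\<And>x. x \<in> slots m \<Longrightarrow> \<bar>g (dirac_sum UNIV x) - V (dirac_sum UNIV x)\<bar> \<le> 2 * e"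
proof -
  let ?\<Phi> = "\<lambda>x :: nat \<times> nat \<Rightarrow> real \<times> ereal. dirac_sum UNIV x"
  have "continuous_map (top_of_set (slots m)) vague_top ?\<Phi>"
  proof (rule continuous_map_into_vague)
    show "?\<Phi> ` topspace (top_of_set (slots m)) \<subseteq> Mp" using slots_in_Mp by auto
    fix f :: "real \<times> ereal \<Rightarrow> real" assume f: "f \<in> CK_plus"
    have "continuous_on (slots m) (\<lambda>x. (\<lambda>(m, x). \<integral>z. f z \<partial>?\<Phi> x) (m, x))"
      by (rule continuous_on_compose2[OF continuous_on_slots_integral[OF f]])
         (auto intro: continuous_intros)
    then show "continuous_map (top_of_set (slots m)) euclideanreal (\<lambda>x. \<integral>z. f z \<partial>?\<Phi> x)" by simp
  qed
  then have cont: "continuous_on (slots m) (\<lambda>x. h (?\<Phi> x))" if "continuous_map vague_top euclideanreal h" for h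
    using continuous_map_compose[OF _ that] by (fastforce simp: o_def)
  define P where "P F \<longleftrightarrow> continuous_on (slots m) F \<and> (\<exists>U. exp_comb U \<and> (\<forall>x\<in>slots m. F x = U (?\<Phi> x)))" for F
  obtain F where F: "P F" "\<And>x. x \<in> slots m \<Longrightarrow> \<bar>g (?\<Phi> x) - F x\<bar> < e"
  proof (rule Stone_Weierstrass_nonseparating[where C = "slots m" and P = P and g = "\<lambda>x. g (?\<Phi> x)" and e = e])
    show "P (\<lambda>_. c)" for c unfolding P_def using exp_comb_const by auto
    show "P F \<Longrightarrow> continuous_on (slots m) F" for F by (simp add: P_def)
    show "P (\<lambda>x. F x + G x)" if FG: "P F" "P G" for F G
    proof -
      obtain U W where "exp_comb U" "\<forall>x\<in>slots m. F x = U (?\<Phi> x)" "exp_comb W" "\<forall>x\<in>slots m. G x = W (?\<Phi> x)"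
        using FG unfolding P_def by blast
      then show ?thesis using FG unfolding P_def
        by (intro conjI continuous_on_add exI[of _ "\<lambda>\<mu>. U \<mu> + W \<mu>"] exp_comb_plus) auto
    qed
    show "P (\<lambda>x. F x * G x)" if FG: "P F" "P G" for F G
    proof -
      obtain U W where "exp_comb U" "\<forall>x\<in>slots m. F x = U (?\<Phi> x)" "exp_comb W" "\<forall>x\<in>slots m. G x = W (?\<Phi> x)"
        using FG unfolding P_def by blast
      then show ?thesis using FG unfolding P_def
        by (intro conjI continuous_on_mult exI[of _ "\<lambda>\<mu>. U \<mu> * W \<mu>"] exp_comb_mult) auto
    qed
    show "continuous_on (slots m) (\<lambda>x. g (?\<Phi> x))" by (rule cont[OF g(1)])
    show "g (?\<Phi> x) = g (?\<Phi> y)" if xy: "x \<in> slots m" "y \<in> slots m" "\<And>F. P F \<Longrightarrow> F x = F y" for x y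
    proof (rule vague_indistinguishable[OF slots_in_Mp[OF xy(1)] slots_in_Mp[OF xy(2)] _ g(1)])
      fix f :: "real \<times> ereal \<Rightarrow> real" assume f: "f \<in> CK_plus"
      have "exp_comb (\<lambda>\<mu>. exp (- (\<integral>z. f z \<partial>\<mu>)))" by (rule exp_comb.exp[OF f, of _ 1]) simp
      then have "P (\<lambda>x. exp (- (\<integral>z. f z \<partial>?\<Phi> x)))"
        unfolding P_def using cont[OF exp_comb_continuous] by blast
      from xy(3)[OF this] show "(\<integral>z. f z \<partial>?\<Phi> x) = (\<integral>z. f z \<partial>?\<Phi> y)" by simp
    qed
  qed (use assms in \<open>auto simp: compact_slots\<close>)
  then obtain U where U: "exp_comb U" "\<And>x. x \<in> slots m \<Longrightarrow> \<bar>g (?\<Phi> x) - U (?\<Phi> x)\<bar> < e"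
    unfolding P_def by fastforce
  obtain K where K: "\<forall>\<mu>\<in>Mp. \<bar>U \<mu>\<bar> \<le> K" using exp_comb_bounded[OF U(1)] by auto
  \<comment> \<open>The bound \<open>K\<close> depends on \<open>e\<close> and \<open>m\<close>; clipping by a polynomial brings it near \<open>B\<close> within the algebra.\<close>
  define clip where "clip t = max (- B) (min B t)" for t
  have "continuous_on {-K..K} clip" unfolding clip_def by (intro continuous_intros)
  then obtain q where q: "real_polynomial_function q" "\<And>t. t \<in> {-K..K} \<Longrightarrow> \<bar>clip t - q t\<bar> < e"
    using Stone_Weierstrass_real_polynomial_function[OF compact_Icc _ \<open>e > 0\<close>] by blast
  have qU: "\<bar>clip (U \<mu>) - q (U \<mu>)\<bar> < e" if "\<mu> \<in> Mp" for \<mu>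
    using K that by (intro q(2)) (auto simp: abs_le_iff)
  show ?thesis
  proof (rule that[OF exp_comb_polynomial[OF q(1) U(1)]])
    show "\<bar>q (U \<mu>)\<bar> \<le> B + e" if "\<mu> \<in> Mp" for \<mu>
    proof -
      have "\<bar>clip (U \<mu>)\<bar> \<le> B" using \<open>B > 0\<close> by (auto simp: clip_def)
      then show ?thesis using qU[OF that] by linarith
    qed
    show "\<bar>g (?\<Phi> x) - q (U (?\<Phi> x))\<bar> \<le> 2 * e" if x: "x \<in> slots m" for x
    proof -
      \<comment> \<open>Clipping to [-B, B] is a contraction that fixes the values of g.\<close>
      have "\<bar>g (?\<Phi> x) - clip (U (?\<Phi> x))\<bar> \<le> \<bar>g (?\<Phi> x) - U (?\<Phi> x)\<bar>"
        using g(2)[OF slots_in_Mp[OF x]] \<open>B > 0\<close> unfolding clip_def by linarith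
      then show ?thesis using U(2)[OF x] qU[OF slots_in_Mp[OF x]] by linarith
    qed
  qed
qed

section \<open>Tightness from Laplace transforms\<close>

lemma (in prob_space) Laplace_near_zero:
  assumes "W \<in> borel_measurable M" "\<And>\<omega>. \<omega> \<in> space M \<Longrightarrow> 0 \<le> W \<omega>"
  shows "(\<lambda>m::nat. \<integral>\<omega>. exp (- (1 / real m * W \<omega>)) \<partial>M) \<longlonglongrightarrow> 1"
proof -
  have "(\<lambda>m::nat. \<integral>\<omega>. exp (- (1 / real m * W \<omega>)) \<partial>M) \<longlonglongrightarrow> (\<integral>\<omega>. 1 \<partial>M)"
  proof (rule integral_dominated_convergence[where w = "\<lambda>_. 1"])
    show "AE \<omega> in M. (\<lambda>m::nat. exp (- (1 / real m * W \<omega>))) \<longlonglongrightarrow> 1"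
    proof (intro AE_I2)
      fix \<omega>
      have "(\<lambda>m::nat. exp (- (1 / real m * W \<omega>))) \<longlonglongrightarrow> exp (- (0 * W \<omega>))"
        by (intro tendsto_intros lim_1_over_n)
      then show "(\<lambda>m::nat. exp (- (1 / real m * W \<omega>))) \<longlonglongrightarrow> 1" by simp
    qed
    show "AE \<omega> in M. norm (exp (- (1 / real m * W \<omega>))) \<le> 1" for m
      using assms(2) by (intro AE_I2) simp
  qed (use assms(1) in auto)
  then show ?thesis by (simp add: prob_space)
qed

text \<open>Markov's inequality for 1 - exp (- W / m), which is at least 1 - exp (-1) where W >
  m.\<close>

lemma (in prob_space) Laplace_tail_bound:
  assumes W: "W \<in> borel_measurable M" "\<And>\<omega>. \<omega> \<in> space M \<Longrightarrow> 0 \<le> W \<omega>" and m: "m > 0"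
  shows "prob {\<omega> \<in> space M. W \<omega> > real m} * (1 - exp (- 1)) \<le> 1 - (\<integral>\<omega>. exp (- (1 / real m * W \<omega>)) \<partial>M)"
proof -
  note [measurable] = W(1)
  have int: "integrable M (\<lambda>\<omega>. exp (- (1 / real m * W \<omega>)))"
    by (rule integrable_const_bound[of _ 1]) (use W in auto)
  have "prob {\<omega> \<in> space M. W \<omega> > real m} * (1 - exp (- 1))
      = (\<integral>\<omega>. indicator {\<omega> \<in> space M. W \<omega> > real m} \<omega> * (1 - exp (- 1)) \<partial>M)"
    by (subst integral_mult_left_zero) simp
  also have "\<dots> \<le> (\<integral>\<omega>. 1 - exp (- (1 / real m * W \<omega>)) \<partial>M)"
  proof (rule integral_mono)
    fix \<omega> assume \<omega>: "\<omega> \<in> space M"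
    show "indicator {\<omega> \<in> space M. W \<omega> > real m} \<omega> * (1 - exp (- 1)) \<le> 1 - exp (- (1 / real m * W \<omega>))"
      using W(2)[OF \<omega>] m by (auto split: split_indicator simp: field_simps)
  next
    show "integrable M (\<lambda>\<omega>. indicator {\<omega> \<in> space M. W \<omega> > real m} \<omega> * (1 - exp (- 1) :: real))"
      by (rule integrable_const_bound[of _ 1]) (auto split: split_indicator)
  qed (use int in auto)
  also have "\<dots> = 1 - (\<integral>\<omega>. exp (- (1 / real m * W \<omega>)) \<partial>M)"
    using int by (subst Bochner_Integration.integral_diff) (auto simp: prob_space)
  finally show ?thesis .
qed

text \<open>One level works for the limit and, by convergence of the transforms, for all large n;
  each of the finitely many other n has its own level. The maximum of these levels serves all, since
  tail probabilities decrease in the level.\<close>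

lemma Laplace_tight:
  assumes M: "prob_space M" "prob_space M'"
    and \<xi>: "\<And>n::nat. \<xi> n \<in> M \<rightarrow>\<^sub>M borel_of vague_top" and \<eta>: "\<eta> \<in> M' \<rightarrow>\<^sub>M borel_of vague_top"
    and lap: "\<And>f. f \<in> CK_plus \<Longrightarrow> (\<lambda>n. \<integral>\<omega>. exp (- (\<integral>z. f z \<partial>\<xi> n \<omega>)) \<partial>M)
      \<longlonglongrightarrow> (\<integral>\<omega>. exp (- (\<integral>z. f z \<partial>\<eta> \<omega>)) \<partial>M')"
    and f: "f \<in> CK_plus" and e: "e > 0"
  obtains m :: nat where "\<And>n. measure M {\<omega> \<in> space M. (\<integral>z. f z \<partial>\<xi> n \<omega>) > real m} \<le> e"
    "measure M' {\<omega> \<in> space M'. (\<integral>z. f z \<partial>\<eta> \<omega>) > real m} \<le> e"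
proof -
  interpret M: prob_space M by fact
  interpret M': prob_space M' by fact
  note \<xi>m = random_Mp_integral_measurable[OF \<xi> f] and \<eta>m = random_Mp_integral_measurable[OF \<eta> f]
  note nn = integral_Mp_nonneg[OF f]
  define k :: real where "k = 1 - exp (- 1)"
  have k: "k > 0" by (simp add: k_def)
  define \<psi> where "\<psi> n m = (\<integral>\<omega>. exp (- (1 / real m * (\<integral>z. f z \<partial>\<xi> n \<omega>))) \<partial>M)" for n m :: nat
  define \<psi>' where "\<psi>' m = (\<integral>\<omega>. exp (- (1 / real m * (\<integral>z. f z \<partial>\<eta> \<omega>))) \<partial>M')" for m :: nat
  have ev: "\<forall>\<^sub>F m in sequentially. 1 - h m < e * k \<and> m > 0" if "h \<longlonglongrightarrow> 1" for h :: "nat \<Rightarrow> real"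
  proof -
    have "\<forall>\<^sub>F m in sequentially. h m > 1 - e * k" using that e k by (intro order_tendstoD) auto
    then show ?thesis using eventually_gt_at_top[of 0] by eventually_elim auto
  qed
  have "\<psi>' \<longlonglongrightarrow> 1" unfolding \<psi>'_def by (rule M'.Laplace_near_zero[OF \<eta>m nn])
  from eventually_happens'[OF sequentially_bot ev[OF this]]
  obtain m1 where m1: "1 - \<psi>' m1 < e * k" "m1 > 0" by auto
  \<comment> \<open>The convergence hypothesis is applied to the test function f / m1.\<close>
  have "(\<lambda>n. \<psi> n m1) \<longlonglongrightarrow> \<psi>' m1"
  proof -
    have "(\<lambda>z. 1 / real m1 * f z) \<in> CK_plus" by (rule CK_plus_cmult[OF f]) simp
    from lap[OF this] show ?thesis unfolding \<psi>_def \<psi>'_def by (simp del: times_divide_eq_left)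
  qed
  then have "\<forall>\<^sub>F n in sequentially. \<psi> n m1 > 1 - e * k"
    using m1 by (intro order_tendstoD) auto
  then obtain N where N: "\<And>n. n \<ge> N \<Longrightarrow> 1 - \<psi> n m1 < e * k"
    unfolding eventually_sequentially by (metis diff_less_eq add.commute)
  have "\<exists>m>0. 1 - \<psi> n m < e * k" for n
  proof -
    have "\<psi> n \<longlonglongrightarrow> 1" unfolding \<psi>_def by (rule M.Laplace_near_zero[OF \<xi>m nn])
    from eventually_happens'[OF sequentially_bot ev[OF this]] show ?thesis by blast
  qed
  then obtain mm where mm: "\<And>n. mm n > 0 \<and> 1 - \<psi> n (mm n) < e * k" by metis
  define m where "m = Max (insert m1 (mm ` {..<N}))"
  have tail: "measure M {\<omega> \<in> space M. (\<integral>z. f z \<partial>\<xi> n \<omega>) > real m} \<le> e"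
    if "1 - \<psi> n j < e * k" "j > 0" "j \<le> m" for n j
  proof -
    have "measure M {\<omega> \<in> space M. (\<integral>z. f z \<partial>\<xi> n \<omega>) > real j} * k < e * k"
      using M.Laplace_tail_bound[OF \<xi>m nn that(2), of n] that(1) unfolding \<psi>_def k_def by linarith
    moreover have "measure M {\<omega> \<in> space M. (\<integral>z. f z \<partial>\<xi> n \<omega>) > real m}
        \<le> measure M {\<omega> \<in> space M. (\<integral>z. f z \<partial>\<xi> n \<omega>) > real j}"
      using that(3) \<xi>m[of n] by (intro M.finite_measure_mono) auto
    ultimately show ?thesis using k by (simp add: mult_less_cancel_right)
  qed
  show ?thesis
  proof (rule that)
    fix n show "measure M {\<omega> \<in> space M. (\<integral>z. f z \<partial>\<xi> n \<omega>) > real m} \<le> e"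
    proof (cases "n \<ge> N")
      case True
      then show ?thesis by (intro tail[of n m1] N m1) (simp_all add: m_def)
    next
      case False
      then show ?thesis using mm[of n] by (intro tail[of n "mm n"]) (simp_all add: m_def)
    qed
    have "measure M' {\<omega> \<in> space M'. (\<integral>z. f z \<partial>\<eta> \<omega>) > real m1} * k < e * k"
      using M'.Laplace_tail_bound[OF \<eta>m nn m1(2)] m1(1) unfolding \<psi>'_def k_def by linarith
    moreover have "measure M' {\<omega> \<in> space M'. (\<integral>z. f z \<partial>\<eta> \<omega>) > real m}
        \<le> measure M' {\<omega> \<in> space M'. (\<integral>z. f z \<partial>\<eta> \<omega>) > real m1}"
    proof -
      have "m1 \<le> m" by (simp add: m_def)
      then show ?thesis using \<eta>m by (intro M'.finite_measure_mono) auto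
    qed
    ultimately show "measure M' {\<omega> \<in> space M'. (\<integral>z. f z \<partial>\<eta> \<omega>) > real m} \<le> e"
      using k by (simp add: mult_less_cancel_right)
  qed
qed

text \<open>For each n, and for the limit, the random measure lies in the image of one fixed
  \<open>slots m\<close> outside an event of probability at most e. There g is replaced by an
  exponential combination, whose expectation converges.\<close>

theorem conv_in_dist_vagueI:
  assumes M: "prob_space M" "prob_space M'"
    and \<xi>: "\<And>n::nat. \<xi> n \<in> M \<rightarrow>\<^sub>M borel_of vague_top" and \<eta>: "\<eta> \<in> M' \<rightarrow>\<^sub>M borel_of vague_top"
    and lap: "\<And>f. f \<in> CK_plus \<Longrightarrow> (\<lambda>n. \<integral>\<omega>. exp (- (\<integral>z. f z \<partial>\<xi> n \<omega>)) \<partial>M)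
      \<longlonglongrightarrow> (\<integral>\<omega>. exp (- (\<integral>z. f z \<partial>\<eta> \<omega>)) \<partial>M')"
  shows "conv_in_dist vague_top M \<xi> M' \<eta>"
  unfolding conv_in_dist_def
proof (intro conjI allI impI \<xi> \<eta>)
  fix g :: "(real \<times> ereal) measure \<Rightarrow> real"
  assume "continuous_map vague_top euclideanreal g \<and> bounded (g ` topspace vague_top)"
  then have g: "continuous_map vague_top euclideanreal g" and bd: "bounded (g ` Mp)"
    by (auto simp: topspace_vague_top)
  obtain B where B: "B > 0" "\<And>\<mu>. \<mu> \<in> Mp \<Longrightarrow> \<bar>g \<mu>\<bar> \<le> B"
    using bd unfolding bounded_pos by auto
  show "(\<lambda>n. \<integral>\<omega>. g (\<xi> n \<omega>) \<partial>M) \<longlonglongrightarrow> (\<integral>\<omega>. g (\<eta> \<omega>) \<partial>M')"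
  proof (rule LIMSEQ_I)
    fix \<epsilon> :: real assume \<epsilon>: "\<epsilon> > 0"
    \<comment> \<open>The total error is at most 2 (2 e + (2 B + e) e) + e, which for e \<le> 1 is
      below (4 B + 8) e.\<close>
    define e where "e = min 1 (\<epsilon> / (4 * B + 8))"
    have e: "e > 0" "e \<le> 1" "(4 * B + 8) * e \<le> \<epsilon>"
    proof -
      have "e \<le> \<epsilon> / (4 * B + 8)" by (simp add: e_def)
      then show "(4 * B + 8) * e \<le> \<epsilon>" using B(1) by (simp add: field_simps)
    qed (use \<epsilon> B(1) in \<open>auto simp: e_def\<close>)
    have "\<exists>f. f \<in> CK_plus \<and> (\<forall>z \<in> slab (1 / real (Suc j)). 1 \<le> f z)" for j
      using CK_plus_bumpE[of "1 / real (Suc j)"] by (metis of_nat_0_less_iff zero_less_Suc zero_less_divide_1_iff)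
    then obtain \<phi> where \<phi>: "\<And>j. \<phi> j \<in> CK_plus" "\<And>j z. z \<in> slab (1 / real (Suc j)) \<Longrightarrow> 1 \<le> \<phi> j z" by metis
    \<comment> \<open>The weights e / 2^(j + 1) sum to e over all rows, so one exceptional event
      covers every row at once.\<close>
    define Q where "Q j m \<longleftrightarrow>
        (\<forall>n. measure M {\<omega> \<in> space M. (\<integral>z. \<phi> j z \<partial>\<xi> n \<omega>) > real m} \<le> e * (1/2) ^ Suc j) \<and>
        measure M' {\<omega> \<in> space M'. (\<integral>z. \<phi> j z \<partial>\<eta> \<omega>) > real m} \<le> e * (1/2) ^ Suc j" for j m :: nat
    have "\<exists>m. Q j m" for j
      by (rule Laplace_tight[OF M \<xi> \<eta> lap \<phi>(1)[of j], where e = "e * (1/2) ^ Suc j"])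
         (assumption, use e in simp, unfold Q_def, blast)
    then obtain m where "\<And>j. Q j (m j)" by metis
    then have m:
      "\<And>n j. measure M {\<omega> \<in> space M. (\<integral>z. \<phi> j z \<partial>\<xi> n \<omega>) > real (m j)} \<le> e * (1/2) ^ Suc j"
      "\<And>j. measure M' {\<omega> \<in> space M'. (\<integral>z. \<phi> j z \<partial>\<eta> \<omega>) > real (m j)} \<le> e * (1/2) ^ Suc j"
      unfolding Q_def by (blast, blast)
    obtain V where V: "exp_comb V" "\<And>\<mu>. \<mu> \<in> Mp \<Longrightarrow> \<bar>V \<mu>\<bar> \<le> B + e"
      "\<And>x. x \<in> slots m \<Longrightarrow> \<bar>g (dirac_sum UNIV x) - V (dirac_sum UNIV x)\<bar> \<le> 2 * e"
      using exp_comb_approx[OF g B(2) B(1) e(1), of m] by blast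
    have close: "\<bar>(\<integral>\<omega>. g (\<zeta> \<omega>) \<partial>N) - (\<integral>\<omega>. V (\<zeta> \<omega>) \<partial>N)\<bar> \<le> 2 * e + (2 * B + e) * e"
      if N: "prob_space N" and \<zeta>: "\<zeta> \<in> N \<rightarrow>\<^sub>M borel_of vague_top"
        and tail: "\<And>j. measure N {\<omega> \<in> space N. (\<integral>z. \<phi> j z \<partial>\<zeta> \<omega>) > real (m j)} \<le> e * (1/2) ^ Suc j"
      for N :: "'c measure" and \<zeta>
    proof -
      interpret N: prob_space N by fact
      note [measurable] = random_Mp_integral_measurable[OF \<zeta> \<phi>(1)]
      define A where "A j = {\<omega> \<in> space N. (\<integral>z. \<phi> j z \<partial>\<zeta> \<omega>) > real (m j)}" for j
      have A: "A j \<in> sets N" for j unfolding A_def by measurable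
      have half: "(\<lambda>j. e * (1/2) ^ Suc j) sums (e * 1)"
        by (intro sums_mult power_half_series)
      have sm: "summable (\<lambda>j. measure N (A j))"
      proof (rule summable_comparison_test'[OF sums_summable[OF half], of 0])
        show "norm (measure N (A j)) \<le> e * (1/2) ^ Suc j" for j
          using tail[of j] unfolding A_def[symmetric] by simp
      qed
      have "measure N (\<Union>j. A j) \<le> (\<Sum>j. measure N (A j))"
        using A sm by (intro N.finite_measure_subadditive_countably) auto
      also have "\<dots> \<le> (\<Sum>j. e * (1/2) ^ Suc j)"
        by (rule suminf_le[OF _ sm sums_summable[OF half]]) (use tail in \<open>simp add: A_def\<close>)
      finally have bad: "measure N (\<Union>j. A j) \<le> e" using half by (simp add: sums_iff)
      have ig: "integrable N (\<lambda>\<omega>. g (\<zeta> \<omega>))"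
        using B(2) random_Mp_in_Mp[OF \<zeta>] measurable_compose[OF \<zeta> continuous_map_borel_of[OF g]]
        by (intro N.integrable_const_bound[of _ B]) auto
      note iV = exp_comb_integrable[OF N \<zeta> V(1)]
      have UA: "(\<Union>j. A j) \<in> sets N" using A by auto
      have iA: "integrable N (indicator (\<Union>j. A j) :: _ \<Rightarrow> real)"
        using UA by (intro integrable_real_indicator) (simp_all add: N.emeasure_eq_measure)
      have pt: "\<bar>g (\<zeta> \<omega>) - V (\<zeta> \<omega>)\<bar> \<le> 2 * e + (2 * B + e) * indicator (\<Union>j. A j) \<omega>" if \<omega>: "\<omega> \<in> space N" for \<omega>
      proof (cases "\<omega> \<in> (\<Union>j. A j)")
        case True
        have "\<bar>g (\<zeta> \<omega>) - V (\<zeta> \<omega>)\<bar> \<le> \<bar>g (\<zeta> \<omega>)\<bar> + \<bar>V (\<zeta> \<omega>)\<bar>" by linarith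
        also have "\<dots> \<le> B + (B + e)"
          by (intro add_mono B(2) V(2) random_Mp_in_Mp[OF \<zeta> \<omega>])
        finally show ?thesis using True e(1) by simp
      next
        case False
        have "emeasure (\<zeta> \<omega>) (slab (1 / real (Suc j))) \<le> of_nat (m j)" for j
        proof -
          have "(\<integral>z. \<phi> j z \<partial>\<zeta> \<omega>) \<le> real (m j)" using False \<omega> by (auto simp: A_def not_less)
          then have "ennreal (\<integral>z. \<phi> j z \<partial>\<zeta> \<omega>) \<le> of_nat (m j)"
            by (metis ennreal_leI ennreal_of_nat_eq_real_of_nat)
          moreover have "emeasure (\<zeta> \<omega>) (slab (1 / real (Suc j))) \<le> ennreal (\<integral>z. \<phi> j z \<partial>\<zeta> \<omega>)"
            by (rule emeasure_slab_le_integral[OF \<phi> _ random_Mp_in_Mp[OF \<zeta> \<omega>]]) simp_all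
          ultimately show ?thesis by (rule order_trans[rotated])
        qed
        then obtain x where "x \<in> slots m" "\<zeta> \<omega> = dirac_sum UNIV x"
          by (rule slots_surj[OF random_Mp_in_Mp[OF \<zeta> \<omega>]])
        then show ?thesis using V(3) False by simp
      qed
      have "\<bar>(\<integral>\<omega>. g (\<zeta> \<omega>) \<partial>N) - (\<integral>\<omega>. V (\<zeta> \<omega>) \<partial>N)\<bar> = \<bar>\<integral>\<omega>. g (\<zeta> \<omega>) - V (\<zeta> \<omega>) \<partial>N\<bar>"
        using ig iV by simp
      also have "\<dots> \<le> (\<integral>\<omega>. \<bar>g (\<zeta> \<omega>) - V (\<zeta> \<omega>)\<bar> \<partial>N)"
        by (rule integral_abs_bound)
      also have "\<dots> \<le> (\<integral>\<omega>. 2 * e + (2 * B + e) * indicator (\<Union>j. A j) \<omega> \<partial>N)"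
        by (rule integral_mono[OF integrable_abs[OF Bochner_Integration.integrable_diff[OF ig iV]] _ pt])
           (intro Bochner_Integration.integrable_add integrable_mult_right iA, simp)
      also have "\<dots> = 2 * e + (2 * B + e) * measure N (\<Union>j. A j)"
        by (subst Bochner_Integration.integral_add)
           (use UA iA in \<open>simp_all add: N.prob_space sets.Int_space_eq1\<close>)
      also have "\<dots> \<le> 2 * e + (2 * B + e) * e"
        using bad B(1) e(1) by (intro add_left_mono mult_left_mono) auto
      finally show ?thesis .
    qed
    have "(\<lambda>n. \<integral>\<omega>. V (\<xi> n \<omega>) \<partial>M) \<longlonglongrightarrow> (\<integral>\<omega>. V (\<eta> \<omega>) \<partial>M')"
      by (rule exp_comb_expectation_converges[OF M \<xi> \<eta> lap V(1)])
    from LIMSEQ_D[OF this e(1)] obtain n0 where n0: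
      "\<And>n. n \<ge> n0 \<Longrightarrow> \<bar>(\<integral>\<omega>. V (\<xi> n \<omega>) \<partial>M) - (\<integral>\<omega>. V (\<eta> \<omega>) \<partial>M')\<bar> < e" by auto
    define K where "K = 2 * e + (2 * B + e) * e"
    have "norm ((\<integral>\<omega>. g (\<xi> n \<omega>) \<partial>M) - (\<integral>\<omega>. g (\<eta> \<omega>) \<partial>M')) < \<epsilon>" if "n \<ge> n0" for n
    proof -
      have "\<bar>(\<integral>\<omega>. g (\<xi> n \<omega>) \<partial>M) - (\<integral>\<omega>. g (\<eta> \<omega>) \<partial>M')\<bar> < 2 * (2 * e + (2 * B + e) * e) + e"
        using n0[OF that] close[OF M(1) \<xi> m(1), of n] close[OF M(2) \<eta> m(2)]
        unfolding K_def[symmetric] by linarith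
      moreover have "(2 * B + e) * e \<le> (2 * B + 1) * e" using e by (intro mult_right_mono) auto
      then have "2 * (2 * e + (2 * B + e) * e) + e < (4 * B + 8) * e" using e(1) by (simp add: algebra_simps)
      ultimately show ?thesis using e(3) by simp
    qed
    then show "\<exists>n0. \<forall>n\<ge>n0. norm ((\<integral>\<omega>. g (\<xi> n \<omega>) \<partial>M) - (\<integral>\<omega>. g (\<eta> \<omega>) \<partial>M')) < \<epsilon>" by blast
  qed
qed

section \<open>The intensity measure and Poisson processes\<close>

lemma E_space_alt: "E_space = - {0}"
  by (auto simp: E_space_def)

lemma E_space_borel [measurable]: "E_space \<in> sets borel"
  unfolding E_space_alt by simp

lemma sets_borel_of_E_top: "sets (borel_of E_top) = sets (restrict_space borel E_space)"
  unfolding E_top_eq by (rule sets_borel_of_top_of_set) simp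

lemma sets_nu [simp]: "sets (nu \<alpha> s p q) = sets (borel_of E_top)"
  by (simp add: nu_def)

lemma space_nu [simp]: "space (nu \<alpha> s p q) = E_space"
  by (simp add: nu_def space_borel_of topspace_E_top)

lemma space_intensity [simp]: "space (intensity \<alpha> s p q) = S_space"
  by (simp add: intensity_def space_pair_measure S_space_def)

lemma sets_subset_of_id_measurable:
  assumes "(\<lambda>x. x) \<in> N \<rightarrow>\<^sub>M K" "space N = space K"
  shows "sets K \<subseteq> sets N"
proof
  fix A assume A: "A \<in> sets K"
  then have "(\<lambda>x. x) -` A \<inter> space N = A" using assms(2) sets.sets_into_space by auto
  then show "A \<in> sets N" using measurable_sets[OF assms(1) A] by simp
qed

text \<open>The identity is measurable in both directions between the product of the traces and the
  trace of the product Borel sets.\<close>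

lemma sets_intensity [simp]: "sets (intensity \<alpha> s p q) = sets (borel_of S_top)"
proof -
  let ?R = "restrict_space borel {0..1::real} \<Otimes>\<^sub>M restrict_space borel E_space"
  let ?B = "restrict_space borel S_space"
  have "sets (intensity \<alpha> s p q) = sets ?R"
    unfolding intensity_def
    by (intro sets_pair_measure_cong) (simp_all add: sets_borel_of_E_top sets_restrict_space)
  also have "\<dots> = sets ?B"
  proof
    have sp: "space ?R = space ?B" by (simp add: space_pair_measure space_restrict_space S_space_def)
    have "(\<lambda>z. (fst z, snd z)) \<in> ?R \<rightarrow>\<^sub>M borel \<Otimes>\<^sub>M borel"
      by (intro measurable_Pair measurable_compose[OF measurable_fst] measurable_compose[OF measurable_snd]
          measurable_restrict_space1) simp_all
    then have "(\<lambda>z. z) \<in> ?R \<rightarrow>\<^sub>M ?B"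
      by (intro measurable_restrict_space2) (auto simp: borel_prod space_pair_measure space_restrict_space S_space_def)
    then show "sets ?B \<subseteq> sets ?R" by (rule sets_subset_of_id_measurable[OF _ sp])
    have "(\<lambda>z. (fst z, snd z)) \<in> ?B \<rightarrow>\<^sub>M ?R"
    proof (intro measurable_Pair measurable_restrict_space2)
      show "fst \<in> ?B \<rightarrow>\<^sub>M borel" "snd \<in> ?B \<rightarrow>\<^sub>M borel"
        by (intro measurable_restrict_space1, simp add: borel_prod[symmetric])+
    qed (auto simp: space_restrict_space S_space_def)
    then show "sets ?R \<subseteq> sets ?B" using sp by (intro sets_subset_of_id_measurable) auto
  qed
  finally show ?thesis by (simp add: sets_borel_of_S_top)
qed

section \<open>Tails and finiteness of the intensity\<close>

text \<open>The sign \<tau> = 1 or \<tau> = -1 selects the half-line (x, \<infinity>] or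
  [-\<infinity>, -x), so that both tails are treated by one argument.\<close>

definition tail_set :: "real \<Rightarrow> real \<Rightarrow> ereal set" where
  "tail_set \<tau> x = {y. ereal x < ereal \<tau> * y}"

definition tail_weight :: "real \<Rightarrow> real \<Rightarrow> real \<Rightarrow> real" where
  "tail_weight p q \<tau> = (if \<tau> = 1 then p else q)"

lemma tail_set_1: "tail_set 1 x = {ereal x<..}"
  by (auto simp: tail_set_def one_ereal_def[symmetric])

lemma tail_set_m1: "tail_set (- 1) x = {..<ereal (- x)}"
proof -
  have "ereal x < ereal (- 1) * y \<longleftrightarrow> y < ereal (- x)" for y by (cases y) auto
  then show ?thesis by (auto simp: tail_set_def)
qed

lemma tail_set_borel [measurable]: "\<tau> \<in> {1, -1} \<Longrightarrow> tail_set \<tau> x \<in> sets borel"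
  by (auto simp: tail_set_1 tail_set_m1)

lemma rectangle_borel:
  "\<tau> \<in> {1, -1} \<Longrightarrow> {0..t::real} \<times> tail_set \<tau> x \<in> sets borel"
  unfolding borel_prod[symmetric] using tail_set_borel[of \<tau> x] by (intro pair_measureI) auto

lemma tail_set_subset_E: "\<tau> \<in> {1, -1} \<Longrightarrow> 0 \<le> x \<Longrightarrow> tail_set \<tau> x \<subseteq> E_space"
  by (auto simp: tail_set_1 tail_set_m1 E_space_alt)

lemma nn_integral_power_tail:
  assumes "\<alpha> > 0" "x > 0" "w \<ge> 0"
  shows "(\<integral>\<^sup>+t. ennreal (w * \<alpha> * t powr (- \<alpha> - 1)) * indicator {x<..} t \<partial>lborel) = ennreal (w * x powr - \<alpha>)"
proof -
  have "(\<integral>\<^sup>+t. ennreal (w * \<alpha> * t powr (- \<alpha> - 1)) * indicator {x<..} t \<partial>lborel)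
      = (\<integral>\<^sup>+t. ennreal (w * \<alpha> * t powr (- \<alpha> - 1)) * indicator {x..} t \<partial>lborel)"
    using AE_lborel_singleton[of x]
    by (intro nn_integral_cong_AE) (auto split: split_indicator elim!: eventually_mono)
  also have "\<dots> = ennreal (0 - (- w * x powr (- \<alpha>)))"
  proof (rule nn_integral_FTC_atLeast)
    fix t assume "x \<le> t"
    then have "t > 0" using assms by simp
    then show "DERIV (\<lambda>t. - w * t powr (- \<alpha>)) t :> w * \<alpha> * t powr (- \<alpha> - 1)"
      by (auto intro!: derivative_eq_intros)
    show "0 \<le> w * \<alpha> * t powr (- \<alpha> - 1)" using assms by simp
  next
    have "((\<lambda>t. - w * t powr (- \<alpha>)) \<longlongrightarrow> - w * 0) at_top"
      using assms by (intro tendsto_mult tendsto_const tendsto_neg_powr filterlim_ident) auto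
    then show "((\<lambda>t. - w * t powr (- \<alpha>)) \<longlongrightarrow> 0) at_top" by simp
  qed simp
  finally show ?thesis by simp
qed

lemma nu_tail:
  assumes "\<alpha> > 0" "x > 0" "p \<ge> 0" "q \<ge> 0" and \<tau>: "\<tau> \<in> {1, -1}"
  shows "emeasure (nu \<alpha> s p q) (tail_set \<tau> x) = ennreal (s powr \<alpha> * tail_weight p q \<tau> * x powr - \<alpha>)"
proof -
  let ?d = "\<lambda>x. s powr \<alpha> * (p * indicator {0<..} x + q * indicator {..<0} x) * \<alpha> * \<bar>x\<bar> powr (- \<alpha> - 1)"
  let ?L = "restrict_space lborel (UNIV - {0::real})"
  let ?w = "s powr \<alpha> * tail_weight p q \<tau>"
  have w: "?w \<ge> 0" using assms by (simp add: tail_weight_def)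
  have m: "ereal \<in> density ?L (\<lambda>x. ennreal (?d x)) \<rightarrow>\<^sub>M borel_of E_top"
  proof -
    have "ereal \<in> ?L \<rightarrow>\<^sub>M restrict_space borel E_space"
      by (intro measurable_restrict_space2 measurable_restrict_space1)
         (auto simp: space_restrict_space E_space_alt)
    then show ?thesis
      by (simp cong: measurable_cong_sets add: sets_borel_of_E_top)
  qed
  have A: "tail_set \<tau> x \<in> sets (borel_of E_top)"
    using tail_set_subset_E[OF \<tau>, of x] tail_set_borel[OF \<tau>, of x] assms
    by (simp add: sets_borel_of_E_top sets_restrict_space_iff)
  let ?A = "{t. x < \<tau> * t}"
  have A': "?A \<in> sets borel" by measurable
  have "emeasure (nu \<alpha> s p q) (tail_set \<tau> x)
      = emeasure (density ?L (\<lambda>x. ennreal (?d x))) (ereal -` tail_set \<tau> x \<inter> (UNIV - {0}))"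
    unfolding nu_def using A m by (subst emeasure_distr) (auto simp: space_restrict_space)
  also have "ereal -` tail_set \<tau> x \<inter> (UNIV - {0}) = ?A"
    using assms by (auto simp: tail_set_def)
  also have "emeasure (density ?L (\<lambda>x. ennreal (?d x))) ?A = (\<integral>\<^sup>+t. ennreal (?d t) * indicator ?A t \<partial>?L)"
  proof (rule emeasure_density)
    show "(\<lambda>x. ennreal (?d x)) \<in> borel_measurable ?L"
      by (intro measurable_restrict_space1) measurable
    have "0 \<notin> ?A" using assms by auto
    then show "?A \<in> sets ?L" using A' by (subst sets_restrict_space_iff) auto
  qed
  also have "\<dots> = (\<integral>\<^sup>+t. ennreal (?d t) * indicator ?A t * indicator (UNIV - {0}) t \<partial>lborel)"
    by (subst nn_integral_restrict_space) auto
  also have "\<dots> = (\<integral>\<^sup>+t. ennreal (?w * \<alpha> * (\<tau> * t) powr (- \<alpha> - 1)) * indicator {x<..} (\<tau> * t) \<partial>lborel)"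
    using assms
    by (intro nn_integral_cong) (auto simp: tail_weight_def split: split_indicator)
  also have "\<dots> = (\<integral>\<^sup>+t. ennreal (?w * \<alpha> * t powr (- \<alpha> - 1)) * indicator {x<..} t \<partial>lborel)"
  \<comment> \<open>For \<tau> = -1 the reflection t \<mapsto> -t, which preserves Lebesgue measure,
    reduces the integral to the right tail.\<close>
  proof (cases "\<tau> = 1")
    case False
    then have "\<tau> = - 1" using \<tau> by auto
    then show ?thesis
      by (subst (2) lborel_distr_uminus[symmetric], subst nn_integral_distr) auto
  qed simp
  also have "\<dots> = ennreal (?w * x powr - \<alpha>)"
    by (rule nn_integral_power_tail[OF assms(1,2) w])
  finally show ?thesis .
qed

text \<open>The half-lines beyond 1 / (n + 1) on either side have finite mass and exhaust
  \<open>E_space\<close>; the product formula for rectangles rests on this.\<close>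

lemma sigma_finite_nu:
  assumes "\<alpha> > 0" "p \<ge> 0" "q \<ge> 0"
  shows "sigma_finite_measure (nu \<alpha> s p q)"
proof
  let ?A = "\<lambda>(\<tau>, n). tail_set \<tau> (1 / real (Suc n))"
  let ?C = "?A ` ({1, -1} \<times> UNIV)"
  have sets: "a \<in> sets (nu \<alpha> s p q)" "emeasure (nu \<alpha> s p q) a \<noteq> \<infinity>" if aC: "a \<in> ?C" for a
  proof -
    obtain \<tau> n where a: "\<tau> \<in> {1, -1}" "a = tail_set \<tau> (1 / real (Suc n))" using aC by auto
    show "a \<in> sets (nu \<alpha> s p q)"
      using tail_set_subset_E[OF a(1), of "1 / real (Suc n)"] tail_set_borel[OF a(1)] a(2)
      by (simp add: sets_borel_of_E_top sets_restrict_space_iff)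
    show "emeasure (nu \<alpha> s p q) a \<noteq> \<infinity>"
      using nu_tail[OF assms(1) _ assms(2,3) a(1), of "1 / real (Suc n)" s] a(2) by simp
  qed
  have "E_space \<subseteq> \<Union>?C"
  proof
    fix y assume y: "y \<in> E_space"
    then have "squash y \<noteq> 0" by (simp add: E_space_alt)
    then obtain n where n: "1 / real (Suc n) < \<bar>squash y\<bar>" using nat_approx_posE[of "\<bar>squash y\<bar>"] by auto
    then have less: "ereal (1 / real (Suc n)) < \<bar>y\<bar>"
      using abs_squash_le_abs[of y] by (meson ereal_less(2) ereal_less_eq(3) less_ereal.simps(1) order_less_le_trans)
    show "y \<in> \<Union>?C"
    proof (cases "y > 0")
      case True
      then have "y \<in> ?A (1, n)" using less by (simp add: tail_set_1 abs_ereal_ge0)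
      then show ?thesis by (intro UnionI[of "?A (1, n)"]) auto
    next
      case False
      then have "y \<in> ?A (- 1, n)" using less y by (cases y) (auto simp: tail_set_m1 E_space_alt)
      then show ?thesis by (intro UnionI[of "?A (- 1, n)"]) auto
    qed
  qed
  moreover have "a \<subseteq> E_space" if "a \<in> ?C" for a
    using sets.sets_into_space[OF sets(1)[OF that]] by simp
  ultimately have "\<Union>?C = E_space" by blast
  then show "\<exists>A. countable A \<and> A \<subseteq> sets (nu \<alpha> s p q) \<and> \<Union>A = space (nu \<alpha> s p q) \<and>
      (\<forall>a\<in>A. emeasure (nu \<alpha> s p q) a \<noteq> \<infinity>)"
    using sets by (intro exI[of _ ?C] conjI) (auto intro!: countable_SIGMA)
qed

lemma intensity_rectangle:
  assumes "\<alpha> > 0" "x > 0" "p \<ge> 0" "q \<ge> 0" and \<tau>: "\<tau> \<in> {1, -1}" and t: "t \<in> {0..1}"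
  shows "emeasure (intensity \<alpha> s p q) ({0..t} \<times> tail_set \<tau> x)
    = ennreal (t * (s powr \<alpha> * tail_weight p q \<tau> * x powr - \<alpha>))"
proof -
  interpret sigma_finite_measure "nu \<alpha> s p q" by (rule sigma_finite_nu) fact+
  have "{0..t} \<in> sets (restrict_space lborel {0..1})" using t by (subst sets_restrict_space_iff) auto
  moreover have "tail_set \<tau> x \<in> sets (nu \<alpha> s p q)"
    using tail_set_subset_E[OF \<tau>, of x] tail_set_borel[OF \<tau>] assms
    by (simp add: sets_borel_of_E_top sets_restrict_space_iff)
  ultimately have "emeasure (intensity \<alpha> s p q) ({0..t} \<times> tail_set \<tau> x)
      = emeasure (restrict_space lborel {0..1}) {0..t} * emeasure (nu \<alpha> s p q) (tail_set \<tau> x)"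
    unfolding intensity_def by (rule emeasure_pair_measure_Times)
  also have "emeasure (restrict_space lborel {0..1}) {0..t} = ennreal t"
    using t by (subst emeasure_restrict_space) auto
  finally show ?thesis using t assms by (simp add: nu_tail ennreal_mult tail_weight_def)
qed

text \<open>The half-lines are strict and the slab is not: the radius u / 2 makes room for the
  boundary.\<close>

lemma slab_subset_tails:
  "u > 0 \<Longrightarrow> slab u \<subseteq> {0..1} \<times> tail_set 1 (u/2) \<union> {0..1} \<times> tail_set (- 1) (u/2)"
proof
  fix z assume u: "u > 0" and z: "z \<in> slab u"
  obtain t y where ty: "z = (t, y)" by (cases z)
  show "z \<in> {0..1} \<times> tail_set 1 (u/2) \<union> {0..1} \<times> tail_set (- 1) (u/2)"
    using u z unfolding ty slab_def
    by (cases y) (auto simp: tail_set_1 tail_set_m1 abs_if split: if_splits)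
qed

lemma intensity_slab_finite:
  assumes "\<alpha> > 0" "p \<ge> 0" "q \<ge> 0" "u > 0"
  shows "emeasure (intensity \<alpha> s p q) (slab u) < \<infinity>"
proof -
  have S: "{0..1} \<times> tail_set \<tau> (u/2) \<in> sets (intensity \<alpha> s p q)" if "\<tau> \<in> {1, -1}" for \<tau>
  proof -
    have "{0..1::real} \<times> tail_set \<tau> (u/2) \<subseteq> S_space"
      using tail_set_subset_E[OF that, of "u/2"] assms by (auto simp: S_space_def)
    moreover note rectangle_borel[OF that, of 1 "u/2"]
    ultimately show ?thesis by (simp add: sets_borel_of_S_top sets_restrict_space_iff)
  qed
  have "emeasure (intensity \<alpha> s p q) (slab u)
      \<le> emeasure (intensity \<alpha> s p q) ({0..1} \<times> tail_set 1 (u/2) \<union> {0..1} \<times> tail_set (- 1) (u/2))"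
    using slab_subset_tails[OF assms(4)] S by (intro emeasure_mono) auto
  also have "\<dots> \<le> emeasure (intensity \<alpha> s p q) ({0..1} \<times> tail_set 1 (u/2))
      + emeasure (intensity \<alpha> s p q) ({0..1} \<times> tail_set (- 1) (u/2))"
    using S by (intro emeasure_subadditive) auto
  also have "\<dots> < \<infinity>"
    using assms by (subst (1 2) intensity_rectangle) auto
  finally show ?thesis .
qed

lemma CK_plus_integrable:
  assumes f: "f \<in> CK_plus" and N: "sets N = sets (borel_of S_top)" "\<And>u. u > 0 \<Longrightarrow> emeasure N (slab u) < \<infinity>"
  shows "integrable N f"
proof -
  obtain u where u: "u > 0" "\<And>t y. \<bar>y\<bar> < ereal u \<Longrightarrow> f (t, y) = 0"
    using CK_plus_supportE[OF f] by blast
  obtain B where B: "\<And>z. f z \<le> B" using CK_plus_bounded[OF f] by blast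
  show ?thesis
  proof (rule integrableI_bounded_set[where A = "slab u" and B = B])
    show "slab u \<in> sets N" using slab_sets[OF u(1)] N(1) by simp
    show "f \<in> borel_measurable N" using CK_plus_measurable[OF f] N(1) by (simp cong: measurable_cong_sets)
    show "AE z in N. z \<in> slab u \<longrightarrow> norm (f z) \<le> B" using B CK_plusD(1)[OF f] by (intro AE_I2) simp
    show "AE z in N. z \<notin> slab u \<longrightarrow> f z = 0" using not_slab_vanish[OF f, of u] u(2) by (intro AE_I2) blast
  qed (use N(2)[OF u(1)] in simp)
qed

section \<open>The Laplace functional of a Poisson process\<close>

text \<open>One decomposition for all measures and all \<psi> with \<psi> 0 = 0: it is applied to
  realisations of the process with the identity and to the intensity with 1 - exp (- x), with the
  same sets and values. The value 0 is left out so that all level sets stay in the slab.\<close>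

lemma simple_function_decomposition:
  fixes f :: "real \<times> ereal \<Rightarrow> real"
  assumes f: "simple_function (borel_of S_top) f" "\<And>z. 0 \<le> f z" "\<And>z. z \<notin> slab u \<Longrightarrow> f z = 0"
    and u: "u > 0"
  obtains m :: nat and A e where "\<And>l. l < m \<Longrightarrow> A l \<in> sets (borel_of S_top)" "\<And>l. l < m \<Longrightarrow> A l \<subseteq> slab u"
    "\<And>l. l < m \<Longrightarrow> 0 \<le> (e l :: real)" "disjoint_family_on A {..<m}"
    "\<And>N (\<psi> :: real \<Rightarrow> real). sets N = sets (borel_of S_top) \<Longrightarrow> emeasure N (slab u) < \<infinity> \<Longrightarrow> \<psi> 0 = 0
      \<Longrightarrow> (\<integral>z. \<psi> (f z) \<partial>N) = (\<Sum>l<m. \<psi> (e l) * measure N (A l))"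
proof -
  define V where "V = f ` S_space - {0}"
  have "finite V" using simple_functionD(1)[OF f(1)] by (simp add: V_def)
  from ex_bij_betw_nat_finite[OF this] obtain e where e: "bij_betw e {0..<card V} V" by blast
  define m where "m = card V"
  have e: "bij_betw e {..<m} V" using e by (simp add: m_def atLeast0LessThan)
  define A where "A l = f -` {e l} \<inter> S_space" for l
  have eV: "e l \<in> V" if "l < m" for l using e that by (auto simp: bij_betw_def)
  have inj: "e l = e k \<Longrightarrow> l = k" if "l < m" "k < m" for l k
    using e that by (auto simp: bij_betw_def inj_on_def)
  have A: "A l \<in> sets (borel_of S_top)" for l
    using simple_functionD(2)[OF f(1), of "{e l}"] by (simp add: A_def)
  have sub: "A l \<subseteq> slab u" if "l < m" for l
  proof (rule subsetI, rule ccontr)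
    fix z assume "z \<in> A l" "z \<notin> slab u"
    then have "e l = 0" using f(3)[of z] by (simp add: A_def)
    then show False using eV[OF that] by (simp add: V_def)
  qed
  have rep: "\<psi> (f z) = (\<Sum>l<m. \<psi> (e l) * indicator (A l) z)" if z: "z \<in> S_space" and \<psi>: "\<psi> 0 = 0" for z and \<psi> :: "real \<Rightarrow> real"
  proof (cases "f z = 0")
    case True
    have "indicator (A l) z = (0::real)" if "l < m" for l
      using eV[OF that] True by (auto simp: A_def V_def split: split_indicator)
    then show ?thesis using True \<psi> by simp
  next
    case False
    then have "f z \<in> V" using z by (simp add: V_def)
    then obtain k where k: "k < m" "e k = f z" using e by (auto simp: bij_betw_def)
    have "(\<Sum>l<m. \<psi> (e l) * indicator (A l) z) = (\<Sum>l<m. if l = k then \<psi> (e l) else 0)"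
      using k z inj by (intro sum.cong refl) (auto simp: A_def split: split_indicator)
    then show ?thesis using k by simp
  qed
  show ?thesis
  proof (rule that)
    show "disjoint_family_on A {..<m}"
      using inj by (auto simp: disjoint_family_on_def A_def)
    show "0 \<le> e l" if "l < m" for l using eV[OF that] f(2) by (auto simp: V_def)
    fix N :: "(real \<times> ereal) measure" and \<psi> :: "real \<Rightarrow> real"
    assume N: "sets N = sets (borel_of S_top)" "emeasure N (slab u) < \<infinity>" and \<psi>: "\<psi> 0 = 0"
    have sp: "space N = S_space" using sets_eq_imp_space_eq[OF N(1)] by simp
    have fin: "emeasure N (A l) < \<infinity>" if "l < m" for l
      using emeasure_mono[OF sub[OF that], of N] slab_sets[OF u] N by (auto intro: order_le_less_trans)
    have "(\<integral>z. \<psi> (f z) \<partial>N) = (\<integral>z. (\<Sum>l<m. \<psi> (e l) * indicator (A l) z) \<partial>N)"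
      by (intro Bochner_Integration.integral_cong refl rep \<psi>) (simp add: sp)
    also have "\<dots> = (\<Sum>l<m. \<integral>z. \<psi> (e l) * indicator (A l) z \<partial>N)"
      using A N fin by (intro Bochner_Integration.integral_sum integrable_mult_right integrable_real_indicator) auto
    also have "\<dots> = (\<Sum>l<m. \<psi> (e l) * measure N (A l))"
    proof (intro sum.cong refl)
      fix l
      have "A l \<inter> space N = A l" by (auto simp: A_def sp)
      then show "(\<integral>z. \<psi> (e l) * indicator (A l) z \<partial>N) = \<psi> (e l) * measure N (A l)" by simp
    qed
    finally show "(\<integral>z. \<psi> (f z) \<partial>N) = (\<Sum>l<m. \<psi> (e l) * measure N (A l))" .
  qed (use A sub in auto)
qed

lemma Mp_slab_finite:
  assumes "\<mu> \<in> Mp" "u > 0"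
  shows "emeasure \<mu> (slab u) < \<infinity>"
proof -
  have "compactin S_top (S_top closure_of (slab u))"
    using compactin_closure_S_top[OF slab_subset[OF assms(2)]] assms(2) by blast
  then show ?thesis using assms slab_sets[OF assms(2)] by (simp add: Mp_def)
qed

lemma Mp_sets: "\<mu> \<in> Mp \<Longrightarrow> sets \<mu> = sets (borel_of S_top)"
  by (auto simp: Mp_def)

context
  fixes M :: "'a measure" and \<Lambda> :: "(real \<times> ereal) measure" and \<Xi> :: "'a \<Rightarrow> (real \<times> ereal) measure"
  assumes M: "prob_space M" and pp: "poisson_process M \<Lambda> \<Xi>"
    and sets_\<Lambda>: "sets \<Lambda> = sets (borel_of S_top)"
    and slab_\<Lambda>: "\<And>u. u > 0 \<Longrightarrow> emeasure \<Lambda> (slab u) < \<infinity>"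
begin

interpretation prob_space M by (rule M)

lemma poisson_emeasure_measurable:
  "A \<in> sets (borel_of S_top) \<Longrightarrow> (\<lambda>\<omega>. emeasure (\<Xi> \<omega>) A) \<in> borel_measurable M"
  using pp by (simp add: poisson_process_def)

lemma poisson_point_prob:
  assumes "A \<in> sets (borel_of S_top)" "emeasure \<Lambda> A < \<infinity>"
  shows "prob {\<omega> \<in> space M. emeasure (\<Xi> \<omega>) A = of_nat k} = exp (- measure \<Lambda> A) * measure \<Lambda> A ^ k / fact k"
  using pp assms unfolding poisson_process_def by (metis (no_types, lifting))

text \<open>The generating function of the Poisson distribution: weighting the point probabilities
  by exp (- v k) gives an exponential series with parameter \<open>lam * exp (- v)\<close>.\<close>

lemma poisson_Laplace_single:
  assumes A: "A \<in> sets (borel_of S_top)" "emeasure \<Lambda> A < \<infinity>" and v: "v \<ge> 0"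
  shows "(\<integral>\<omega>. exp (- (v * measure (\<Xi> \<omega>) A)) \<partial>M) = exp (- ((1 - exp (- v)) * measure \<Lambda> A))"
proof -
  note [measurable] = poisson_emeasure_measurable[OF A(1)]
  define lam where "lam = measure \<Lambda> A"
  define B where "B k = {\<omega> \<in> space M. emeasure (\<Xi> \<omega>) A = of_nat k}" for k
  have B: "B k \<in> events" for k unfolding B_def by measurable
  have PB: "prob (B k) = exp (- lam) * lam ^ k / fact k" for k
    unfolding B_def lam_def by (rule poisson_point_prob[OF A])
  have disj: "disjoint_family B" by (auto simp: disjoint_family_on_def B_def)
  have ex: "(\<lambda>k. exp (- lam) * x ^ k / fact k) sums (exp (- lam) * exp x)" for x :: real
    using sums_mult[OF exp_converges[of x], of "exp (- lam)"] by (simp add: field_simps)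
  have "(\<lambda>k. prob (B k)) sums prob (\<Union>k. B k)"
    using B disj by (intro finite_measure_UNION) auto
  \<comment> \<open>The point probabilities add up to 1, so an infinite or non-integer mass has
    probability zero.\<close>
  then have "prob (\<Union>k. B k) = 1"
    using sums_unique2[OF _ ex[of lam]] unfolding PB by (simp add: exp_minus)
  then have AEB: "AE \<omega> in M. \<omega> \<in> (\<Union>k. B k)" using B by (subst (asm) prob_eq_1) auto
  define f where "f k \<omega> = exp (- (v * real k)) * indicator (B k) \<omega>" for k \<omega>
  have fB: "f j \<omega> = (if j = k then exp (- (v * real k)) else 0)" if "\<omega> \<in> B k" for j k \<omega>
    using that disj by (auto simp: f_def disjoint_family_on_def split: split_indicator)
  have f_sums: "(\<lambda>j. f j \<omega>) sums exp (- (v * real k))" if "\<omega> \<in> B k" for k \<omega>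
    unfolding fB[OF that] by (rule sums_single)
  have int: "integrable M (f k)" for k
    unfolding f_def using B by (intro integrable_mult_right integrable_real_indicator) (auto simp: emeasure_eq_measure)
  have If: "(\<integral>\<omega>. f k \<omega> \<partial>M) = exp (- lam) * (lam * exp (- v)) ^ k / fact k" for k
  proof -
    have "exp (- (v * real k)) = exp (- v) ^ k" by (simp add: exp_of_nat_mult[symmetric] mult.commute)
    then show ?thesis using B[of k] PB[of k] unfolding f_def by (simp add: sets.Int_space_eq2 power_mult_distrib)
  qed
  have "(\<lambda>k. \<integral>\<omega>. f k \<omega> \<partial>M) sums (\<integral>\<omega>. (\<Sum>k. f k \<omega>) \<partial>M)"
  proof (rule sums_integral[OF int])
    show "AE \<omega> in M. summable (\<lambda>i. norm (f i \<omega>))"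
      using AEB
    proof eventually_elim
      case (elim \<omega>)
      then obtain k where "\<omega> \<in> B k" by auto
      from sums_summable[OF f_sums[OF this]] show ?case by (simp add: f_def)
    qed
    show "summable (\<lambda>i. \<integral>\<omega>. norm (f i \<omega>) \<partial>M)"
      using sums_summable[OF ex[of "lam * exp (- v)"]] If by (simp add: f_def)
  qed
  then have "(\<integral>\<omega>. (\<Sum>k. f k \<omega>) \<partial>M) = exp (- lam) * exp (lam * exp (- v))"
    using sums_unique2[OF _ ex[of "lam * exp (- v)"]] unfolding If by simp
  also have "\<dots> = exp (- ((1 - exp (- v)) * lam))"
    by (simp add: exp_add[symmetric] algebra_simps)
  also have "(\<integral>\<omega>. (\<Sum>k. f k \<omega>) \<partial>M) = (\<integral>\<omega>. exp (- (v * measure (\<Xi> \<omega>) A)) \<partial>M)"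
  proof (rule integral_cong_AE)
    show "(\<lambda>\<omega>. \<Sum>k. f k \<omega>) \<in> borel_measurable M"
      using borel_measurable_integrable[OF int] by (intro borel_measurable_suminf)
    show "(\<lambda>\<omega>. exp (- (v * measure (\<Xi> \<omega>) A))) \<in> borel_measurable M" unfolding measure_def by measurable
    show "AE \<omega> in M. (\<Sum>k. f k \<omega>) = exp (- (v * measure (\<Xi> \<omega>) A))"
      using AEB
    proof eventually_elim
      case (elim \<omega>)
      then obtain k where k: "\<omega> \<in> B k" by auto
      then have "measure (\<Xi> \<omega>) A = real k" by (simp add: B_def measure_def)
      then show ?case using sums_unique[OF f_sums[OF k]] by simp
    qed
  qed
  finally show ?thesis by (simp add: lam_def)
qed

lemma poisson_Laplace_simple:
  fixes A :: "nat \<Rightarrow> (real \<times> ereal) set" and v :: "nat \<Rightarrow> real" and m :: nat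
  assumes A: "\<And>i. i < m \<Longrightarrow> A i \<in> sets (borel_of S_top)" "\<And>i. i < m \<Longrightarrow> emeasure \<Lambda> (A i) < \<infinity>"
    and disj: "disjoint_family_on A {..<m}" and v: "\<And>i. i < m \<Longrightarrow> v i \<ge> 0"
  shows "(\<integral>\<omega>. exp (- (\<Sum>i<m. v i * measure (\<Xi> \<omega>) (A i))) \<partial>M)
    = exp (- (\<Sum>i<m. (1 - exp (- v i)) * measure \<Lambda> (A i)))"
proof -
  have "indep_vars (\<lambda>_. borel) (\<lambda>i \<omega>. emeasure (\<Xi> \<omega>) (A i)) {..<m}"
    using pp[unfolded poisson_process_def, THEN conjunct2, THEN conjunct2, THEN conjunct2, rule_format, of A m]
      A(1) disj by (simp add: image_subset_iff)
  then have ind: "indep_vars (\<lambda>_. borel) (\<lambda>i \<omega>. exp (- (v i * measure (\<Xi> \<omega>) (A i)))) {..<m}"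
    unfolding measure_def by (rule indep_vars_compose2) measurable
  have "(\<integral>\<omega>. exp (- (\<Sum>i<m. v i * measure (\<Xi> \<omega>) (A i))) \<partial>M)
      = (\<integral>\<omega>. (\<Prod>i<m. exp (- (v i * measure (\<Xi> \<omega>) (A i)))) \<partial>M)"
    by (simp add: exp_sum[symmetric] sum_negf)
  also have "\<dots> = (\<Prod>i<m. \<integral>\<omega>. exp (- (v i * measure (\<Xi> \<omega>) (A i))) \<partial>M)"
  proof (rule indep_vars_lebesgue_integral[OF _ ind])
    fix i assume i: "i \<in> {..<m}"
    then have "(\<lambda>\<omega>. exp (- (v i * measure (\<Xi> \<omega>) (A i)))) \<in> borel_measurable M"
      using poisson_emeasure_measurable[OF A(1)[of i]] unfolding measure_def by simp
    then show "integrable M (\<lambda>\<omega>. exp (- (v i * measure (\<Xi> \<omega>) (A i))))"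
      using v[of i] i by (intro integrable_const_bound[of _ 1]) (auto simp: measure_nonneg)
  qed simp
  also have "\<dots> = (\<Prod>i<m. exp (- ((1 - exp (- v i)) * measure \<Lambda> (A i))))"
    by (intro prod.cong refl poisson_Laplace_single A v) auto
  finally show ?thesis by (simp add: exp_sum[symmetric] sum_negf)
qed

text \<open>Simple functions increase to h, and dominated convergence with majorants h and 1 - exp
  (- h) carries both sides to the limit. A Poisson process has measurable counts and lies in
  \<open>Mp\<close> only almost surely, so the integrals enter through measurable versions
  \<open>W\<close> and \<open>V i\<close>.\<close>

lemma poisson_Laplace:
  assumes h: "h \<in> CK_plus" and W: "W \<in> borel_measurable M" "AE \<omega> in M. W \<omega> = (\<integral>z. h z \<partial>\<Xi> \<omega>)"
  shows "(\<integral>\<omega>. exp (- W \<omega>) \<partial>M) = exp (- (\<integral>z. 1 - exp (- h z) \<partial>\<Lambda>))"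
proof -
  obtain u where u: "u > 0" "\<And>t y. \<bar>y\<bar> < ereal u \<Longrightarrow> h (t, y) = 0"
    using CK_plus_supportE[OF h] by blast
  obtain f where f: "incseq f" "\<And>i. simple_function (borel_of S_top) (f i)"
    "\<And>x. bdd_above (range (\<lambda>i. f i x))" "\<And>i x. 0 \<le> f i x" "h = (SUP i. f i)"
    using borel_measurable_implies_simple_function_sequence_real[OF CK_plus_measurable[OF h] CK_plusD(1)[OF h]] by auto
  have hx: "h x = (SUP i. f i x)" for x by (simp add: f(5) image_image)
  have lim: "(\<lambda>i. f i x) \<longlonglongrightarrow> h x" for x
    unfolding hx by (intro LIMSEQ_incseq_SUP f(3) incseq_SucI le_funD[OF incseqD[OF f(1)]]) simp
  have le: "f i x \<le> h x" for i x
    unfolding hx by (rule cSUP_upper[OF _ f(3)]) simp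
  have van: "f i z = 0" if "z \<notin> slab u" for i z
    using le[of i z] f(4)[of i z] not_slab_vanish[OF h, of u z] u(2) that by simp
  have MpA: "AE \<omega> in M. \<Xi> \<omega> \<in> Mp" using pp by (simp add: poisson_process_def)
  have conv: "(\<lambda>i. \<integral>z. f i z \<partial>N) \<longlonglongrightarrow> (\<integral>z. h z \<partial>N)"
    "(\<lambda>i. \<integral>z. 1 - exp (- f i z) \<partial>N) \<longlonglongrightarrow> (\<integral>z. 1 - exp (- h z) \<partial>N)"
    if N: "sets N = sets (borel_of S_top)" "\<And>u. u > 0 \<Longrightarrow> emeasure N (slab u) < \<infinity>" for N
  proof -
    have mf: "f i \<in> borel_measurable N" for i
      using borel_measurable_simple_function[OF f(2)] N(1) by (simp cong: measurable_cong_sets)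
    have mh: "h \<in> borel_measurable N" using CK_plus_measurable[OF h] N(1) by (simp cong: measurable_cong_sets)
    show "(\<lambda>i. \<integral>z. f i z \<partial>N) \<longlonglongrightarrow> (\<integral>z. h z \<partial>N)"
      by (rule integral_dominated_convergence[where w = h])
         (use mf mh lim le f(4) CK_plus_integrable[OF h N] in auto)
    show "(\<lambda>i. \<integral>z. 1 - exp (- f i z) \<partial>N) \<longlonglongrightarrow> (\<integral>z. 1 - exp (- h z) \<partial>N)"
    proof (rule integral_dominated_convergence[where w = "\<lambda>z. 1 - exp (- h z)"])
      show "integrable N (\<lambda>z. 1 - exp (- h z))"
        by (rule CK_plus_integrable[OF CK_plus_one_minus_exp[OF h] N])
      show "AE z in N. (\<lambda>i. 1 - exp (- f i z)) \<longlonglongrightarrow> 1 - exp (- h z)"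
        using lim by (intro AE_I2 tendsto_intros)
      show "AE z in N. norm (1 - exp (- f i z)) \<le> 1 - exp (- h z)" for i
        using le f(4) by (intro AE_I2) simp
    qed (use mf mh in simp_all)
  qed
  define Q where "Q i V \<longleftrightarrow> V \<in> borel_measurable M \<and> (AE \<omega> in M. V \<omega> = (\<integral>z. f i z \<partial>\<Xi> \<omega>)) \<and>
      (\<integral>\<omega>. exp (- V \<omega>) \<partial>M) = exp (- (\<integral>z. 1 - exp (- f i z) \<partial>\<Lambda>))" for i V
  have "\<exists>V. Q i V" for i
  proof -
    obtain m :: nat and A e where A: "\<And>l. l < m \<Longrightarrow> A l \<in> sets (borel_of S_top)" "\<And>l. l < m \<Longrightarrow> A l \<subseteq> slab u"
      "\<And>l. l < m \<Longrightarrow> 0 \<le> (e l :: real)" "disjoint_family_on A {..<m}"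
      "\<And>N (\<psi> :: real \<Rightarrow> real). sets N = sets (borel_of S_top) \<Longrightarrow> emeasure N (slab u) < \<infinity> \<Longrightarrow> \<psi> 0 = 0
        \<Longrightarrow> (\<integral>z. \<psi> (f i z) \<partial>N) = (\<Sum>l<m. \<psi> (e l) * measure N (A l))"
      by (rule simple_function_decomposition[OF f(2)[of i] f(4) van u(1)]) (assumption, rule that)
    define V where "V \<omega> = (\<Sum>l<m. e l * measure (\<Xi> \<omega>) (A l))" for \<omega>
    have "V \<in> borel_measurable M"
      unfolding V_def measure_def
      by (intro borel_measurable_sum borel_measurable_times borel_measurable_const measurable_compose[OF poisson_emeasure_measurable[OF A(1)]]) auto
    moreover have "AE \<omega> in M. V \<omega> = (\<integral>z. f i z \<partial>\<Xi> \<omega>)"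
      using MpA
    proof eventually_elim
      case (elim \<omega>)
      show ?case unfolding V_def
        using A(5)[OF Mp_sets[OF elim] Mp_slab_finite[OF elim u(1)], of "\<lambda>x. x"] by simp
    qed
    moreover have "(\<integral>\<omega>. exp (- V \<omega>) \<partial>M) = exp (- (\<integral>z. 1 - exp (- f i z) \<partial>\<Lambda>))"
    proof -
      have fin: "emeasure \<Lambda> (A l) < \<infinity>" if "l < m" for l
        using emeasure_mono[OF A(2)[OF that], of \<Lambda>] slab_sets[OF u(1)] sets_\<Lambda> slab_\<Lambda>[OF u(1)]
        by (auto intro: order_le_less_trans)
      show ?thesis unfolding V_def
        using poisson_Laplace_simple[OF A(1) fin A(4) A(3)] A(5)[OF sets_\<Lambda> slab_\<Lambda>[OF u(1)], of "\<lambda>x. 1 - exp (- x)"]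
        by simp
    qed
    ultimately show ?thesis unfolding Q_def by blast
  qed
  then obtain V where V: "\<And>i. Q i (V i)" by metis
  have "(\<lambda>i. \<integral>\<omega>. exp (- V i \<omega>) \<partial>M) \<longlonglongrightarrow> (\<integral>\<omega>. exp (- W \<omega>) \<partial>M)"
  proof (rule integral_dominated_convergence[where w = "\<lambda>_. 1"])
    have "AE \<omega> in M. \<forall>i. V i \<omega> = (\<integral>z. f i z \<partial>\<Xi> \<omega>)"
      using V unfolding Q_def by (subst AE_all_countable) auto
    then show "AE \<omega> in M. (\<lambda>i. exp (- V i \<omega>)) \<longlonglongrightarrow> exp (- W \<omega>)"
      using W(2) MpA
    proof eventually_elim
      case (elim \<omega>)
      then show ?case using conv(1)[OF Mp_sets[OF elim(3)] Mp_slab_finite[OF elim(3)]]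
        by (auto intro!: tendsto_intros)
    qed
    show "AE \<omega> in M. norm (exp (- V i \<omega>)) \<le> 1" for i
    proof -
      have "AE \<omega> in M. V i \<omega> = (\<integral>z. f i z \<partial>\<Xi> \<omega>)" using V unfolding Q_def by blast
      then show ?thesis
      proof eventually_elim
        case (elim \<omega>)
        have "0 \<le> (\<integral>z. f i z \<partial>\<Xi> \<omega>)" using f(4) by simp
        then show ?case using elim by simp
      qed
    qed
    show "(\<lambda>\<omega>. exp (- V i \<omega>)) \<in> borel_measurable M" for i
    proof -
      have [measurable]: "V i \<in> borel_measurable M" using V[of i] unfolding Q_def by blast
      show ?thesis by measurable
    qed
  qed (use W in auto)
  moreover have "(\<lambda>i. \<integral>\<omega>. exp (- V i \<omega>) \<partial>M) \<longlonglongrightarrow> exp (- (\<integral>z. 1 - exp (- h z) \<partial>\<Lambda>))"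
    using V conv(2)[OF sets_\<Lambda> slab_\<Lambda>] unfolding Q_def by (auto intro!: tendsto_intros)
  ultimately show ?thesis by (rule LIMSEQ_unique)
qed

end

section \<open>From convergence on rectangles to convergence of integrals\<close>

lemma squash_sign_mult: "\<tau> \<in> {1, -1} \<Longrightarrow> squash (ereal \<tau> * y) = \<tau> * squash y"
  by (auto simp: one_ereal_def[symmetric] simp flip: uminus_ereal.simps)

text \<open>The threshold v / (1 - v) is v unsquashed; a uniform grid in the squashed coordinate
  thus consists of half-lines.\<close>

lemma tail_set_squash:
  assumes "\<tau> \<in> {1, -1}" "0 \<le> v" "v < 1"
  shows "{y. v < \<tau> * squash y} = tail_set \<tau> (v / (1 - v))"
proof -
  have "squash (ereal (v / (1 - v))) = v"
    using squash_unsquash[of v] assms by (simp add: unsquash_def)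
  then have "v < \<tau> * squash y \<longleftrightarrow> ereal (v / (1 - v)) < ereal \<tau> * y" for y
    using squash_less_iff[of "ereal (v / (1 - v))" "ereal \<tau> * y"] squash_sign_mult[OF assms(1), of y]
    by (simp del: squash_simps)
  then show ?thesis by (auto simp: tail_set_def)
qed

text \<open>Time and squashed size are cut by a grid of width 1 / K, separately for each sign. A
  grid cell is an alternating sum of four rectangles that start at time 0 and extend to an infinite
  point, so the masses of cells converge. The test function is nearly constant on cells, and the
  error is charged to a neighbourhood of its support whose mass stays bounded.\<close>

theorem rectangle_convergence:
  fixes \<mu> :: "nat \<Rightarrow> (real \<times> ereal) measure" and \<Lambda> :: "(real \<times> ereal) measure"
  assumes sets: "\<And>n. sets (\<mu> n) = sets borel" "sets \<Lambda> = sets borel"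
    and fin: "\<And>n t x \<tau>. t \<in> {0..1} \<Longrightarrow> x > 0 \<Longrightarrow> \<tau> \<in> {1, -1} \<Longrightarrow> emeasure (\<mu> n) ({0..t} \<times> tail_set \<tau> x) < \<infinity>"
      "\<And>t x \<tau>. t \<in> {0..1} \<Longrightarrow> x > 0 \<Longrightarrow> \<tau> \<in> {1, -1} \<Longrightarrow> emeasure \<Lambda> ({0..t} \<times> tail_set \<tau> x) < \<infinity>"
    and conv: "\<And>t x \<tau>. t \<in> {0..1} \<Longrightarrow> x > 0 \<Longrightarrow> \<tau> \<in> {1, -1} \<Longrightarrow>
      (\<lambda>n. measure (\<mu> n) ({0..t} \<times> tail_set \<tau> x)) \<longlonglongrightarrow> measure \<Lambda> ({0..t} \<times> tail_set \<tau> x)"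
    and h: "h \<in> CK_plus"
  shows "(\<lambda>n. \<integral>z. h z \<partial>\<mu> n) \<longlonglongrightarrow> (\<integral>z. h z \<partial>\<Lambda>)"
proof -
  obtain u where u: "u > 0" "\<And>t y. \<bar>y\<bar> < ereal u \<Longrightarrow> h (t, y) = 0"
    using CK_plus_supportE[OF h] by blast
  define \<kappa> where "\<kappa> = squash (ereal u)"
  have \<kappa>: "0 < \<kappa>" "\<kappa> < 1"
    using u(1) squash_strict_mono[of 0 "ereal u"] squash_strict_mono[of "ereal u" \<infinity>] by (auto simp: \<kappa>_def simp del: squash_simps(1))
  have h0: "h (t, y) = 0" if "\<bar>squash y\<bar> < \<kappa>" for t y
    using that u(2)[of y t] squash_less_iff[of "\<bar>y\<bar>" "ereal u"] by (simp add: \<kappa>_def abs_squash del: squash_simps)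
  \<comment> \<open>The mass of a neighbourhood of the support of h, which lies in |squash y| \<ge>
    \<kappa>; the whole approximation error is a multiple of it.\<close>
  define B where "B N = (\<Sum>\<tau>\<in>{1, -1}. measure N ({0..1} \<times> {y. \<kappa> / 2 < \<tau> * squash y}))" for N :: "(real \<times> ereal) measure"
  have half: "{y. \<kappa> / 2 < \<tau> * squash y} = tail_set \<tau> (\<kappa> / 2 / (1 - \<kappa> / 2))" "\<kappa> / 2 / (1 - \<kappa> / 2) > 0" if "\<tau> \<in> {1, -1}" for \<tau>
    using tail_set_squash[OF that, of "\<kappa> / 2"] \<kappa> by auto
  have Bconv: "(\<lambda>n. B (\<mu> n)) \<longlonglongrightarrow> B \<Lambda>"
    unfolding B_def
  proof (intro tendsto_sum)
    fix \<tau> :: real assume \<tau>: "\<tau> \<in> {1, -1}"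
    show "(\<lambda>n. measure (\<mu> n) ({0..1} \<times> {y. \<kappa> / 2 < \<tau> * squash y}))
        \<longlonglongrightarrow> measure \<Lambda> ({0..1} \<times> {y. \<kappa> / 2 < \<tau> * squash y})"
      unfolding half(1)[OF \<tau>] using conv[of 1] half(2)[OF \<tau>] \<tau> by simp
  qed
  have "\<exists>D :: (real \<times> ereal) measure \<Rightarrow> real. (\<lambda>n. D (\<mu> n)) \<longlonglongrightarrow> D \<Lambda> \<and>
      (\<forall>N \<in> range \<mu> \<union> {\<Lambda>}. \<bar>(\<integral>z. h z \<partial>N) - D N\<bar> \<le> \<epsilon> * B N)" if \<epsilon>: "\<epsilon> > 0" for \<epsilon>
  proof -
    obtain d where d: "d > 0" "\<And>t t' y y'. t \<in> {0..1} \<Longrightarrow> t' \<in> {0..1} \<Longrightarrow> \<bar>t - t'\<bar> < d \<Longrightarrow>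
        \<bar>squash y - squash y'\<bar> < d \<Longrightarrow> \<bar>h (t, y) - h (t', y')\<bar> < \<epsilon>"
      using CK_plus_uniformly_continuous[OF h \<epsilon>] by blast
    have "min d (\<kappa> / 2) > 0" using d \<kappa> by simp
    then obtain K' where K': "1 / real (Suc K') < min d (\<kappa> / 2)" by (rule nat_approx_posE)
    define K where "K = Suc K'"
    have K: "0 < K" "1 / real K < d" "1 / real K < \<kappa> / 2" using K' by (simp_all add: K_def)
    \<comment> \<open>For a = 0 the rectangle is empty, so that the first column of cells contains t
      = 0; for b \<ge> K it is empty because |squash y| \<le> 1.\<close>
    define Rs where "Rs a b \<tau> = (if a = 0 then {} else {0..real a / real K} \<times> {y. real b / real K < \<tau> * squash y})"
      for a b :: nat and \<tau> :: real
    have RsT: "Rs a b \<tau> = {} \<or> (\<exists>t x. t \<in> {0..1} \<and> x > 0 \<and> Rs a b \<tau> = {0..t} \<times> tail_set \<tau> x)"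
      if "\<tau> \<in> {1, -1}" "a \<le> K" "1 \<le> b" for a b \<tau>
    proof (cases "a = 0 \<or> K \<le> b")
      case True
      have "\<not> real b / real K < \<tau> * squash y" if "K \<le> b" for y
      proof -
        have "\<tau> * squash y \<le> 1" using \<open>\<tau> \<in> {1, -1}\<close> squash_range[of y] by auto
        also have "1 \<le> real b / real K" using that K(1) by simp
        finally show ?thesis by simp
      qed
      then show ?thesis using True by (auto simp: Rs_def)
    next
      case False
      let ?v = "real b / real K"
      have v: "0 < ?v" "?v < 1" using False K(1) that by auto
      have "Rs a b \<tau> = {0..real a / real K} \<times> tail_set \<tau> (?v / (1 - ?v))"
        using False tail_set_squash[OF that(1), of ?v] v by (simp add: Rs_def)
      moreover have "1 - ?v > 0" using v by linarith
      then have "?v / (1 - ?v) > 0" using v(1) divide_pos_pos by blast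
      moreover have "real a / real K \<in> {0..1}" using that(2) K(1) by auto
      ultimately show ?thesis by blast
    qed
    have Rs_sets: "Rs a b \<tau> \<in> sets borel" if "\<tau> \<in> {1, -1}" "a \<le> K" "1 \<le> b" for a b \<tau>
      using RsT[OF that] rectangle_borel[OF that(1)] by (elim disjE exE) auto
    have Rs_fin: "emeasure N (Rs a b \<tau>) < \<infinity>" if "N \<in> range \<mu> \<union> {\<Lambda>}" "\<tau> \<in> {1, -1}" "a \<le> K" "1 \<le> b" for N a b \<tau>
    proof (cases "Rs a b \<tau> = {}")
      case False
      then have "\<exists>t x. t \<in> {0..1} \<and> x > 0 \<and> Rs a b \<tau> = {0..t} \<times> tail_set \<tau> x" using RsT[OF that(2-4)] by simp
      then obtain t x where "t \<in> {0..1}" "x > 0" "Rs a b \<tau> = {0..t} \<times> tail_set \<tau> x" by (elim exE conjE)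
      then show ?thesis using fin that(1,2) by auto
    qed simp
    have Rs_conv: "(\<lambda>n. measure (\<mu> n) (Rs a b \<tau>)) \<longlonglongrightarrow> measure \<Lambda> (Rs a b \<tau>)" if "\<tau> \<in> {1, -1}" "a \<le> K" "1 \<le> b" for a b \<tau>
    proof (cases "Rs a b \<tau> = {}")
      case False
      then have "\<exists>t x. t \<in> {0..1} \<and> x > 0 \<and> Rs a b \<tau> = {0..t} \<times> tail_set \<tau> x" using RsT[OF that] by simp
      then obtain t x where "t \<in> {0..1}" "x > 0" "Rs a b \<tau> = {0..t} \<times> tail_set \<tau> x" by (elim exE conjE)
      then show ?thesis using conv[of t x \<tau>] that(1) by simp
    qed simp
    define F where "F a b \<tau> = h (real a / real K, unsquash (\<tau> * (real b / real K)))" for a b :: nat and \<tau> :: real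
    \<comment> \<open>Rows start at b = 2, so that the lower threshold (b - 1) / K is positive and
      all masses involved are finite.\<close>
    define I where "I = {1, -1::real} \<times> {1..K} \<times> {2..K}"
    have I: "\<tau> \<in> {1, -1}" "a \<le> K" "a - 1 \<le> K" "1 \<le> b" "1 \<le> b - 1" if "(\<tau>, a, b) \<in> I" for \<tau> a b
      using that by (auto simp: I_def)
    define D where "D N = (\<Sum>(\<tau>, a, b)\<in>I. F a b \<tau> * (measure N (Rs a (b - 1) \<tau>) - measure N (Rs (a - 1) (b - 1) \<tau>)
        - measure N (Rs a b \<tau>) + measure N (Rs (a - 1) b \<tau>)))" for N :: "(real \<times> ereal) measure"
    define \<phi> where "\<phi> z = (\<Sum>(\<tau>, a, b)\<in>I. F a b \<tau> * (indicator (Rs a (b - 1) \<tau>) z - indicator (Rs (a - 1) (b - 1) \<tau>) z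
        - indicator (Rs a b \<tau>) z + indicator (Rs (a - 1) b \<tau>) z))" for z
    have \<phi>0: "\<phi> z = 0" if nz: "\<And>a b \<tau>. \<tau> \<in> {1, -1} \<Longrightarrow> a \<le> K \<Longrightarrow> 1 \<le> b \<Longrightarrow> z \<notin> Rs a b \<tau>" for z
      unfolding \<phi>_def
    proof (intro sum.neutral ballI)
      fix i assume "i \<in> I"
      moreover obtain \<tau> a b where i: "i = (\<tau>, a, b)" by (cases i)
      ultimately have iI: "(\<tau>, a, b) \<in> I" by simp
      note ii = I[OF iI]
      show "(case i of (\<tau>, a, b) \<Rightarrow> F a b \<tau> * (indicator (Rs a (b - 1) \<tau>) z - indicator (Rs (a - 1) (b - 1) \<tau>) z
        - indicator (Rs a b \<tau>) z + indicator (Rs (a - 1) b \<tau>) z)) = 0"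
        unfolding i prod.case
        using nz[OF ii(1,2,5)] nz[OF ii(1,3,5)] nz[OF ii(1,2,4)] nz[OF ii(1,3,4)] by simp
    qed
    define \<beta> where "\<beta> z = (\<Sum>\<tau>\<in>{1, -1::real}. indicator ({0..1} \<times> {y. \<kappa> / 2 < \<tau> * squash y}) z :: real)" for z :: "real \<times> ereal"
    have pt: "\<bar>h z - \<phi> z\<bar> \<le> \<epsilon> * \<beta> z" for z
    proof -
      obtain t y where z: "z = (t, y)" by (cases z)
      define w where "w = \<bar>squash y\<bar>"
      have w: "0 \<le> w" "w \<le> 1" using abs_squash_le_1 by (auto simp: w_def)
      have \<beta>0: "\<beta> z \<ge> 0" by (simp add: \<beta>_def sum_nonneg)
      consider "t \<notin> {0..1}" | "w \<le> 1 / real K" | "t \<in> {0..1}" "1 / real K < w" by linarith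
      then show ?thesis
      proof cases
        case 1
        have "z \<notin> Rs a b \<tau>" if "a \<le> K" for a b \<tau>
        proof
          assume "z \<in> Rs a b \<tau>"
          then have "0 \<le> t" "t \<le> real a / real K" by (auto simp: Rs_def z split: if_splits)
          moreover have "real a / real K \<le> 1" using that K(1) by simp
          ultimately show False using 1 by simp
        qed
        then have "\<phi> z = 0" by (intro \<phi>0)
        moreover have "h z = 0" using 1 CK_plusD(2)[OF h, of z] by (auto simp: z S_space_alt)
        ultimately show ?thesis using \<beta>0 \<epsilon> by simp
      next
        case 2
        have "z \<notin> Rs a b \<tau>" if "\<tau> \<in> {1, -1}" "1 \<le> b" for a b \<tau>
        proof
          assume "z \<in> Rs a b \<tau>"
          then have "real b / real K < \<tau> * squash y" by (auto simp: Rs_def z split: if_splits)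
          also have "\<tau> * squash y \<le> w" using that(1) by (auto simp: w_def)
          also have "w \<le> real 1 / real K" using 2 by simp
          also have "\<dots> \<le> real b / real K" using that(2) by (intro divide_right_mono) auto
          finally show False by simp
        qed
        then have "\<phi> z = 0" by (intro \<phi>0)
        moreover have "h z = 0" unfolding z by (rule h0) (use 2 K \<kappa> in \<open>simp add: w_def\<close>)
        ultimately show ?thesis using \<beta>0 \<epsilon> by simp
      next
        case 3
        define \<tau>0 where "\<tau>0 = sgn (squash y)"
        have "squash y \<noteq> 0" using 3(2) K(1) by (auto simp: w_def)
        then have \<tau>0: "\<tau>0 \<in> {1, -1}" "\<tau>0 * squash y = w" "squash y = \<tau>0 * w"
          by (auto simp: \<tau>0_def w_def sgn_if)
        \<comment> \<open>The cell containing the point: columns are ((a - 1) / K, a / K], with 0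
          added to the first one, whence the maximum with 1.\<close>
        define a0 where "a0 = nat (max 1 \<lceil>t * real K\<rceil>)"
        define b0 where "b0 = nat \<lceil>w * real K\<rceil>"
        have a_le: "a0 \<le> a \<longleftrightarrow> 1 \<le> a \<and> t \<le> real a / real K" for a
        proof -
          have "a0 \<le> a \<longleftrightarrow> 1 \<le> a \<and> \<lceil>t * real K\<rceil> \<le> int a" unfolding a0_def by linarith
          also have "\<lceil>t * real K\<rceil> \<le> int a \<longleftrightarrow> t \<le> real a / real K"
            using K(1) by (simp add: ceiling_le_iff field_simps)
          finally show ?thesis .
        qed
        have b_less: "b < b0 \<longleftrightarrow> real b / real K < w" for b
        proof -
          have "b < b0 \<longleftrightarrow> int b < \<lceil>w * real K\<rceil>" unfolding b0_def by linarith
          also have "\<dots> \<longleftrightarrow> real b / real K < w"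
            using K(1) by (simp add: less_ceiling_iff field_simps)
          finally show ?thesis .
        qed
        have a0: "1 \<le> a0" "a0 \<le> K" using a_le[of a0] a_le[of K] 3(1) K(1) by auto
        have b0: "2 \<le> b0" "b0 \<le> K"
        proof -
          show "2 \<le> b0" using b_less[of 1] 3(2) by simp
          show "b0 \<le> K" using b_less[of K] w(2) K(1) by simp
        qed
        have ind: "indicator (Rs a b \<tau>) z = (if \<tau> = \<tau>0 \<and> a0 \<le> a \<and> b < b0 then 1 else (0::real))" if "\<tau> \<in> {1, -1}" for a b \<tau>
        proof -
          have "real b / real K < \<tau> * squash y \<longleftrightarrow> \<tau> = \<tau>0 \<and> b < b0"
          proof (cases "\<tau> = \<tau>0")
            case False
            then have "\<tau> * squash y = - w" using that \<tau>0 by auto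
            moreover have "0 \<le> real b / real K" by simp
            ultimately show ?thesis using False w(1) by linarith
          qed (simp add: \<tau>0(2) b_less)
          then show ?thesis using a_le[of a] 3(1) by (auto simp: Rs_def z split: split_indicator)
        qed
        have "\<phi> z = (\<Sum>i\<in>I. if i = (\<tau>0, a0, b0) then F a0 b0 \<tau>0 else 0)"
          unfolding \<phi>_def
        proof (intro sum.cong refl)
          fix i assume "i \<in> I"
          moreover obtain \<tau> a b where i: "i = (\<tau>, a, b)" by (cases i)
          ultimately have iI: "(\<tau>, a, b) \<in> I" by simp
          have "1 \<le> a" "2 \<le> b" using iI by (auto simp: I_def)
          then have "a0 \<le> a - 1 \<longleftrightarrow> a0 < a" "b - 1 < b0 \<longleftrightarrow> b \<le> b0" by auto
          then show "(case i of (\<tau>, a, b) \<Rightarrow> F a b \<tau> * (indicator (Rs a (b - 1) \<tau>) z - indicator (Rs (a - 1) (b - 1) \<tau>) z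
        - indicator (Rs a b \<tau>) z + indicator (Rs (a - 1) b \<tau>) z)) = (if i = (\<tau>0, a0, b0) then F a0 b0 \<tau>0 else 0)"
            unfolding i by (simp add: ind[OF I(1)[OF iI]])
        qed
        also have "\<dots> = F a0 b0 \<tau>0"
        proof -
          have "(\<tau>0, a0, b0) \<in> I" using a0 b0 \<tau>0(1) by (simp add: I_def)
          moreover have "finite I" by (simp add: I_def)
          ultimately show ?thesis by simp
        qed
        finally have \<phi>z: "\<phi> z = F a0 b0 \<tau>0" .
        have "a0 - 1 < a0" using a0 by simp
        then have "\<not> a0 \<le> a0 - 1" by simp
        then have "a0 = 1 \<or> real (a0 - 1) / real K < t" using a_le[of "a0 - 1"] by auto
        then have ta: "\<bar>t - real a0 / real K\<bar> \<le> 1 / real K"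
        proof
          assume "a0 = 1"
          then show ?thesis using a_le[of a0] 3(1) by auto
        next
          assume "real (a0 - 1) / real K < t"
          then have "real a0 / real K - 1 / real K < t" using a0(1) by (simp add: of_nat_diff diff_divide_distrib)
          then show ?thesis using a_le[of a0] by auto
        qed
        have "real (b0 - 1) / real K < w" using b_less[of "b0 - 1"] b0 by simp
        then have wb: "real b0 / real K - 1 / real K < w" "w \<le> real b0 / real K"
          using b_less[of b0] b0(1) by (simp_all add: of_nat_diff diff_divide_distrib)
        have "\<bar>\<tau>0 * (real b0 / real K)\<bar> \<le> 1" using \<tau>0(1) b0(2) K(1) by auto
        then have sq: "squash (unsquash (\<tau>0 * (real b0 / real K))) = \<tau>0 * (real b0 / real K)" by (rule squash_unsquash)
        show ?thesis
        \<comment> \<open>Beyond \<kappa> / 2 uniform continuity bounds the error by \<epsilon>;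
          otherwise the outer corner of the cell has squashed size below w + 1 / K < \<kappa>, so h
          vanishes both at the point and at the corner.\<close>
        proof (cases "\<kappa> / 2 < w")
          case True
          have "\<bar>squash y - \<tau>0 * (real b0 / real K)\<bar> \<le> 1 / real K"
            using wb \<tau>0 by auto
          then have "\<bar>h z - \<phi> z\<bar> < \<epsilon>"
            unfolding \<phi>z F_def unfolding z using ta K 3(1) a0(2) by (intro d(2)) (auto simp: sq simp del: times_divide_eq_right)
          moreover have "\<beta> z = 1"
          proof -
            have "- \<tau>0 \<noteq> \<tau>0" "{1, -1} = {\<tau>0, - \<tau>0}" using \<tau>0(1) by auto
            moreover have "\<not> \<kappa> / 2 < - \<tau>0 * squash y" using \<tau>0(2) w(1) \<kappa> by simp
            ultimately show ?thesis using True 3(1) \<tau>0(2) by (simp add: \<beta>_def z)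
          qed
          ultimately show ?thesis by simp
        next
          case False
          have "h z = 0" unfolding z using False \<kappa> by (intro h0) (simp add: w_def)
          moreover have "F a0 b0 \<tau>0 = 0"
            unfolding F_def
          proof (rule h0)
            have "\<bar>\<tau>0 * (real b0 / real K)\<bar> = real b0 / real K" using \<tau>0(1) by auto
            then show "\<bar>squash (unsquash (\<tau>0 * (real b0 / real K)))\<bar> < \<kappa>" unfolding sq using wb False K by linarith
          qed
          ultimately show ?thesis using \<phi>z \<beta>0 \<epsilon> by simp
        qed
      qed
    qed
    have "(\<lambda>n. D (\<mu> n)) \<longlonglongrightarrow> D \<Lambda>"
      unfolding D_def
      by (intro tendsto_sum) (auto intro!: tendsto_intros Rs_conv dest: I)
    moreover have "\<bar>(\<integral>z. h z \<partial>N) - D N\<bar> \<le> \<epsilon> * B N" if N: "N \<in> range \<mu> \<union> {\<Lambda>}" for N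
    proof -
      have sN: "sets N = sets borel" "space N = UNIV" using N sets sets_eq_imp_space_eq[of N borel] by auto
      have ind: "integrable N (indicator (Rs a b \<tau>) :: _ \<Rightarrow> real)" "(\<integral>z. indicator (Rs a b \<tau>) z \<partial>N) = measure N (Rs a b \<tau>)"
        if "\<tau> \<in> {1, -1}" "a \<le> K" "1 \<le> b" for a b \<tau>
        using Rs_fin[OF N that] Rs_sets[OF that] sN by (auto intro!: integrable_real_indicator)
      define g where "g i z = (case i of (\<tau>, a, b) \<Rightarrow> F a b \<tau> * (indicator (Rs a (b - 1) \<tau>) z - indicator (Rs (a - 1) (b - 1) \<tau>) z
          - indicator (Rs a b \<tau>) z + indicator (Rs (a - 1) b \<tau>) z))" for i z
      have int\<phi>: "integrable N (g i)"
        and I\<phi>: "(\<integral>z. g i z \<partial>N) = (case i of (\<tau>, a, b) \<Rightarrow> F a b \<tau> * (measure N (Rs a (b - 1) \<tau>) - measure N (Rs (a - 1) (b - 1) \<tau>)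
          - measure N (Rs a b \<tau>) + measure N (Rs (a - 1) b \<tau>)))" if iI: "i \<in> I" for i
      proof -
        obtain \<tau> a b where i: "i = (\<tau>, a, b)" by (cases i)
        note ii = I[OF iI[unfolded i]]
        note i1 = ind[OF ii(1,2,5)] and i2 = ind[OF ii(1,3,5)] and i3 = ind[OF ii(1,2,4)] and i4 = ind[OF ii(1,3,4)]
        show "integrable N (g i)" unfolding g_def i prod.case
          by (intro integrable_mult_right Bochner_Integration.integrable_add Bochner_Integration.integrable_diff i1(1) i2(1) i3(1) i4(1))
        show "(\<integral>z. g i z \<partial>N) = (case i of (\<tau>, a, b) \<Rightarrow> F a b \<tau> * (measure N (Rs a (b - 1) \<tau>) - measure N (Rs (a - 1) (b - 1) \<tau>)
          - measure N (Rs a b \<tau>) + measure N (Rs (a - 1) b \<tau>)))"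
          unfolding g_def i prod.case integral_mult_right_zero
          using i1 i2 i3 i4 by (simp del: integral_indicator)
      qed
      have \<phi>g: "\<phi> = (\<lambda>z. \<Sum>i\<in>I. g i z)" by (simp add: \<phi>_def g_def fun_eq_iff)
      have i\<phi>: "integrable N \<phi>" unfolding \<phi>g using int\<phi> by (intro Bochner_Integration.integrable_sum)
      have D: "(\<integral>z. \<phi> z \<partial>N) = D N"
        unfolding \<phi>g D_def using int\<phi> by (subst Bochner_Integration.integral_sum) (auto intro!: sum.cong simp: I\<phi>)
      have Ts: "{0..1::real} \<times> tail_set \<tau> x \<in> sets N" if "\<tau> \<in> {1, -1}" for \<tau> x
        using rectangle_borel[OF that] by (simp only: sN)
      have Tf: "emeasure N ({0..1} \<times> tail_set \<tau> x) < \<infinity>" if "\<tau> \<in> {1, -1}" "x > 0" for \<tau> x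
        using fin that N by auto
      have i\<beta>1: "integrable N (indicator ({0..1} \<times> {y. \<kappa> / 2 < \<tau> * squash y}) :: _ \<Rightarrow> real)"
        "(\<integral>z. indicator ({0..1} \<times> {y. \<kappa> / 2 < \<tau> * squash y}) z \<partial>N) = measure N ({0..1} \<times> {y. \<kappa> / 2 < \<tau> * squash y})"
        if "\<tau> \<in> {1, -1}" for \<tau>
        using Ts[OF that] Tf[OF that half(2)[OF that]] half(1)[OF that] sN by (auto intro!: integrable_real_indicator)
      have i\<beta>: "integrable N \<beta>" unfolding \<beta>_def using i\<beta>1(1) by (intro Bochner_Integration.integrable_sum)
      have B\<beta>: "(\<integral>z. \<beta> z \<partial>N) = B N"
        unfolding \<beta>_def B_def using i\<beta>1 by (subst Bochner_Integration.integral_sum) (auto simp del: integral_indicator)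
      have ih: "integrable N h"
      proof (rule Bochner_Integration.integrable_bound)
        show "integrable N (\<lambda>z. \<bar>\<phi> z\<bar> + \<epsilon> * \<beta> z)" using i\<phi> i\<beta> by (intro Bochner_Integration.integrable_add integrable_abs integrable_mult_right)
        show "h \<in> borel_measurable N" using CK_plus_borel[OF h] sN by (simp cong: measurable_cong_sets)
        show "AE z in N. norm (h z) \<le> norm (\<bar>\<phi> z\<bar> + \<epsilon> * \<beta> z)"
        proof (intro AE_I2)
          fix z show "norm (h z) \<le> norm (\<bar>\<phi> z\<bar> + \<epsilon> * \<beta> z)" using pt[of z] by (simp add: abs_le_iff) linarith
        qed
      qed
      have "\<bar>(\<integral>z. h z \<partial>N) - D N\<bar> = \<bar>\<integral>z. h z - \<phi> z \<partial>N\<bar>"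
        using ih i\<phi> D by simp
      also have "\<dots> \<le> (\<integral>z. \<bar>h z - \<phi> z\<bar> \<partial>N)" by (rule integral_abs_bound)
      also have "\<dots> \<le> (\<integral>z. \<epsilon> * \<beta> z \<partial>N)"
        using ih i\<phi> i\<beta> pt by (intro integral_mono integrable_abs Bochner_Integration.integrable_diff integrable_mult_right)
      also have "\<dots> = \<epsilon> * B N" using B\<beta> by simp
      finally show ?thesis .
    qed
    ultimately show ?thesis by blast
  qed
  note key = this
  have Bn: "0 \<le> B N" for N by (simp add: B_def sum_nonneg)
  show ?thesis
  proof (rule LIMSEQ_I)
    fix r :: real assume r: "r > 0"
    \<comment> \<open>Three errors of at most r / 4 each; the mass \<open>B (\<mu> n)\<close> is
      eventually below \<open>B \<Lambda> + 1\<close>.\<close>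
    define \<epsilon> where "\<epsilon> = r / (4 * (B \<Lambda> + 1))"
    have \<epsilon>: "\<epsilon> > 0" "\<epsilon> * (B \<Lambda> + 1) = r / 4" using r Bn[of \<Lambda>] by (auto simp: \<epsilon>_def field_simps)
    obtain D where D: "(\<lambda>n. D (\<mu> n)) \<longlonglongrightarrow> D \<Lambda>" "\<And>N. N \<in> range \<mu> \<union> {\<Lambda>} \<Longrightarrow> \<bar>(\<integral>z. h z \<partial>N) - D N\<bar> \<le> \<epsilon> * B N"
      using key[OF \<epsilon>(1)] by blast
    have "\<forall>\<^sub>F n in sequentially. B (\<mu> n) < B \<Lambda> + 1" using order_tendstoD(2)[OF Bconv] by simp
    moreover have "\<forall>\<^sub>F n in sequentially. \<bar>D (\<mu> n) - D \<Lambda>\<bar> < r / 4"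
      using tendstoD[OF D(1), of "r / 4"] r by (simp add: dist_real_def)
    ultimately have "\<forall>\<^sub>F n in sequentially. norm ((\<integral>z. h z \<partial>\<mu> n) - (\<integral>z. h z \<partial>\<Lambda>)) < r"
    proof eventually_elim
      case (elim n)
      have "\<bar>(\<integral>z. h z \<partial>\<mu> n) - D (\<mu> n)\<bar> \<le> \<epsilon> * (B \<Lambda> + 1)"
      proof -
        have "\<epsilon> * B (\<mu> n) \<le> \<epsilon> * (B \<Lambda> + 1)" using elim(1) \<epsilon>(1) by (intro mult_left_mono) auto
        then show ?thesis using D(2)[of "\<mu> n"] by simp
      qed
      moreover have "\<bar>(\<integral>z. h z \<partial>\<Lambda>) - D \<Lambda>\<bar> \<le> \<epsilon> * (B \<Lambda> + 1)"
      proof -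
        have "\<epsilon> * B \<Lambda> \<le> \<epsilon> * (B \<Lambda> + 1)" using \<epsilon>(1) by (intro mult_left_mono) auto
        then show ?thesis using D(2)[of \<Lambda>] by simp
      qed
      ultimately show ?case using elim(2) \<epsilon>(2) r unfolding real_norm_def by linarith
    qed
    then show "\<exists>n0. \<forall>n\<ge>n0. norm ((\<integral>z. h z \<partial>\<mu> n) - (\<integral>z. h z \<partial>\<Lambda>)) < r"
      by (simp add: eventually_sequentially)
  qed
qed

section \<open>Regularly varying stationary sequences\<close>

text \<open>Monotonicity encloses each value between those at neighbouring grid points, and there
  the limit varies by less than e / 2. Uniformity matters because the thresholds x / \<sigma>_i
  range over a compact interval.\<close>

lemma antimono_pointwise_uniform_limit:
  fixes f :: "nat \<Rightarrow> real \<Rightarrow> real" and g :: "real \<Rightarrow> real"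
  assumes AB: "A \<le> B" and mono: "\<And>n x y. A \<le> x \<Longrightarrow> x \<le> y \<Longrightarrow> y \<le> B \<Longrightarrow> f n y \<le> f n x"
    and lim: "\<And>x. x \<in> {A..B} \<Longrightarrow> (\<lambda>n. f n x) \<longlonglongrightarrow> g x" and g: "continuous_on {A..B} g"
    and e: "e > 0"
  shows "\<forall>\<^sub>F n in sequentially. \<forall>x\<in>{A..B}. \<bar>f n x - g x\<bar> < e"
proof -
  have "uniformly_continuous_on {A..B} g" by (rule compact_uniformly_continuous[OF g compact_Icc])
  then obtain d where d: "d > 0" "\<And>x y. x \<in> {A..B} \<Longrightarrow> y \<in> {A..B} \<Longrightarrow> \<bar>y - x\<bar> < d \<Longrightarrow> \<bar>g y - g x\<bar> < e / 2"
    using e unfolding uniformly_continuous_on_def dist_real_def by (metis half_gt_zero)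
  \<comment> \<open>Mesh d / 2, cut off at B; K is large enough for the last grid point to be
    B.\<close>
  define K where "K = nat \<lceil>(B - A) / (d/2)\<rceil> + 1"
  define y where "y k = min B (A + real k * (d/2))" for k
  have yB: "y k \<in> {A..B}" for k using AB d by (simp add: y_def)
  have "\<forall>\<^sub>F n in sequentially. \<forall>k\<in>{..K}. \<bar>f n (y k) - g (y k)\<bar> < e / 2"
    using tendstoD[OF lim[OF yB], of "e/2"] e by (intro eventually_ball_finite) (auto simp: dist_real_def)
  then show ?thesis
  proof eventually_elim
    case (elim n)
    show ?case
    proof
      fix x assume x: "x \<in> {A..B}"
      define k where "k = nat \<lfloor>(x - A) / (d/2)\<rfloor>"
      have k: "real k \<le> (x - A) / (d/2)" "(x - A) / (d/2) < real k + 1"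
        using x d by (auto simp: k_def)
      have yk: "y k \<le> x" "x \<le> y (Suc k)" "x - y k < d" "y (Suc k) - x < d"
      proof -
        have a: "real k * (d/2) \<le> x - A" using k(1) d by (simp add: field_simps)
        have b: "x - A < (real k + 1) * (d/2)" using k(2) d by (simp add: field_simps)
        show "y k \<le> x" using a by (simp add: y_def)
        show "x \<le> y (Suc k)" using b x by (simp add: y_def add.commute)
        show "x - y k < d" using b a x d by (simp add: y_def min_def algebra_simps)
        have "y (Suc k) \<le> A + real k * (d/2) + d/2"
          unfolding y_def by (rule min.coboundedI2) (simp add: field_simps)
        then show "y (Suc k) - x < d" using a d by linarith
      qed
      have "(x - A) / (d/2) \<le> (B - A) / (d/2)" using x d by (intro divide_right_mono) auto
      then have "real k \<le> (B - A) / (d/2)" using k(1) by linarith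
      then have "real k \<le> real_of_int \<lceil>(B - A) / (d/2)\<rceil>" by linarith
      then have kK: "Suc k \<le> K" unfolding K_def by linarith
      have "f n x \<le> f n (y k)" "f n (y (Suc k)) \<le> f n x"
        using mono yk x yB[of k] yB[of "Suc k"] by auto
      moreover have "\<bar>f n (y k) - g (y k)\<bar> < e / 2" "\<bar>f n (y (Suc k)) - g (y (Suc k))\<bar> < e / 2"
        using elim kK by auto
      moreover have "\<bar>g (y k) - g x\<bar> < e / 2" "\<bar>g (y (Suc k)) - g x\<bar> < e / 2"
        using d(2)[OF x yB[of k]] d(2)[OF x yB[of "Suc k"]] yk by auto
      ultimately show "\<bar>f n x - g x\<bar> < e" unfolding abs_less_iff by linarith
    qed
  qed
qed

text \<open>The Cesaro mean along floor (t n), multiplied by floor (t n) / n, which tends to t. For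
  t = 0 this index does not diverge, but the sum is empty.\<close>

lemma Cesaro_floor:
  fixes b :: "nat \<Rightarrow> real"
  assumes lim: "(\<lambda>n. 1 / real n * (\<Sum>i = 1..n. b i)) \<longlonglongrightarrow> l" and t: "0 \<le> t"
  shows "(\<lambda>n. 1 / real n * (\<Sum>i = 1..nat \<lfloor>t * real n\<rfloor>. b i)) \<longlonglongrightarrow> t * l"
proof (cases "t = 0")
  case False
  define m where "m n = nat \<lfloor>t * real n\<rfloor>" for n
  have "filterlim m at_top sequentially"
    unfolding m_def using t False
    by (intro filterlim_compose[OF filterlim_nat_sequentially] filterlim_compose[OF filterlim_floor_sequentially]
        filterlim_tendsto_pos_mult_at_top[OF tendsto_const] filterlim_real_sequentially) auto
  then have l1: "(\<lambda>n. 1 / real (m n) * (\<Sum>i = 1..m n. b i)) \<longlonglongrightarrow> l"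
    by (rule filterlim_compose[OF lim])
  have l2: "(\<lambda>n. real (m n) / real n) \<longlonglongrightarrow> t"
  proof (rule tendsto_sandwich)
    have "(\<lambda>n. t - 1 / real n) \<longlonglongrightarrow> t - 0" by (intro tendsto_intros lim_1_over_n)
    then show "(\<lambda>n. t - 1 / real n) \<longlonglongrightarrow> t" by simp
    show "\<forall>\<^sub>F n in sequentially. t - 1 / real n \<le> real (m n) / real n"
      using eventually_gt_at_top[of 0]
    proof eventually_elim
      case (elim n)
      have "t * real n - 1 \<le> real (m n)" unfolding m_def by linarith
      then have "(t * real n - 1) / real n \<le> real (m n) / real n" by (rule divide_right_mono) simp
      then show ?case using elim by (simp add: diff_divide_distrib)
    qed
    show "\<forall>\<^sub>F n in sequentially. real (m n) / real n \<le> t"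
      using eventually_gt_at_top[of 0]
    proof eventually_elim
      case (elim n)
      have "0 \<le> t * real n" using t by simp
      then have "real (m n) \<le> t * real n" unfolding m_def by linarith
      then show ?case using elim by (simp add: divide_le_eq)
    qed
  qed auto
  have "\<forall>\<^sub>F n in sequentially. real (m n) / real n * (1 / real (m n) * (\<Sum>i = 1..m n. b i)) = 1 / real n * (\<Sum>i = 1..m n. b i)"
    using eventually_compose_filterlim[OF eventually_gt_at_top[of 0] \<open>filterlim m at_top sequentially\<close>]
    by eventually_elim simp
  then show ?thesis
    using Lim_transform_eventually[OF tendsto_mult[OF l2 l1]] by (simp add: m_def)
qed simp

section \<open>Tail asymptotics and truncated moments\<close>

locale heavy_tailed_sequence = prob_space M for M :: "'a measure" +
  fixes Z :: "int \<Rightarrow> 'a \<Rightarrow> real" and L :: "real \<Rightarrow> real" and a :: "nat \<Rightarrow> real" and \<alpha> p q :: real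
  assumes \<alpha>: "\<alpha> > 0"
    and Z_meas [measurable]: "\<And>i. Z i \<in> borel_measurable M"
    and stationary: "strictly_stationary M Z"
    and tail: "\<And>x. x > 0 \<Longrightarrow> prob {\<omega> \<in> space M. \<bar>Z 1 \<omega>\<bar> > x} = x powr (- \<alpha>) * L x"
    and slow: "slowly_varying L"
    and right_tail: "((\<lambda>x. prob {\<omega> \<in> space M. Z 1 \<omega> > x} / prob {\<omega> \<in> space M. \<bar>Z 1 \<omega>\<bar> > x}) \<longlongrightarrow> p) at_top"
    and left_tail: "((\<lambda>x. prob {\<omega> \<in> space M. Z 1 \<omega> < - x} / prob {\<omega> \<in> space M. \<bar>Z 1 \<omega>\<bar> > x}) \<longlongrightarrow> q) at_top"
    and pq: "0 \<le> p" "0 \<le> q"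
    and a_pos: "\<And>n. n \<ge> 1 \<Longrightarrow> a n > 0"
    and a_top: "filterlim a at_top sequentially"
    and a_norm: "(\<lambda>n. real n * prob {\<omega> \<in> space M. \<bar>Z 1 \<omega>\<bar> > a n}) \<longlonglongrightarrow> 1"
begin

definition T :: "real \<Rightarrow> real" where
  "T x = prob {\<omega> \<in> space M. \<bar>Z 1 \<omega>\<bar> > x}"

lemma T_nonneg: "0 \<le> T x" by (simp add: T_def)

lemma stationary_distr:
  assumes "finite J" "A \<in> sets (\<Pi>\<^sub>M j\<in>J. borel)"
  shows "prob {\<omega> \<in> space M. (\<lambda>j\<in>J. Z (j + h) \<omega>) \<in> A} = prob {\<omega> \<in> space M. (\<lambda>j\<in>J. Z j \<omega>) \<in> A}"
proof -
  have m: "(\<lambda>\<omega>. \<lambda>j\<in>J. Z (j + h) \<omega>) \<in> M \<rightarrow>\<^sub>M (\<Pi>\<^sub>M j\<in>J. borel)" for h by measurable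
  have e: "(\<lambda>\<omega>. \<lambda>j\<in>J. Z (j + h) \<omega>) -` A \<inter> space M = {\<omega> \<in> space M. (\<lambda>j\<in>J. Z (j + h) \<omega>) \<in> A}" for h by auto
  have "measure (distr M (\<Pi>\<^sub>M j\<in>J. borel) (\<lambda>\<omega>. \<lambda>j\<in>J. Z (j + h) \<omega>)) A
      = measure (distr M (\<Pi>\<^sub>M j\<in>J. borel) (\<lambda>\<omega>. \<lambda>j\<in>J. Z j \<omega>)) A"
    using stationary assms(1) by (simp add: strictly_stationary_def)
  then show ?thesis
    using measure_distr[OF m[of h] assms(2)] measure_distr[OF m[of 0] assms(2)] e[of h] e[of 0] by simp
qed

lemma stationary_one:
  assumes "B \<in> sets borel"
  shows "prob {\<omega> \<in> space M. Z i \<omega> \<in> B} = prob {\<omega> \<in> space M. Z 1 \<omega> \<in> B}"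
proof -
  have "(\<Pi>\<^sub>E j\<in>{1::int}. B) \<in> sets (\<Pi>\<^sub>M j\<in>{1}. borel)" using assms by (intro sets_PiM_I_finite) auto
  from stationary_distr[OF _ this, of "i - 1"] show ?thesis by (simp add: PiE_iff)
qed

lemma stationary_two:
  assumes "A \<in> sets borel" "B \<in> sets borel" "l \<noteq> 0"
  shows "prob {\<omega> \<in> space M. Z i \<omega> \<in> A \<and> Z (i + l) \<omega> \<in> B} = prob {\<omega> \<in> space M. Z 1 \<omega> \<in> A \<and> Z (1 + l) \<omega> \<in> B}"
proof -
  have "(\<Pi>\<^sub>E j\<in>{1, 1 + l}. if j = 1 then A else B) \<in> sets (\<Pi>\<^sub>M j\<in>{1, 1 + l}. borel)"
    using assms by (intro sets_PiM_I_finite) auto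
  from stationary_distr[OF _ this, of "i - 1"] show ?thesis using assms(3) by (simp add: PiE_iff add.commute)
qed

lemma prob_abs_gt: "prob {\<omega> \<in> space M. \<bar>Z i \<omega>\<bar> > x} = T x"
  using stationary_one[of "{z. \<bar>z\<bar> > x}" i] by (simp add: T_def)

lemma tail_ratio:
  assumes "t > 0"
  shows "((\<lambda>x. T (t * x) / T x) \<longlongrightarrow> t powr (- \<alpha>)) at_top"
proof -
  have "((\<lambda>x. t powr (- \<alpha>) * (L (t * x) / L x)) \<longlongrightarrow> t powr (- \<alpha>) * 1) at_top"
    using slow assms unfolding slowly_varying_def by (intro tendsto_intros) auto
  moreover have "\<forall>\<^sub>F x in at_top. t powr (- \<alpha>) * (L (t * x) / L x) = T (t * x) / T x"
    using eventually_gt_at_top[of 0]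
  proof eventually_elim
    case (elim x)
    then show ?case using assms by (simp add: T_def tail powr_mult)
  qed
  ultimately show ?thesis by (simp add: Lim_transform_eventually)
qed

text \<open>The ratio T x / T x tends to 1, whereas it would be 0 by the convention for division if
  T x were 0.\<close>

lemma T_pos_eventually: "\<forall>\<^sub>F x in at_top. T x > 0"
proof -
  have "\<forall>\<^sub>F x in at_top. T (1 * x) / T x > 0"
    using order_tendstoD(1)[OF tail_ratio[of 1], of 0] by simp
  then show ?thesis
  proof eventually_elim
    case (elim x) then show ?case using T_nonneg[of x] by (cases "T x = 0") auto
  qed
qed

lemma scaled_tail:
  assumes "x > 0"
  shows "(\<lambda>n. real n * T (x * a n)) \<longlonglongrightarrow> x powr (- \<alpha>)"
proof -
  have "(\<lambda>n. (T (x * a n) / T (a n)) * (real n * T (a n))) \<longlonglongrightarrow> x powr (- \<alpha>) * 1"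
    using filterlim_compose[OF tail_ratio[OF assms] a_top] a_norm unfolding T_def[symmetric] by (intro tendsto_mult)
  moreover have "\<forall>\<^sub>F n in sequentially. (T (x * a n) / T (a n)) * (real n * T (a n)) = real n * T (x * a n)"
    using eventually_compose_filterlim[OF T_pos_eventually a_top] by eventually_elim simp
  ultimately show ?thesis by (simp add: Lim_transform_eventually)
qed

lemma scaled_signed_tail:
  assumes "x > 0" and \<tau>: "\<tau> \<in> {1, -1}"
  shows "(\<lambda>n. real n * prob {\<omega> \<in> space M. \<tau> * Z 1 \<omega> > x * a n}) \<longlonglongrightarrow> tail_weight p q \<tau> * x powr (- \<alpha>)"
proof -
  define R where "R y = prob {\<omega> \<in> space M. \<tau> * Z 1 \<omega> > y}" for y
  have lim: "((\<lambda>y. R y / T y) \<longlongrightarrow> tail_weight p q \<tau>) at_top"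
  proof (cases "\<tau> = 1")
    case False
    then have "R y = prob {\<omega> \<in> space M. Z 1 \<omega> < - y}" for y
      using \<tau> unfolding R_def by (intro arg_cong[where f = prob]) auto
    then show ?thesis using left_tail False by (simp add: T_def tail_weight_def)
  qed (use right_tail in \<open>simp add: T_def tail_weight_def R_def\<close>)
  have xa: "filterlim (\<lambda>n. x * a n) at_top sequentially"
    by (rule filterlim_tendsto_pos_mult_at_top[OF tendsto_const assms(1) a_top])
  have "(\<lambda>n. R (x * a n) / T (x * a n) * (real n * T (x * a n))) \<longlonglongrightarrow> tail_weight p q \<tau> * x powr (- \<alpha>)"
    by (intro tendsto_mult filterlim_compose[OF lim xa] scaled_tail assms)
  moreover have "\<forall>\<^sub>F n in sequentially. R (x * a n) / T (x * a n) * (real n * T (x * a n)) = real n * R (x * a n)"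
    using eventually_compose_filterlim[OF T_pos_eventually xa] by eventually_elim simp
  ultimately show ?thesis unfolding R_def[symmetric] by (rule Lim_transform_eventually)
qed

text \<open>A Potter-type bound along powers of 2; it replaces Karamata's theorem below.\<close>

lemma geometric_tail_bound:
  assumes "\<delta> < \<alpha>" 
  obtains x0 where "x0 > 0" "\<And>x k. x \<ge> x0 \<Longrightarrow> T (2 ^ k * x) \<le> (2 powr (- \<delta>)) ^ k * T x"
proof -
  have "2 powr (- \<alpha>) < 2 powr (- \<delta>)" using assms by simp
  then have "\<forall>\<^sub>F x in at_top. T (2 * x) / T x < 2 powr (- \<delta>)"
    using order_tendstoD(2)[OF tail_ratio[of 2]] by simp
  then have "\<forall>\<^sub>F x in at_top. T (2 * x) \<le> 2 powr (- \<delta>) * T x"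
    using T_pos_eventually by eventually_elim (simp add: divide_less_eq)
  then obtain x1 where x1: "\<And>x. x \<ge> x1 \<Longrightarrow> T (2 * x) \<le> 2 powr (- \<delta>) * T x"
    unfolding eventually_at_top_linorder by blast
  show ?thesis
  proof (rule that[of "max 1 x1"])
    fix x k assume x: "x \<ge> max 1 x1"
    show "T (2 ^ k * x) \<le> (2 powr (- \<delta>)) ^ k * T x"
    proof (induction k)
      case (Suc k)
      have "x1 \<le> x" "1 * x \<le> 2 ^ k * x" using x by (auto intro!: mult_right_mono)
      then have "x1 \<le> 2 ^ k * x" by linarith
      then have "T (2 ^ Suc k * x) \<le> 2 powr (- \<delta>) * T (2 ^ k * x)" using x1 by (simp add: mult.assoc)
      also have "\<dots> \<le> 2 powr (- \<delta>) * ((2 powr (- \<delta>)) ^ k * T x)" by (intro mult_left_mono Suc.IH) simp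
      finally show ?case by (simp add: mult.assoc)
    qed simp
  qed simp
qed

text \<open>Take the least power of 2 for which 2^m y reaches |z|; since |z| > y it is not 2^0, so
  it has a predecessor, which is the inner radius of the shell.\<close>

lemma truncated_moment_dyadic:
  fixes z y \<delta> :: real
  assumes "y > 0" "\<delta> > 0" "\<bar>z\<bar> > y"
  obtains k :: nat where "\<bar>z\<bar> > 2 ^ k * y" "\<bar>z\<bar> powr \<delta> \<le> (2 ^ Suc k * y) powr \<delta>"
proof -
  have "\<exists>k::nat. \<bar>z\<bar> \<le> 2 ^ k * y"
  proof -
    obtain k :: nat where "\<bar>z\<bar> / y < 2 ^ k" using real_arch_pow[of 2 "\<bar>z\<bar> / y"] by auto
    then show ?thesis using assms(1) by (intro exI[of _ k]) (simp add: field_simps)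
  qed
  then obtain m :: nat where m: "\<bar>z\<bar> \<le> 2 ^ m * y" "\<And>j. j < m \<Longrightarrow> \<not> \<bar>z\<bar> \<le> 2 ^ j * y"
    using exists_least_iff[of "\<lambda>k::nat. \<bar>z\<bar> \<le> 2 ^ k * y"] by auto
  have "m \<noteq> 0" using m(1) assms(3) by (intro notI) auto
  then obtain k where k: "m = Suc k" by (cases m) auto
  show ?thesis
  proof (rule that[of k])
    show "\<bar>z\<bar> > 2 ^ k * y" using m(2)[of k] k by simp
    show "\<bar>z\<bar> powr \<delta> \<le> (2 ^ Suc k * y) powr \<delta>" using m(1) k assms by (intro powr_mono2) auto
  qed
qed

text \<open>The range |Z| > x is cut into dyadic shells, which gives the series of (2^(k + 1)
  x)^\<delta> T (2^k x). With an exponent \<delta>' strictly between \<delta> and \<alpha> the tail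
  bound dominates it by a geometric series of ratio 2^(\<delta> - \<delta>').\<close>

lemma truncated_moment_bound:
  assumes "0 < \<delta>" "\<delta> < \<alpha>"
  obtains C x0 where "C \<ge> 0" "x0 > 0"
    "\<And>x i. x \<ge> x0 \<Longrightarrow> (\<integral>\<^sup>+\<omega>. ennreal (\<bar>Z i \<omega>\<bar> powr \<delta> * indicator {\<omega>. \<bar>Z i \<omega>\<bar> > x} \<omega>) \<partial>M) \<le> ennreal (C * x powr \<delta> * T x)"
proof -
  define \<delta>' where "\<delta>' = (\<delta> + \<alpha>) / 2"
  have \<delta>': "\<delta> < \<delta>'" "\<delta>' < \<alpha>" using assms by (auto simp: \<delta>'_def)
  obtain x0 where x0: "x0 > 0" "\<And>x k. x \<ge> x0 \<Longrightarrow> T (2 ^ k * x) \<le> (2 powr (- \<delta>')) ^ k * T x"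
    using geometric_tail_bound[OF \<delta>'(2)] by blast
  define r where "r = 2 powr (\<delta> - \<delta>')"
  have r: "0 < r" "r < 1" using \<delta>' by (auto simp: r_def powr_less_one)
  \<comment> \<open>The factor 2^\<delta> comes from the ratio of outer and inner radius of a shell,
    the rest is the sum of the geometric series.\<close>
  define C where "C = 2 powr \<delta> * (1 / (1 - r))"
  show ?thesis
  proof (rule that[of C x0])
    show "C \<ge> 0" using r by (simp add: C_def)
    fix x i assume x: "x \<ge> x0"
    then have x_pos: "x > 0" using x0(1) by simp
    let ?A = "\<lambda>k::nat. {\<omega> \<in> space M. \<bar>Z i \<omega>\<bar> > 2 ^ k * x}"
    have "(\<integral>\<^sup>+\<omega>. ennreal (\<bar>Z i \<omega>\<bar> powr \<delta> * indicator {\<omega>. \<bar>Z i \<omega>\<bar> > x} \<omega>) \<partial>M)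
        \<le> (\<integral>\<^sup>+\<omega>. (\<Sum>k. ennreal ((2 ^ Suc k * x) powr \<delta>) * indicator (?A k) \<omega>) \<partial>M)"
    proof (rule nn_integral_mono)
      fix \<omega> assume \<omega>: "\<omega> \<in> space M"
      show "ennreal (\<bar>Z i \<omega>\<bar> powr \<delta> * indicator {\<omega>. \<bar>Z i \<omega>\<bar> > x} \<omega>)
          \<le> (\<Sum>k. ennreal ((2 ^ Suc k * x) powr \<delta>) * indicator (?A k) \<omega>)"
      proof (cases "\<bar>Z i \<omega>\<bar> > x")
        case True
        obtain k where k: "\<bar>Z i \<omega>\<bar> > 2 ^ k * x" "\<bar>Z i \<omega>\<bar> powr \<delta> \<le> (2 ^ Suc k * x) powr \<delta>"
          by (rule truncated_moment_dyadic[OF x_pos assms(1) True])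
        have "ennreal (\<bar>Z i \<omega>\<bar> powr \<delta> * indicator {\<omega>. \<bar>Z i \<omega>\<bar> > x} \<omega>) \<le> ennreal ((2 ^ Suc k * x) powr \<delta>) * indicator (?A k) \<omega>"
          using True k \<omega> by (simp add: ennreal_leI)
        also have "\<dots> \<le> (\<Sum>k. ennreal ((2 ^ Suc k * x) powr \<delta>) * indicator (?A k) \<omega>)"
        proof -
          define g where "g k = ennreal ((2 ^ Suc k * x) powr \<delta>) * indicator (?A k) \<omega>" for k
          have "g k \<le> suminf g" using sum_le_suminf[of g "{k}"] by simp
          then show ?thesis unfolding g_def .
        qed
        finally show ?thesis .
      qed simp
    qed
    also have "\<dots> = (\<Sum>k. \<integral>\<^sup>+\<omega>. ennreal ((2 ^ Suc k * x) powr \<delta>) * indicator (?A k) \<omega> \<partial>M)"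
      by (rule nn_integral_suminf) measurable
    also have "\<dots> = (\<Sum>k. ennreal ((2 ^ Suc k * x) powr \<delta> * T (2 ^ k * x)))"
    proof (intro suminf_cong)
      fix k
      have "?A k \<in> sets M" by measurable
      then show "(\<integral>\<^sup>+\<omega>. ennreal ((2 ^ Suc k * x) powr \<delta>) * indicator (?A k) \<omega> \<partial>M) = ennreal ((2 ^ Suc k * x) powr \<delta> * T (2 ^ k * x))"
        by (simp add: nn_integral_cmult_indicator emeasure_eq_measure prob_abs_gt ennreal_mult T_nonneg)
    qed
    also have "\<dots> \<le> (\<Sum>k. ennreal ((2 powr \<delta> * x powr \<delta> * T x) * r ^ k))"
    proof (intro suminf_le ennreal_leI allI)
      fix k
      have "(2 ^ Suc k * x) powr \<delta> * T (2 ^ k * x) \<le> (2 ^ Suc k * x) powr \<delta> * ((2 powr (- \<delta>')) ^ k * T x)"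
        by (intro mult_left_mono x0(2) x) simp
      also have "\<dots> = (2 powr \<delta> * x powr \<delta> * T x) * r ^ k"
      proof -
        have "(2 ^ Suc k * x) powr \<delta> = 2 powr \<delta> * (2 powr \<delta>) ^ k * x powr \<delta>"
          using x_pos by (simp add: powr_mult powr_power[symmetric] powr_realpow[symmetric] powr_powr mult.commute)
        moreover have "(2 powr \<delta>) ^ k * (2 powr (- \<delta>')) ^ k = r ^ k"
          by (simp add: r_def power_mult_distrib[symmetric] powr_add[symmetric])
        ultimately show ?thesis by (simp add: algebra_simps)
      qed
      finally show "(2 ^ Suc k * x) powr \<delta> * T (2 ^ k * x) \<le> (2 powr \<delta> * x powr \<delta> * T x) * r ^ k" .
    qed auto
    also have "\<dots> = ennreal ((2 powr \<delta> * x powr \<delta> * T x) * (1 / (1 - r)))"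
      using r T_nonneg by (intro suminf_ennreal_eq sums_mult geometric_sums) auto
    finally show "(\<integral>\<^sup>+\<omega>. ennreal (\<bar>Z i \<omega>\<bar> powr \<delta> * indicator {\<omega>. \<bar>Z i \<omega>\<bar> > x} \<omega>) \<partial>M) \<le> ennreal (C * x powr \<delta> * T x)"
      by (simp add: C_def algebra_simps)
  qed (use x0 in auto)
qed

section \<open>Expected point counts of the scaled sequence\<close>

text \<open>Each probability is \<open>f n (x / \<sigma> i) / real n\<close>, with one function for
  all i. Since x / \<sigma>_i stays in [x / \<beta>2, x / \<beta>1], uniform convergence replaces
  that function by its power-law limit, from which \<sigma>_i^\<alpha> factors out to be
  averaged.\<close>

lemma scaled_rectangle_sum:
  fixes \<sigma> :: "nat \<Rightarrow> real"
  assumes \<sigma>: "0 < \<beta>1" "\<And>i. \<beta>1 \<le> \<sigma> i" "\<And>i. \<sigma> i \<le> \<beta>2"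
    and lim: "(\<lambda>n. 1 / real n * (\<Sum>i = 1..n. \<sigma> i powr \<alpha>)) \<longlonglongrightarrow> v"
    and t: "0 \<le> t" and x: "x > 0" and \<tau>: "\<tau> \<in> {1, -1}"
  shows "(\<lambda>n. \<Sum>i = 1..nat \<lfloor>t * real n\<rfloor>. prob {\<omega> \<in> space M. \<tau> * (\<sigma> i * Z 1 \<omega>) > x * a n})
    \<longlonglongrightarrow> t * (v * tail_weight p q \<tau> * x powr (- \<alpha>))"
proof -
  define f where "f n y = real n * prob {\<omega> \<in> space M. \<tau> * Z 1 \<omega> > y * a n}" for n y
  define g where "g y = tail_weight p q \<tau> * y powr (- \<alpha>)" for y
  define m where "m n = nat \<lfloor>t * real n\<rfloor>" for n
  have \<sigma>pos: "\<sigma> i > 0" for i using \<sigma>(1) \<sigma>(2)[of i] by linarith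
  have \<beta>: "\<beta>1 \<le> \<beta>2" using \<sigma>(2,3)[of 0] by linarith
  have AB: "0 < x / \<beta>2" "x / \<beta>2 \<le> x / \<beta>1" using x \<sigma>(1) \<beta> by (auto intro!: divide_left_mono)
  have unif: "\<forall>\<^sub>F n in sequentially. \<forall>y\<in>{x / \<beta>2..x / \<beta>1}. \<bar>f n y - g y\<bar> < e" if "e > 0" for e
  proof (rule antimono_pointwise_uniform_limit[OF AB(2) _ _ _ that])
    show "f n y' \<le> f n y" if "x / \<beta>2 \<le> y" "y \<le> y'" "y' \<le> x / \<beta>1" for n y y'
    proof (cases "n = 0")
      case False
      then have "y * a n \<le> y' * a n" using that(2) a_pos[of n] by (intro mult_right_mono) auto
      then show ?thesis unfolding f_def by (intro mult_left_mono finite_measure_mono) auto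
    qed (simp add: f_def)
    show "(\<lambda>n. f n y) \<longlonglongrightarrow> g y" if "y \<in> {x / \<beta>2..x / \<beta>1}" for y
      unfolding f_def g_def using that AB by (intro scaled_signed_tail \<tau>) auto
    show "continuous_on {x / \<beta>2..x / \<beta>1} g"
      unfolding g_def using AB by (intro continuous_intros) auto
  qed
  have fterm: "prob {\<omega> \<in> space M. \<tau> * (\<sigma> i * Z 1 \<omega>) > x * a n} = f n (x / \<sigma> i) / real n" if "n \<ge> 1" for n i
  proof -
    have "\<tau> * (\<sigma> i * z) > x * a n \<longleftrightarrow> \<tau> * z > x / \<sigma> i * a n" for z
      using \<sigma>pos[of i] by (simp add: field_simps)
    then show ?thesis using that by (simp add: f_def)
  qed
  have gterm: "g (x / \<sigma> i) = tail_weight p q \<tau> * x powr (- \<alpha>) * \<sigma> i powr \<alpha>" for i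
    using x \<sigma>pos[of i] by (simp add: g_def powr_divide powr_minus divide_simps)
  have diff: "(\<lambda>n. (\<Sum>i = 1..m n. prob {\<omega> \<in> space M. \<tau> * (\<sigma> i * Z 1 \<omega>) > x * a n})
      - tail_weight p q \<tau> * x powr (- \<alpha>) * (1 / real n * (\<Sum>i = 1..m n. \<sigma> i powr \<alpha>))) \<longlonglongrightarrow> 0"
  proof (rule tendstoI)
    fix e :: real assume e: "e > 0"
    \<comment> \<open>At most t n terms are summed and divided by n, hence this tolerance per
      term.\<close>
    have "e / (t + 1) > 0" using e t by simp
    from unif[OF this] show "\<forall>\<^sub>F n in sequentially. dist ((\<Sum>i = 1..m n. prob {\<omega> \<in> space M. \<tau> * (\<sigma> i * Z 1 \<omega>) > x * a n})
      - tail_weight p q \<tau> * x powr (- \<alpha>) * (1 / real n * (\<Sum>i = 1..m n. \<sigma> i powr \<alpha>))) 0 < e"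
      using eventually_ge_at_top[of 1]
    proof eventually_elim
      case (elim n)
      have mn: "real (m n) \<le> t * real n" unfolding m_def using t by (simp add: of_nat_nat)
      have "x / \<sigma> i \<in> {x / \<beta>2..x / \<beta>1}" for i
        using x \<sigma>(1) \<sigma>(2,3)[of i] \<sigma>pos[of i] by (auto intro!: divide_left_mono)
      then have b: "\<bar>f n (x / \<sigma> i) - g (x / \<sigma> i)\<bar> \<le> e / (t + 1)" for i using elim(1) by (meson less_imp_le)
      have "(\<Sum>i = 1..m n. prob {\<omega> \<in> space M. \<tau> * (\<sigma> i * Z 1 \<omega>) > x * a n})
          - tail_weight p q \<tau> * x powr (- \<alpha>) * (1 / real n * (\<Sum>i = 1..m n. \<sigma> i powr \<alpha>))
          = (\<Sum>i = 1..m n. f n (x / \<sigma> i) - g (x / \<sigma> i)) / real n"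
        by (simp add: fterm[OF elim(2)] gterm sum_subtractf sum_divide_distrib[symmetric] sum_distrib_left[symmetric] diff_divide_distrib)
      also have "\<bar>\<dots>\<bar> = \<bar>\<Sum>i = 1..m n. f n (x / \<sigma> i) - g (x / \<sigma> i)\<bar> / real n" by simp
      also have "\<dots> \<le> (\<Sum>i = 1..m n. e / (t + 1)) / real n"
        by (intro divide_right_mono order_trans[OF sum_abs] sum_mono b) simp
      also have "\<dots> = real (m n) / real n * (e / (t + 1))" by simp
      also have "\<dots> \<le> t * (e / (t + 1))" using mn elim(2) e t by (intro mult_right_mono) (auto simp: divide_le_eq)
      also have "\<dots> < e" using e t by (simp add: field_simps)
      finally show ?case by (simp add: dist_real_def)
    qed
  qed
  have "(\<lambda>n. tail_weight p q \<tau> * x powr (- \<alpha>) * (1 / real n * (\<Sum>i = 1..m n. \<sigma> i powr \<alpha>)))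
      \<longlonglongrightarrow> tail_weight p q \<tau> * x powr (- \<alpha>) * (t * v)"
    unfolding m_def by (intro tendsto_mult tendsto_const Cesaro_floor lim t)
  from tendsto_add[OF diff this] show ?thesis by (simp add: m_def algebra_simps)
qed

text \<open>The sum of expectations is the integral of h against the expected point measure, the
  image of counting measure times \<open>M\<close>. Its masses on rectangles are the sums just
  treated, and their limits are the rectangle masses of the intensity.\<close>

theorem intensity_limit:
  fixes \<sigma> :: "nat \<Rightarrow> real"
  assumes \<sigma>: "0 < \<beta>1" "\<And>i. \<beta>1 \<le> \<sigma> i" "\<And>i. \<sigma> i \<le> \<beta>2"
    and lim: "(\<lambda>n. 1 / real n * (\<Sum>i = 1..n. \<sigma> i powr \<alpha>)) \<longlonglongrightarrow> s powr \<alpha>"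
    and h: "h \<in> CK_plus"
  shows "(\<lambda>n. \<Sum>i = 1..n. \<integral>\<omega>. h (real i / real n, ereal (\<sigma> i * Z 1 \<omega> / a n)) \<partial>M)
    \<longlonglongrightarrow> (\<integral>z. h z \<partial>intensity \<alpha> s p q)"
proof -
  define N where "N n = count_space {1..n} \<Otimes>\<^sub>M M" for n :: nat
  define \<zeta> where "\<zeta> n = (\<lambda>(i, \<omega>). (real i / real n, ereal (\<sigma> i * Z 1 \<omega> / a n)))" for n
  define \<mu> where "\<mu> n = distr (N n) borel (\<zeta> n)" for n
  \<comment> \<open>The intensity lives on \<open>S_space\<close>; it is pushed to the whole Borel
    space so that all measures share one sigma-algebra.\<close>
  define \<Lambda> where "\<Lambda> = distr (intensity \<alpha> s p q) borel (\<lambda>z. z)"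
  have \<zeta>m: "\<zeta> n \<in> N n \<rightarrow>\<^sub>M borel" for n
    unfolding N_def \<zeta>_def
  proof (rule measurable_pair_measure_countable1)
    fix i show "(\<lambda>\<omega>. case (i, \<omega>) of (i, \<omega>) \<Rightarrow> (real i / real n, ereal (\<sigma> i * Z 1 \<omega> / a n))) \<in> M \<rightarrow>\<^sub>M borel"
      unfolding prod.case borel_prod[symmetric] by measurable
  qed simp
  have idm: "(\<lambda>z. z) \<in> intensity \<alpha> s p q \<rightarrow>\<^sub>M borel"
  proof -
    have "(\<lambda>z. z) \<in> restrict_space borel S_space \<rightarrow>\<^sub>M borel" by (rule measurable_restrict_space1) simp
    then show ?thesis by (simp cong: measurable_cong_sets add: sets_borel_of_S_top)
  qed
  have em: "emeasure (N n) X = (\<Sum>i = 1..n. emeasure M (Pair i -` X))" if "X \<in> sets (N n)" for n X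
    using that unfolding N_def by (subst emeasure_pair_measure_alt) (auto simp: nn_integral_count_space_finite)
  have e\<mu>: "emeasure (\<mu> n) ({0..t} \<times> tail_set \<tau> x)
      = ennreal (\<Sum>i = 1..nat \<lfloor>t * real n\<rfloor>. prob {\<omega> \<in> space M. \<tau> * (\<sigma> i * Z 1 \<omega>) > x * a n})"
    if t: "t \<in> {0..1}" and "x > 0" and \<tau>: "\<tau> \<in> {1, -1}" for n t x \<tau>
  proof (cases "n = 0")
    case True
    then have "space (N n) = {}" by (simp add: N_def space_pair_measure)
    then show ?thesis using True rectangle_borel[OF \<tau>] by (simp add: \<mu>_def emeasure_distr \<zeta>m)
  next
    case False
    let ?R = "{0..t} \<times> tail_set \<tau> x"
    have R: "?R \<in> sets borel" by (rule rectangle_borel[OF \<tau>])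
    have "emeasure (\<mu> n) ?R = emeasure (N n) (\<zeta> n -` ?R \<inter> space (N n))"
      unfolding \<mu>_def by (rule emeasure_distr[OF \<zeta>m R])
    also have "\<dots> = (\<Sum>i = 1..n. emeasure M (Pair i -` (\<zeta> n -` ?R \<inter> space (N n))))"
      by (rule em) (rule measurable_sets[OF \<zeta>m R])
    also have "\<dots> = (\<Sum>i = 1..n. if i \<le> nat \<lfloor>t * real n\<rfloor> then ennreal (prob {\<omega> \<in> space M. \<tau> * (\<sigma> i * Z 1 \<omega>) > x * a n}) else 0)"
    proof (intro sum.cong refl)
      fix i assume i: "i \<in> {1..n}"
      have ti: "real i / real n \<le> t \<longleftrightarrow> i \<le> nat \<lfloor>t * real n\<rfloor>"
      proof -
        have "real i / real n \<le> t \<longleftrightarrow> real i \<le> t * real n" using False by (simp add: divide_le_eq)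
        also have "\<dots> \<longleftrightarrow> int i \<le> \<lfloor>t * real n\<rfloor>" by (simp add: le_floor_iff)
        also have "\<dots> \<longleftrightarrow> i \<le> nat \<lfloor>t * real n\<rfloor>" using i by auto
        finally show ?thesis .
      qed
      have "(ereal (\<sigma> i * z / a n) \<in> tail_set \<tau> x) \<longleftrightarrow> \<tau> * (\<sigma> i * z) > x * a n" for z
        using a_pos[of n] False by (simp add: tail_set_def field_simps)
      then have "Pair i -` (\<zeta> n -` ?R \<inter> space (N n)) = (if i \<le> nat \<lfloor>t * real n\<rfloor> then {\<omega> \<in> space M. \<tau> * (\<sigma> i * Z 1 \<omega>) > x * a n} else {})"
        using ti i by (auto simp: \<zeta>_def N_def space_pair_measure)
      then show "emeasure M (Pair i -` (\<zeta> n -` ?R \<inter> space (N n)))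
          = (if i \<le> nat \<lfloor>t * real n\<rfloor> then ennreal (prob {\<omega> \<in> space M. \<tau> * (\<sigma> i * Z 1 \<omega>) > x * a n}) else 0)"
        by (simp add: emeasure_eq_measure)
    qed
    also have "\<dots> = (\<Sum>i \<in> {i \<in> {1..n}. i \<le> nat \<lfloor>t * real n\<rfloor>}. ennreal (prob {\<omega> \<in> space M. \<tau> * (\<sigma> i * Z 1 \<omega>) > x * a n}))"
      by (rule sum.inter_filter[symmetric]) simp
    also have "{i \<in> {1..n}. i \<le> nat \<lfloor>t * real n\<rfloor>} = {1..nat \<lfloor>t * real n\<rfloor>}"
    proof -
      have "t * real n \<le> 1 * real n" using t by (intro mult_right_mono) auto
      then have "nat \<lfloor>t * real n\<rfloor> \<le> n" by linarith
      then show ?thesis by auto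
    qed
    finally show ?thesis by (simp add: sum_ennreal)
  qed
  have e\<Lambda>: "emeasure \<Lambda> ({0..t} \<times> tail_set \<tau> x) = ennreal (t * (s powr \<alpha> * tail_weight p q \<tau> * x powr - \<alpha>))"
    if t: "t \<in> {0..1}" and "x > 0" and \<tau>: "\<tau> \<in> {1, -1}" for t x \<tau>
  proof -
    have "emeasure \<Lambda> ({0..t} \<times> tail_set \<tau> x) = emeasure (intensity \<alpha> s p q) ({0..t} \<times> tail_set \<tau> x)"
      unfolding \<Lambda>_def using tail_set_subset_E[OF \<tau>, of x] t that(2)
      by (subst emeasure_distr[OF idm rectangle_borel[OF \<tau>]])
         (auto intro!: arg_cong[where f = "emeasure _"] simp: S_space_def)
    then show ?thesis using intensity_rectangle[OF \<alpha> that(2) pq \<tau> t] by simp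
  qed
  have "(\<lambda>n. \<integral>z. h z \<partial>\<mu> n) \<longlonglongrightarrow> (\<integral>z. h z \<partial>\<Lambda>)"
  proof (rule rectangle_convergence[OF _ _ _ _ _ h])
    fix t x \<tau> :: real assume A: "t \<in> {0..1}" "x > 0" "\<tau> \<in> {1, -1}"
    show "emeasure (\<mu> n) ({0..t} \<times> tail_set \<tau> x) < \<infinity>" for n by (simp add: e\<mu>[OF A])
    show "emeasure \<Lambda> ({0..t} \<times> tail_set \<tau> x) < \<infinity>" by (simp add: e\<Lambda>[OF A])
    have "0 \<le> t * (s powr \<alpha> * tail_weight p q \<tau> * x powr - \<alpha>)" using A pq by (simp add: tail_weight_def)
    from measure_eq_emeasure_eq_ennreal[OF this e\<Lambda>[OF A]]
    show "(\<lambda>n. measure (\<mu> n) ({0..t} \<times> tail_set \<tau> x)) \<longlonglongrightarrow> measure \<Lambda> ({0..t} \<times> tail_set \<tau> x)"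
      unfolding measure_eq_emeasure_eq_ennreal[OF sum_nonneg e\<mu>[OF A], OF measure_nonneg]
      using scaled_rectangle_sum[OF \<sigma> lim _ A(2,3), of t] A(1) by (simp add: sum_nonneg)
  qed (simp_all add: \<mu>_def \<Lambda>_def)
  moreover have "(\<integral>z. h z \<partial>\<Lambda>) = (\<integral>z. h z \<partial>intensity \<alpha> s p q)"
    unfolding \<Lambda>_def by (rule integral_distr[OF idm CK_plus_borel[OF h]])
  moreover have "(\<integral>z. h z \<partial>\<mu> n) = (\<Sum>i = 1..n. \<integral>\<omega>. h (real i / real n, ereal (\<sigma> i * Z 1 \<omega> / a n)) \<partial>M)" for n
  proof -
    obtain B where B: "\<And>z. h z \<le> B" using CK_plus_bounded[OF h] by blast
    interpret C: sigma_finite_measure "count_space {1..n}" by (rule sigma_finite_measure_count_space_finite) simp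
    interpret P: pair_sigma_finite "count_space {1..n}" M ..
    have hm: "(\<lambda>x. h (\<zeta> n x)) \<in> borel_measurable (N n)"
      by (rule measurable_compose[OF \<zeta>m CK_plus_borel[OF h]])
    have "emeasure (N n) (space (N n)) < \<infinity>"
      by (subst em) (auto simp: less_top[symmetric] emeasure_eq_measure)
    then have int: "integrable (N n) (\<lambda>x. h (\<zeta> n x))"
      using hm B CK_plusD(1)[OF h]
      by (intro integrableI_bounded_set[where A = "space (N n)" and B = B]) auto
    have "(\<integral>z. h z \<partial>\<mu> n) = (\<integral>x. h (\<zeta> n x) \<partial>N n)"
      unfolding \<mu>_def by (rule integral_distr[OF \<zeta>m CK_plus_borel[OF h]])
    also have "\<dots> = (\<integral>i. (\<integral>\<omega>. h (\<zeta> n (i, \<omega>)) \<partial>M) \<partial>count_space {1..n})"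
      using P.integral_fst'[OF int[unfolded N_def]] by (simp add: N_def)
    also have "\<dots> = (\<Sum>i = 1..n. \<integral>\<omega>. h (\<zeta> n (i, \<omega>)) \<partial>M)" by (rule lebesgue_integral_count_space_finite) simp
    finally show ?thesis by (simp add: \<zeta>_def)
  qed
  ultimately show ?thesis by simp
qed

text \<open>Values up to l a_n contribute at most half of the threshold by the choice of l; the rest
  is handled by Markov's inequality and the truncated moment bound. \<open>D\<close> depends neither
  on the shift m nor on i or n, which makes the truncation of the series uniform.\<close>

lemma weighted_moment_tail:
  fixes w :: "nat \<Rightarrow> real"
  assumes \<delta>: "0 < \<delta>" "\<delta> < \<alpha>" and w: "\<And>j. 0 \<le> w j" "summable w" and \<kappa>: "\<kappa> > 0"
  obtains D n0 where "D \<ge> 0" "\<And>n m i. n \<ge> n0 \<Longrightarrow>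
    real n * prob {\<omega> \<in> space M. (\<Sum>j. ennreal (w (j + m) * \<bar>Z (i - int j) \<omega>\<bar> powr \<delta>)) > ennreal (\<kappa> * a n powr \<delta>)}
      \<le> D * (\<Sum>j. w (j + m))"
proof -
  \<comment> \<open>Chosen so that l^\<delta> times any tail sum of w is at most \<kappa> / 2; the
    added 1 covers w = 0.\<close>
  define l where "l = (\<kappa> / (2 * (suminf w + 1))) powr (1 / \<delta>)"
  have sw: "0 \<le> suminf w" by (intro suminf_nonneg w)
  have l: "l > 0" "l powr \<delta> = \<kappa> / (2 * (suminf w + 1))"
    using \<kappa> \<delta> sw by (auto simp: l_def powr_powr)
  have lw: "l powr \<delta> * W \<le> \<kappa> / 2" if "0 \<le> W" "W \<le> suminf w" for W
  proof -
    have "\<kappa> / (2 * (suminf w + 1)) * W \<le> \<kappa> / (2 * (suminf w + 1)) * (suminf w + 1)"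
      using \<kappa> sw that by (intro mult_left_mono) auto
    also have "\<dots> = \<kappa> / 2" using sw by (simp add: field_simps)
    finally show ?thesis by (simp add: l(2))
  qed
  obtain C x0 where C: "C \<ge> 0" "x0 > 0"
    "\<And>x i. x \<ge> x0 \<Longrightarrow> (\<integral>\<^sup>+\<omega>. ennreal (\<bar>Z i \<omega>\<bar> powr \<delta> * indicator {\<omega>. \<bar>Z i \<omega>\<bar> > x} \<omega>) \<partial>M) \<le> ennreal (C * x powr \<delta> * T x)"
    using truncated_moment_bound[OF \<delta>] by blast
  have "filterlim (\<lambda>n. l * a n) at_top sequentially"
    by (rule filterlim_tendsto_pos_mult_at_top[OF tendsto_const l(1) a_top])
  then have "\<forall>\<^sub>F n in sequentially. l * a n \<ge> x0" unfolding filterlim_at_top by blast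
  moreover have "\<forall>\<^sub>F n in sequentially. real n * T (l * a n) < l powr (- \<alpha>) + 1"
    using order_tendstoD(2)[OF scaled_tail[OF l(1)]] by simp
  ultimately have "\<forall>\<^sub>F n in sequentially. l * a n \<ge> x0 \<and> real n * T (l * a n) \<le> l powr (- \<alpha>) + 1 \<and> n \<ge> 1"
    using eventually_ge_at_top[of 1] by eventually_elim auto
  then obtain n0 where n0: "\<And>n. n \<ge> n0 \<Longrightarrow> l * a n \<ge> x0 \<and> real n * T (l * a n) \<le> l powr (- \<alpha>) + 1 \<and> n \<ge> 1"
    unfolding eventually_sequentially by blast
  show ?thesis
  proof (rule that[of "2 / \<kappa> * C * l powr \<delta> * (l powr (- \<alpha>) + 1)" n0])
    show "0 \<le> 2 / \<kappa> * C * l powr \<delta> * (l powr (- \<alpha>) + 1)" using \<kappa> C by simp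
    fix n m i assume "n \<ge> n0"
    note n = n0[OF this]
    have an: "a n > 0" using a_pos n by auto
    let ?x = "l * a n"
    define W where "W = (\<Sum>j. w (j + m))"
    have sm: "summable (\<lambda>j. w (j + m))" using w(2) by (simp add: summable_iff_shift)
    have W: "0 \<le> W" unfolding W_def by (intro suminf_nonneg sm w)
    have W_le: "W \<le> suminf w"
      unfolding W_def using suminf_split_initial_segment[OF w(2), of m] sum_nonneg[of "{..<m}" w] w(1) by simp
    have W_sum: "(\<Sum>j. ennreal (w (j + m) * c)) = ennreal (W * c)" if "c \<ge> 0" for c
      using that w(1) sums_mult2[OF summable_sums[OF sm], of c] unfolding W_def by (intro suminf_ennreal_eq) auto
    define R where "R \<omega> = (\<Sum>j. ennreal (w (j + m)) * ennreal (\<bar>Z (i - int j) \<omega>\<bar> powr \<delta> * indicator {\<omega>. \<bar>Z (i - int j) \<omega>\<bar> > ?x} \<omega>))" for \<omega>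
    have Rm [measurable]: "R \<in> borel_measurable M" unfolding R_def by measurable
    have V: "(\<Sum>j. ennreal (w (j + m) * \<bar>Z (i - int j) \<omega>\<bar> powr \<delta>)) \<le> ennreal (\<kappa> / 2 * a n powr \<delta>) + R \<omega>" for \<omega>
    proof -
      have "(\<Sum>j. ennreal (w (j + m) * \<bar>Z (i - int j) \<omega>\<bar> powr \<delta>))
          \<le> (\<Sum>j. ennreal (w (j + m) * ?x powr \<delta>) + ennreal (w (j + m)) * ennreal (\<bar>Z (i - int j) \<omega>\<bar> powr \<delta> * indicator {\<omega>. \<bar>Z (i - int j) \<omega>\<bar> > ?x} \<omega>))"
      proof (intro suminf_le allI)
        fix j
        have "\<bar>Z (i - int j) \<omega>\<bar> powr \<delta> \<le> ?x powr \<delta> + \<bar>Z (i - int j) \<omega>\<bar> powr \<delta> * indicator {\<omega>. \<bar>Z (i - int j) \<omega>\<bar> > ?x} \<omega>"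
          using \<delta>(1) powr_mono2[of \<delta> "\<bar>Z (i - int j) \<omega>\<bar>" ?x] by (auto split: split_indicator)
        then have "w (j + m) * \<bar>Z (i - int j) \<omega>\<bar> powr \<delta>
            \<le> w (j + m) * ?x powr \<delta> + w (j + m) * (\<bar>Z (i - int j) \<omega>\<bar> powr \<delta> * indicator {\<omega>. \<bar>Z (i - int j) \<omega>\<bar> > ?x} \<omega>)"
          using mult_left_mono[OF _ w(1)[of "j + m"]] by (simp add: distrib_left[symmetric])
        then show "ennreal (w (j + m) * \<bar>Z (i - int j) \<omega>\<bar> powr \<delta>)
          \<le> ennreal (w (j + m) * ?x powr \<delta>) + ennreal (w (j + m)) * ennreal (\<bar>Z (i - int j) \<omega>\<bar> powr \<delta> * indicator {\<omega>. \<bar>Z (i - int j) \<omega>\<bar> > ?x} \<omega>)"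
          using w(1) by (simp add: ennreal_mult[symmetric] ennreal_plus[symmetric] ennreal_leI del: ennreal_plus)
      qed auto
      also have "\<dots> = (\<Sum>j. ennreal (w (j + m) * ?x powr \<delta>)) + R \<omega>"
        unfolding R_def by (rule suminf_add[symmetric]) auto
      also have "(\<Sum>j. ennreal (w (j + m) * ?x powr \<delta>)) = ennreal (W * ?x powr \<delta>)" by (rule W_sum) simp
      also have "W * ?x powr \<delta> = l powr \<delta> * W * a n powr \<delta>" using l an by (simp add: powr_mult)
      also have "ennreal (l powr \<delta> * W * a n powr \<delta>) \<le> ennreal (\<kappa> / 2 * a n powr \<delta>)"
        by (intro ennreal_leI mult_right_mono lw W W_le) simp
      finally show ?thesis by (simp add: add_right_mono)
    qed
    \<comment> \<open>Markov's inequality at the level \<kappa> a_n^\<delta> / 2, the half left over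
      by the bounded part.\<close>
    let ?c = "2 / (\<kappa> * a n powr \<delta>)"
    have c: "?c > 0" using \<kappa> an by simp
    have nn: "0 \<le> W * (C * ?x powr \<delta> * T ?x)" using W C(1) T_nonneg by simp
    have "{\<omega> \<in> space M. (\<Sum>j. ennreal (w (j + m) * \<bar>Z (i - int j) \<omega>\<bar> powr \<delta>)) > ennreal (\<kappa> * a n powr \<delta>)}
        \<subseteq> {\<omega> \<in> space M. 1 \<le> ennreal ?c * R \<omega>}"
    proof safe
      fix \<omega> assume \<omega>: "(\<Sum>j. ennreal (w (j + m) * \<bar>Z (i - int j) \<omega>\<bar> powr \<delta>)) > ennreal (\<kappa> * a n powr \<delta>)"
      have less: "ennreal (\<kappa> * a n powr \<delta>) < ennreal (\<kappa> / 2 * a n powr \<delta>) + R \<omega>"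
        using \<omega> V[of \<omega>] by (rule order_less_le_trans)
      then show "1 \<le> ennreal ?c * R \<omega>"
      proof (cases "R \<omega>" rule: ennreal_cases)
        case (real r)
        then have "\<kappa> * a n powr \<delta> < \<kappa> / 2 * a n powr \<delta> + r"
          using less \<kappa> by (simp add: ennreal_plus[symmetric] ennreal_less_iff del: ennreal_plus)
        then have "1 \<le> ?c * r" using \<kappa> an by (simp add: field_simps)
        then show ?thesis using real c by (simp add: ennreal_mult[symmetric] del: ennreal_1 add: ennreal_1[symmetric])
      next
        case top
        then show ?thesis using c \<kappa> an by (simp add: ennreal_mult_top)
      qed
    qed
    then have "emeasure M {\<omega> \<in> space M. (\<Sum>j. ennreal (w (j + m) * \<bar>Z (i - int j) \<omega>\<bar> powr \<delta>)) > ennreal (\<kappa> * a n powr \<delta>)}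
        \<le> emeasure M {\<omega> \<in> space M. 1 \<le> ennreal ?c * R \<omega>}"
      by (intro emeasure_mono) auto
    also have "\<dots> \<le> ennreal ?c * (\<integral>\<^sup>+\<omega>. R \<omega> * indicator (space M) \<omega> \<partial>M)"
      by (rule nn_integral_Markov_inequality) auto
    also have "(\<integral>\<^sup>+\<omega>. R \<omega> * indicator (space M) \<omega> \<partial>M) = (\<integral>\<^sup>+\<omega>. R \<omega> \<partial>M)" by (intro nn_integral_cong) simp
    also have "(\<integral>\<^sup>+\<omega>. R \<omega> \<partial>M) = (\<Sum>j. ennreal (w (j + m)) * (\<integral>\<^sup>+\<omega>. ennreal (\<bar>Z (i - int j) \<omega>\<bar> powr \<delta> * indicator {\<omega>. \<bar>Z (i - int j) \<omega>\<bar> > ?x} \<omega>) \<partial>M))"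
      unfolding R_def by (subst nn_integral_suminf) (auto simp: nn_integral_cmult)
    also have "\<dots> \<le> (\<Sum>j. ennreal (w (j + m)) * ennreal (C * ?x powr \<delta> * T ?x))"
      using n by (intro suminf_le mult_left_mono C(3)) auto
    also have "\<dots> = (\<Sum>j. ennreal (w (j + m) * (C * ?x powr \<delta> * T ?x)))"
      using w(1) C(1) T_nonneg by (intro suminf_cong) (simp add: ennreal_mult)
    also have "\<dots> = ennreal (W * (C * ?x powr \<delta> * T ?x))" using C(1) T_nonneg by (intro W_sum) simp
    finally have "emeasure M {\<omega> \<in> space M. (\<Sum>j. ennreal (w (j + m) * \<bar>Z (i - int j) \<omega>\<bar> powr \<delta>)) > ennreal (\<kappa> * a n powr \<delta>)}
        \<le> ennreal ?c * ennreal (W * (C * ?x powr \<delta> * T ?x))" by (simp add: mult_left_mono)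
    also have "\<dots> = ennreal (?c * (W * (C * ?x powr \<delta> * T ?x)))"
      by (rule ennreal_mult[OF less_imp_le[OF c] nn, symmetric])
    finally have "prob {\<omega> \<in> space M. (\<Sum>j. ennreal (w (j + m) * \<bar>Z (i - int j) \<omega>\<bar> powr \<delta>)) > ennreal (\<kappa> * a n powr \<delta>)}
        \<le> ?c * (W * (C * ?x powr \<delta> * T ?x))"
      unfolding emeasure_eq_measure using c nn by (subst (asm) ennreal_le_iff) (auto simp only: mult_nonneg_nonneg less_imp_le)
    also have "\<dots> = 2 / \<kappa> * C * l powr \<delta> * T ?x * W"
      using l an by (simp add: powr_mult field_simps)
    finally have "real n * prob {\<omega> \<in> space M. (\<Sum>j. ennreal (w (j + m) * \<bar>Z (i - int j) \<omega>\<bar> powr \<delta>)) > ennreal (\<kappa> * a n powr \<delta>)}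
        \<le> real n * (2 / \<kappa> * C * l powr \<delta> * T ?x * W)" by (rule mult_left_mono) simp
    also have "\<dots> = 2 / \<kappa> * C * l powr \<delta> * W * (real n * T ?x)" by (simp add: algebra_simps)
    also have "\<dots> \<le> 2 / \<kappa> * C * l powr \<delta> * W * (l powr (- \<alpha>) + 1)"
      using n \<kappa> C(1) W by (intro mult_left_mono) auto
    finally show "real n * prob {\<omega> \<in> space M. (\<Sum>j. ennreal (w (j + m) * \<bar>Z (i - int j) \<omega>\<bar> powr \<delta>)) > ennreal (\<kappa> * a n powr \<delta>)}
      \<le> 2 / \<kappa> * C * l powr \<delta> * (l powr (- \<alpha>) + 1) * (\<Sum>j. w (j + m))"
      by (simp add: W_def mult.commute mult.left_commute)
  qed
qed

end

text \<open>With S the sum of the b_j^\<delta>, b_j^\<delta> \<le> S gives b_j \<le> b_j^\<delta>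
  S^(1 / \<delta> - 1), the exponent being nonnegative as \<delta> \<le> 1; summation yields S^(1 /
  \<delta>).\<close>

lemma suminf_le_powr_suminf:
  fixes b :: "nat \<Rightarrow> real"
  assumes b: "\<And>j. 0 \<le> b j" and \<delta>: "0 < \<delta>" "\<delta> \<le> 1" and sm: "summable (\<lambda>j. b j powr \<delta>)"
  shows "summable b" "suminf b \<le> (\<Sum>j. b j powr \<delta>) powr (1 / \<delta>)"
proof -
  define S where "S = (\<Sum>j. b j powr \<delta>)"
  have S: "0 \<le> S" unfolding S_def by (intro suminf_nonneg sm) simp
  have le: "b j \<le> b j powr \<delta> * S powr (1 / \<delta> - 1)" for j
  proof (cases "b j = 0")
    case False
    then have bj: "b j > 0" using b[of j] by simp
    have "b j powr \<delta> \<le> S"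
      using sum_le_suminf[OF sm, of "{j}"] by (simp add: S_def)
    then have "(b j powr \<delta>) powr (1 / \<delta> - 1) \<le> S powr (1 / \<delta> - 1)"
      using \<delta> by (intro powr_mono2) auto
    then have "b j powr \<delta> * (b j powr \<delta>) powr (1 / \<delta> - 1) \<le> b j powr \<delta> * S powr (1 / \<delta> - 1)"
      by (intro mult_left_mono) auto
    moreover have "b j powr \<delta> * (b j powr \<delta>) powr (1 / \<delta> - 1) = b j"
      using bj \<delta> by (simp add: powr_powr powr_add[symmetric] algebra_simps)
    ultimately show ?thesis by simp
  qed simp
  have sm2: "summable (\<lambda>j. b j powr \<delta> * S powr (1 / \<delta> - 1))" by (rule summable_mult2[OF sm])
  show sb: "summable b" by (rule summable_comparison_test'[OF sm2, of 0]) (use le b in auto)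
  have "suminf b \<le> (\<Sum>j. b j powr \<delta> * S powr (1 / \<delta> - 1))" by (rule suminf_le[OF le sb sm2])
  also have "\<dots> = S * S powr (1 / \<delta> - 1)" using suminf_mult2[OF sm] by (simp add: S_def)
  also have "\<dots> = S powr (1 / \<delta>)" using S by (cases "S = 0") (simp_all add: powr_mult_base)
  finally show "suminf b \<le> (\<Sum>j. b j powr \<delta>) powr (1 / \<delta>)" by (simp add: S_def)
qed

section \<open>The Laplace functional of the scaled sequence\<close>

text \<open>Bonferroni inequalities in product form, by induction: a further factor x changes the
  defect by (1 - x)(1 - P), where P is the product so far, and the first inequality bounds 1 - P by
  a sum.\<close>

lemma one_minus_prod_approx:
  fixes x :: "nat \<Rightarrow> real"
  assumes x: "\<And>i. 0 \<le> x i" "\<And>i. x i \<le> 1"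
  shows "1 - (\<Prod>i=1..r. x i) \<le> (\<Sum>i=1..r. 1 - x i)"
    and "(\<Sum>i=1..r. 1 - x i) - (1 - (\<Prod>i=1..r. x i)) \<le> (\<Sum>j=1..r. \<Sum>i\<in>{1..<j}. (1 - x i) * (1 - x j))"
proof -
  have "1 - (\<Prod>i=1..r. x i) \<le> (\<Sum>i=1..r. 1 - x i) \<and>
    (\<Sum>i=1..r. 1 - x i) - (1 - (\<Prod>i=1..r. x i)) \<le> (\<Sum>j=1..r. \<Sum>i\<in>{1..<j}. (1 - x i) * (1 - x j))"
  proof (induction r)
    case (Suc r)
    let ?P = "\<Prod>i=1..r. x i"
    have P: "?P \<le> 1" by (rule prod_le_1) (use x in auto)
    have "(1 - x (Suc r)) * (1 - ?P) \<le> (1 - x (Suc r)) * (\<Sum>i=1..r. 1 - x i)"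
      using Suc.IH x by (intro mult_left_mono) auto
    also have "\<dots> = (\<Sum>i\<in>{1..<Suc r}. (1 - x i) * (1 - x (Suc r)))"
      by (simp add: sum_distrib_left mult.commute atLeastLessThanSuc_atLeastAtMost)
    finally have A: "(1 - x (Suc r)) * (1 - ?P) \<le> (\<Sum>i\<in>{1..<Suc r}. (1 - x i) * (1 - x (Suc r)))" .
    have B: "0 \<le> (1 - x (Suc r)) * (1 - ?P)" using x P by simp
    have D: "(\<Sum>i=1..Suc r. 1 - x i) - (1 - (\<Prod>i=1..Suc r. x i))
        = (\<Sum>i=1..r. 1 - x i) - (1 - ?P) + (1 - x (Suc r)) * (1 - ?P)"
      by (simp add: algebra_simps)
    have E: "(\<Sum>j=1..Suc r. \<Sum>i\<in>{1..<j}. (1 - x i) * (1 - x j))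
        = (\<Sum>j=1..r. \<Sum>i\<in>{1..<j}. (1 - x i) * (1 - x j)) + (\<Sum>i\<in>{1..<Suc r}. (1 - x i) * (1 - x (Suc r)))"
      by simp
    show ?case using Suc.IH A B D E by linarith
  qed simp
  then show "1 - (\<Prod>i=1..r. x i) \<le> (\<Sum>i=1..r. 1 - x i)"
    "(\<Sum>i=1..r. 1 - x i) - (1 - (\<Prod>i=1..r. x i)) \<le> (\<Sum>j=1..r. \<Sum>i\<in>{1..<j}. (1 - x i) * (1 - x j))" by auto
qed

text \<open>Pairs are regrouped by lag. The lag is written i - 1 with i \<ge> 2, the form in which
  condition D' counts pairs with the first variable.\<close>

lemma sum_lag_le:
  fixes Q :: "nat \<Rightarrow> real"
  assumes "\<And>l. 0 \<le> Q l"
  shows "(\<Sum>j=1..r. \<Sum>i\<in>{1..<j}. Q (j - i)) \<le> real r * (\<Sum>i=2..r. Q (i - 1))"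
proof -
  have "(\<Sum>i\<in>{1..<j}. Q (j - i)) \<le> (\<Sum>i=2..r. Q (i - 1))" if "j \<in> {1..r}" for j
  proof -
    have "(\<Sum>i\<in>{1..<j}. Q (j - i)) = (\<Sum>i=2..j. Q (i - 1))"
      by (rule sum.reindex_bij_witness[of _ "\<lambda>i. j + 1 - i" "\<lambda>i. j + 1 - i"]) auto
    also have "\<dots> \<le> (\<Sum>i=2..r. Q (i - 1))" using that assms by (intro sum_mono2) auto
    finally show ?thesis .
  qed
  then have "(\<Sum>j=1..r. \<Sum>i\<in>{1..<j}. Q (j - i)) \<le> (\<Sum>j=1..r. \<Sum>i=2..r. Q (i - 1))" by (rule sum_mono)
  then show ?thesis by simp
qed

lemma sum_blocks:
  fixes f :: "nat \<Rightarrow> real"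
  shows "(\<Sum>k=1..K. \<Sum>i=1..r. f (i + (k - 1) * r)) = (\<Sum>l=1..K * r. f l)"
proof (induction K)
  case (Suc K)
  have "(\<Sum>l=1..Suc K * r. f l) = (\<Sum>l=1..K * r. f l) + (\<Sum>l=K * r + 1..K * r + r. f l)"
    by (subst sum.ub_add_nat[symmetric]) (auto simp: add.commute)
  also have "(\<Sum>l=K * r + 1..K * r + r. f l) = (\<Sum>i=1..r. f (i + K * r))"
    using sum.shift_bounds_cl_nat_ivl[of f 1 "K * r" r] by (simp add: add.commute)
  finally show ?case using Suc.IH by simp
qed simp

text \<open>For 0 \<le> x \<le> 1/2 one has - x - 2 x^2 \<le> ln (1 - x) \<le> - x, and the squares
  sum to at most the maximal term times the sum.\<close>

lemma prod_one_minus_tendsto: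
  fixes \<theta> :: "nat \<Rightarrow> nat \<Rightarrow> real" and K :: "nat \<Rightarrow> nat"
  assumes \<theta>: "\<And>n k. 0 \<le> \<theta> n k" and max: "\<And>n k. \<theta> n k \<le> \<epsilon> n" "\<epsilon> \<longlonglongrightarrow> 0"
    and sum: "(\<lambda>n. \<Sum>k=1..K n. \<theta> n k) \<longlonglongrightarrow> I"
  shows "(\<lambda>n. \<Prod>k=1..K n. 1 - \<theta> n k) \<longlonglongrightarrow> exp (- I)"
proof (rule tendsto_sandwich)
  have ev: "\<forall>\<^sub>F n in sequentially. \<epsilon> n < 1 / 2" using order_tendstoD(2)[OF max(2), of "1 / 2"] by simp
  have ln: "exp (- x - 2 * x\<^sup>2) \<le> 1 - x" "1 - x \<le> exp (- x)" if "0 \<le> x" "x \<le> 1 / 2" for x :: real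
  proof -
    have "- x - 2 * x\<^sup>2 \<le> ln (1 - x)" using that by (rule ln_one_minus_pos_lower_bound)
    then have "exp (- x - 2 * x\<^sup>2) \<le> exp (ln (1 - x))" by simp
    then show "exp (- x - 2 * x\<^sup>2) \<le> 1 - x" using that by simp
    show "1 - x \<le> exp (- x)" using exp_ge_add_one_self[of "- x"] by simp
  qed
  show "\<forall>\<^sub>F n in sequentially. exp (- (\<Sum>k=1..K n. \<theta> n k) - 2 * \<epsilon> n * (\<Sum>k=1..K n. \<theta> n k)) \<le> (\<Prod>k=1..K n. 1 - \<theta> n k)"
    using ev
  proof eventually_elim
    case (elim n)
    have le: "\<theta> n k \<le> 1 / 2" for k using max(1)[of n k] elim by linarith
    have "(\<Sum>k=1..K n. 2 * (\<theta> n k)\<^sup>2) \<le> (\<Sum>k=1..K n. 2 * \<epsilon> n * \<theta> n k)"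
      using \<theta> max(1) by (intro sum_mono) (auto simp: power2_eq_square intro: mult_right_mono)
    then have "exp (- (\<Sum>k=1..K n. \<theta> n k) - 2 * \<epsilon> n * (\<Sum>k=1..K n. \<theta> n k)) \<le> exp (\<Sum>k=1..K n. - \<theta> n k - 2 * (\<theta> n k)\<^sup>2)"
      by (simp add: sum_subtractf sum_negf sum_distrib_left)
    also have "\<dots> = (\<Prod>k=1..K n. exp (- \<theta> n k - 2 * (\<theta> n k)\<^sup>2))" by (rule exp_sum) simp
    also have "\<dots> \<le> (\<Prod>k=1..K n. 1 - \<theta> n k)" using ln(1) \<theta> le by (intro prod_mono) auto
    finally show ?case .
  qed
  show "\<forall>\<^sub>F n in sequentially. (\<Prod>k=1..K n. 1 - \<theta> n k) \<le> exp (- (\<Sum>k=1..K n. \<theta> n k))"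
    using ev
  proof eventually_elim
    case (elim n)
    have le: "\<theta> n k \<le> 1 / 2" for k using max(1)[of n k] elim by linarith
    have "(\<Prod>k=1..K n. 1 - \<theta> n k) \<le> (\<Prod>k=1..K n. exp (- \<theta> n k))"
    proof (intro prod_mono conjI)
      fix k show "0 \<le> 1 - \<theta> n k" using le[of k] by linarith
      show "1 - \<theta> n k \<le> exp (- \<theta> n k)" by (rule ln(2)[OF \<theta> le])
    qed
    then show ?case by (simp add: exp_sum[symmetric] sum_negf)
  qed
  have "(\<lambda>n. - (\<Sum>k=1..K n. \<theta> n k) - 2 * \<epsilon> n * (\<Sum>k=1..K n. \<theta> n k)) \<longlonglongrightarrow> - I - 2 * 0 * I"
    by (intro tendsto_intros sum max(2))
  from tendsto_exp[OF this]
  show "(\<lambda>n. exp (- (\<Sum>k=1..K n. \<theta> n k) - 2 * \<epsilon> n * (\<Sum>k=1..K n. \<theta> n k))) \<longlonglongrightarrow> exp (- I)" by simp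
  show "(\<lambda>n. exp (- (\<Sum>k=1..K n. \<theta> n k))) \<longlonglongrightarrow> exp (- I)" by (intro tendsto_intros sum)
qed

lemma CK_plus_comp_measurable:
  assumes "f \<in> CK_plus" and [measurable]: "g \<in> borel_measurable M"
  shows "(\<lambda>\<omega>. f (t, ereal (g \<omega>))) \<in> borel_measurable M"
proof (rule measurable_compose[OF _ CK_plus_borel[OF assms(1)]])
  show "(\<lambda>\<omega>. (t, ereal (g \<omega>))) \<in> M \<rightarrow>\<^sub>M borel" unfolding borel_prod[symmetric] by measurable
qed

section \<open>Anticlustering and the blocked Laplace functional\<close>

locale scaled_heavy_tailed_sequence = heavy_tailed_sequence M Z L a \<alpha> p q
  for M :: "'a measure" and Z L a \<alpha> p q +
  fixes \<sigma> :: "int \<Rightarrow> real" and Y :: "int \<Rightarrow> 'a \<Rightarrow> real" and \<beta>1 \<beta>2 s :: real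
  assumes D': "cond_D' M Z a"
    and \<beta>1: "0 < \<beta>1" and \<sigma>_lower: "\<And>i. \<beta>1 \<le> \<sigma> i" and \<sigma>_upper: "\<And>i. \<sigma> i \<le> \<beta>2"
    and \<sigma>_mean: "(\<lambda>n. 1 / real n * (\<Sum>i = 1..n. \<sigma> (int i) powr \<alpha>)) \<longlonglongrightarrow> s powr \<alpha>"
    and Y: "\<And>i \<omega>. Y i \<omega> = \<sigma> i * Z i \<omega>"
    and A': "cond_A' M Y a"
begin

lemma \<sigma>_pos: "0 < \<sigma> i" using \<beta>1 \<sigma>_lower[of i] by linarith

lemma \<beta>2: "0 < \<beta>2" using \<sigma>_pos[of 0] \<sigma>_upper[of 0] by linarith

lemma Y_meas [measurable]: "Y i \<in> borel_measurable M"
proof -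
  have "(\<lambda>\<omega>. \<sigma> i * Z i \<omega>) \<in> borel_measurable M" by measurable
  then show ?thesis by (simp add: Y[abs_def])
qed

lemma abs_Y_le: "\<bar>Y i \<omega>\<bar> \<le> \<beta>2 * \<bar>Z i \<omega>\<bar>"
  using \<sigma>_upper[of i] \<sigma>_pos[of i] by (simp add: Y abs_mult mult_right_mono)

definition Q :: "real \<Rightarrow> nat \<Rightarrow> nat \<Rightarrow> real" where
  "Q v n l = prob {\<omega> \<in> space M. \<bar>Z 1 \<omega>\<bar> > v * a n \<and> \<bar>Z (1 + int l) \<omega>\<bar> > v * a n}"

lemma Q_nonneg: "0 \<le> Q v n l" by (simp add: Q_def)

lemma prob_two_exceed:
  assumes "l \<ge> 1"
  shows "prob {\<omega> \<in> space M. \<bar>Z i \<omega>\<bar> > v * a n \<and> \<bar>Z (i + int l) \<omega>\<bar> > v * a n} = Q v n l"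
  using stationary_two[of "{z. \<bar>z\<bar> > v * a n}" "{z. \<bar>z\<bar> > v * a n}" "int l" i] assms by (simp add: Q_def)

text \<open>For any fixed k, \<open>r n\<close> is eventually at most \<open>n div k\<close>, so the
  sum is dominated by the one in condition D'; k is fixed from the tolerance before n grows. Both
  the block lengths and constant window lengths are admissible.\<close>

lemma anticlustering:
  fixes r :: "nat \<Rightarrow> nat"
  assumes v: "v > 0" and r: "(\<lambda>n. real (r n) / real n) \<longlonglongrightarrow> 0"
  shows "(\<lambda>n. real n * (\<Sum>i = 2..r n. Q v n (i - 1))) \<longlonglongrightarrow> 0"
proof (rule tendstoI)
  fix e :: real assume e: "e > 0"
  let ?S = "\<lambda>n m. real n * (\<Sum>i = 2..m. measure M {\<omega> \<in> space M. \<bar>Z 1 \<omega>\<bar> / a n > v \<and> \<bar>Z (int i) \<omega>\<bar> / a n > v})"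
  have "(\<lambda>k. limsup (\<lambda>n. ereal (?S n (n div k)))) \<longlonglongrightarrow> 0"
    using D' v unfolding cond_D'_def by blast
  then have "\<forall>\<^sub>F k in sequentially. limsup (\<lambda>n. ereal (?S n (n div k))) < ereal e"
    using e by (intro order_tendstoD(2)) auto
  from eventually_happens'[OF sequentially_bot eventually_conj[OF this eventually_gt_at_top[of 0]]]
  obtain k where k: "limsup (\<lambda>n. ereal (?S n (n div k))) < ereal e" "k > 0" by auto
  have "\<forall>\<^sub>F n in sequentially. ereal (?S n (n div k)) < ereal e" by (rule Limsup_lessD[OF k(1)])
  moreover have "\<forall>\<^sub>F n in sequentially. real (r n) / real n < 1 / real k"
    using order_tendstoD(2)[OF r] k(2) by simp
  ultimately show "\<forall>\<^sub>F n in sequentially. dist (real n * (\<Sum>i = 2..r n. Q v n (i - 1))) 0 < e"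
    using eventually_ge_at_top[of 1]
  proof eventually_elim
    case (elim n)
    have "real (r n) * real k < real n" using elim k(2) by (simp add: field_simps)
    then have "r n * k < n" by (metis of_nat_less_iff of_nat_mult)
    then have rn: "r n \<le> n div k" using k(2) by (simp add: less_eq_div_iff_mult_less_eq)
    have an: "a n > 0" using a_pos elim by auto
    have "real n * (\<Sum>i = 2..r n. Q v n (i - 1)) \<le> real n * (\<Sum>i = 2..n div k. Q v n (i - 1))"
      using rn Q_nonneg by (intro mult_left_mono sum_mono2) auto
    also have "\<dots> = ?S n (n div k)"
    proof -
      have "Q v n (i - 1) = measure M {\<omega> \<in> space M. \<bar>Z 1 \<omega>\<bar> / a n > v \<and> \<bar>Z (int i) \<omega>\<bar> / a n > v}" if "i \<in> {2..n div k}" for i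
      proof -
        have "1 + int (i - 1) = int i" using that by auto
        then show ?thesis using an by (simp add: Q_def less_divide_eq)
      qed
      then show ?thesis by simp
    qed
    also have "\<dots> < e" using elim by simp
    finally show ?case using Q_nonneg by (simp add: sum_nonneg)
  qed
qed

lemma integral_stationary:
  fixes g :: "real \<Rightarrow> real"
  assumes "g \<in> borel_measurable borel"
  shows "(\<integral>\<omega>. g (Z i \<omega>) \<partial>M) = (\<integral>\<omega>. g (Z 1 \<omega>) \<partial>M)"
proof -
  have "distr M borel (Z i) = distr M borel (Z 1)"
  proof (rule measure_eqI)
    fix A assume "A \<in> sets (distr M borel (Z i))"
    then have A: "A \<in> sets borel" by simp
    show "emeasure (distr M borel (Z i)) A = emeasure (distr M borel (Z 1)) A"
      using stationary_one[OF A, of i] A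
      by (simp add: emeasure_distr emeasure_eq_measure vimage_def Int_def conj_commute)
  qed simp
  then show ?thesis using integral_distr[OF Z_meas[of i] assms] integral_distr[OF Z_meas[of 1] assms] by simp
qed

text \<open>|Y| \<le> \<beta>2 |Z| turns the radius u into a threshold for Z; the extra factor 2
  yields a strict inequality, to match the strict exceedances of condition D'.\<close>

lemma support_exceed:
  assumes u: "u > 0" "\<And>t y. \<bar>y\<bar> < ereal u \<Longrightarrow> h (t, y) = (0 :: real)" and n: "n \<ge> 1"
    and ne: "h (t, ereal (Y i \<omega> / a n)) \<noteq> 0"
  shows "\<bar>Z i \<omega>\<bar> > u / (2 * \<beta>2) * a n"
proof -
  have an: "a n > 0" using a_pos[OF n] .
  have "\<not> \<bar>ereal (Y i \<omega> / a n)\<bar> < ereal u" using u(2) ne by blast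
  then have "u * a n \<le> \<bar>Y i \<omega>\<bar>" using an by (simp add: not_less field_simps)
  also have "\<dots> \<le> \<beta>2 * \<bar>Z i \<omega>\<bar>" by (rule abs_Y_le)
  finally have "u * a n / \<beta>2 \<le> \<bar>Z i \<omega>\<bar>" using \<beta>2 by (simp add: field_simps)
  moreover have "u / (2 * \<beta>2) * a n < u * a n / \<beta>2" using u(1) an \<beta>2 by (simp add: field_simps)
  ultimately show ?thesis by linarith
qed

lemma expectation_le_tail:
  assumes u: "u > 0" "\<And>t y. \<bar>y\<bar> < ereal u \<Longrightarrow> h (t, y) = (0 :: real)" and n: "n \<ge> 1"
    and g: "\<And>\<omega>. \<bar>g \<omega>\<bar> \<le> c" "\<And>\<omega>. h (t, ereal (Y i \<omega> / a n)) = 0 \<Longrightarrow> h (t', ereal (Y i \<omega> / a n)) = 0 \<Longrightarrow> g \<omega> = 0"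
      "g \<in> borel_measurable M"
  shows "\<bar>\<integral>\<omega>. g \<omega> \<partial>M\<bar> \<le> c * T (u / (2 * \<beta>2) * a n)"
proof -
  let ?A = "{\<omega> \<in> space M. \<bar>Z i \<omega>\<bar> > u / (2 * \<beta>2) * a n}"
  have c: "0 \<le> c" using g(1) abs_ge_zero order_trans by blast
  have ig: "integrable M g" by (rule integrable_const_bound[of _ c]) (use g in auto)
  have A: "?A \<in> sets M" by measurable
  have "\<bar>\<integral>\<omega>. g \<omega> \<partial>M\<bar> \<le> (\<integral>\<omega>. \<bar>g \<omega>\<bar> \<partial>M)" by (rule integral_abs_bound)
  also have "\<dots> \<le> (\<integral>\<omega>. c * indicator ?A \<omega> \<partial>M)"
  proof (rule integral_mono)
    show "integrable M (\<lambda>\<omega>. c * indicator ?A \<omega>)"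
      using A by (intro integrable_mult_right integrable_real_indicator) (auto simp: emeasure_eq_measure)
    fix \<omega> assume "\<omega> \<in> space M"
    then show "\<bar>g \<omega>\<bar> \<le> c * indicator ?A \<omega>"
      using g(1)[of \<omega>] g(2)[of \<omega>] support_exceed[of u h n _ i \<omega>, OF u n] c
      by (cases "g \<omega> = 0") (auto split: split_indicator)
  qed (use ig in auto)
  also have "\<dots> = c * T (u / (2 * \<beta>2) * a n)" using A prob_abs_gt[of "u / (2 * \<beta>2) * a n" i] by simp
  finally show ?thesis .
qed

theorem Y_Laplace_limit:
  assumes h: "h \<in> CK_plus"
  shows "(\<lambda>n. \<integral>\<omega>. exp (- (\<Sum>i = 1..n. h (real i / real n, ereal (Y (int i) \<omega> / a n)))) \<partial>M)
    \<longlonglongrightarrow> exp (- (\<integral>z. 1 - exp (- h z) \<partial>intensity \<alpha> s p q))"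
proof -
  obtain u where u: "u > 0" "\<And>t y. \<bar>y\<bar> < ereal u \<Longrightarrow> h (t, y) = 0"
    using CK_plus_supportE[OF h] by blast
  define v where "v = u / (2 * \<beta>2)"
  have v: "v > 0" using u \<beta>2 by (simp add: v_def)
  \<comment> \<open>1 - exp (- h) is itself a test function with the same radius of vanishing; the
    limiting exponent is its integral.\<close>
  define H where "H z = 1 - exp (- h z)" for z
  have H: "H \<in> CK_plus" unfolding H_def[abs_def] by (rule CK_plus_one_minus_exp[OF h])
  have Hu: "H (t, y) = 0" if "\<bar>y\<bar> < ereal u" for t y using u(2)[OF that] by (simp add: H_def)
  have Hm: "(\<lambda>\<omega>. H (t, ereal (Y i \<omega> / a n))) \<in> borel_measurable M" for t i n
    by (rule CK_plus_comp_measurable[OF H]) measurable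
  have hm [measurable]: "(\<lambda>\<omega>. h (t, ereal (Y i \<omega> / a n))) \<in> borel_measurable M" for t i n
    by (rule CK_plus_comp_measurable[OF h]) measurable
  have H1: "0 \<le> H z" "H z \<le> 1" for z using CK_plusD(1)[OF h, of z] by (auto simp: H_def)
  obtain r where r: "\<And>n. r n > 0" "(\<lambda>n. real (r n) / real n) \<longlonglongrightarrow> 0"
    "\<And>f. f \<in> CK_plus \<Longrightarrow> (\<lambda>n. (\<integral>\<omega>. exp (- (\<Sum>i = 1..n. f (real i / real n, ereal (Y (int i) \<omega> / a n)))) \<partial>M)
       - (\<Prod>k = 1..n div r n. \<integral>\<omega>. exp (- (\<Sum>i = 1..r n.
           f (real (k * r n) / real n, ereal (Y (int (i + (k - 1) * r n)) \<omega> / a n)))) \<partial>M)) \<longlonglongrightarrow> 0"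
    using A' unfolding cond_A'_def by blast
  define K where "K n = n div r n" for n
  have Kr: "K n * r n \<le> n" "n - K n * r n < r n" for n
    using r(1)[of n] by (auto simp: K_def minus_div_mult_eq_mod)
  define E where "E n k = (\<integral>\<omega>. exp (- (\<Sum>i = 1..r n. h (real (k * r n) / real n, ereal (Y (int (i + (k - 1) * r n)) \<omega> / a n)))) \<partial>M)" for n k
  define b where "b n t l = (\<integral>\<omega>. H (t, ereal (Y (int l) \<omega> / a n)) \<partial>M)" for n :: nat and t :: real and l :: nat
  have b0: "0 \<le> b n t l" for n t l unfolding b_def using H1 by (intro integral_nonneg_AE) auto
  have bT: "b n t l \<le> T (v * a n)" if "n \<ge> 1" for n t l
  proof -
    have "\<bar>b n t l\<bar> \<le> 1 * T (u / (2 * \<beta>2) * a n)"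
      unfolding b_def
      by (rule expectation_le_tail[where h = H, OF u(1) Hu that, where t = t and t' = t and i = "int l"])
         (use H1 Hm in auto)
    then show ?thesis using b0[of n t l] by (simp add: v_def)
  qed
  have nT: "(\<lambda>n. real n * T (v * a n)) \<longlonglongrightarrow> v powr (- \<alpha>)" by (rule scaled_tail[OF v])
  have rT: "(\<lambda>n. real (r n) * T (v * a n)) \<longlonglongrightarrow> 0"
  proof -
    have "(\<lambda>n. real (r n) / real n * (real n * T (v * a n))) \<longlonglongrightarrow> 0 * v powr (- \<alpha>)"
      by (intro tendsto_mult r(2) nT)
    moreover have "\<forall>\<^sub>F n in sequentially. real (r n) / real n * (real n * T (v * a n)) = real (r n) * T (v * a n)"
      using eventually_ge_at_top[of 1] by eventually_elim simp
    ultimately show ?thesis by (simp add: Lim_transform_eventually)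
  qed
  have exceed: "\<bar>Z i \<omega>\<bar> > v * a n" if "n \<ge> 1" "h (t, ereal (Y i \<omega> / a n)) \<noteq> 0" for n t i \<omega>
    unfolding v_def by (rule support_exceed[where h = h, OF u(1) _ that]) (rule u(2))
  \<comment> \<open>Bonferroni bounds within a block, the error being the expected number of joint
    exceedances, counted by lag.\<close>
  have block: "1 - E n k \<le> (\<Sum>i = 1..r n. b n (real (k * r n) / real n) (i + (k - 1) * r n))"
    "(\<Sum>i = 1..r n. b n (real (k * r n) / real n) (i + (k - 1) * r n)) - (1 - E n k)
      \<le> real (r n) * (\<Sum>i = 2..r n. Q v n (i - 1))" if n: "n \<ge> 1" for n k
  proof -
    define x where "x i \<omega> = exp (- h (real (k * r n) / real n, ereal (Y (int (i + (k - 1) * r n)) \<omega> / a n)))" for i \<omega>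
    have x: "0 \<le> x i \<omega>" "x i \<omega> \<le> 1" for i \<omega> using CK_plusD(1)[OF h] by (auto simp: x_def)
    have xm [measurable]: "x i \<in> borel_measurable M" for i
      unfolding x_def by measurable
    have ix: "integrable M (x i)" for i by (rule integrable_const_bound[of _ 1]) (use x in auto)
    have i1x: "integrable M (\<lambda>\<omega>. 1 - x i \<omega>)" for i using ix by simp
    have px: "0 \<le> (\<Prod>i=1..r n. x i \<omega>)" "(\<Prod>i=1..r n. x i \<omega>) \<le> 1" for \<omega>
      using x by (auto intro: prod_nonneg prod_le_1)
    have ip: "integrable M (\<lambda>\<omega>. \<Prod>i=1..r n. x i \<omega>)"
      by (rule integrable_const_bound[of _ 1]) (use px in auto)
    have ixx: "integrable M (\<lambda>\<omega>. (1 - x i \<omega>) * (1 - x j \<omega>))" for i j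
      by (rule integrable_const_bound[of _ 1]) (use x in \<open>auto simp: abs_mult mult_le_one\<close>)
    have E: "E n k = (\<integral>\<omega>. (\<Prod>i=1..r n. x i \<omega>) \<partial>M)"
      by (simp add: E_def x_def exp_sum[symmetric] sum_negf)
    have bx: "b n (real (k * r n) / real n) (i + (k - 1) * r n) = (\<integral>\<omega>. 1 - x i \<omega> \<partial>M)" for i
      by (simp add: b_def x_def H_def)
    have sb: "(\<Sum>i = 1..r n. b n (real (k * r n) / real n) (i + (k - 1) * r n)) = (\<integral>\<omega>. (\<Sum>i=1..r n. 1 - x i \<omega>) \<partial>M)"
      unfolding bx using i1x by (subst Bochner_Integration.integral_sum) auto
    have E1: "1 - E n k = (\<integral>\<omega>. 1 - (\<Prod>i=1..r n. x i \<omega>) \<partial>M)"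
      unfolding E using ip by (simp add: prob_space)
    show "1 - E n k \<le> (\<Sum>i = 1..r n. b n (real (k * r n) / real n) (i + (k - 1) * r n))"
      unfolding sb E1
    proof (rule integral_mono)
      show "1 - (\<Prod>i=1..r n. x i \<omega>) \<le> (\<Sum>i=1..r n. 1 - x i \<omega>)" for \<omega>
        by (rule one_minus_prod_approx(1)) (rule x)+
    qed (use ip i1x in auto)
    have pair: "(\<integral>\<omega>. (1 - x i \<omega>) * (1 - x j \<omega>) \<partial>M) \<le> Q v n (j - i)" if ij: "i < j" for i j
    proof -
      let ?i = "int (i + (k - 1) * r n)"
      let ?A = "{\<omega> \<in> space M. \<bar>Z ?i \<omega>\<bar> > v * a n \<and> \<bar>Z (?i + int (j - i)) \<omega>\<bar> > v * a n}"
      have A: "?A \<in> sets M" by measurable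
      have eq: "?i + int (j - i) = int (j + (k - 1) * r n)" using ij by simp
      have "(\<integral>\<omega>. (1 - x i \<omega>) * (1 - x j \<omega>) \<partial>M) \<le> (\<integral>\<omega>. indicator ?A \<omega> \<partial>M)"
      proof (rule integral_mono[OF ixx])
        show "integrable M (indicator ?A :: _ \<Rightarrow> real)"
          using A by (intro integrable_real_indicator) (auto simp: emeasure_eq_measure)
        fix \<omega> assume \<omega>: "\<omega> \<in> space M"
        show "(1 - x i \<omega>) * (1 - x j \<omega>) \<le> indicator ?A \<omega>"
        proof (cases "x i \<omega> = 1 \<or> x j \<omega> = 1")
          case True
          then show ?thesis by auto
        next
          case False
          then have "h (real (k * r n) / real n, ereal (Y ?i \<omega> / a n)) \<noteq> 0"
            "h (real (k * r n) / real n, ereal (Y (int (j + (k - 1) * r n)) \<omega> / a n)) \<noteq> 0"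
            by (auto simp: x_def)
          then have "\<omega> \<in> ?A" using \<omega> exceed[OF n] by (simp only: eq mem_Collect_eq)
          moreover have "(1 - x i \<omega>) * (1 - x j \<omega>) \<le> 1" using x by (intro mult_le_one) auto
          ultimately show ?thesis by simp
        qed
      qed
      also have "\<dots> = prob ?A" using A by simp
      also have "\<dots> = Q v n (j - i)" by (rule prob_two_exceed) (use ij in auto)
      finally show ?thesis .
    qed
    have "(\<Sum>i = 1..r n. b n (real (k * r n) / real n) (i + (k - 1) * r n)) - (1 - E n k)
        = (\<integral>\<omega>. (\<Sum>i=1..r n. 1 - x i \<omega>) - (1 - (\<Prod>i=1..r n. x i \<omega>)) \<partial>M)"
      unfolding sb E1 using ip i1x by (subst Bochner_Integration.integral_diff) auto
    also have "\<dots> \<le> (\<integral>\<omega>. (\<Sum>j=1..r n. \<Sum>i\<in>{1..<j}. (1 - x i \<omega>) * (1 - x j \<omega>)) \<partial>M)"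
    proof (rule integral_mono)
      show "(\<Sum>i=1..r n. 1 - x i \<omega>) - (1 - (\<Prod>i=1..r n. x i \<omega>)) \<le> (\<Sum>j=1..r n. \<Sum>i\<in>{1..<j}. (1 - x i \<omega>) * (1 - x j \<omega>))" for \<omega>
        by (rule one_minus_prod_approx(2)) (rule x)+
      show "integrable M (\<lambda>\<omega>. \<Sum>j=1..r n. \<Sum>i\<in>{1..<j}. (1 - x i \<omega>) * (1 - x j \<omega>))"
        using ixx by (intro Bochner_Integration.integrable_sum)
    qed (use ip i1x in auto)
    also have "\<dots> = (\<Sum>j=1..r n. \<Sum>i\<in>{1..<j}. \<integral>\<omega>. (1 - x i \<omega>) * (1 - x j \<omega>) \<partial>M)"
      using ixx by (subst Bochner_Integration.integral_sum, simp, subst Bochner_Integration.integral_sum) auto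
    also have "\<dots> \<le> (\<Sum>j=1..r n. \<Sum>i\<in>{1..<j}. Q v n (j - i))"
      using pair by (intro sum_mono) auto
    also have "\<dots> \<le> real (r n) * (\<Sum>i = 2..r n. Q v n (i - 1))" by (rule sum_lag_le[OF Q_nonneg])
    finally show "(\<Sum>i = 1..r n. b n (real (k * r n) / real n) (i + (k - 1) * r n)) - (1 - E n k)
      \<le> real (r n) * (\<Sum>i = 2..r n. Q v n (i - 1))" .
  qed
  let ?B = "\<lambda>n. \<Sum>k=1..K n. \<Sum>i=1..r n. b n (real (k * r n) / real n) (i + (k - 1) * r n)"
  let ?I = "\<integral>z. H z \<partial>intensity \<alpha> s p q"
  have S: "(\<lambda>n. \<Sum>l = 1..n. b n (real l / real n) l) \<longlonglongrightarrow> ?I"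
  proof -
    have "b n t l = (\<integral>\<omega>. H (t, ereal (\<sigma> (int l) * Z 1 \<omega> / a n)) \<partial>M)" for n t l
      unfolding b_def Y by (rule integral_stationary) (rule CK_plus_comp_measurable[OF H], measurable)
    then show ?thesis
      using intensity_limit[of \<beta>1 "\<lambda>i. \<sigma> (int i)" \<beta>2 s H, OF \<beta>1 \<sigma>_lower \<sigma>_upper \<sigma>_mean H] by simp
  qed
  \<comment> \<open>Two corrections: inside a block the time moves from the block end to the time of
    the point, a shift below r_n / n; and the fewer than r_n points after the last full block are
    added.\<close>
  have BS: "(\<lambda>n. ?B n - (\<Sum>l = 1..n. b n (real l / real n) l)) \<longlonglongrightarrow> 0"
  proof (rule tendstoI)
    fix e :: real assume e: "e > 0"
    \<comment> \<open>An oscillation e' of H costs at most e' per exceedance, and the expected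
      number n T (v a_n) of exceedances is eventually below v^(-\<alpha>) + 1.\<close>
    define e' where "e' = e / 2 / (v powr (- \<alpha>) + 1)"
    have vp: "v powr (- \<alpha>) + 1 > 0" by (rule add_nonneg_pos) auto
    have e': "e' > 0" unfolding e'_def by (rule divide_pos_pos[OF half_gt_zero[OF e] vp])
    have "x / y * y = x" if "y > 0" for x y :: real using that by simp
    from this[OF vp, of "e / 2"] have e'v: "e' * (v powr (- \<alpha>) + 1) = e / 2" unfolding e'_def .
    obtain d where d: "d > 0" "\<And>t t' y y'. t \<in> {0..1} \<Longrightarrow> t' \<in> {0..1} \<Longrightarrow> \<bar>t - t'\<bar> < d \<Longrightarrow>
        \<bar>squash y - squash y'\<bar> < d \<Longrightarrow> \<bar>H (t, y) - H (t', y')\<bar> < e'"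
      using CK_plus_uniformly_continuous[OF H e'] by blast
    have "\<forall>\<^sub>F n in sequentially. real (r n) / real n < d" using order_tendstoD(2)[OF r(2) d(1)] .
    moreover have "\<forall>\<^sub>F n in sequentially. real (r n) * T (v * a n) < e / 2" using order_tendstoD(2)[OF rT, of "e / 2"] e by simp
    moreover have "\<forall>\<^sub>F n in sequentially. real n * T (v * a n) < v powr (- \<alpha>) + 1" using order_tendstoD(2)[OF nT, of "v powr (- \<alpha>) + 1"] by simp
    ultimately show "\<forall>\<^sub>F n in sequentially. dist (?B n - (\<Sum>l = 1..n. b n (real l / real n) l)) 0 < e"
      using eventually_ge_at_top[of 1]
    proof eventually_elim
      case (elim n)
      note n = elim(4)
      have term_le: "\<bar>b n (real (k * r n) / real n) (i + (k - 1) * r n) - b n (real (i + (k - 1) * r n) / real n) (i + (k - 1) * r n)\<bar> \<le> e' * T (v * a n)"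
        if ki: "k \<in> {1..K n}" "i \<in> {1..r n}" for k i
      proof -
        let ?l = "i + (k - 1) * r n" let ?t = "real (k * r n) / real n" let ?t' = "real (i + (k - 1) * r n) / real n"
        have krn: "k * r n \<le> n" using ki(1) Kr(1)[of n] by (meson atLeastAtMost_iff mult_le_mono1 order_trans)
        have kk: "k * r n = r n + (k - 1) * r n" using ki(1) by (cases k) auto
        have l: "?l \<le> k * r n" "k * r n - ?l < r n" using ki(2) kk by auto
        have t: "?t \<in> {0..1}" "?t' \<in> {0..1}" using krn l n by (auto simp del: of_nat_mult of_nat_add)
        have "?t - ?t' = real (k * r n - ?l) / real n"
          unfolding of_nat_diff[OF l(1)] by (simp only: diff_divide_distrib)
        then have "\<bar>?t - ?t'\<bar> = real (k * r n - ?l) / real n" by (simp only: abs_of_nonneg divide_nonneg_nonneg of_nat_0_le_iff)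
        also have "\<dots> \<le> real (r n) / real n"
          by (rule divide_right_mono[OF of_nat_mono[OF less_imp_le[OF l(2)]] of_nat_0_le_iff])
        finally have tt: "\<bar>?t - ?t'\<bar> < d" using elim(1) by linarith
        have int: "integrable M (\<lambda>\<omega>. H (t, ereal (Y (int ?l) \<omega> / a n)))" for t
          by (rule integrable_const_bound[of _ 1]) (use H1 Hm in auto)
        have "b n ?t ?l - b n ?t' ?l = (\<integral>\<omega>. H (?t, ereal (Y (int ?l) \<omega> / a n)) - H (?t', ereal (Y (int ?l) \<omega> / a n)) \<partial>M)"
          unfolding b_def using int by simp
        also have "\<bar>\<dots>\<bar> \<le> e' * T (u / (2 * \<beta>2) * a n)"
        proof (rule expectation_le_tail[where h = H, OF u(1) Hu n, where t = ?t and t' = ?t' and i = "int ?l"])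
          show "\<bar>H (?t, ereal (Y (int ?l) \<omega> / a n)) - H (?t', ereal (Y (int ?l) \<omega> / a n))\<bar> \<le> e'" for \<omega>
            using d(2)[OF t tt, of "ereal (Y (int ?l) \<omega> / a n)" "ereal (Y (int ?l) \<omega> / a n)"] d(1) by simp
        qed (use Hm in auto)
        finally show ?thesis by (simp add: v_def)
      qed
      let ?C = "\<Sum>k=1..K n. \<Sum>i=1..r n. b n (real (i + (k - 1) * r n) / real n) (i + (k - 1) * r n)"
      have C: "?C = (\<Sum>l=1..K n * r n. b n (real l / real n) l)"
        by (rule sum_blocks[of "\<lambda>l. b n (real l / real n) l"])
      have "\<bar>?B n - ?C\<bar> \<le> (\<Sum>k=1..K n. \<Sum>i=1..r n. e' * T (v * a n))"
        unfolding sum_subtractf[symmetric]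
        by (intro order_trans[OF sum_abs] sum_mono term_le)
      also have "\<dots> = e' * T (v * a n) * real (K n * r n)" by (simp add: mult_ac)
      also have "\<dots> \<le> e' * T (v * a n) * real n"
        by (rule mult_left_mono[OF of_nat_mono[OF Kr(1)] mult_nonneg_nonneg[OF less_imp_le[OF e'] T_nonneg]])
      also have "\<dots> = e' * (real n * T (v * a n))" by simp
      also have "\<dots> \<le> e' * (v powr (- \<alpha>) + 1)" using elim(3) e' by (intro mult_left_mono) auto
      finally have 1: "\<bar>?B n - ?C\<bar> \<le> e / 2" using e'v by simp
      have "(\<Sum>l = 1..n. b n (real l / real n) l) = ?C + (\<Sum>l = K n * r n + 1..n. b n (real l / real n) l)"
        unfolding C using sum.ub_add_nat[of 1 "K n * r n" "\<lambda>l. b n (real l / real n) l" "n - K n * r n"] Kr(1)[of n] by simp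
      moreover have "(\<Sum>l = K n * r n + 1..n. b n (real l / real n) l) \<le> (\<Sum>l = K n * r n + 1..n. T (v * a n))"
        by (intro sum_mono bT n)
      moreover have "(\<Sum>l = K n * r n + 1..n. T (v * a n)) \<le> real (r n) * T (v * a n)"
      proof -
        have "(\<Sum>l = K n * r n + 1..n. T (v * a n)) = real (n - K n * r n) * T (v * a n)"
          by (simp only: sum_constant card_atLeastAtMost) simp
        then show ?thesis using mult_right_mono[OF of_nat_mono[OF less_imp_le[OF Kr(2)]] T_nonneg] by (simp only:)
      qed
      moreover have "0 \<le> (\<Sum>l = K n * r n + 1..n. b n (real l / real n) l)" by (intro sum_nonneg b0)
      ultimately have "\<bar>?B n - (\<Sum>l = 1..n. b n (real l / real n) l)\<bar> < e" using 1 elim(2) unfolding abs_less_iff abs_le_iff by linarith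
      then show ?case by (simp add: dist_real_def)
    qed
  qed
  have B: "?B \<longlonglongrightarrow> ?I" using tendsto_add[OF BS S] by simp
  have E1: "E n k \<le> 1" for n k
    unfolding E_def
  proof (rule integral_le_const)
    let ?g = "\<lambda>\<omega>. exp (- (\<Sum>i = 1..r n. h (real (k * r n) / real n, ereal (Y (int (i + (k - 1) * r n)) \<omega> / a n))))"
    have le: "?g \<omega> \<le> 1" for \<omega> using CK_plusD(1)[OF h] by (simp add: sum_nonneg)
    show "integrable M ?g" by (rule integrable_const_bound[of _ 1]) (use le in simp_all)
    show "AE \<omega> in M. ?g \<omega> \<le> 1" using le by (intro AE_I2)
  qed
  \<comment> \<open>The Bonferroni deficit is at most k_n r_n \<le> n times the lag sum, which
    vanishes by anticlustering.\<close>
  have sum\<theta>: "(\<lambda>n. \<Sum>k=1..K n. 1 - E n k) \<longlonglongrightarrow> ?I"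
  proof -
    have "(\<lambda>n. ?B n - (\<Sum>k=1..K n. 1 - E n k)) \<longlonglongrightarrow> 0"
    proof (rule tendsto_sandwich[OF _ _ tendsto_const anticlustering[OF v r(2)]])
      show "\<forall>\<^sub>F n in sequentially. 0 \<le> ?B n - (\<Sum>k=1..K n. 1 - E n k)"
        using eventually_ge_at_top[of 1]
      proof eventually_elim
        case (elim n)
        have "(\<Sum>k=1..K n. 1 - E n k) \<le> ?B n" by (intro sum_mono block(1) elim)
        then show ?case by linarith
      qed
      show "\<forall>\<^sub>F n in sequentially. ?B n - (\<Sum>k=1..K n. 1 - E n k) \<le> real n * (\<Sum>i = 2..r n. Q v n (i - 1))"
        using eventually_ge_at_top[of 1]
      proof eventually_elim
        case (elim n)
        have "?B n - (\<Sum>k=1..K n. 1 - E n k) \<le> (\<Sum>k=1..K n. real (r n) * (\<Sum>i = 2..r n. Q v n (i - 1)))"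
          unfolding sum_subtractf[symmetric] by (intro sum_mono block(2) elim)
        also have "\<dots> = real (K n * r n) * (\<Sum>i = 2..r n. Q v n (i - 1))" by (simp add: mult.assoc)
        also have "\<dots> \<le> real n * (\<Sum>i = 2..r n. Q v n (i - 1))"
          using Kr(1)[of n] Q_nonneg by (intro mult_right_mono sum_nonneg) (auto simp del: of_nat_mult)
        finally show ?case .
      qed
    qed
    from tendsto_diff[OF B this] show ?thesis by simp
  qed
  have "(\<lambda>n. \<Prod>k=1..K n. 1 - (1 - E n k)) \<longlonglongrightarrow> exp (- ?I)"
  proof (rule prod_one_minus_tendsto[OF _ _ _ sum\<theta>])
    show "0 \<le> 1 - E n k" for n k using E1[of n k] by simp
    \<comment> \<open>At n = 0 nothing is known about \<open>a 0\<close>; the trivial bound 1 serves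
      there.\<close>
    show "1 - E n k \<le> (if n \<ge> 1 then real (r n) * T (v * a n) else 1)" for n k
    proof (cases "n \<ge> 1")
      case True
      have "1 - E n k \<le> (\<Sum>i = 1..r n. T (v * a n))"
        using block(1)[OF True] by (rule order_trans) (intro sum_mono bT True)
      then show ?thesis using True by simp
    next
      case False
      have "0 \<le> E n k" unfolding E_def by (intro integral_nonneg_AE) auto
      then show ?thesis using False by simp
    qed
    show "(\<lambda>n. if n \<ge> 1 then real (r n) * T (v * a n) else 1) \<longlonglongrightarrow> 0"
    proof (rule Lim_transform_eventually[OF rT])
      show "\<forall>\<^sub>F n in sequentially. real (r n) * T (v * a n) = (if n \<ge> 1 then real (r n) * T (v * a n) else 1)"
        using eventually_ge_at_top[of 1] by eventually_elim simp
    qed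
  qed
  then have "(\<lambda>n. \<Prod>k=1..K n. E n k) \<longlonglongrightarrow> exp (- ?I)" by simp
  from tendsto_add[OF r(3)[OF h] this[unfolded K_def E_def]] show ?thesis by (simp add: H_def)
qed

end

section \<open>The limiting cluster process\<close>

lemma slab_approx_finite:
  assumes "\<And>k::nat. finite {i \<in> I. x i \<in> slab (1 / real (Suc k))}" "u > 0"
  shows "finite {i \<in> I. x i \<in> slab u}"
proof -
  obtain k where k: "1 / real (Suc k) < u" using nat_approx_posE[OF assms(2)] by auto
  have "slab u \<subseteq> slab (1 / real (Suc k))"
    unfolding slab_def using k by (auto intro: order_trans[of _ "ereal u"] less_imp_le)
  then have "{i \<in> I. x i \<in> slab u} \<subseteq> {i \<in> I. x i \<in> slab (1 / real (Suc k))}" by auto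
  then show ?thesis using assms(1) finite_subset by blast
qed

text \<open>Membership in \<open>Mp\<close> becomes countably many conditions on series of
  indicators, hence a measurable event when the points are random.\<close>

lemma dirac_sum_nat_in_Mp_iff:
  fixes x :: "nat \<Rightarrow> real \<times> ereal"
  shows "dirac_sum UNIV x \<in> Mp \<longleftrightarrow> (\<forall>k::nat. (\<Sum>i. indicator (slab (1 / real (Suc k))) (x i) :: ennreal) < \<infinity>)"
proof -
  have "(\<Sum>i. indicator (slab u) (x i) :: ennreal) < \<infinity> \<longleftrightarrow> finite {i \<in> UNIV. x i \<in> slab u}" if "u > 0" for u
  proof -
    have "(\<Sum>i. indicator (slab u) (x i) :: ennreal) = emeasure (dirac_sum UNIV x) (slab u)"
      by (simp add: emeasure_dirac_sum[OF slab_sets[OF that]] nn_integral_count_space_nat)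
    also have "\<dots> = emeasure (count_space UNIV) {i \<in> UNIV. x i \<in> slab u}"
      by (rule emeasure_dirac_sum_count[OF slab_sets[OF that]])
    finally show ?thesis by (simp add: emeasure_count_space of_nat_less_top)
  qed
  then have "(\<forall>k::nat. (\<Sum>i. indicator (slab (1 / real (Suc k))) (x i) :: ennreal) < \<infinity>)
      \<longleftrightarrow> (\<forall>k::nat. finite {i \<in> UNIV. x i \<in> slab (1 / real (Suc k))})" by simp
  also have "\<dots> \<longleftrightarrow> (\<forall>u>0. finite {i \<in> UNIV. x i \<in> slab u})"
  proof (intro iffI allI impI)
    fix u :: real assume "\<forall>k::nat. finite {i \<in> UNIV. x i \<in> slab (1 / real (Suc k))}" "u > 0"
    then show "finite {i \<in> UNIV. x i \<in> slab u}" by (intro slab_approx_finite[of UNIV x u]) auto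
  next
    fix k assume "\<forall>u>0. finite {i \<in> UNIV. x i \<in> slab u}"
    then show "finite {i \<in> UNIV. x i \<in> slab (1 / real (Suc k))}" by (simp only: zero_less_divide_1_iff of_nat_0_less_iff zero_less_Suc)
  qed
  finally show ?thesis by (simp add: dirac_sum_in_Mp_iff)
qed

text \<open>The series is defined for every configuration and measurable in its points; it stands in
  for the integral where measurability is at stake.\<close>

lemma integral_dirac_sum_series:
  fixes x :: "nat \<Rightarrow> real \<times> ereal"
  assumes "dirac_sum UNIV x \<in> Mp" and f: "f \<in> CK_plus"
  shows "(\<integral>z. f z \<partial>dirac_sum UNIV x) = enn2real (\<Sum>i. ennreal (f (x i)))"
proof -
  obtain u where u: "u > 0" "\<And>t y. \<bar>y\<bar> < ereal u \<Longrightarrow> f (t, y) = 0"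
    using CK_plus_supportE[OF f] by blast
  have fin: "finite {i \<in> UNIV. x i \<in> slab u}" using assms(1) u(1) by (simp add: dirac_sum_in_Mp_iff)
  have "(\<Sum>i. ennreal (f (x i))) = (\<Sum>i \<in> {i \<in> UNIV. x i \<in> slab u}. ennreal (f (x i)))"
    using not_slab_vanish[OF f, of u] u(2) by (intro suminf_finite[OF fin]) simp
  also have "\<dots> = ennreal (\<Sum>i \<in> {i \<in> UNIV. x i \<in> slab u}. f (x i))"
    using CK_plusD(1)[OF f] by (simp add: sum_ennreal)
  finally have "(\<Sum>i. ennreal (f (x i))) = ennreal (\<integral>z. f z \<partial>dirac_sum UNIV x)"
    by (simp only: integral_Mp_slab[OF f u(2) fin])
  then show ?thesis by (simp add: integral_Mp_nonneg[OF f])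
qed

text \<open>Off \<open>Mp\<close> the empty configuration is substituted, so that all values lie in
  the vague space.\<close>

lemma random_dirac_sum_measurable:
  fixes x :: "nat \<Rightarrow> 'b \<Rightarrow> real \<times> ereal"
  assumes x [measurable]: "\<And>i. x i \<in> borel_measurable M"
  shows "(\<lambda>\<omega>. if dirac_sum UNIV (\<lambda>i. x i \<omega>) \<in> Mp then dirac_sum UNIV (\<lambda>i. x i \<omega>) else dirac_sum {} (\<lambda>i. x i \<omega>))
    \<in> M \<rightarrow>\<^sub>M borel_of vague_top"
    and "f \<in> CK_plus \<Longrightarrow> (\<lambda>\<omega>. enn2real (\<Sum>i. ennreal (f (x i \<omega>)))) \<in> borel_measurable M"
proof -
  have ser: "(\<lambda>\<omega>. enn2real (\<Sum>i. ennreal (f (x i \<omega>)))) \<in> borel_measurable M" if f: "f \<in> CK_plus" for f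
  proof -
    have [measurable]: "(\<lambda>\<omega>. f (x i \<omega>)) \<in> borel_measurable M" for i
      by (rule measurable_compose[OF x CK_plus_borel[OF f]])
    show ?thesis by measurable
  qed
  then show "f \<in> CK_plus \<Longrightarrow> (\<lambda>\<omega>. enn2real (\<Sum>i. ennreal (f (x i \<omega>)))) \<in> borel_measurable M" .
  have emp: "dirac_sum {} w \<in> Mp" for w :: "nat \<Rightarrow> real \<times> ereal" by (simp add: dirac_sum_in_Mp_iff)
  have [measurable]: "slab u \<in> sets borel" for u by (intro borel_closed compact_imp_closed compact_slab)
  have S: "{\<omega> \<in> space M. dirac_sum UNIV (\<lambda>i. x i \<omega>) \<in> Mp} \<in> sets M"
    unfolding dirac_sum_nat_in_Mp_iff by measurable
  show "(\<lambda>\<omega>. if dirac_sum UNIV (\<lambda>i. x i \<omega>) \<in> Mp then dirac_sum UNIV (\<lambda>i. x i \<omega>) else dirac_sum {} (\<lambda>i. x i \<omega>))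
    \<in> M \<rightarrow>\<^sub>M borel_of vague_top"
  proof (rule measurable_into_vague)
    fix f :: "real \<times> ereal \<Rightarrow> real" assume f: "f \<in> CK_plus"
    have "(\<integral>z. f z \<partial>(if dirac_sum UNIV (\<lambda>i. x i \<omega>) \<in> Mp then dirac_sum UNIV (\<lambda>i. x i \<omega>) else dirac_sum {} (\<lambda>i. x i \<omega>)))
        = (if dirac_sum UNIV (\<lambda>i. x i \<omega>) \<in> Mp then enn2real (\<Sum>i. ennreal (f (x i \<omega>))) else 0)" for \<omega>
      using integral_dirac_sum_series[OF _ f, of "\<lambda>i. x i \<omega>"] integral_dirac_sum_CK[OF f, of "{}" "{}" "\<lambda>i. x i \<omega>"] by simp
    moreover have "(\<lambda>\<omega>. if dirac_sum UNIV (\<lambda>i. x i \<omega>) \<in> Mp then enn2real (\<Sum>i. ennreal (f (x i \<omega>))) else 0) \<in> borel_measurable M"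
      by (rule measurable_If[OF ser[OF f] _ S]) simp
    ultimately show "(\<lambda>\<omega>. \<integral>z. f z \<partial>(if dirac_sum UNIV (\<lambda>i. x i \<omega>) \<in> Mp then dirac_sum UNIV (\<lambda>i. x i \<omega>) else dirac_sum {} (\<lambda>i. x i \<omega>))) \<in> borel_measurable M"
      by simp
  qed (use emp in auto)
qed

text \<open>Eventually |c_j| \<le> 1, where a larger exponent gives a smaller power.\<close>

lemma summable_powr_larger:
  fixes c :: "nat \<Rightarrow> real"
  assumes sm: "summable (\<lambda>j. \<bar>c j\<bar> powr \<delta>)" and \<delta>: "0 < \<delta>" "\<delta> \<le> \<alpha>"
  shows "summable (\<lambda>j. \<bar>c j\<bar> powr \<alpha>)"
proof (rule summable_comparison_test_ev[OF _ sm])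
  have "\<forall>\<^sub>F j in sequentially. \<bar>c j\<bar> powr \<delta> < 1"
    using order_tendstoD(2)[OF summable_LIMSEQ_zero[OF sm]] by simp
  then show "\<forall>\<^sub>F j in sequentially. norm (\<bar>c j\<bar> powr \<alpha>) \<le> \<bar>c j\<bar> powr \<delta>"
  proof eventually_elim
    case (elim j)
    have "\<bar>c j\<bar> \<le> 1"
    proof (rule ccontr)
      assume "\<not> \<bar>c j\<bar> \<le> 1"
      then have "1 \<le> \<bar>c j\<bar> powr \<delta>" using \<delta>(1) by (intro ge_one_powr_ge_zero) auto
      then show False using elim by simp
    qed
    then show ?case using powr_mono'[OF \<delta>(2), of "\<bar>c j\<bar>"] by simp
  qed
qed

text \<open>Strict half-lines beyond u / 2 cover the slab. The order u^(-\<alpha>) of the bound is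
  what produces the summable weights |c_j|^\<alpha> for the radii u / |c_j|.\<close>

lemma intensity_slab_le:
  assumes "\<alpha> > 0" "p \<ge> 0" "q \<ge> 0" "u > 0"
  shows "measure (intensity \<alpha> s p q) (slab u) \<le> s powr \<alpha> * (p + q) * (u / 2) powr - \<alpha>"
proof -
  have T: "emeasure (intensity \<alpha> s p q) ({0..1} \<times> tail_set \<tau> (u/2)) = ennreal (s powr \<alpha> * tail_weight p q \<tau> * (u / 2) powr - \<alpha>)"
    if "\<tau> \<in> {1, -1}" for \<tau>
    using intensity_rectangle[OF assms(1) _ assms(2,3) that, of "u / 2" 1 s] assms(4) by simp
  have S: "{0..1} \<times> tail_set \<tau> (u/2) \<in> sets (intensity \<alpha> s p q)" if "\<tau> \<in> {1, -1}" for \<tau>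
  proof -
    have "{0..1::real} \<times> tail_set \<tau> (u/2) \<subseteq> S_space"
      using tail_set_subset_E[OF that, of "u/2"] assms by (auto simp: S_space_def)
    moreover note rectangle_borel[OF that, of 1 "u/2"]
    ultimately show ?thesis by (simp add: sets_borel_of_S_top sets_restrict_space_iff)
  qed
  have "emeasure (intensity \<alpha> s p q) (slab u)
      \<le> emeasure (intensity \<alpha> s p q) ({0..1} \<times> tail_set 1 (u/2) \<union> {0..1} \<times> tail_set (- 1) (u/2))"
    using slab_subset_tails[OF assms(4)] S by (intro emeasure_mono) auto
  also have "\<dots> \<le> emeasure (intensity \<alpha> s p q) ({0..1} \<times> tail_set 1 (u/2))
      + emeasure (intensity \<alpha> s p q) ({0..1} \<times> tail_set (- 1) (u/2))"
    using S by (intro emeasure_subadditive) auto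
  also have "\<dots> = ennreal (s powr \<alpha> * p * (u / 2) powr - \<alpha>) + ennreal (s powr \<alpha> * q * (u / 2) powr - \<alpha>)"
    by (simp add: T tail_weight_def)
  also have "\<dots> = ennreal (s powr \<alpha> * (p + q) * (u / 2) powr - \<alpha>)"
    using assms by (simp add: ennreal_plus[symmetric] algebra_simps del: ennreal_plus)
  finally show ?thesis unfolding measure_def using assms by (intro enn2real_leI) auto
qed

section \<open>Clusters attached to Poisson points\<close>

definition fold_scaled :: "(nat \<Rightarrow> real) \<Rightarrow> (real \<times> ereal \<Rightarrow> real) \<Rightarrow> nat \<Rightarrow> real \<times> ereal \<Rightarrow> real" where
  "fold_scaled c f m z = (\<Sum>j<m. (case z of (t, y) \<Rightarrow> f (t, y * ereal (c j))))"

lemma fold_scaled_CK: "f \<in> CK_plus \<Longrightarrow> fold_scaled c f m \<in> CK_plus"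
  unfolding fold_scaled_def[abs_def] by (intro CK_plus_sum CK_plus_scale) simp

locale poisson_scaling = prob_space M' for M' :: "'b measure" +
  fixes T :: "nat \<Rightarrow> 'b \<Rightarrow> real" and P :: "nat \<Rightarrow> 'b \<Rightarrow> ereal" and c :: "nat \<Rightarrow> real" and \<alpha> s p q \<delta> :: real
  assumes T_meas [measurable]: "\<And>i. T i \<in> borel_measurable M'" and P_meas [measurable]: "\<And>i. P i \<in> borel_measurable M'"
    and points: "\<And>i \<omega>. \<omega> \<in> space M' \<Longrightarrow> (T i \<omega>, P i \<omega>) \<in> S_space"
    and poisson: "poisson_process M' (intensity \<alpha> s p q) (\<lambda>\<omega>. dirac_sum UNIV (\<lambda>i. (T i \<omega>, P i \<omega>)))"
    and \<alpha>: "\<alpha> > 0" and pq: "0 \<le> p" "0 \<le> q"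
    and c: "summable (\<lambda>j. \<bar>c j\<bar> powr \<delta>)" and \<delta>: "0 < \<delta>" "\<delta> < \<alpha>"
begin

definition base :: "'b \<Rightarrow> (real \<times> ereal) measure" where
  "base \<omega> = dirac_sum UNIV (\<lambda>i. (T i \<omega>, P i \<omega>))"

definition pt :: "'b \<Rightarrow> nat \<times> nat \<Rightarrow> real \<times> ereal" where
  "pt \<omega> = (\<lambda>(i, j). (T i \<omega>, P i \<omega> * ereal (c j)))"

text \<open>The double index is flattened by \<open>prod_decode\<close> because measurability was
  established for sequences of random points.\<close>

definition cluster :: "'b \<Rightarrow> (real \<times> ereal) measure" where
  "cluster \<omega> = dirac_sum UNIV (\<lambda>k. pt \<omega> (prod_decode k))"

lemma cluster_eq: "cluster \<omega> = dirac_sum UNIV (pt \<omega>)"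
  unfolding cluster_def by (rule dirac_sum_reindex[symmetric]) (rule bij_prod_decode)

lemma TP_meas [measurable]: "(\<lambda>\<omega>. (T i \<omega>, P i \<omega>)) \<in> borel_measurable M'"
  unfolding borel_prod[symmetric] by measurable

lemma pt_meas [measurable]: "(\<lambda>\<omega>. pt \<omega> k) \<in> borel_measurable M'"
  by (cases k) (simp add: pt_def borel_prod[symmetric])

lemma base_in_Mp: "AE \<omega> in M'. base \<omega> \<in> Mp"
  using poisson by (simp add: poisson_process_def base_def)

lemma pt_slab:
  assumes "u > 0" "pt \<omega> (i, j) \<in> slab u"
  shows "c j \<noteq> 0" "(T i \<omega>, P i \<omega>) \<in> slab (u / \<bar>c j\<bar>)"
proof -
  have *: "T i \<omega> \<in> {0..1}" "ereal u \<le> \<bar>P i \<omega> * ereal (c j)\<bar>" using assms(2) by (auto simp: pt_def slab_def)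
  show cj: "c j \<noteq> 0"
  proof
    assume "c j = 0"
    then show False using *(2) assms(1) by (simp add: zero_ereal_def[symmetric])
  qed
  have "ereal (u / \<bar>c j\<bar>) \<le> \<bar>P i \<omega>\<bar>"
    using *(2) cj by (cases "P i \<omega>") (auto simp: abs_mult field_simps)
  then show "(T i \<omega>, P i \<omega>) \<in> slab (u / \<bar>c j\<bar>)" using *(1) by (simp add: slab_def)
qed

text \<open>The void probability is exp (- \<lambda>), and 1 - exp (- \<lambda>) \<le>
  \<lambda>.\<close>

lemma prob_base_slab_nonzero:
  assumes "v > 0"
  shows "prob {\<omega> \<in> space M'. emeasure (base \<omega>) (slab v) \<noteq> 0} \<le> measure (intensity \<alpha> s p q) (slab v)"
proof -
  note sl = slab_sets[OF assms]
  have [measurable]: "(\<lambda>\<omega>. emeasure (base \<omega>) (slab v)) \<in> borel_measurable M'"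
    using poisson sl by (simp add: poisson_process_def base_def)
  have E: "{\<omega> \<in> space M'. emeasure (base \<omega>) (slab v) = 0} \<in> sets M'" by measurable
  have "{\<omega> \<in> space M'. emeasure (base \<omega>) (slab v) \<noteq> 0} = space M' - {\<omega> \<in> space M'. emeasure (base \<omega>) (slab v) = 0}" by auto
  then have "prob {\<omega> \<in> space M'. emeasure (base \<omega>) (slab v) \<noteq> 0} = 1 - prob {\<omega> \<in> space M'. emeasure (base \<omega>) (slab v) = 0}"
    using prob_compl[OF E] by simp
  also have "prob {\<omega> \<in> space M'. emeasure (base \<omega>) (slab v) = 0} = exp (- measure (intensity \<alpha> s p q) (slab v))"
    using poisson_point_prob[OF prob_space_axioms poisson sets_intensity intensity_slab_finite[OF \<alpha> pq] sl intensity_slab_finite[OF \<alpha> pq assms], of 0]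
    by (simp add: base_def)
  also have "1 - exp (- measure (intensity \<alpha> s p q) (slab v)) \<le> measure (intensity \<alpha> s p q) (slab v)"
    using exp_ge_add_one_self[of "- measure (intensity \<alpha> s p q) (slab v)"] by simp
  finally show ?thesis by simp
qed

text \<open>Borel-Cantelli in j: a point multiplied by c_j reaches the slab only if the base process
  has a point in the slab of radius u / |c_j|, which has probability of order |c_j|^\<alpha>. Almost
  surely finitely many j remain, each with finitely many points.\<close>

lemma finite_clusters:
  assumes u: "u > 0"
  shows "AE \<omega> in M'. finite {k \<in> UNIV. pt \<omega> k \<in> slab u}"
proof -
  \<comment> \<open>For c_j = 0 all points get second coordinate 0 and leave the space, so the event
    is empty; this also avoids the radius u / 0.\<close>
  define A where "A j = (if c j = 0 then {} else {\<omega> \<in> space M'. emeasure (base \<omega>) (slab (u / \<bar>c j\<bar>)) \<noteq> 0})" for j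
  have v: "u / \<bar>c j\<bar> > 0" if "c j \<noteq> 0" for j using u that by simp
  have A: "A j \<in> sets M'" for j
  proof (cases "c j = 0")
    case False
    have [measurable]: "(\<lambda>\<omega>. emeasure (base \<omega>) (slab (u / \<bar>c j\<bar>))) \<in> borel_measurable M'"
      using poisson slab_sets[OF v[OF False]] by (simp add: poisson_process_def base_def)
    show ?thesis using False unfolding A_def by simp
  qed (simp add: A_def)
  define C where "C = s powr \<alpha> * (p + q) * (u / 2) powr - \<alpha>"
  have PA: "prob (A j) \<le> C * \<bar>c j\<bar> powr \<alpha>" for j
  proof (cases "c j = 0")
    case True
    then show ?thesis by (simp add: A_def)
  next
    case False
    have "prob (A j) \<le> s powr \<alpha> * (p + q) * (u / \<bar>c j\<bar> / 2) powr - \<alpha>"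
      using prob_base_slab_nonzero[OF v[OF False]] intensity_slab_le[OF \<alpha> pq v[OF False], of s] False by (simp add: A_def)
    also have "(u / \<bar>c j\<bar> / 2) powr - \<alpha> = (u / 2) powr - \<alpha> * \<bar>c j\<bar> powr \<alpha>"
      using u False by (simp add: powr_divide powr_minus powr_mult divide_simps)
    finally show ?thesis by (simp add: C_def mult.assoc)
  qed
  have "summable (\<lambda>j. C * \<bar>c j\<bar> powr \<alpha>)"
    using summable_powr_larger[OF c \<delta>(1)] \<delta>(2) by (intro summable_mult) simp
  then have "summable (\<lambda>j. prob (A j))"
    by (rule summable_comparison_test') (use PA in simp)
  from borel_cantelli_AE1[OF A _ this]
  have "AE \<omega> in M'. \<forall>\<^sub>F j in sequentially. \<omega> \<in> space M' - A j" by (simp add: emeasure_eq_measure)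
  then show ?thesis using base_in_Mp
  proof eventually_elim
    case (elim \<omega>)
    then obtain J where J: "\<And>j. j \<ge> J \<Longrightarrow> \<omega> \<in> space M' - A j" unfolding eventually_sequentially by blast
    have \<omega>: "\<omega> \<in> space M'" using J[of J] by simp
    have fin: "finite {i. (T i \<omega>, P i \<omega>) \<in> slab v}" if "v > 0" for v
      using elim(2) that by (simp add: base_def dirac_sum_in_Mp_iff)
    have "j < J" if "pt \<omega> (i, j) \<in> slab u" for i j
    proof (rule ccontr)
      assume "\<not> j < J"
      note ps = pt_slab[OF u that]
      have "emeasure (base \<omega>) (slab (u / \<bar>c j\<bar>)) = 0"
        using J[of j] \<open>\<not> j < J\<close> ps(1) \<omega> by (simp add: A_def)
      moreover have "emeasure (base \<omega>) (slab (u / \<bar>c j\<bar>)) = of_nat (card {i \<in> UNIV. (T i \<omega>, P i \<omega>) \<in> slab (u / \<bar>c j\<bar>)})"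
        unfolding base_def using fin[OF v[OF ps(1)]] by (subst emeasure_dirac_sum_count[OF slab_sets[OF v[OF ps(1)]]]) simp
      ultimately have "{i. (T i \<omega>, P i \<omega>) \<in> slab (u / \<bar>c j\<bar>)} = {}"
        using fin[OF v[OF ps(1)]] by simp
      then show False using ps(2) by blast
    qed
    then have "{k \<in> UNIV. pt \<omega> k \<in> slab u} \<subseteq> (\<Union>j\<in>{j. j < J \<and> c j \<noteq> 0}. (\<lambda>i. (i, j)) ` {i. (T i \<omega>, P i \<omega>) \<in> slab (u / \<bar>c j\<bar>)})"
      using pt_slab[OF u] by fastforce
    moreover have "finite (\<Union>j\<in>{j. j < J \<and> c j \<noteq> 0}. (\<lambda>i. (i, j)) ` {i. (T i \<omega>, P i \<omega>) \<in> slab (u / \<bar>c j\<bar>)})"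
      using fin v by (intro finite_UN_I finite_imageI) auto
    ultimately show ?case by (rule finite_subset)
  qed
qed

lemma cluster_in_Mp: "AE \<omega> in M'. cluster \<omega> \<in> Mp"
proof -
  have "AE \<omega> in M'. \<forall>n::nat. finite {k \<in> UNIV. pt \<omega> k \<in> slab (1 / real (Suc n))}"
    by (subst AE_all_countable) (intro allI finite_clusters, simp)
  then show ?thesis
  proof eventually_elim
    case (elim \<omega>)
    then have "finite {k \<in> UNIV. pt \<omega> k \<in> slab u}" if "u > 0" for u
      using slab_approx_finite[of UNIV "pt \<omega>" u] that by blast
    then show ?case unfolding cluster_eq by (simp add: dirac_sum_in_Mp_iff)
  qed
qed

text \<open>The cluster sum is locally finite only almost surely; it is replaced by the empty configuration
  on the null set so as to be a random element of \<open>Mp\<close>.\<close>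

definition N :: "'b \<Rightarrow> (real \<times> ereal) measure" where
  "N \<omega> = (if cluster \<omega> \<in> Mp then cluster \<omega> else dirac_sum {} (\<lambda>k. pt \<omega> (prod_decode k)))"

lemma N_measurable: "N \<in> M' \<rightarrow>\<^sub>M borel_of vague_top"
  unfolding N_def[abs_def] cluster_def by (rule random_dirac_sum_measurable) measurable

lemma N_AE: "AE \<omega> in M'. N \<omega> = dirac_sum UNIV (\<lambda>(i, j). (T i \<omega>, P i \<omega> * ereal (c j)))"
  using cluster_in_Mp by eventually_elim (simp add: N_def cluster_eq pt_def)

text \<open>For almost every realisation only finitely many pairs (i, j) contribute, so the sums
  over j < m eventually equal the full sum; bounded convergence then gives the limit in m.\<close>

lemma N_Laplace:
  assumes f: "f \<in> CK_plus"
  shows "(\<lambda>m. exp (- (\<integral>z. 1 - exp (- fold_scaled c f m z) \<partial>intensity \<alpha> s p q)))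
    \<longlonglongrightarrow> (\<integral>\<omega>. exp (- (\<integral>z. f z \<partial>N \<omega>)) \<partial>M')"
proof -
  define W where "W m \<omega> = enn2real (\<Sum>i. ennreal (fold_scaled c f m (T i \<omega>, P i \<omega>)))" for m \<omega>
  have Wm: "W m \<in> borel_measurable M'" for m
    unfolding W_def[abs_def] by (rule random_dirac_sum_measurable(2)[OF TP_meas fold_scaled_CK[OF f]])
  have WA: "AE \<omega> in M'. W m \<omega> = (\<integral>z. fold_scaled c f m z \<partial>base \<omega>)" for m
    using base_in_Mp
  proof eventually_elim
    case (elim \<omega>)
    show ?case unfolding W_def base_def
      by (rule integral_dirac_sum_series[OF elim[unfolded base_def] fold_scaled_CK[OF f], symmetric])
  qed
  have LW: "(\<integral>\<omega>. exp (- W m \<omega>) \<partial>M') = exp (- (\<integral>z. 1 - exp (- fold_scaled c f m z) \<partial>intensity \<alpha> s p q))" for m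
    by (rule poisson_Laplace[OF prob_space_axioms poisson sets_intensity intensity_slab_finite[OF \<alpha> pq] fold_scaled_CK[OF f] Wm])
       (use WA in \<open>simp_all add: base_def\<close>)
  have "(\<lambda>m. \<integral>\<omega>. exp (- W m \<omega>) \<partial>M') \<longlonglongrightarrow> (\<integral>\<omega>. exp (- (\<integral>z. f z \<partial>N \<omega>)) \<partial>M')"
  proof (rule integral_dominated_convergence[where w = "\<lambda>_. 1"])
    show "(\<lambda>\<omega>. exp (- (\<integral>z. f z \<partial>N \<omega>))) \<in> borel_measurable M'"
      using random_Mp_integral_measurable[OF N_measurable f] by measurable
    show "(\<lambda>\<omega>. exp (- W m \<omega>)) \<in> borel_measurable M'" for m using Wm by measurable
    show "AE \<omega> in M'. norm (exp (- W m \<omega>)) \<le> 1" for m by (intro AE_I2) (simp add: W_def)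
    have "AE \<omega> in M'. \<forall>m. W m \<omega> = (\<integral>z. fold_scaled c f m z \<partial>base \<omega>)"
      using WA by (subst AE_all_countable) auto
    then show "AE \<omega> in M'. (\<lambda>m. exp (- W m \<omega>)) \<longlonglongrightarrow> exp (- (\<integral>z. f z \<partial>N \<omega>))"
      using cluster_in_Mp
    proof eventually_elim
      case (elim \<omega>)
      obtain u where u: "u > 0" "\<And>t y. \<bar>y\<bar> < ereal u \<Longrightarrow> f (t, y) = 0"
        using CK_plus_supportE[OF f] by blast
      define F where "F = {k \<in> UNIV. pt \<omega> k \<in> slab u}"
      have F: "finite F" using elim(2) u(1) unfolding cluster_eq F_def by (simp add: dirac_sum_in_Mp_iff)
      have van: "f (pt \<omega> k) = 0" if "k \<notin> F" for k
        using not_slab_vanish[OF f, of u "pt \<omega> k"] u(2) that by (simp add: F_def)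
      have IN: "(\<integral>z. f z \<partial>N \<omega>) = (\<Sum>k\<in>F. f (pt \<omega> k))"
        using elim(2) van F by (simp add: N_def cluster_eq integral_dirac_sum_CK[OF f])
      obtain m0 where m0: "\<And>k. k \<in> F \<Longrightarrow> snd k < m0"
        using F finite_nat_set_iff_bounded[of "snd ` F"] by auto
      have "W m \<omega> = (\<integral>z. f z \<partial>N \<omega>)" if m: "m \<ge> m0" for m
      proof -
        have "W m \<omega> = (\<integral>z. fold_scaled c f m z \<partial>base \<omega>)" using elim(1) by simp
        also have "\<dots> = (\<Sum>i\<in>fst ` F. fold_scaled c f m (T i \<omega>, P i \<omega>))"
          unfolding base_def
        proof (rule integral_dirac_sum_CK[OF fold_scaled_CK[OF f]])
          fix i assume i: "i \<notin> fst ` F"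
          then have "(i, j) \<notin> F" for j by force
          from van[OF this] show "fold_scaled c f m (T i \<omega>, P i \<omega>) = 0" by (simp add: fold_scaled_def pt_def)
        qed (use F in auto)
        also have "\<dots> = (\<Sum>i\<in>fst ` F. \<Sum>j<m. f (pt \<omega> (i, j)))" by (simp add: fold_scaled_def pt_def)
        also have "\<dots> = (\<Sum>k\<in>fst ` F \<times> {..<m}. f (pt \<omega> k))" by (simp add: sum.cartesian_product)
        also have "\<dots> = (\<Sum>k\<in>F. f (pt \<omega> k))"
        proof (rule sum.mono_neutral_right)
          show "F \<subseteq> fst ` F \<times> {..<m}" using m0 m by (force simp: mem_Times_iff)
        qed (use F van in auto)
        finally show ?thesis by (simp add: IN)
      qed
      then have "\<forall>\<^sub>F m in sequentially. exp (- (\<integral>z. f z \<partial>N \<omega>)) = exp (- W m \<omega>)"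
        by (intro eventually_sequentiallyI[of m0]) simp
      then show ?case by (rule Lim_transform_eventually[OF tendsto_const])
    qed
  qed auto
  then show ?thesis by (simp add: LW)
qed

end

section \<open>The linear process\<close>

text \<open>Purely deterministic, under the assumption that the truncation errors are small, no two
  large values are within distance m, and none is near the two ends. Each x_i is then either small
  or close to a single c_j y_(i - j), and the reindexing l = i - j loses only boundary terms, which
  vanish. What remains is an error \<epsilon> for each large x_i.\<close>

lemma truncation_pointwise:
  fixes c :: "nat \<Rightarrow> real" and x :: "nat \<Rightarrow> real" and y :: "int \<Rightarrow> real" and big :: "int \<Rightarrow> bool"
  assumes f: "f \<in> CK_plus" and u: "u > 0" "\<And>t y. \<bar>y\<bar> < ereal u \<Longrightarrow> f (t, y) = 0"
    and unif: "\<And>t t' y y'. t \<in> {0..1} \<Longrightarrow> t' \<in> {0..1} \<Longrightarrow> \<bar>t - t'\<bar> < \<eta> \<Longrightarrow> \<bar>y - y'\<bar> < \<eta>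
      \<Longrightarrow> \<bar>f (t, ereal y) - f (t', ereal y')\<bar> \<le> \<epsilon>"
    and n: "n \<ge> 1" "real m < \<eta> * real n"
    and \<kappa>: "0 < \<kappa>" "2 * \<kappa> < \<eta>" "2 * \<kappa> < u / 2"
    and small: "\<And>l. \<not> big l \<Longrightarrow> \<bar>y l\<bar> \<le> \<theta>" "\<theta> * (\<Sum>j<m. \<bar>c j\<bar>) \<le> \<kappa>" "0 \<le> \<theta>"
    and trunc: "\<And>i. i \<in> {1..n} \<Longrightarrow> \<bar>x i - (\<Sum>j<m. c j * y (int i - int j))\<bar> \<le> \<kappa>"
    and isolated: "\<And>i l. i \<in> {1 - int m..int n} \<Longrightarrow> l \<in> {1..m} \<Longrightarrow> \<not> (big i \<and> big (i + int l))"
    and boundary: "\<And>i. i \<in> {1 - int m..0} \<union> {int n - int m + 1..int n} \<Longrightarrow> \<not> big i"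
    and \<epsilon>: "0 \<le> \<epsilon>"
  shows "\<bar>(\<Sum>i=1..n. f (real i / real n, ereal (x i)))
      - (\<Sum>l=1..n. fold_scaled c f m (real l / real n, ereal (y (int l))))\<bar>
    \<le> \<epsilon> * (\<Sum>i=1..n. of_bool (\<bar>x i\<bar> > u / 2))"
proof -
  define G where "G j l = f (real_of_int l / real n, ereal (y l * c j))" for j :: nat and l :: int
  have cj: "\<bar>c j\<bar> \<le> (\<Sum>j<m. \<bar>c j\<bar>)" if "j < m" for j
    using that by (intro member_le_sum) auto
  have cs: "\<bar>y l * c j\<bar> \<le> \<kappa>" if "\<not> big l" "j < m" for l j
  proof -
    have "\<bar>y l * c j\<bar> \<le> \<theta> * (\<Sum>j<m. \<bar>c j\<bar>)"
      unfolding abs_mult using small(1)[OF that(1)] cj[OF that(2)] small(3) by (intro mult_mono) auto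
    then show ?thesis using small(2) by linarith
  qed
  have W: "(\<Sum>j<m. \<bar>c j\<bar> * \<theta>) \<le> \<kappa>"
    using small(2) by (metis sum_distrib_right mult.commute)
  have f0: "f (t, ereal v) = 0" if "\<bar>v\<bar> < u" for t v using u(2)[of "ereal v" t] that by simp
  have G0: "G j l = 0" if "\<not> big l" "j < m" for j l
    unfolding G_def using cs[OF that] \<kappa> u(1) by (intro f0) linarith
  \<comment> \<open>Shifting the index by j changes the range only near 1 and n, where no value is
    large and \<open>G\<close> is 0.\<close>
  have range: "(\<Sum>i=1..n. G j (int i - int j)) = (\<Sum>i=1..n. G j (int i))" if j: "j < m" for j
  proof -
    have A: "(\<Sum>i=1..n. G j (int i - int j)) = (\<Sum>l\<in>{1 - int j..int n - int j}. G j l)"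
      by (rule sum.reindex_bij_witness[of _ "\<lambda>l. nat (l + int j)" "\<lambda>i. int i - int j"]) auto
    have B: "(\<Sum>i=1..n. G j (int i)) = (\<Sum>l\<in>{1..int n}. G j l)"
      by (rule sum.reindex_bij_witness[of _ nat int]) auto
    have "(\<Sum>l\<in>{1 - int j..int n - int j}. G j l) = (\<Sum>l\<in>{1 - int j..int n}. G j l)"
    proof (rule sum.mono_neutral_left)
      show "\<forall>l\<in>{1 - int j..int n} - {1 - int j..int n - int j}. G j l = 0"
        using j by (intro ballI G0 boundary) auto
    qed auto
    moreover have "(\<Sum>l\<in>{1..int n}. G j l) = (\<Sum>l\<in>{1 - int j..int n}. G j l)"
    proof (rule sum.mono_neutral_left)
      show "\<forall>l\<in>{1 - int j..int n} - {1..int n}. G j l = 0"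
        using j by (intro ballI G0 boundary) auto
    qed auto
    ultimately show ?thesis using A B by simp
  qed
  have "(\<Sum>l=1..n. fold_scaled c f m (real l / real n, ereal (y (int l)))) = (\<Sum>l=1..n. \<Sum>j<m. G j (int l))"
    by (simp add: fold_scaled_def G_def)
  also have "\<dots> = (\<Sum>j<m. \<Sum>l=1..n. G j (int l))" by (rule sum.swap)
  also have "\<dots> = (\<Sum>j<m. \<Sum>i=1..n. G j (int i - int j))" by (intro sum.cong refl range[symmetric]) simp
  also have "\<dots> = (\<Sum>i=1..n. \<Sum>j<m. G j (int i - int j))" by (rule sum.swap)
  finally have B: "(\<Sum>l=1..n. fold_scaled c f m (real l / real n, ereal (y (int l)))) = (\<Sum>i=1..n. \<Sum>j<m. G j (int i - int j))" .
  have per: "\<bar>f (real i / real n, ereal (x i)) - (\<Sum>j<m. G j (int i - int j))\<bar> \<le> \<epsilon> * of_bool (\<bar>x i\<bar> > u / 2)" if i: "i \<in> {1..n}" for i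
  proof (cases "\<exists>j<m. big (int i - int j)")
    case False
    have "\<bar>\<Sum>j<m. c j * y (int i - int j)\<bar> \<le> (\<Sum>j<m. \<bar>c j\<bar> * \<theta>)"
      using False small(1) by (intro order_trans[OF sum_abs] sum_mono) (simp add: abs_mult mult_left_mono)
    also have "\<dots> \<le> \<kappa>" by (rule W)
    finally have "\<bar>x i\<bar> < u" using trunc[OF i] \<kappa> u(1) unfolding abs_le_iff abs_less_iff by linarith
    then have "f (real i / real n, ereal (x i)) = 0" by (rule f0)
    moreover have "(\<Sum>j<m. G j (int i - int j)) = 0" using False by (intro sum.neutral ballI G0) auto
    ultimately show ?thesis using \<epsilon> by simp
  next
    case True
    then obtain j0 where j0: "j0 < m" "big (int i - int j0)" by auto
    have not_both: False if "j < k" "k < m" "big (int i - int j)" "big (int i - int k)" for j k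
    proof -
      have "int i - int k + int (k - j) = int i - int j" using that(1) by simp
      moreover have "int i - int k \<in> {1 - int m..int n}" "k - j \<in> {1..m}" using that(1,2) i by auto
      ultimately show False using isolated[of "int i - int k" "k - j"] that(3,4) by simp
    qed
    then have uniq: "\<not> big (int i - int j)" if "j < m" "j \<noteq> j0" for j
      using that j0 by (metis linorder_neqE_nat)
    \<comment> \<open>The only large index in the window is at least 1, so its time lies in [0,1],
      where the modulus of continuity applies.\<close>
    have pos: "int i - int j0 \<ge> 1"
    proof (rule ccontr)
      assume "\<not> 1 \<le> int i - int j0"
      then have "int i - int j0 \<in> {1 - int m..0}" using i j0(1) by auto
      then show False using boundary j0(2) by blast
    qed
    let ?v = "y (int i - int j0) * c j0"
    have S: "(\<Sum>j<m. g j) = g j0 + (\<Sum>j\<in>{..<m} - {j0}. g j)" for g :: "nat \<Rightarrow> real"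
      using j0(1) by (intro sum.remove) auto
    have GS: "(\<Sum>j<m. G j (int i - int j)) = G j0 (int i - int j0)"
      unfolding S using uniq by (simp add: G0)
    have "\<bar>\<Sum>j\<in>{..<m} - {j0}. c j * y (int i - int j)\<bar> \<le> (\<Sum>j\<in>{..<m} - {j0}. \<bar>c j\<bar> * \<theta>)"
      using uniq small(1) by (intro order_trans[OF sum_abs] sum_mono) (simp add: abs_mult mult_left_mono)
    also have "\<dots> \<le> (\<Sum>j<m. \<bar>c j\<bar> * \<theta>)" using small(3) by (intro sum_mono2) auto
    also have "\<dots> \<le> \<kappa>" by (rule W)
    finally have "\<bar>(\<Sum>j<m. c j * y (int i - int j)) - ?v\<bar> \<le> \<kappa>" unfolding S by (simp add: mult.commute)
    then have close: "\<bar>x i - ?v\<bar> \<le> 2 * \<kappa>" using trunc[OF i] unfolding abs_le_iff by linarith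
    show ?thesis
    \<comment> \<open>If |x_i| \<le> u / 2, the single large term has size below u because 2
      \<kappa> < u / 2; both values of f vanish and no error is charged.\<close>
    proof (cases "\<bar>x i\<bar> > u / 2")
      case True
      let ?t = "real i / real n" let ?t' = "real_of_int (int i - int j0) / real n"
      have t: "?t \<in> {0..1}" using i by simp
      have "real_of_int (int i - int j0) \<le> real n" "0 \<le> real_of_int (int i - int j0)" using i pos by auto
      then have t': "?t' \<in> {0..1}" using n(1) by (simp add: divide_le_eq_1)
      have "\<bar>?t - ?t'\<bar> = real j0 / real n" by (simp add: diff_divide_distrib)
      also have "\<dots> < \<eta>"
      proof -
        have "real j0 < \<eta> * real n" using j0(1) n(2) by linarith
        then show ?thesis using n(1) by (simp add: divide_less_eq)
      qed
      finally have "\<bar>f (?t, ereal (x i)) - f (?t', ereal ?v)\<bar> \<le> \<epsilon>"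
        using close \<kappa>(2) by (intro unif t t') auto
      then show ?thesis using True unfolding GS by (simp add: G_def)
    next
      case False
      then have "f (real i / real n, ereal (x i)) = 0" using u(1) by (intro f0) linarith
      moreover have "G j0 (int i - int j0) = 0"
        unfolding G_def using False close \<kappa>(3) by (intro f0) linarith
      ultimately show ?thesis using GS False by simp
    qed
  qed
  have "\<bar>(\<Sum>i=1..n. f (real i / real n, ereal (x i)))
      - (\<Sum>l=1..n. fold_scaled c f m (real l / real n, ereal (y (int l))))\<bar>
      = \<bar>\<Sum>i=1..n. f (real i / real n, ereal (x i)) - (\<Sum>j<m. G j (int i - int j))\<bar>"
    unfolding B by (simp add: sum_subtractf)
  also have "\<dots> \<le> (\<Sum>i=1..n. \<epsilon> * of_bool (\<bar>x i\<bar> > u / 2))"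
    by (intro order_trans[OF sum_abs] sum_mono per)
  finally show ?thesis by (simp only: sum_distrib_left)
qed

text \<open>The bound 1 applies on the exceptional event, the Lipschitz bound on its
  complement.\<close>

lemma exp_neg_diff_le:
  fixes x y :: real
  assumes "0 \<le> x" "0 \<le> y"
  shows "\<bar>exp (- x) - exp (- y)\<bar> \<le> 1" "\<bar>exp (- x) - exp (- y)\<bar> \<le> \<bar>x - y\<bar>"
proof -
  have b: "0 < exp (- x)" "exp (- x) \<le> 1" "0 < exp (- y)" "exp (- y) \<le> 1" using assms by auto
  then show "\<bar>exp (- x) - exp (- y)\<bar> \<le> 1" unfolding abs_le_iff by linarith
  have le: "exp (- v) - exp (- w) \<le> w - v" if "v \<le> w" "0 \<le> v" for v w :: real
  proof -
    have "exp (- v) - exp (- w) = exp (- v) * (1 - exp (- (w - v)))"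
      by (simp add: algebra_simps exp_add[symmetric])
    also have "\<dots> \<le> 1 * (1 - exp (- (w - v)))"
      using that by (intro mult_right_mono) auto
    also have "\<dots> = 1 - exp (- (w - v))" by simp
    also have "\<dots> \<le> w - v" using exp_ge_add_one_self[of "- (w - v)"] by linarith
    finally show ?thesis .
  qed
  show "\<bar>exp (- x) - exp (- y)\<bar> \<le> \<bar>x - y\<bar>"
  proof (cases "x \<le> y")
    case True
    have "exp (- y) \<le> exp (- x)" using True by simp
    then show ?thesis using le[OF True assms(1)] True by simp
  next
    case False
    then have "exp (- x) \<le> exp (- y)" by simp
    then show ?thesis using le[OF _ assms(2), of x] False by simp
  qed
qed

section \<open>Probability of truncation errors and the limit in m\<close>

locale linear_process = scaled_heavy_tailed_sequence M Z L a \<alpha> p q \<sigma> Y \<beta>1 \<beta>2 s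
  for M :: "'a measure" and Z L a \<alpha> p q \<sigma> Y \<beta>1 \<beta>2 s +
  fixes c :: "nat \<Rightarrow> real" and \<delta> :: real and X :: "nat \<Rightarrow> 'a \<Rightarrow> real"
  assumes \<delta>: "0 < \<delta>" "\<delta> < \<alpha>" "\<delta> \<le> 1"
    and c: "summable (\<lambda>j. \<bar>c j\<bar> powr \<delta>)"
    and X: "\<And>n \<omega>. X n \<omega> = (\<Sum>j. c j * Y (int n - int j) \<omega>)"
begin

text \<open>For m = 0 the sum is empty, so bounds on \<open>X i \<omega> - Xt m i \<omega>\<close>
  contain the tail bound for X_i itself.\<close>

definition Xt :: "nat \<Rightarrow> nat \<Rightarrow> 'a \<Rightarrow> real" where
  "Xt m i \<omega> = (\<Sum>j<m. c j * Y (int i - int j) \<omega>)"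

lemma X_meas [measurable]: "X i \<in> borel_measurable M"
proof -
  have "(\<lambda>\<omega>. \<Sum>j. c j * Y (int i - int j) \<omega>) \<in> borel_measurable M" by measurable
  then show ?thesis by (simp add: X[abs_def])
qed

lemma Xt_meas [measurable]: "Xt m i \<in> borel_measurable M"
  unfolding Xt_def[abs_def] by measurable

text \<open>Subadditivity of the \<delta>-th power bounds the tail of the series. The hypothesis
  also forces absolute convergence, so the infinite sum defining X is a genuine limit at this
  \<omega>.\<close>

lemma truncation_error:
  assumes K: "K > 0"
    and V: "(\<Sum>j. ennreal (\<bar>c (j + m)\<bar> powr \<delta> * \<bar>Z (int i - int m - int j) \<omega>\<bar> powr \<delta>)) \<le> ennreal ((K / \<beta>2) powr \<delta>)"
  shows "\<bar>X i \<omega> - Xt m i \<omega>\<bar> \<le> K"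
proof -
  define b where "b j = \<bar>c (j + m)\<bar> * \<bar>Z (int i - int m - int j) \<omega>\<bar>" for j
  have bp: "b j powr \<delta> = \<bar>c (j + m)\<bar> powr \<delta> * \<bar>Z (int i - int m - int j) \<omega>\<bar> powr \<delta>" for j
    by (simp add: b_def powr_mult)
  have V': "(\<Sum>j. ennreal (b j powr \<delta>)) \<le> ennreal ((K / \<beta>2) powr \<delta>)" using V by (simp add: bp)
  then have "(\<Sum>j. ennreal (b j powr \<delta>)) \<noteq> top" by (metis ennreal_neq_top top.extremum_unique)
  then have sm: "summable (\<lambda>j. b j powr \<delta>)" by (intro summable_suminf_not_top) auto
  have "(\<Sum>j. ennreal (b j powr \<delta>)) = ennreal (\<Sum>j. b j powr \<delta>)"
    by (rule suminf_ennreal2[OF _ sm]) simp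
  with V' have "ennreal (\<Sum>j. b j powr \<delta>) \<le> ennreal ((K / \<beta>2) powr \<delta>)" by (simp only:)
  then have S: "(\<Sum>j. b j powr \<delta>) \<le> (K / \<beta>2) powr \<delta>" by (subst (asm) ennreal_le_iff) auto
  have b0: "0 \<le> b j" for j by (simp add: b_def)
  note sb = suminf_le_powr_suminf[of b \<delta>, OF b0 \<delta>(1,3) sm]
  have "suminf b \<le> (\<Sum>j. b j powr \<delta>) powr (1 / \<delta>)" by (rule sb(2))
  also have "\<dots> \<le> ((K / \<beta>2) powr \<delta>) powr (1 / \<delta>)"
    using S \<delta>(1) sm by (intro powr_mono2 suminf_nonneg) auto
  also have "\<dots> = K / \<beta>2" using K \<beta>2 \<delta>(1) by (simp add: powr_powr)
  finally have bK: "\<beta>2 * suminf b \<le> K" using \<beta>2 by (simp add: field_simps)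
  define g where "g j = c j * Y (int i - int j) \<omega>" for j
  have gm: "\<bar>g (j + m)\<bar> \<le> \<beta>2 * b j" for j
  proof -
    have g: "g (j + m) = c (j + m) * Y (int i - int m - int j) \<omega>" by (simp add: g_def algebra_simps)
    show ?thesis
      using mult_left_mono[OF abs_Y_le[of "int i - int m - int j" \<omega>], of "\<bar>c (j + m)\<bar>"]
      unfolding g b_def abs_mult by (simp add: mult.left_commute)
  qed
  have sbm: "summable (\<lambda>j. \<beta>2 * b j)" by (rule summable_mult[OF sb(1)])
  have abs_sm: "summable (\<lambda>j. \<bar>g (j + m)\<bar>)"
    by (rule summable_comparison_test'[OF sbm, of 0]) (use gm in simp)
  then have "summable (\<lambda>j. g (j + m))" by (rule summable_rabs_cancel)
  then have "summable g" by (simp add: summable_iff_shift)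
  then have "suminf g = (\<Sum>j. g (j + m)) + (\<Sum>j<m. g j)" by (rule suminf_split_initial_segment)
  moreover have "X i \<omega> = suminf g" "Xt m i \<omega> = (\<Sum>j<m. g j)" by (simp_all add: X Xt_def g_def[abs_def])
  ultimately have "X i \<omega> - Xt m i \<omega> = (\<Sum>j. g (j + m))" by simp
  also have "\<bar>\<dots>\<bar> \<le> (\<Sum>j. \<bar>g (j + m)\<bar>)" by (rule summable_rabs[OF abs_sm])
  also have "\<dots> \<le> (\<Sum>j. \<beta>2 * b j)" by (rule suminf_le[OF gm abs_sm sbm])
  also have "\<dots> = \<beta>2 * suminf b" by (rule suminf_mult[OF sb(1)])
  finally show ?thesis using bK by linarith
qed

text \<open>\<open>D\<close> and \<open>n0\<close> are fixed before m and i: the case m = 0 bounds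
  the number of large X_i, the case of large m makes the truncation error small.\<close>

lemma truncation_probability:
  assumes \<kappa>: "\<kappa> > 0"
  obtains D n0 where "D \<ge> 0" "\<And>n m i. n \<ge> n0 \<Longrightarrow>
    real n * prob {\<omega> \<in> space M. \<bar>X i \<omega> - Xt m i \<omega>\<bar> > \<kappa> * a n} \<le> D * (\<Sum>j. \<bar>c (j + m)\<bar> powr \<delta>)"
proof -
  have kp: "(\<kappa> / \<beta>2) powr \<delta> > 0" using \<kappa> \<beta>2 by simp
  show thesis
  proof (rule weighted_moment_tail[OF \<delta>(1,2) powr_ge_zero c kp])
    fix D n0
    assume D: "D \<ge> 0" "\<And>n m i. n \<ge> n0 \<Longrightarrow>
      real n * prob {\<omega> \<in> space M. (\<Sum>j. ennreal (\<bar>c (j + m)\<bar> powr \<delta> * \<bar>Z (i - int j) \<omega>\<bar> powr \<delta>)) > ennreal ((\<kappa> / \<beta>2) powr \<delta> * a n powr \<delta>)}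
        \<le> D * (\<Sum>j. \<bar>c (j + m)\<bar> powr \<delta>)"
    show thesis
    proof (rule that[of D "max n0 1"])
      fix n m i assume n: "n \<ge> max n0 1"
      have an: "a n > 0" using a_pos n by auto
      have "(\<kappa> / \<beta>2) powr \<delta> * a n powr \<delta> = (\<kappa> * a n / \<beta>2) powr \<delta>"
        using \<kappa> \<beta>2 an by (simp add: powr_mult[symmetric])
      then have "{\<omega> \<in> space M. \<bar>X i \<omega> - Xt m i \<omega>\<bar> > \<kappa> * a n} \<subseteq>
          {\<omega> \<in> space M. (\<Sum>j. ennreal (\<bar>c (j + m)\<bar> powr \<delta> * \<bar>Z (int i - int m - int j) \<omega>\<bar> powr \<delta>)) > ennreal ((\<kappa> / \<beta>2) powr \<delta> * a n powr \<delta>)}"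
        using truncation_error[of "\<kappa> * a n" m i] \<kappa> an by (auto simp: not_less[symmetric])
      then have "prob {\<omega> \<in> space M. \<bar>X i \<omega> - Xt m i \<omega>\<bar> > \<kappa> * a n} \<le>
          prob {\<omega> \<in> space M. (\<Sum>j. ennreal (\<bar>c (j + m)\<bar> powr \<delta> * \<bar>Z (int i - int m - int j) \<omega>\<bar> powr \<delta>)) > ennreal ((\<kappa> / \<beta>2) powr \<delta> * a n powr \<delta>)}"
        by (rule finite_measure_mono) measurable
      then have "real n * prob {\<omega> \<in> space M. \<bar>X i \<omega> - Xt m i \<omega>\<bar> > \<kappa> * a n} \<le> real n *
          prob {\<omega> \<in> space M. (\<Sum>j. ennreal (\<bar>c (j + m)\<bar> powr \<delta> * \<bar>Z (int i - int m - int j) \<omega>\<bar> powr \<delta>)) > ennreal ((\<kappa> / \<beta>2) powr \<delta> * a n powr \<delta>)}"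
        by (rule mult_left_mono) simp
      also have "\<dots> \<le> D * (\<Sum>j. \<bar>c (j + m)\<bar> powr \<delta>)" using n by (intro D(2)) simp
      finally show "real n * prob {\<omega> \<in> space M. \<bar>X i \<omega> - Xt m i \<omega>\<bar> > \<kappa> * a n} \<le> D * (\<Sum>j. \<bar>c (j + m)\<bar> powr \<delta>)" .
    qed (use D in auto)
  qed
qed

lemma expectation_sum_indicator:
  assumes "finite I" "\<And>i. i \<in> I \<Longrightarrow> S i \<in> sets M"
  shows "integrable M (\<lambda>\<omega>. \<Sum>i\<in>I. indicator (S i) \<omega> :: real)" "(\<integral>\<omega>. (\<Sum>i\<in>I. indicator (S i) \<omega> :: real) \<partial>M) = (\<Sum>i\<in>I. prob (S i))"
proof -
  have i: "integrable M (indicator (S i) :: _ \<Rightarrow> real)" if "i \<in> I" for i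
    using assms(2)[OF that] by (intro integrable_real_indicator) (auto simp: emeasure_eq_measure)
  then show "integrable M (\<lambda>\<omega>. \<Sum>i\<in>I. indicator (S i) \<omega> :: real)" by (intro Bochner_Integration.integrable_sum)
  have "(\<integral>\<omega>. (\<Sum>i\<in>I. indicator (S i) \<omega> :: real) \<partial>M) = (\<Sum>i\<in>I. \<integral>\<omega>. indicator (S i) \<omega> \<partial>M)"
    using i by (intro Bochner_Integration.integral_sum)
  also have "\<dots> = (\<Sum>i\<in>I. prob (S i))" using assms(2) by (intro sum.cong) auto
  finally show "(\<integral>\<omega>. (\<Sum>i\<in>I. indicator (S i) \<omega> :: real) \<partial>M) = (\<Sum>i\<in>I. prob (S i))" .
qed

definition LX :: "(real \<times> ereal \<Rightarrow> real) \<Rightarrow> nat \<Rightarrow> real" where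
  "LX f n = (\<integral>\<omega>. exp (- (\<Sum>i = 1..n. f (real i / real n, ereal (X i \<omega> / a n)))) \<partial>M)"

definition LY :: "(real \<times> ereal \<Rightarrow> real) \<Rightarrow> nat \<Rightarrow> real" where
  "LY f n = (\<integral>\<omega>. exp (- (\<Sum>i = 1..n. f (real i / real n, ereal (Y (int i) \<omega> / a n)))) \<partial>M)"

text \<open>Three union bounds for the failure of the pointwise estimate, namely a truncation error,
  two exceedances at lag at most m, and an exceedance near either end; then \<epsilon> times the
  expected number of large X_i, written as the truncation error for m = 0.\<close>

lemma truncation_expectation:
  assumes f: "f \<in> CK_plus" and u: "u > 0" "\<And>t y. \<bar>y\<bar> < ereal u \<Longrightarrow> f (t, y) = 0"
    and unif: "\<And>t t' y y'. t \<in> {0..1} \<Longrightarrow> t' \<in> {0..1} \<Longrightarrow> \<bar>t - t'\<bar> < \<eta> \<Longrightarrow> \<bar>y - y'\<bar> < \<eta>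
      \<Longrightarrow> \<bar>f (t, ereal y) - f (t', ereal y')\<bar> \<le> \<epsilon>"
    and n: "n \<ge> 1" "n \<ge> m" "real m < \<eta> * real n"
    and \<kappa>: "0 < \<kappa>" "2 * \<kappa> < \<eta>" "2 * \<kappa> < u / 2"
    and \<theta>: "\<beta>2 * \<theta> * (\<Sum>j<m. \<bar>c j\<bar>) \<le> \<kappa>" "0 < \<theta>" and \<epsilon>: "0 \<le> \<epsilon>"
  shows "\<bar>LX f n - LY (fold_scaled c f m) n\<bar>
    \<le> (\<Sum>i=1..n. prob {\<omega> \<in> space M. \<bar>X i \<omega> - Xt m i \<omega>\<bar> > \<kappa> * a n})
      + 2 * (real n * (\<Sum>i = 2..m + 1. Q \<theta> n (i - 1))) + 2 * real m * T (\<theta> * a n)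
      + \<epsilon> * (\<Sum>i=1..n. prob {\<omega> \<in> space M. \<bar>X i \<omega> - Xt 0 i \<omega>\<bar> > u / 2 * a n})"
proof -
  have an: "a n > 0" using a_pos n by auto
  let ?A = "\<lambda>\<omega>. \<Sum>i = 1..n. f (real i / real n, ereal (X i \<omega> / a n))"
  let ?B = "\<lambda>\<omega>. \<Sum>i = 1..n. fold_scaled c f m (real i / real n, ereal (Y (int i) \<omega> / a n))"
  define big where "big l \<omega> \<longleftrightarrow> \<bar>Z l \<omega>\<bar> > \<theta> * a n" for l \<omega>
  define S1 where "S1 i = {\<omega> \<in> space M. \<bar>X i \<omega> - Xt m i \<omega>\<bar> > \<kappa> * a n}" for i
  define S2 where "S2 = (\<lambda>(i, l). {\<omega> \<in> space M. \<bar>Z i \<omega>\<bar> > \<theta> * a n \<and> \<bar>Z (i + int l) \<omega>\<bar> > \<theta> * a n})"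
  define S3 where "S3 i = {\<omega> \<in> space M. \<bar>Z i \<omega>\<bar> > \<theta> * a n}" for i
  define S4 where "S4 i = {\<omega> \<in> space M. \<bar>X i \<omega> - Xt 0 i \<omega>\<bar> > u / 2 * a n}" for i
  have S1m: "S1 i \<in> sets M" for i unfolding S1_def by measurable
  have S2m: "S2 k \<in> sets M" for k unfolding S2_def by (cases k) simp
  have S3m: "S3 i \<in> sets M" for i unfolding S3_def by measurable
  have S4m: "S4 i \<in> sets M" for i unfolding S4_def by measurable
  define I2 where "I2 = {1 - int m..int n} \<times> {1..m}"
  define I3 where "I3 = {1 - int m..0} \<union> {int n - int m + 1..int n}"
  have fin: "finite I2" "finite I3" by (auto simp: I2_def I3_def)
  \<comment> \<open>On the exceptional event at least one of these indicator sums is \<ge> 1, which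
    dominates the difference of the exponentials.\<close>
  define R1 where "R1 \<omega> = (\<Sum>i\<in>{1..n}. indicator (S1 i) \<omega> :: real)" for \<omega>
  define R2 where "R2 \<omega> = (\<Sum>k\<in>I2. indicator (S2 k) \<omega> :: real)" for \<omega>
  define R3 where "R3 \<omega> = (\<Sum>i\<in>I3. indicator (S3 i) \<omega> :: real)" for \<omega>
  define R4 where "R4 \<omega> = (\<Sum>i\<in>{1..n}. indicator (S4 i) \<omega> :: real)" for \<omega>
  note R_def = R1_def R2_def R3_def R4_def
  have R0: "0 \<le> R1 \<omega>" "0 \<le> R2 \<omega>" "0 \<le> R3 \<omega>" "0 \<le> R4 \<omega>" for \<omega> unfolding R_def by (simp_all add: sum_nonneg)
  have A0: "0 \<le> ?A \<omega>" and B0: "0 \<le> ?B \<omega>" for \<omega>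
    using CK_plusD(1)[OF f] CK_plusD(1)[OF fold_scaled_CK[OF f]] by (auto intro!: sum_nonneg)
  have pt: "\<bar>exp (- ?A \<omega>) - exp (- ?B \<omega>)\<bar> \<le> R1 \<omega> + R2 \<omega> + R3 \<omega> + \<epsilon> * R4 \<omega>" if \<omega>: "\<omega> \<in> space M" for \<omega>
  proof (cases "(\<exists>i\<in>{1..n}. \<omega> \<in> S1 i) \<or> (\<exists>k\<in>I2. \<omega> \<in> S2 k) \<or> (\<exists>i\<in>I3. \<omega> \<in> S3 i)")
    case True
    have one: "1 \<le> (\<Sum>i\<in>I. indicator (S i) \<omega> :: real)" if fI: "finite I" and ex: "\<exists>i\<in>I. \<omega> \<in> S i" for I and S :: "'i \<Rightarrow> 'a set"
    proof -
      obtain i where i: "i \<in> I" "\<omega> \<in> S i" using ex by auto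
      have "indicator (S i) \<omega> \<le> (\<Sum>i\<in>I. indicator (S i) \<omega> :: real)" using i fI by (intro member_le_sum) auto
      then show ?thesis using i by simp
    qed
    have "1 \<le> R1 \<omega> + R2 \<omega> + R3 \<omega>"
      using True
    proof (elim disjE)
      assume "\<exists>i\<in>{1..n}. \<omega> \<in> S1 i"
      from one[OF _ this] show ?thesis using R0(2,3)[of \<omega>] unfolding R1_def by simp
    next
      assume "\<exists>k\<in>I2. \<omega> \<in> S2 k"
      from one[OF fin(1) this] show ?thesis using R0(1,3)[of \<omega>] unfolding R2_def by simp
    next
      assume "\<exists>i\<in>I3. \<omega> \<in> S3 i"
      from one[OF fin(2) this] show ?thesis using R0(1,2)[of \<omega>] unfolding R3_def by simp
    qed
    moreover have "0 \<le> \<epsilon> * R4 \<omega>" using \<epsilon> R0(4) by simp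
    ultimately show ?thesis using exp_neg_diff_le(1)[OF A0 B0, of \<omega> \<omega>] by linarith
  next
    case False
    have "\<bar>?A \<omega> - ?B \<omega>\<bar> \<le> \<epsilon> * (\<Sum>i=1..n. of_bool (\<bar>X i \<omega> / a n\<bar> > u / 2))"
    proof (rule truncation_pointwise[where big = "\<lambda>l. big l \<omega>" and y = "\<lambda>l. Y l \<omega> / a n" and x = "\<lambda>i. X i \<omega> / a n" and \<theta> = "\<beta>2 * \<theta>" and \<kappa> = \<kappa> and \<eta> = \<eta>,
        OF f u(1) _ _ n(1,3) \<kappa> _ \<theta>(1) _ _ _ _ \<epsilon>])
      show "f (t, y) = 0" if "\<bar>y\<bar> < ereal u" for t y using u(2)[OF that] .
      show "\<bar>f (t, ereal y) - f (t', ereal y')\<bar> \<le> \<epsilon>"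
        if "t \<in> {0..1}" "t' \<in> {0..1}" "\<bar>t - t'\<bar> < \<eta>" "\<bar>y - y'\<bar> < \<eta>" for t t' y y' using unif[OF that] .
      show "\<bar>Y l \<omega> / a n\<bar> \<le> \<beta>2 * \<theta>" if "\<not> big l \<omega>" for l
      proof -
        have "\<bar>Y l \<omega>\<bar> \<le> \<beta>2 * \<bar>Z l \<omega>\<bar>" by (rule abs_Y_le)
        also have "\<dots> \<le> \<beta>2 * (\<theta> * a n)" using that \<beta>2 by (intro mult_left_mono) (auto simp: big_def)
        finally show ?thesis using an by (simp add: field_simps)
      qed
      show "0 \<le> \<beta>2 * \<theta>" using \<beta>2 \<theta>(2) by simp
      show "\<bar>X i \<omega> / a n - (\<Sum>j<m. c j * (Y (int i - int j) \<omega> / a n))\<bar> \<le> \<kappa>" if "i \<in> {1..n}" for i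
      proof -
        have "X i \<omega> / a n - (\<Sum>j<m. c j * (Y (int i - int j) \<omega> / a n)) = (X i \<omega> - Xt m i \<omega>) / a n"
          by (simp add: Xt_def sum_divide_distrib diff_divide_distrib)
        moreover have "\<bar>X i \<omega> - Xt m i \<omega>\<bar> \<le> \<kappa> * a n" using False that \<omega> by (auto simp: S1_def not_less)
        ultimately show ?thesis using an by (simp add: divide_le_eq)
      qed
      show "\<not> (big i \<omega> \<and> big (i + int l) \<omega>)" if "i \<in> {1 - int m..int n}" "l \<in> {1..m}" for i l
      proof -
        have "(i, l) \<in> I2" using that by (simp add: I2_def)
        then have "\<omega> \<notin> S2 (i, l)" using False by blast
        then show ?thesis using \<omega> by (simp add: S2_def big_def)
      qed
      show "\<not> big i \<omega>" if "i \<in> {1 - int m..0} \<union> {int n - int m + 1..int n}" for i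
      proof -
        have "\<omega> \<notin> S3 i" using False that unfolding I3_def by blast
        then show ?thesis using \<omega> by (simp add: S3_def big_def)
      qed
    qed
    also have "(\<Sum>i=1..n. of_bool (\<bar>X i \<omega> / a n\<bar> > u / 2)) = R4 \<omega>"
      unfolding R4_def using \<omega> an
      by (intro sum.cong refl) (simp add: S4_def Xt_def indicator_def less_divide_eq)
    finally have "\<bar>?A \<omega> - ?B \<omega>\<bar> \<le> \<epsilon> * R4 \<omega>" .
    then show ?thesis using exp_neg_diff_le(2)[OF A0 B0, of \<omega> \<omega>] R0[of \<omega>] by linarith
  qed
  have m1: "(\<lambda>\<omega>. f (t, ereal (X i \<omega> / a n))) \<in> borel_measurable M" for t i
    by (rule CK_plus_comp_measurable[OF f]) measurable
  have m2: "(\<lambda>\<omega>. fold_scaled c f m (t, ereal (Y i \<omega> / a n))) \<in> borel_measurable M" for t i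
    by (rule CK_plus_comp_measurable[OF fold_scaled_CK[OF f]]) measurable
  have iA: "integrable M (\<lambda>\<omega>. exp (- ?A \<omega>))"
  proof (rule integrable_const_bound[of _ 1])
    note [measurable] = m1
    show "(\<lambda>\<omega>. exp (- ?A \<omega>)) \<in> borel_measurable M" by measurable
  qed (use A0 in simp)
  have iB: "integrable M (\<lambda>\<omega>. exp (- ?B \<omega>))"
  proof (rule integrable_const_bound[of _ 1])
    note [measurable] = m2
    show "(\<lambda>\<omega>. exp (- ?B \<omega>)) \<in> borel_measurable M" by measurable
  qed (use B0 in simp)
  note e1 = expectation_sum_indicator[of "{1..n}" S1, OF _ S1m, folded R1_def]
  note e2 = expectation_sum_indicator[of I2 S2, OF fin(1) S2m, folded R2_def]
  note e3 = expectation_sum_indicator[of I3 S3, OF fin(2) S3m, folded R3_def]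
  note e4 = expectation_sum_indicator[of "{1..n}" S4, OF _ S4m, folded R4_def]
  have "\<bar>LX f n - LY (fold_scaled c f m) n\<bar> = \<bar>\<integral>\<omega>. exp (- ?A \<omega>) - exp (- ?B \<omega>) \<partial>M\<bar>"
    unfolding LX_def LY_def using iA iB by simp
  also have "\<dots> \<le> (\<integral>\<omega>. \<bar>exp (- ?A \<omega>) - exp (- ?B \<omega>)\<bar> \<partial>M)" by (rule integral_abs_bound)
  also have "\<dots> \<le> (\<integral>\<omega>. R1 \<omega> + R2 \<omega> + R3 \<omega> + \<epsilon> * R4 \<omega> \<partial>M)"
    by (rule integral_mono[OF _ _ pt])
       (use iA iB e1(1) e2(1) e3(1) e4(1) in \<open>auto intro!: integrable_abs Bochner_Integration.integrable_diff Bochner_Integration.integrable_add integrable_mult_right\<close>)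
  also have "\<dots> = (\<integral>\<omega>. R1 \<omega> \<partial>M) + (\<integral>\<omega>. R2 \<omega> \<partial>M) + (\<integral>\<omega>. R3 \<omega> \<partial>M) + \<epsilon> * (\<integral>\<omega>. R4 \<omega> \<partial>M)"
    using e1(1) e2(1) e3(1) e4(1) by simp
  also have "(\<integral>\<omega>. R2 \<omega> \<partial>M) \<le> 2 * (real n * (\<Sum>i = 2..m + 1. Q \<theta> n (i - 1)))"
  proof -
    have "(\<integral>\<omega>. R2 \<omega> \<partial>M) = (\<Sum>(i, l)\<in>I2. Q \<theta> n l)"
      unfolding e2(2) by (intro sum.cong refl) (auto simp: S2_def I2_def prob_two_exceed)
    also have "\<dots> = real (n + m) * (\<Sum>l=1..m. Q \<theta> n l)"
      unfolding I2_def by (subst sum.cartesian_product[symmetric]) simp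
    also have "(\<Sum>l=1..m. Q \<theta> n l) = (\<Sum>i = 2..m + 1. Q \<theta> n (i - 1))"
      by (rule sum.reindex_bij_witness[of _ "\<lambda>i. i - 1" "\<lambda>l. l + 1"]) auto
    \<comment> \<open>The starting indices form a range of n + m \<le> 2 n integers, whence the
      factor 2.\<close>
    also have "real (n + m) * (\<Sum>i = 2..m + 1. Q \<theta> n (i - 1)) \<le> (2 * real n) * (\<Sum>i = 2..m + 1. Q \<theta> n (i - 1))"
      using n(2) by (intro mult_right_mono sum_nonneg Q_nonneg) simp
    finally show ?thesis by simp
  qed
  also have "(\<integral>\<omega>. R3 \<omega> \<partial>M) \<le> 2 * real m * T (\<theta> * a n)"
  proof -
    have "(\<integral>\<omega>. R3 \<omega> \<partial>M) = real (card I3) * T (\<theta> * a n)"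
      unfolding e3(2) by (simp add: S3_def prob_abs_gt)
    also have "\<dots> \<le> (2 * real m) * T (\<theta> * a n)"
    proof (rule mult_right_mono[OF _ T_nonneg])
      have "card I3 \<le> card {1 - int m..0} + card {int n - int m + 1..int n}" unfolding I3_def by (rule card_Un_le)
      then show "real (card I3) \<le> 2 * real m" by simp
    qed
    finally show ?thesis .
  qed
  finally show ?thesis using e1(2) e4(2) by (simp add: S1_def S4_def)
qed

theorem truncation_Laplace:
  assumes f: "f \<in> CK_plus" and e: "e > 0"
  shows "\<exists>m0. \<forall>m\<ge>m0. \<forall>\<^sub>F n in sequentially. \<bar>LX f n - LY (fold_scaled c f m) n\<bar> < e"
proof -
  obtain u where u: "u > 0" "\<And>t y. \<bar>y\<bar> < ereal u \<Longrightarrow> f (t, y) = 0"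
    using CK_plus_supportE[OF f] by blast
  define C where "C m = (\<Sum>j. \<bar>c (j + m)\<bar> powr \<delta>)" for m
  have "u / 2 > 0" using u(1) by simp
  then obtain D1 n1 where D1: "D1 \<ge> 0" "\<And>n m i. n \<ge> n1 \<Longrightarrow>
    real n * prob {\<omega> \<in> space M. \<bar>X i \<omega> - Xt m i \<omega>\<bar> > u / 2 * a n} \<le> D1 * (\<Sum>j. \<bar>c (j + m)\<bar> powr \<delta>)"
    by (rule truncation_probability) blast
  have C0: "0 \<le> C m" for m unfolding C_def by (intro suminf_nonneg summable_ignore_initial_segment[OF c]) simp
  \<comment> \<open>Dominates the expected number of i with |X_i| > (u / 2) a_n, independently of m
    and of large n; so \<epsilon>, \<eta> and \<kappa> can be fixed before m.\<close>
  define K where "K = D1 * C 0 + 1"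
  have K: "K > 0" unfolding K_def by (rule add_nonneg_pos[OF mult_nonneg_nonneg[OF D1(1) C0]]) simp
  define \<epsilon> where "\<epsilon> = e / 4 / K"
  have \<epsilon>: "\<epsilon> > 0" "\<epsilon> * K = e / 4" using e K by (simp_all add: \<epsilon>_def)
  obtain \<eta> where \<eta>: "\<eta> > 0" "\<And>t t' y y'. t \<in> {0..1} \<Longrightarrow> t' \<in> {0..1} \<Longrightarrow> \<bar>t - t'\<bar> < \<eta> \<Longrightarrow>
      \<bar>squash y - squash y'\<bar> < \<eta> \<Longrightarrow> \<bar>f (t, y) - f (t', y')\<bar> < \<epsilon>"
    using CK_plus_uniformly_continuous[OF f \<epsilon>(1)] by blast
  have unif: "\<bar>f (t, ereal y) - f (t', ereal y')\<bar> \<le> \<epsilon>"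
    if "t \<in> {0..1}" "t' \<in> {0..1}" "\<bar>t - t'\<bar> < \<eta>" "\<bar>y - y'\<bar> < \<eta>" for t t' y y'
    using \<eta>(2)[OF that(1-3), of "ereal y" "ereal y'"] squash_lipschitz[of y y'] that(4) by simp
  \<comment> \<open>A third leaves 2 \<kappa> strictly below both \<eta> and u / 2.\<close>
  define \<kappa> where "\<kappa> = min \<eta> (u / 2) / 3"
  have \<kappa>: "0 < \<kappa>" "2 * \<kappa> < \<eta>" "2 * \<kappa> < u / 2" using \<eta>(1) u(1) by (auto simp: \<kappa>_def)
  obtain D2 n2 where D2: "D2 \<ge> 0" "\<And>n m i. n \<ge> n2 \<Longrightarrow>
    real n * prob {\<omega> \<in> space M. \<bar>X i \<omega> - Xt m i \<omega>\<bar> > \<kappa> * a n} \<le> D2 * (\<Sum>j. \<bar>c (j + m)\<bar> powr \<delta>)"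
    using truncation_probability[OF \<kappa>(1)] by blast
  have "e / 4 / (D2 + 1) > 0" using e D2(1) by simp
  from suminf_exist_split[OF this c] obtain m0 where m0: "\<And>m. m \<ge> m0 \<Longrightarrow> \<bar>C m\<bar> < e / 4 / (D2 + 1)"
    unfolding C_def by auto
  have tail: "D2 * C m < e / 4" if "m \<ge> m0" for m
  proof -
    have "D2 * C m \<le> (D2 + 1) * C m" using C0 by (intro mult_right_mono) auto
    also have "\<dots> < e / 4" using m0[OF that] C0[of m] D2(1) by (simp add: field_simps)
    finally show ?thesis .
  qed
  have avg: "(\<Sum>i=1..n. prob (S i)) \<le> B" if "n \<ge> 1" "\<And>i. real n * prob (S i) \<le> B" for n B and S :: "nat \<Rightarrow> 'a set"
  proof -
    have "prob (S i) \<le> B / real n" for i using that(2)[of i] that(1) by (simp add: field_simps)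
    then have "(\<Sum>i=1..n. prob (S i)) \<le> (\<Sum>i=1..n. B / real n)" by (intro sum_mono)
    then show ?thesis using that(1) by simp
  qed
  have "\<forall>\<^sub>F n in sequentially. \<bar>LX f n - LY (fold_scaled c f m) n\<bar> < e" if m: "m \<ge> m0" for m
  proof -
    define W where "W = (\<Sum>j<m. \<bar>c j\<bar>)"
    have W: "0 \<le> W" by (simp add: W_def sum_nonneg)
    \<comment> \<open>Values of Z up to \<theta> a_n contribute at most \<kappa> a_n to a whole
      window; the 1 added to W avoids division by 0. The threshold depends on m, which is harmless
      because n grows last.\<close>
    define \<theta> where "\<theta> = \<kappa> / (\<beta>2 * (W + 1))"
    have \<theta>: "0 < \<theta>" "\<beta>2 * \<theta> * W \<le> \<kappa>"
    proof -
      show "0 < \<theta>" using \<kappa>(1) \<beta>2 W by (simp add: \<theta>_def)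
      have "\<beta>2 * \<theta> = \<kappa> / (W + 1)" using \<beta>2 by (simp add: \<theta>_def)
      then have "\<beta>2 * \<theta> * W = \<kappa> * (W / (W + 1))" by simp
      also have "\<dots> \<le> \<kappa> * 1" using \<kappa>(1) W by (intro mult_left_mono) auto
      finally show "\<beta>2 * \<theta> * W \<le> \<kappa>" by simp
    qed
    have q: "(\<lambda>n. real n * (\<Sum>i = 2..m + 1. Q \<theta> n (i - 1))) \<longlonglongrightarrow> 0"
      by (rule anticlustering[OF \<theta>(1), of "\<lambda>_. m + 1"]) (rule lim_const_over_n)
    have t: "(\<lambda>n. 2 * real m * T (\<theta> * a n)) \<longlonglongrightarrow> 0"
    proof -
      have "(\<lambda>n. 2 * real m / real n * (real n * T (\<theta> * a n))) \<longlonglongrightarrow> 0 * \<theta> powr (- \<alpha>)"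
        by (intro tendsto_mult lim_const_over_n scaled_tail \<theta>(1))
      moreover have "\<forall>\<^sub>F n in sequentially. 2 * real m / real n * (real n * T (\<theta> * a n)) = 2 * real m * T (\<theta> * a n)"
        using eventually_ge_at_top[of 1] by eventually_elim simp
      ultimately show ?thesis by (simp add: Lim_transform_eventually)
    qed
    \<comment> \<open>Error budget: e / 4 for truncation, twice e / 16 for lagged pairs, e / 8 for
      the ends, e / 4 for large X_i.\<close>
    have "\<forall>\<^sub>F n in sequentially. real n * (\<Sum>i = 2..m + 1. Q \<theta> n (i - 1)) < e / 16"
      using order_tendstoD(2)[OF q, of "e / 16"] e by simp
    moreover have "\<forall>\<^sub>F n in sequentially. 2 * real m * T (\<theta> * a n) < e / 8"
      using order_tendstoD(2)[OF t, of "e / 8"] e by simp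
    moreover have "\<forall>\<^sub>F n in sequentially. real m / real n < \<eta>"
      using order_tendstoD(2)[OF lim_const_over_n[of "real m"] \<eta>(1)] .
    ultimately show ?thesis
      using eventually_ge_at_top[of "max (max 1 m) (max n1 n2)"]
    proof eventually_elim
      case (elim n)
      have n: "n \<ge> 1" "n \<ge> m" "n \<ge> n1" "n \<ge> n2" using elim(4) by auto
      have mn: "real m < \<eta> * real n" using elim(3) n(1) by (simp add: field_simps)
      have 1: "(\<Sum>i=1..n. prob {\<omega> \<in> space M. \<bar>X i \<omega> - Xt m i \<omega>\<bar> > \<kappa> * a n}) \<le> D2 * C m"
        using D2(2)[OF n(4)] unfolding C_def by (intro avg n(1))
      have 2: "(\<Sum>i=1..n. prob {\<omega> \<in> space M. \<bar>X i \<omega> - Xt 0 i \<omega>\<bar> > u / 2 * a n}) \<le> D1 * C 0"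
        using D1(2)[OF n(3), of _ 0] unfolding C_def by (intro avg n(1))
      have "\<epsilon> * (\<Sum>i=1..n. prob {\<omega> \<in> space M. \<bar>X i \<omega> - Xt 0 i \<omega>\<bar> > u / 2 * a n}) \<le> \<epsilon> * K"
        using 2 \<epsilon>(1) by (intro mult_left_mono) (auto simp: K_def)
      moreover have "\<bar>LX f n - LY (fold_scaled c f m) n\<bar>
        \<le> (\<Sum>i=1..n. prob {\<omega> \<in> space M. \<bar>X i \<omega> - Xt m i \<omega>\<bar> > \<kappa> * a n})
          + 2 * (real n * (\<Sum>i = 2..m + 1. Q \<theta> n (i - 1))) + 2 * real m * T (\<theta> * a n)
          + \<epsilon> * (\<Sum>i=1..n. prob {\<omega> \<in> space M. \<bar>X i \<omega> - Xt 0 i \<omega>\<bar> > u / 2 * a n})"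
      proof (rule truncation_expectation[OF f u(1) _ _ n(1,2) mn \<kappa> _ \<theta>(1) less_imp_le[OF \<epsilon>(1)]])
        show "f (t, y) = 0" if "\<bar>y\<bar> < ereal u" for t y using u(2)[OF that] .
        show "\<bar>f (t, ereal y) - f (t', ereal y')\<bar> \<le> \<epsilon>"
          if "t \<in> {0..1}" "t' \<in> {0..1}" "\<bar>t - t'\<bar> < \<eta>" "\<bar>y - y'\<bar> < \<eta>" for t t' y y' using unif[OF that] .
        show "\<beta>2 * \<theta> * (\<Sum>j<m. \<bar>c j\<bar>) \<le> \<kappa>" using \<theta>(2) by (simp add: W_def)
      qed
      ultimately show ?case using 1 elim(1,2) \<epsilon>(2) tail[OF m] e by linarith
    qed
  qed
  then show ?thesis by blast
qed

lemma point_process_measurable: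
  "(\<lambda>\<omega>. dirac_sum {1..n} (\<lambda>i. (real i / real n, ereal (X i \<omega> / a n)))) \<in> M \<rightarrow>\<^sub>M borel_of vague_top"
proof (rule measurable_into_vague)
  show "dirac_sum {1..n} (\<lambda>i. (real i / real n, ereal (X i \<omega> / a n))) \<in> Mp" for \<omega>
    by (simp add: dirac_sum_in_Mp_iff)
  fix f :: "real \<times> ereal \<Rightarrow> real" assume f: "f \<in> CK_plus"
  have [measurable]: "(\<lambda>\<omega>. f (t, ereal (X i \<omega> / a n))) \<in> borel_measurable M" for t i
    by (rule CK_plus_comp_measurable[OF f]) measurable
  show "(\<lambda>\<omega>. \<integral>z. f z \<partial>dirac_sum {1..n} (\<lambda>i. (real i / real n, ereal (X i \<omega> / a n)))) \<in> borel_measurable M"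
    by (subst integral_dirac_sum_CK[OF f, of "{1..n}"]) auto
qed

end

text \<open>The Poisson points are given on a probability space of their own. The limit is a version
  of their cluster sum: a random element of \<open>Mp\<close> everywhere, equal to the sum almost
  surely.\<close>

theorem theorem2p5:
  fixes M :: "'a measure" and Z Y :: "int \<Rightarrow> 'a \<Rightarrow> real" and X :: "nat \<Rightarrow> 'a \<Rightarrow> real"
    and L :: "real \<Rightarrow> real" and a :: "nat \<Rightarrow> real" and \<sigma> :: "int \<Rightarrow> real" and c :: "nat \<Rightarrow> real"
    and \<alpha> p q \<beta>\<^sub>1 \<beta>\<^sub>2 s \<delta> :: real
    and M' :: "'b measure" and T :: "nat \<Rightarrow> 'b \<Rightarrow> real" and P :: "nat \<Rightarrow> 'b \<Rightarrow> ereal"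
  assumes "prob_space M"
    and "\<alpha> > 0"
    and "\<And>i. Z i \<in> borel_measurable M"
    and "strictly_stationary M Z"
    and "\<And>x. x > 0 \<Longrightarrow> measure M {\<omega> \<in> space M. \<bar>Z 1 \<omega>\<bar> > x} = x powr (- \<alpha>) * L x"
    and "slowly_varying L"
    and "((\<lambda>x. measure M {\<omega> \<in> space M. Z 1 \<omega> > x} / measure M {\<omega> \<in> space M. \<bar>Z 1 \<omega>\<bar> > x})
           \<longlongrightarrow> p) at_top"
    and "((\<lambda>x. measure M {\<omega> \<in> space M. Z 1 \<omega> < - x} / measure M {\<omega> \<in> space M. \<bar>Z 1 \<omega>\<bar> > x})
           \<longlongrightarrow> q) at_top"
    and "p \<in> {0..1}" and "p + q = 1"
    and "\<And>n. n \<ge> 1 \<Longrightarrow> a n > 0"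
    and "filterlim a at_top sequentially"
    and "(\<lambda>n. real n * measure M {\<omega> \<in> space M. \<bar>Z 1 \<omega>\<bar> > a n}) \<longlonglongrightarrow> 1"
    and "cond_D' M Z a"
    and "0 < \<beta>\<^sub>1" and "\<And>i. \<beta>\<^sub>1 \<le> \<sigma> i" and "\<And>i. \<sigma> i \<le> \<beta>\<^sub>2"
    and "s > 0"
    and "(\<lambda>n. 1 / real n * (\<Sum>i = 1..n. \<sigma> (int i) powr \<alpha>)) \<longlonglongrightarrow> s powr \<alpha>"
    and "\<And>i \<omega>. Y i \<omega> = \<sigma> i * Z i \<omega>"
    and "cond_A' M Y a"
    and "\<delta> < \<alpha>" and "0 < \<delta>" and "\<delta> \<le> 1"
    and "summable (\<lambda>j. \<bar>c j\<bar> powr \<delta>)"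
    and "\<And>n \<omega>. X n \<omega> = (\<Sum>j. c j * Y (int n - int j) \<omega>)"
    and "prob_space M'"
    and "\<And>i. T i \<in> borel_measurable M'" and "\<And>i. P i \<in> borel_measurable M'"
    and "\<And>i \<omega>. \<omega> \<in> space M' \<Longrightarrow> (T i \<omega>, P i \<omega>) \<in> S_space"
    and "poisson_process M' (intensity \<alpha> s p q) (\<lambda>\<omega>. dirac_sum UNIV (\<lambda>i. (T i \<omega>, P i \<omega>)))"
  shows "\<exists>N. (AE \<omega> in M'. N \<omega> = dirac_sum UNIV (\<lambda>(i, j). (T i \<omega>, P i \<omega> * ereal (c j)))) \<and>
             conv_in_dist vague_top
               M (\<lambda>n \<omega>. dirac_sum {1..n} (\<lambda>i. (real i / real n, ereal (X i \<omega> / a n))))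
               M' N"
proof -
  have pq: "0 \<le> p" "0 \<le> q" using assms(9,10) by auto
  interpret LP: linear_process M Z L a \<alpha> p q \<sigma> Y \<beta>\<^sub>1 \<beta>\<^sub>2 s c \<delta> X
    by (intro linear_process.intro scaled_heavy_tailed_sequence.intro heavy_tailed_sequence.intro
        heavy_tailed_sequence_axioms.intro scaled_heavy_tailed_sequence_axioms.intro
        linear_process_axioms.intro assms pq)
  interpret PS: poisson_scaling M' T P c \<alpha> s p q \<delta>
    by (intro poisson_scaling.intro poisson_scaling_axioms.intro assms pq)
  have lap: "(\<lambda>n. \<integral>\<omega>. exp (- (\<integral>z. f z \<partial>dirac_sum {1..n} (\<lambda>i. (real i / real n, ereal (X i \<omega> / a n))))) \<partial>M)
      \<longlonglongrightarrow> (\<integral>\<omega>. exp (- (\<integral>z. f z \<partial>PS.N \<omega>)) \<partial>M')" (is "_ \<longlonglongrightarrow> ?l") if f: "f \<in> CK_plus" for f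
  proof -
    \<comment> \<open>Interchange of limits: m is fixed large enough for the truncation and for the
      Poisson side, and only then does n grow.\<close>
    have lim: "LP.LX f \<longlonglongrightarrow> ?l"
    proof (rule LIMSEQ_I)
      fix e :: real assume e: "e > 0"
      obtain m0 where m0: "\<And>m. m \<ge> m0 \<Longrightarrow> \<forall>\<^sub>F n in sequentially. \<bar>LP.LX f n - LP.LY (fold_scaled c f m) n\<bar> < e / 3"
        using LP.truncation_Laplace[OF f, of "e / 3"] e by auto
      have "\<forall>\<^sub>F m in sequentially. dist (exp (- (\<integral>z. 1 - exp (- fold_scaled c f m z) \<partial>intensity \<alpha> s p q))) ?l < e / 3"
        using tendstoD[OF PS.N_Laplace[OF f], of "e / 3"] e by simp
      from eventually_happens'[OF sequentially_bot eventually_conj[OF this eventually_ge_at_top[of m0]]]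
      obtain m where m: "m \<ge> m0"
        "\<bar>exp (- (\<integral>z. 1 - exp (- fold_scaled c f m z) \<partial>intensity \<alpha> s p q)) - ?l\<bar> < e / 3"
        by (auto simp: dist_real_def)
      have "\<forall>\<^sub>F n in sequentially. dist (LP.LY (fold_scaled c f m) n) (exp (- (\<integral>z. 1 - exp (- fold_scaled c f m z) \<partial>intensity \<alpha> s p q))) < e / 3"
        using tendstoD[OF LP.Y_Laplace_limit[OF fold_scaled_CK[OF f]], of "e / 3"] e unfolding LP.LY_def by simp
      with m0[OF m(1)] have "\<forall>\<^sub>F n in sequentially. norm (LP.LX f n - ?l) < e"
      proof eventually_elim
        case (elim n)
        then show ?case using m(2) unfolding dist_real_def real_norm_def by linarith
      qed
      then show "\<exists>n0. \<forall>n\<ge>n0. norm (LP.LX f n - ?l) < e" by (simp add: eventually_sequentially)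
    qed
    have eq: "(\<integral>z. f z \<partial>dirac_sum {1..n} (\<lambda>i. (real i / real n, ereal (X i \<omega> / a n))))
        = (\<Sum>i = 1..n. f (real i / real n, ereal (X i \<omega> / a n)))" for n \<omega>
      by (rule integral_dirac_sum_CK[OF f]) auto
    show ?thesis using lim unfolding LP.LX_def[abs_def] eq .
  qed
  show ?thesis
    using PS.N_AE conv_in_dist_vagueI[OF assms(1,27) LP.point_process_measurable PS.N_measurable lap]
    by blast
qed

end
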